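(* We have the identities (of measures on $\Omega$) $$2\zeta_\star=\mu_{\star,\perp,\perp}-\mu_{\star,\parallel,\parallel}\qquad\text{and}\qquad\mu_{\star,\perp,\parallel}=0.$$
   Context: $\Omega\subset\mathbb R^2$ is a smooth bounded domain. $V:\mathbb R^k\to\mathbb R$ ($k\ge1$) is smooth with $\inf V=0$ and satisfies: (1) the zero set $\Sigma=\{V=0\}$ is finite with at least two elements; (2) $\nabla^2V(\sigma)$ is positive definite at each $\sigma\in\Sigma$; (3) there are $\alpha_\infty,R_\infty>0$ with $y\cdot\nabla V(y)\ge\alpha_\infty|y|^2$ if $|y|>R_\infty$, and $V(y)\to+\infty$ as $|y|\to+\infty$. Set $e_\varepsilon(u)=\varepsilon\frac{|\nabla u|^2}{2}+\frac1\varepsilon V(u)$ and $E_\varepsilon(u)=\int_\Omega e_\varepsilon(u)dx$. $D^2(x,r)$ is the open disk of center $x$ and radius $r$. Let $M_0>0$, $\varepsilon_n\in(0,1]$, $\varepsilon_n\to0$, and let $u_{\varepsilon_n}\in H^1(\Omega,\mathbb R^k)$ be solutions of $-\Delta u_{\varepsilon_n}=-\varepsilon_n^{-2}\nabla_uV(u_{\varepsilon_n})$ in $\Omega$ with $E_{\varepsilon_n}(u_{\varepsilon_n})\le M_0$. Passing to a subsequence, we have weak convergence as measures on $\Omega$: $e_{\varepsilon_n}(u_{\varepsilon_n})dx\rightharpoonup\nu_\star$, $\frac{V(u_{\varepsilon_n})}{\varepsilon_n}dx\rightharpoonup\zeta_\star$ and, for $i,j=1,2$ and coordinates relative to an orthonormal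 basis, $\varepsilon_n\,\partial_{x_i}u_{\varepsilon_n}\cdot\partial_{x_j}u_{\varepsilon_n}\,dx\rightharpoonup\mu_{\star,i,j}$ (signed Radon measures). Let $\eta_1>0$ be a constant depending only on $V$ with the clearing-out property (such a constant exists): for every sequence $\tilde\varepsilon_n\in(0,1]$ with $\tilde\varepsilon_n\to0$, all solutions $v_n\in H^1(\Omega,\mathbb R^k)$ of $-\Delta v_n=-\tilde\varepsilon_n^{-2}\nabla_uV(v_n)$ in $\Omega$ with $\sup_nE_{\tilde\varepsilon_n}(v_n)<+\infty$, and every measure $\nu$ on $\Omega$ such that $e_{\tilde\varepsilon_n}(v_n)dx\rightharpoonup\nu$ weakly as measures on $\Omega$, if $D^2(x_0,r)\subset\Omega$ and $\nu(\overline{D^2(x_0,r)})<\eta_1r$, then $\nu(\overline{D^2(x_0,r/2)})=0$. The concentration set is $\mathfrak S_\star=\{x\in\Omega:\liminf_{r\to0}\nu_\star(\overline{D^2(x,r)})/r\ge\eta_1\}$; it is closed in $\Omega$, $1$-rectifiable and of finite $\mathcal H^1$ measure. (Closed disks are understood intersected with $\Omega$.) Put $\lambda=\mathcal H^1\llcorner\mathfrak S_\star$. The measures $\nu_\star,\zeta_\star,\mu_{\star,i,j}$ are absolutely continuous with respect to $\lambda$; write $\mu_{\star,i,j}=m_{\star,i,j}\,\lambda$. For $\mathcal H^1$-a.e. $x_0\in\mathfrak S_\star$ there is an approximate tangent line, spanned by a unit vector $\vec e_{x_0}$. At such $x_0$, choose the orthonormal frame $(\vec{\mathbf e}_1,\vec{\mathbf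 e}_2)$ so that $\vec{\mathbf e}_1=\vec e_{x_0}$, and set, with the densities computed in that frame, $m_{\star,\perp,\perp}(x_0)=m_{\star,2,2}(x_0)$, $m_{\star,\parallel,\parallel}(x_0)=m_{\star,1,1}(x_0)$, $m_{\star,\perp,\parallel}(x_0)=m_{\star,1,2}(x_0)$. Equivalently, in a fixed frame, with $\tau=\vec e_{x_0}$ and $n$ the unit vector obtained by rotating $\tau$ by $\pi/2$: $m_{\star,\parallel,\parallel}=\sum_{i,j}m_{\star,i,j}\tau_i\tau_j$, $m_{\star,\perp,\perp}=\sum_{i,j}m_{\star,i,j}n_in_j$, $m_{\star,\perp,\parallel}=\sum_{i,j}m_{\star,i,j}\tau_in_j$. Finally $\mu_{\star,\perp,\perp}=m_{\star,\perp,\perp}\lambda$, $\mu_{\star,\parallel,\parallel}=m_{\star,\parallel,\parallel}\lambda$, $\mu_{\star,\perp,\parallel}=m_{\star,\perp,\parallel}\lambda$. *)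

theory Defs
  imports "HOL-Analysis.Analysis"
begin

definition partial_deriv :: "'n::finite \<Rightarrow> (real^'n \<Rightarrow> real) \<Rightarrow> real^'n \<Rightarrow> real" where
  "partial_deriv i f x = frechet_derivative f (at x) (axis i 1)"

definition grad :: "(real^'n::finite \<Rightarrow> real) \<Rightarrow> real^'n \<Rightarrow> real^'n" where
  "grad f x = (\<chi> i. partial_deriv i f x)"

definition hessian :: "(real^'n::finite \<Rightarrow> real) \<Rightarrow> real^'n \<Rightarrow> real^'n^'n" where
  "hessian f x = (\<chi> i j. partial_deriv i (partial_deriv j f) x)"

primrec Ck_on :: "nat \<Rightarrow> (real^'n::finite) set \<Rightarrow> (real^'n \<Rightarrow> real) \<Rightarrow> bool" where
  "Ck_on 0 S f \<longleftrightarrow> continuous_on S f"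
| "Ck_on (Suc k) S f \<longleftrightarrow>
     (\<forall>x\<in>S. f differentiable (at x)) \<and> (\<forall>i. Ck_on k S (partial_deriv i f))"

(* used for open S only *)
definition smooth_on :: "(real^'n::finite) set \<Rightarrow> (real^'n \<Rightarrow> real) \<Rightarrow> bool" where
  "smooth_on S f \<longleftrightarrow> (\<forall>k. Ck_on k S f)"

(* Smoothness of the boundary is expressed by local defining functions; the gradient
   condition forces the frontier to be the zero set of \<phi> in U. *)
definition smooth_bounded_domain :: "(real^'n::finite) set \<Rightarrow> bool" where
  "smooth_bounded_domain \<Omega> \<longleftrightarrow>
     open \<Omega> \<and> connected \<Omega> \<and> bounded \<Omega> \<and> \<Omega> \<noteq> {} \<and>
     (\<forall>p\<in>frontier \<Omega>. \<exists>U \<phi>. open U \<and> p \<in> U \<and> smooth_on U \<phi> \<and>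
        (\<forall>x\<in>U. grad \<phi> x \<noteq> 0) \<and> \<Omega> \<inter> U = {x\<in>U. \<phi> x < 0})"

definition multi_well_potential :: "(real^'k::finite \<Rightarrow> real) \<Rightarrow> bool" where
  "multi_well_potential V \<longleftrightarrow>
     smooth_on UNIV V \<and> bdd_below (range V) \<and> (INF y. V y) = 0 \<and>
     finite {y. V y = 0} \<and> 2 \<le> card {y. V y = 0} \<and>
     (\<forall>\<sigma>. V \<sigma> = 0 \<longrightarrow> (\<forall>\<xi>. \<xi> \<noteq> 0 \<longrightarrow> 0 < \<xi> \<bullet> (hessian V \<sigma> *v \<xi>))) \<and>
     (\<exists>\<alpha>>0. \<exists>R>0. \<forall>y. R < norm y \<longrightarrow> \<alpha> * (norm y)\<^sup>2 \<le> y \<bullet> grad V y) \<and>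
     filterlim V at_top at_infinity"


definition test_function :: "(real^'n::finite) set \<Rightarrow> (real^'n \<Rightarrow> real) \<Rightarrow> bool" where
  "test_function \<Omega> \<phi> \<longleftrightarrow>
     smooth_on UNIV \<phi> \<and> (\<exists>K. compact K \<and> K \<subseteq> \<Omega> \<and> (\<forall>x. x \<notin> K \<longrightarrow> \<phi> x = 0))"

definition locally_integrable_on ::
    "(real^'n::finite \<Rightarrow> real^'k::finite) \<Rightarrow> (real^'n) set \<Rightarrow> bool" where
  "locally_integrable_on f \<Omega> \<longleftrightarrow>
     (\<forall>K. compact K \<longrightarrow> K \<subseteq> \<Omega> \<longrightarrow> f absolutely_integrable_on K)"

definition has_weak_partial :: "(real^'n::finite) set \<Rightarrow> 'n \<Rightarrow>
    (real^'n \<Rightarrow> real^'k::finite) \<Rightarrow> (real^'n \<Rightarrow> real^'k) \<Rightarrow> bool" where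
  "has_weak_partial \<Omega> i u w \<longleftrightarrow>
     locally_integrable_on u \<Omega> \<and> locally_integrable_on w \<Omega> \<and>
     (\<forall>\<phi>. test_function \<Omega> \<phi> \<longrightarrow>
        (LINT x|lebesgue_on \<Omega>. partial_deriv i \<phi> x *\<^sub>R u x)
          = - (LINT x|lebesgue_on \<Omega>. \<phi> x *\<^sub>R w x))"

(* determined only up to a Lebesgue null set of \<Omega> *)
definition weak_partial :: "(real^'n::finite) set \<Rightarrow> 'n \<Rightarrow>
    (real^'n \<Rightarrow> real^'k::finite) \<Rightarrow> real^'n \<Rightarrow> real^'k" where
  "weak_partial \<Omega> i u = (SOME w. has_weak_partial \<Omega> i u w)"

definition L2_on :: "(real^'n::finite) set \<Rightarrow> (real^'n \<Rightarrow> real^'k::finite) \<Rightarrow> bool" where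
  "L2_on \<Omega> f \<longleftrightarrow>
     f \<in> borel_measurable (lebesgue_on \<Omega>) \<and> integrable (lebesgue_on \<Omega>) (\<lambda>x. (norm (f x))\<^sup>2)"

definition H1_on :: "(real^'n::finite) set \<Rightarrow> (real^'n \<Rightarrow> real^'k::finite) \<Rightarrow> bool" where
  "H1_on \<Omega> u \<longleftrightarrow> L2_on \<Omega> u \<and> (\<forall>i. \<exists>w. L2_on \<Omega> w \<and> has_weak_partial \<Omega> i u w)"

(* - Laplace u = - \<epsilon>^(-2) grad V(u) in the sense of distributions. Scalar test functions with
   vector-valued integrals are the same as vector-valued test functions. *)
definition allen_cahn_solution :: "(real^'k::finite \<Rightarrow> real) \<Rightarrow> (real^2) set \<Rightarrow> real \<Rightarrow>
    (real^2 \<Rightarrow> real^'k) \<Rightarrow> bool" where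
  "allen_cahn_solution V \<Omega> \<epsilon> u \<longleftrightarrow>
     H1_on \<Omega> u \<and> locally_integrable_on (\<lambda>x. grad V (u x)) \<Omega> \<and>
     (\<forall>\<phi>. test_function \<Omega> \<phi> \<longrightarrow>
        (LINT x|lebesgue_on \<Omega>. (\<Sum>i\<in>UNIV. partial_deriv i \<phi> x *\<^sub>R weak_partial \<Omega> i u x))
          = - (1 / \<epsilon>\<^sup>2) *\<^sub>R (LINT x|lebesgue_on \<Omega>. \<phi> x *\<^sub>R grad V (u x)))"

definition energy_density :: "(real^'k::finite \<Rightarrow> real) \<Rightarrow> (real^2) set \<Rightarrow> real \<Rightarrow>
    (real^2 \<Rightarrow> real^'k) \<Rightarrow> real^2 \<Rightarrow> real" where
  "energy_density V \<Omega> \<epsilon> u x =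
     \<epsilon> * ((\<Sum>i\<in>UNIV. (norm (weak_partial \<Omega> i u x))\<^sup>2) / 2) + (1 / \<epsilon>) * V (u x)"

definition energy :: "(real^'k::finite \<Rightarrow> real) \<Rightarrow> (real^2) set \<Rightarrow> real \<Rightarrow>
    (real^2 \<Rightarrow> real^'k) \<Rightarrow> ennreal" where
  "energy V \<Omega> \<epsilon> u = (\<integral>\<^sup>+ x. ennreal (energy_density V \<Omega> \<epsilon> u x) \<partial>lebesgue_on \<Omega>)"


definition radon_measure_on :: "(real^'n::finite) set \<Rightarrow> (real^'n) measure \<Rightarrow> bool" where
  "radon_measure_on \<Omega> \<nu> \<longleftrightarrow>
     sets \<nu> = sets (restrict_space borel \<Omega>) \<and>
     (\<forall>K. compact K \<longrightarrow> K \<subseteq> \<Omega> \<longrightarrow> emeasure \<nu> K < \<infinity>)"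

definition Cc :: "(real^'n::finite) set \<Rightarrow> (real^'n \<Rightarrow> real) set" where
  "Cc \<Omega> = {\<phi>. continuous_on UNIV \<phi> \<and>
             (\<exists>K. compact K \<and> K \<subseteq> \<Omega> \<and> (\<forall>x. x \<notin> K \<longrightarrow> \<phi> x = 0))}"

(* g n dx converges weakly on \<Omega> to the (positive) measure \<nu> *)
definition weakly_converges :: "(real^'n::finite) set \<Rightarrow> (nat \<Rightarrow> real^'n \<Rightarrow> real) \<Rightarrow>
    (real^'n) measure \<Rightarrow> bool" where
  "weakly_converges \<Omega> g \<nu> \<longleftrightarrow>
     radon_measure_on \<Omega> \<nu> \<and>
     (\<forall>\<phi>\<in>Cc \<Omega>. (\<lambda>n. LINT x|lebesgue_on \<Omega>. \<phi> x * g n x) \<longlonglongrightarrow> (LINT x|\<nu>. \<phi> x))"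

(* A finite signed Borel measure on \<Omega> is a real-valued set function that is a difference
   P - N of finite positive measures (Jordan decomposition). The integral of \<phi> against it
   does not depend on the choice of P and N. *)
definition weakly_converges_signed :: "(real^'n::finite) set \<Rightarrow> (nat \<Rightarrow> real^'n \<Rightarrow> real) \<Rightarrow>
    ((real^'n) set \<Rightarrow> real) \<Rightarrow> bool" where
  "weakly_converges_signed \<Omega> g \<mu> \<longleftrightarrow>
     (\<exists>P N. finite_measure P \<and> finite_measure N \<and>
        sets P = sets (restrict_space borel \<Omega>) \<and> sets N = sets (restrict_space borel \<Omega>) \<and>
        (\<forall>A\<in>sets (restrict_space borel \<Omega>). \<mu> A = measure P A - measure N A) \<and>
        (\<forall>\<phi>\<in>Cc \<Omega>. (\<lambda>n. LINT x|lebesgue_on \<Omega>. \<phi> x * g n x)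
                      \<longlonglongrightarrow> (LINT x|P. \<phi> x) - (LINT x|N. \<phi> x)))"

(* The set function A \<mapsto> integral of f over A. The completion makes room for f that are
   measurable only up to null sets, such as densities depending on an approximate tangent. *)
definition density_measure :: "'a measure \<Rightarrow> ('a \<Rightarrow> real) \<Rightarrow> 'a set \<Rightarrow> real" where
  "density_measure lam f A = (LINT x:A|completion lam. f x)"

definition has_signed_density :: "'a measure \<Rightarrow> ('a \<Rightarrow> real) \<Rightarrow> ('a set \<Rightarrow> real) \<Rightarrow> bool" where
  "has_signed_density lam f \<mu> \<longleftrightarrow>
     integrable (completion lam) f \<and> (\<forall>A\<in>sets lam. \<mu> A = density_measure lam f A)"


(* In dimension one the normalising constant of Hausdorff measure is 1. Boundedness of the
   covering sets is required because diameter is unspecified on unbounded sets. *)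
definition hausdorff1_pre :: "real \<Rightarrow> 'a::metric_space set \<Rightarrow> ennreal" where
  "hausdorff1_pre \<delta> A =
     (INF U\<in>{U :: nat \<Rightarrow> 'a set. A \<subseteq> (\<Union>i. U i) \<and> (\<forall>i. bounded (U i) \<and> diameter (U i) \<le> \<delta>)}.
        (\<Sum>i. ennreal (diameter (U i))))"

definition hausdorff1_outer :: "'a::metric_space set \<Rightarrow> ennreal" where
  "hausdorff1_outer A = (SUP \<delta>\<in>{0<..}. hausdorff1_pre \<delta> A)"

(* hausdorff1_outer is a metric outer measure, hence countably additive on Borel sets *)
definition hausdorff1 :: "'a::metric_space measure" where
  "hausdorff1 = measure_of UNIV (sets borel) hausdorff1_outer"

definition hausdorff1_on :: "(real^2) set \<Rightarrow> (real^2) set \<Rightarrow> (real^2) measure" where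
  "hausdorff1_on \<Omega> S = density (restrict_space hausdorff1 \<Omega>) (indicator S)"

definition rot90 :: "real^2 \<Rightarrow> real^2" where
  "rot90 v = vector [- v$2, v$1]"

(* The line spanned by the unit vector \<tau> is an approximate tangent line of S at x:
   positive upper density, and zero density outside every cone around the line.
   For a unit vector \<tau>, |rot90 \<tau> \<bullet> (y - x)| is the distance of y to the line x + span {\<tau>}. *)
definition approx_tangent :: "(real^2) set \<Rightarrow> real^2 \<Rightarrow> real^2 \<Rightarrow> bool" where
  "approx_tangent S x \<tau> \<longleftrightarrow>
     norm \<tau> = 1 \<and>
     0 < Limsup (at_right 0) (\<lambda>r. emeasure hausdorff1 (S \<inter> cball x r) / ennreal (2 * r)) \<and>
     (\<forall>s. 0 < s \<and> s < 1 \<longrightarrow>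
        ((\<lambda>r. emeasure hausdorff1
                (S \<inter> cball x r \<inter> {y. s * norm (y - x) \<le> \<bar>rot90 \<tau> \<bullet> (y - x)\<bar>}) / ennreal r)
          \<longlongrightarrow> 0) (at_right 0))"


definition clearing_out :: "(real^'k::finite \<Rightarrow> real) \<Rightarrow> (real^2) set \<Rightarrow> real \<Rightarrow> bool" where
  "clearing_out V \<Omega> \<eta> \<longleftrightarrow>
     (\<forall>(\<epsilon> :: nat \<Rightarrow> real) (v :: nat \<Rightarrow> real^2 \<Rightarrow> real^'k) \<nu> (M :: real) x r.
        (\<forall>n. 0 < \<epsilon> n \<and> \<epsilon> n \<le> 1) \<longrightarrow> \<epsilon> \<longlonglongrightarrow> 0 \<longrightarrow>
        (\<forall>n. allen_cahn_solution V \<Omega> (\<epsilon> n) (v n)) \<longrightarrow>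
        (\<forall>n. energy V \<Omega> (\<epsilon> n) (v n) \<le> ennreal M) \<longrightarrow>
        weakly_converges \<Omega> (\<lambda>n. energy_density V \<Omega> (\<epsilon> n) (v n)) \<nu> \<longrightarrow>
        0 < r \<longrightarrow> ball x r \<subseteq> \<Omega> \<longrightarrow>
        emeasure \<nu> (cball x r \<inter> \<Omega>) < ennreal (\<eta> * r) \<longrightarrow>
        emeasure \<nu> (cball x (r / 2) \<inter> \<Omega>) = 0)"

definition concentration_set :: "(real^2) set \<Rightarrow> real \<Rightarrow> (real^2) measure \<Rightarrow> (real^2) set" where
  "concentration_set \<Omega> \<eta> \<nu> =
     {x\<in>\<Omega>. ennreal \<eta> \<le> Liminf (at_right 0) (\<lambda>r. emeasure \<nu> (cball x r \<inter> \<Omega>) / ennreal r)}"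

(* component, along the vectors a and b, of the matrix-valued density m at x *)
definition frame_component :: "(2 \<Rightarrow> 2 \<Rightarrow> real^2 \<Rightarrow> real) \<Rightarrow>
    (real^2 \<Rightarrow> real^2) \<Rightarrow> (real^2 \<Rightarrow> real^2) \<Rightarrow> real^2 \<Rightarrow> real" where
  "frame_component m a b x = (\<Sum>i\<in>UNIV. \<Sum>j\<in>UNIV. m i j x * a x $ i * b x $ j)"

definition m_parallel_parallel where
  "m_parallel_parallel m \<tau> = frame_component m \<tau> \<tau>"

definition m_perp_perp where
  "m_perp_perp m \<tau> = frame_component m (\<lambda>x. rot90 (\<tau> x)) (\<lambda>x. rot90 (\<tau> x))"

definition m_perp_parallel where
  "m_perp_parallel m \<tau> = frame_component m \<tau> (\<lambda>x. rot90 (\<tau> x))"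

end

theory Submission
  imports Defs
begin

text \<open>
  A smooth solution makes the stress tensor \<open>e\<^sub>\<epsilon>(u) \<delta>\<^sub>l\<^sub>j - \<epsilon> \<partial>\<^sub>lu \<bullet> \<partial>\<^sub>ju\<close> divergence free (Pohozaev's identity).
  For a weak solution, this identity is obtained by mollification, which requires \<open>u\<close> to be
  locally bounded: by Kato's inequality and the coercivity of \<open>V\<close>, a convex function of \<open>u\<close> that grows
  linearly is subharmonic, and averages of subharmonic functions decrease as the radius shrinks.
  In the limit \<open>\<epsilon> \<rightarrow> 0\<close>, the matrix measure \<open>a \<lambda>\<close> with
  \<open>a\<^sub>l\<^sub>j = (z + (m\<^sub>1\<^sub>1 + m\<^sub>2\<^sub>2) / 2) \<delta>\<^sub>l\<^sub>j - m\<^sub>l\<^sub>j\<close> and \<open>\<zeta> = z \<lambda>\<close> is divergence free. Blowing it up at a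
  Lebesgue point of \<open>a\<close> with an approximate tangent line shows that \<open>a\<close> annihilates the normal \<open>n\<close>.
  The identities are \<open>n \<bullet> a n = 0\<close> and \<open>\<tau> \<bullet> a n = 0\<close>.
\<close>

section \<open>Partial derivatives and smooth bump functions\<close>

text \<open>\<open>V\<close> has no growth bound from above and \<open>u\<close> is only an
  \<open>H1_on\<close> function, so the product of the equation with a derivative of
  \<open>u\<close> need not be integrable. A mollification satisfies the equation with
  \<open>grad V (u x)\<close> averaged, not with \<open>grad V\<close> taken at the average. This
  commutator tends to 0 only almost everywhere and multiplies gradients that converge in L1, so it
  must be bounded; the bound on \<open>u\<close> provides this. Testing with translated kernels
  turns every weak identity into a pointwise identity between convolutions. The stress identity is
  proved for C^1 test functions: their partials are continuous with compact support, as the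
  convergence of measures demands, and the cutoff of the blow-up may be a squared positive part.
  Writing the energy density through potential and trace leaves \<open>\<zeta>\<close> and the
  \<open>\<mu> i j\<close> in the limit; \<open>\<nu>\<close> makes \<open>S\<close> closed in
  \<open>\<Omega>\<close> and of finite length. Lebesgue points are found by Vitali coverings
  directly for Hausdorff measure, with averages divided by the radius and not by the mass of the
  ball, so that upper density bounds suffice.\<close>

definition has_partials ::
    "(real^'n::finite \<Rightarrow> 'b::real_normed_vector) \<Rightarrow> ('n \<Rightarrow> real^'n \<Rightarrow> 'b) \<Rightarrow> bool" where
  "has_partials f D \<longleftrightarrow>
     (\<forall>x. (f has_derivative (\<lambda>h. \<Sum>i\<in>UNIV. h $ i *\<^sub>R D i x)) (at x)) \<and>
     (\<forall>i. continuous_on UNIV (D i))"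

lemma has_partialsI:
  assumes "\<And>x. (f has_derivative f' x) (at x)"
    and "\<And>x h. f' x h = (\<Sum>i\<in>UNIV. h $ i *\<^sub>R D i x)"
    and "\<And>i. continuous_on UNIV (D i)"
  shows "has_partials f D"
proof -
  have "f' x = (\<lambda>h. \<Sum>i\<in>UNIV. h $ i *\<^sub>R D i x)" for x
    using assms(2) by (rule ext)
  then show ?thesis
    unfolding has_partials_def using assms(1,3) by metis
qed

lemma has_partials_derivative:
  "has_partials f D \<Longrightarrow> (f has_derivative (\<lambda>h. \<Sum>i\<in>UNIV. h $ i *\<^sub>R D i x)) (at x)"
  by (simp add: has_partials_def)

lemma has_partials_continuous_partial: "has_partials f D \<Longrightarrow> continuous_on A (D i)"
  by (auto simp: has_partials_def intro: continuous_on_subset)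

lemma has_partials_continuous: "has_partials f D \<Longrightarrow> continuous_on A f"
  by (meson continuous_at_imp_continuous_on has_derivative_continuous has_partials_derivative)

text \<open>The bridge from explicit families of partials, in which all computations are done, to
  \<open>partial_deriv\<close>, in which test functions and weak solutions are phrased.\<close>

lemma has_partials_imp_partial_deriv:
  assumes "has_partials f D"
  shows "partial_deriv i f = D i"
proof
  fix x
  have "frechet_derivative f (at x) = (\<lambda>h. \<Sum>i\<in>UNIV. h $ i *\<^sub>R D i x)"
    using frechet_derivative_at[OF has_partials_derivative[OF assms]] by simp
  then have "partial_deriv i f x = (\<Sum>j\<in>UNIV. axis i 1 $ j *\<^sub>R D j x)"
    by (simp add: partial_deriv_def)
  also have "\<dots> = (\<Sum>j\<in>UNIV. if j = i then D j x else 0)"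
    by (intro sum.cong) (auto simp: axis_def)
  finally show "partial_deriv i f x = D i x" by simp
qed

text \<open>Off the closed set \<open>K\<close> the function agrees with 0 on a whole neighbourhood,
  and derivatives are unique.\<close>

lemma has_partials_outside:
  assumes "has_partials f D" "closed K" "\<And>x. x \<notin> K \<Longrightarrow> f x = 0" "x \<notin> K"
  shows "D i x = 0"
proof -
  have "((\<lambda>_. 0) has_derivative (\<lambda>h. \<Sum>i\<in>UNIV. h $ i *\<^sub>R D i x)) (at x)"
    using has_partials_derivative[OF assms(1)] open_Compl[OF assms(2)]
    by (rule has_derivative_transform_within_open) (use assms(3,4) in auto)
  then have "(\<lambda>h. \<Sum>i\<in>UNIV. h $ i *\<^sub>R D i x) = (\<lambda>h. 0)"
    using has_derivative_const has_derivative_unique by blast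
  then have "(\<Sum>j\<in>UNIV. axis i 1 $ j *\<^sub>R D j x) = 0" by meson
  moreover have "(\<Sum>j\<in>UNIV. axis i 1 $ j *\<^sub>R D j x) = (\<Sum>j\<in>UNIV. if j = i then D j x else 0)"
    by (intro sum.cong) (auto simp: axis_def)
  ultimately show ?thesis by simp
qed

lemma has_partials_const: "has_partials (\<lambda>x. c) (\<lambda>i x. 0)"
  by (rule has_partialsI) (rule has_derivative_const, auto)

lemma has_partials_coord:
  "has_partials (\<lambda>x::real^'n::finite. x $ j) (\<lambda>i x. if i = j then 1 else 0)"
proof (rule has_partialsI)
  show "((\<lambda>x::real^'n. x $ j) has_derivative (\<lambda>h. h $ j)) (at x)" for x
    by (intro bounded_linear_imp_has_derivative bounded_linear_vec_nth)
  show "h $ j = (\<Sum>i\<in>UNIV. h $ i *\<^sub>R (if i = j then 1 else 0))" for h :: "real^'n"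
    by (simp add: if_distrib cong: if_cong)
qed auto

lemma has_partials_add:
  assumes "has_partials f D" "has_partials g E"
  shows "has_partials (\<lambda>x. f x + g x) (\<lambda>i x. D i x + E i x)"
  by (rule has_partialsI)
    (rule has_derivative_add[OF assms[THEN has_partials_derivative]],
     auto simp: sum.distrib scaleR_right_distrib intro!: continuous_intros
       assms[THEN has_partials_continuous_partial])

lemma has_partials_bilinear:
  assumes "bounded_bilinear B" and f: "has_partials f D" and g: "has_partials g E"
  shows "has_partials (\<lambda>x. B (f x) (g x)) (\<lambda>i x. B (f x) (E i x) + B (D i x) (g x))"
proof -
  interpret bounded_bilinear B by fact
  show ?thesis
    by (rule has_partialsI, rule FDERIV[OF f[THEN has_partials_derivative] g[THEN has_partials_derivative]])
      (auto simp: sum_left sum_right scaleR_left scaleR_right sum.distrib scaleR_right_distrib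
        intro!: continuous_intros continuous_on has_partials_continuous[OF f] has_partials_continuous[OF g]
        has_partials_continuous_partial[OF f] has_partials_continuous_partial[OF g])
qed

lemmas has_partials_mult = has_partials_bilinear[OF bounded_bilinear_mult]
lemmas has_partials_inner = has_partials_bilinear[OF bounded_bilinear_inner]

lemma has_partials_cmult:
  fixes f :: "real^'n::finite \<Rightarrow> real"
  assumes "has_partials f D"
  shows "has_partials (\<lambda>x. c * f x) (\<lambda>i x. c * D i x)"
  using has_partials_mult[OF has_partials_const[of c] assms] by simp

lemma has_partials_sum:
  assumes "\<And>j. j \<in> J \<Longrightarrow> has_partials (f j) (D j)"
  shows "has_partials (\<lambda>x. \<Sum>j\<in>J. f j x) (\<lambda>i x. \<Sum>j\<in>J. D j i x)"
  using assms
  by (induction J rule: infinite_finite_induct)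
    (auto intro!: has_partials_const has_partials_add)

lemma has_partials_compose_real:
  assumes f: "has_partials f D" and g: "\<And>t. (g has_real_derivative g' t) (at t)"
    and g': "continuous_on UNIV g'"
  shows "has_partials (\<lambda>x. g (f x)) (\<lambda>i x. g' (f x) * D i x)"
proof (rule has_partialsI)
  show "((\<lambda>x. g (f x)) has_derivative (\<lambda>h. g' (f x) * (\<Sum>i\<in>UNIV. h $ i *\<^sub>R D i x))) (at x)" for x
    using has_derivative_compose[OF has_partials_derivative[OF f] g[unfolded has_field_derivative_def]]
    by simp
  show "continuous_on UNIV (\<lambda>x. g' (f x) * D i x)" for i
    by (intro continuous_intros continuous_on_compose2[OF g'] has_partials_continuous[OF f]
        has_partials_continuous_partial[OF f]) auto
qed (auto simp: sum_distrib_left mult.left_commute intro!: sum.cong)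

lemma has_partials_compose_vec:
  fixes \<Phi> :: "'b::real_inner \<Rightarrow> real"
  assumes v: "has_partials v G" and \<Phi>: "\<And>y. (\<Phi> has_derivative (\<lambda>h. p y \<bullet> h)) (at y)"
    and p: "continuous_on UNIV p"
  shows "has_partials (\<lambda>x. \<Phi> (v x)) (\<lambda>i x. p (v x) \<bullet> G i x)"
proof (rule has_partialsI)
  show "((\<lambda>x. \<Phi> (v x)) has_derivative (\<lambda>h. p (v x) \<bullet> (\<Sum>i\<in>UNIV. h $ i *\<^sub>R G i x))) (at x)" for x
    using has_derivative_compose[OF has_partials_derivative[OF v] \<Phi>] by simp
  show "continuous_on UNIV (\<lambda>x. p (v x) \<bullet> G i x)" for i
    by (intro continuous_intros continuous_on_compose2[OF p] has_partials_continuous[OF v]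
        has_partials_continuous_partial[OF v]) auto
qed (auto simp: inner_sum_right intro!: sum.cong)

text \<open>The functions \<open>bump p\<close> include \<open>t \<mapsto> exp (-1/t)\<close> (for \<open>p = 1\<close>) and are closed
  under differentiation.\<close>

definition bump :: "real poly \<Rightarrow> real \<Rightarrow> real" where
  "bump p t = (if 0 < t then poly p (1 / t) * exp (- (1 / t)) else 0)"

text \<open>The chain rule for \<open>poly p (1 / t) * exp (- (1 / t))\<close> produces the factor
  \<open>p - pderiv p\<close> at \<open>1 / t\<close> and the square of \<open>1 / t\<close>;
  \<open>monom 1 2\<close> is that square.\<close>

definition bump_next :: "real poly \<Rightarrow> real poly" where
  "bump_next p = monom 1 2 * (p - pderiv p)"

lemma bump_nonpos [simp]: "t \<le> 0 \<Longrightarrow> bump p t = 0"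
  by (simp add: bump_def)

lemma poly_times_exp_tendsto_0: "((\<lambda>s. poly p s * exp (- s)) \<longlongrightarrow> (0::real)) at_top"
proof -
  have "((\<lambda>s. \<Sum>i\<le>degree p. coeff p i * (s ^ i / exp s)) \<longlongrightarrow> (\<Sum>i\<le>degree p. coeff p i * 0)) at_top"
    by (intro tendsto_intros tendsto_power_div_exp_0)
  then show ?thesis
    by (simp add: poly_altdef sum_distrib_right exp_minus divide_inverse mult.assoc)
qed

lemma bump_tendsto_0: "(bump p \<longlongrightarrow> 0) (at 0)"
proof (rule filterlim_split_at)
  show "(bump p \<longlongrightarrow> 0) (at_left 0)"
    by (rule tendsto_eventually) (auto simp: eventually_at_filter)
  have "((\<lambda>t. poly p (inverse t) * exp (- inverse t)) \<longlongrightarrow> 0) (at_right (0::real))"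
    using filterlim_compose[OF poly_times_exp_tendsto_0 filterlim_inverse_at_top_right] .
  then show "(bump p \<longlongrightarrow> 0) (at_right 0)"
    by (rule Lim_transform_eventually)
      (auto simp: bump_def eventually_at_filter inverse_eq_divide)
qed

lemma bump_has_derivative: "(bump p has_real_derivative bump (bump_next p) t) (at t)"
proof -
  consider "t > 0" | "t < 0" | "t = 0" by linarith
  then show ?thesis
  proof cases
    case 1
    have inv: "((\<lambda>t. 1 / t) has_real_derivative - ((1 / t)\<^sup>2)) (at t)"
      using DERIV_inverse[of t] 1 by (simp add: inverse_eq_divide power_divide numeral_2_eq_2)
    have "((\<lambda>t. poly p (1 / t) * exp (- (1 / t))) has_real_derivative
        poly (pderiv p) (1 / t) * - ((1 / t)\<^sup>2) * exp (- (1 / t)) +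
        exp (- (1 / t)) * - (- ((1 / t)\<^sup>2)) * poly p (1 / t)) (at t)"
      by (rule DERIV_mult[OF DERIV_chain2[OF poly_DERIV inv] DERIV_chain2[OF DERIV_exp DERIV_minus[OF inv]]])
    also have "poly (pderiv p) (1 / t) * - ((1 / t)\<^sup>2) * exp (- (1 / t)) +
        exp (- (1 / t)) * - (- ((1 / t)\<^sup>2)) * poly p (1 / t) = bump (bump_next p) t"
      using 1 by (simp add: bump_def bump_next_def poly_monom algebra_simps)
    finally have "((\<lambda>t. poly p (1 / t) * exp (- (1 / t))) has_real_derivative bump (bump_next p) t) (at t)" .
    moreover have ev: "eventually (\<lambda>s. poly p (1 / s) * exp (- (1 / s)) = bump p s) (nhds t)"
      using eventually_nhds_in_open[of "{0<..}" t] 1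
      by (auto elim!: eventually_mono simp: bump_def)
    ultimately show ?thesis
      using DERIV_cong_ev[OF refl ev refl, THEN iffD1] by blast
  next
    case 2
    have "((\<lambda>t. 0) has_real_derivative bump (bump_next p) t) (at t)"
      using 2 by simp
    moreover have ev: "eventually (\<lambda>s. 0 = bump p s) (nhds t)"
      using eventually_nhds_in_open[of "{..<0}" t] 2
      by (auto elim!: eventually_mono)
    ultimately show ?thesis
      using DERIV_cong_ev[OF refl ev refl, THEN iffD1] by blast
  next
    case 3
    \<comment> \<open>Dividing by \<open>h\<close> multiplies the polynomial in \<open>1 / h\<close>
      by its variable, so the difference quotient at 0 is again a function of the same
      family.\<close>
    have "(bump (pCons 0 p) \<longlongrightarrow> 0) (at 0)" by (rule bump_tendsto_0)
    then have "((\<lambda>h. bump p h / h) \<longlongrightarrow> 0) (at 0)"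
      by (rule Lim_transform_eventually) (auto simp: bump_def eventually_at_filter)
    then show ?thesis using 3 by (simp add: has_field_derivative_iff)
  qed
qed

lemma continuous_on_bump: "continuous_on A (bump p)"
  by (meson DERIV_isCont bump_has_derivative continuous_at_imp_continuous_on)

lemma has_partials_bump:
  assumes "has_partials f D"
  shows "has_partials (\<lambda>x. bump p (f x)) (\<lambda>i x. bump (bump_next p) (f x) * D i x)"
  by (intro has_partials_compose_real[OF assms] bump_has_derivative continuous_on_bump)

text \<open>A class closed under partial derivatives, so that \<open>smooth_on\<close> follows from
  a single induction on the order. It contains the radial kernels used for mollification and is
  stable under \<open>y \<mapsto> x - y\<close>, which makes translated kernels admissible as test
  functions.\<close>

inductive bump_algebra :: "(real^'n::finite \<Rightarrow> real) \<Rightarrow> bool" where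
  const: "bump_algebra (\<lambda>x. c)"
| coord: "bump_algebra (\<lambda>x. x $ i)"
| add: "bump_algebra f \<Longrightarrow> bump_algebra g \<Longrightarrow> bump_algebra (\<lambda>x. f x + g x)"
| mult: "bump_algebra f \<Longrightarrow> bump_algebra g \<Longrightarrow> bump_algebra (\<lambda>x. f x * g x)"
| bump: "bump_algebra f \<Longrightarrow> bump_algebra (\<lambda>x. bump p (f x))"

text \<open>The symmetry of second derivatives is part of the induction because it is immediate
  from the form of the generators.\<close>

lemma bump_algebra_partials_aux:
  assumes "bump_algebra f"
  shows "\<exists>D D2. has_partials f D \<and> (\<forall>i. bump_algebra (D i)) \<and>
    (\<forall>i. has_partials (D i) (D2 i)) \<and> (\<forall>i j. D2 i j = D2 j i)"
  using assms
proof induction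
  case (const c)
  show ?case
    by (rule exI[of _ "\<lambda>i x. 0"], rule exI[of _ "\<lambda>i j x. 0"])
      (simp add: has_partials_const bump_algebra.const)
next
  case (coord j)
  show ?case
    by (intro exI[of _ "\<lambda>i x. if i = j then 1 else 0"] exI[of _ "\<lambda>i j x. 0"])
      (simp add: has_partials_coord has_partials_const bump_algebra.const)
next
  case (add f g)
  obtain D D2 where D: "has_partials f D" "\<forall>i. bump_algebra (D i)"
      "\<forall>i. has_partials (D i) (D2 i)" "\<forall>i j. D2 i j = D2 j i"
    using add.IH(1) by (elim exE conjE)
  obtain E E2 where E: "has_partials g E" "\<forall>i. bump_algebra (E i)"
      "\<forall>i. has_partials (E i) (E2 i)" "\<forall>i j. E2 i j = E2 j i"
    using add.IH(2) by (elim exE conjE)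
  note * = D(1) D(2-4)[rule_format] E(1) E(2-4)[rule_format]
  show ?case
  proof (rule exI[of _ "\<lambda>i x. D i x + E i x"], rule exI[of _ "\<lambda>i j x. D2 i j x + E2 i j x"],
      intro conjI allI)
    show "has_partials (\<lambda>x. f x + g x) (\<lambda>i x. D i x + E i x)"
      by (rule has_partials_add[OF *(1,5)])
    show "bump_algebra (\<lambda>x. D i x + E i x)" for i
      by (rule bump_algebra.add[OF *(2,6)])
    show "has_partials (\<lambda>x. D i x + E i x) (\<lambda>j x. D2 i j x + E2 i j x)" for i
      by (rule has_partials_add[OF *(3,7)])
    have "D2 i j x = D2 j i x" "E2 i j x = E2 j i x" for i j x
      by (rule fun_cong[OF *(4)], rule fun_cong[OF *(8)])
    then show "(\<lambda>x. D2 i j x + E2 i j x) = (\<lambda>x. D2 j i x + E2 j i x)" for i j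
      by (auto simp: fun_eq_iff)
  qed
next
  case (mult f g)
  obtain D D2 where D: "has_partials f D" "\<forall>i. bump_algebra (D i)"
      "\<forall>i. has_partials (D i) (D2 i)" "\<forall>i j. D2 i j = D2 j i"
    using mult.IH(1) by (elim exE conjE)
  obtain E E2 where E: "has_partials g E" "\<forall>i. bump_algebra (E i)"
      "\<forall>i. has_partials (E i) (E2 i)" "\<forall>i j. E2 i j = E2 j i"
    using mult.IH(2) by (elim exE conjE)
  note * = D(1) D(2-4)[rule_format] E(1) E(2-4)[rule_format]
  have 1: "has_partials (\<lambda>x. f x * E i x + D i x * g x)
      (\<lambda>j x. (f x * E2 i j x + D j x * E i x) + (D i x * E j x + D2 i j x * g x))" for i
    by (rule has_partials_add[OF has_partials_mult[OF *(1,7)] has_partials_mult[OF *(3,5)]])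
  have 2: "D2 i j x = D2 j i x" "E2 i j x = E2 j i x" for i j x
    by (rule fun_cong[OF *(4)], rule fun_cong[OF *(8)])
  show ?case
  proof (rule exI[of _ "\<lambda>i x. f x * E i x + D i x * g x"],
      rule exI[of _ "\<lambda>i j x. (f x * E2 i j x + D j x * E i x) + (D i x * E j x + D2 i j x * g x)"],
      intro conjI allI)
    show "has_partials (\<lambda>x. f x * g x) (\<lambda>i x. f x * E i x + D i x * g x)"
      by (rule has_partials_mult[OF *(1,5)])
    show "bump_algebra (\<lambda>x. f x * E i x + D i x * g x)" for i
      by (rule bump_algebra.add[OF bump_algebra.mult[OF mult.hyps(1) *(6)]
            bump_algebra.mult[OF *(2) mult.hyps(2)]])
  qed (use 1 in assumption, use 2 in \<open>auto simp: fun_eq_iff algebra_simps\<close>)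
next
  case (bump f p)
  obtain D D2 where D: "has_partials f D" "\<forall>i. bump_algebra (D i)"
      "\<forall>i. has_partials (D i) (D2 i)" "\<forall>i j. D2 i j = D2 j i"
    using bump.IH by (elim exE conjE)
  note * = D(1) D(2-4)[rule_format]
  let ?p = "bump_next p" and ?q = "bump_next (bump_next p)"
  have 1: "has_partials (\<lambda>x. bump ?p (f x) * D i x)
      (\<lambda>j x. bump ?p (f x) * D2 i j x + (bump ?q (f x) * D j x) * D i x)" for i
    by (rule has_partials_mult[OF has_partials_bump[OF *(1)] *(3)])
  have 2: "D2 i j x = D2 j i x" for i j x by (rule fun_cong[OF *(4)])
  show ?case
  proof (rule exI[of _ "\<lambda>i x. bump ?p (f x) * D i x"],
      rule exI[of _ "\<lambda>i j x. bump ?p (f x) * D2 i j x + (bump ?q (f x) * D j x) * D i x"],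
      intro conjI allI)
    show "has_partials (\<lambda>x. bump p (f x)) (\<lambda>i x. bump ?p (f x) * D i x)"
      by (rule has_partials_bump[OF *(1)])
    show "bump_algebra (\<lambda>x. bump ?p (f x) * D i x)" for i
      by (rule bump_algebra.mult[OF bump_algebra.bump[OF bump.hyps] *(2)])
  qed (use 1 in assumption, use 2 in \<open>auto simp: fun_eq_iff algebra_simps\<close>)
qed

lemma bump_algebra_has_partials:
  assumes "bump_algebra f"
  shows "has_partials f (\<lambda>i. partial_deriv i f)" and "bump_algebra (partial_deriv i f)"
    and "partial_deriv i (partial_deriv j f) = partial_deriv j (partial_deriv i f)"
proof -
  obtain D D2 where D: "has_partials f D" "\<forall>i. bump_algebra (D i)"
      "\<forall>i. has_partials (D i) (D2 i)" "\<forall>i j. D2 i j = D2 j i"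
    using bump_algebra_partials_aux[OF assms] by (elim exE conjE)
  note * = D(1) D(2-4)[rule_format]
  have Df: "partial_deriv i f = D i" for i
    using *(1) by (rule has_partials_imp_partial_deriv)
  show "has_partials f (\<lambda>i. partial_deriv i f)" "bump_algebra (partial_deriv i f)"
    using * by (simp_all add: Df)
  have "partial_deriv i (D j) = D2 j i" for i j
    using *(3) by (rule has_partials_imp_partial_deriv)
  then show "partial_deriv i (partial_deriv j f) = partial_deriv j (partial_deriv i f)"
    using *(4)[of i j] by (simp only: Df)
qed

lemma bump_algebra_smooth:
  assumes "bump_algebra f"
  shows "smooth_on UNIV f"
proof -
  have "Ck_on k UNIV f" for k
    using assms
  proof (induction k arbitrary: f)
    case 0
    then show ?case
      using has_partials_continuous[OF bump_algebra_has_partials(1)] by auto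
  next
    case (Suc k)
    then show ?case
      using has_partials_derivative[OF bump_algebra_has_partials(1)[OF Suc.prems]]
      by (auto simp: differentiable_def intro: bump_algebra_has_partials(2))
  qed
  then show ?thesis by (simp add: smooth_on_def)
qed

lemma bump_algebra_reflect:
  assumes "bump_algebra f"
  shows "bump_algebra (\<lambda>y. f (x - y))"
  using assms
proof induction
  case (coord i)
  have "bump_algebra (\<lambda>y. x $ i + (-1) * y $ i)" by (intro bump_algebra.intros)
  then show ?case by simp
qed (auto intro: bump_algebra.intros)

lemma bump_algebra_sum:
  "(\<And>j. j \<in> J \<Longrightarrow> bump_algebra (f j)) \<Longrightarrow> bump_algebra (\<lambda>x. \<Sum>j\<in>J. f j x)"
  by (induction J rule: infinite_finite_induct) (auto intro: bump_algebra.intros)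

lemma norm_power2_vec: "(norm (x::real^'n::finite))\<^sup>2 = (\<Sum>i\<in>UNIV. x $ i * x $ i)"
  by (simp add: power2_norm_eq_inner inner_vec_def)

lemma bump_algebra_radial: "bump_algebra (\<lambda>x. bump p (a + b * (norm (x::real^'n::finite))\<^sup>2))"
  unfolding norm_power2_vec by (intro bump_algebra.intros bump_algebra_sum)

section \<open>Compactly supported functions and convolution\<close>

lemma uniformly_continuous_compact_support:
  fixes f :: "'a::euclidean_space \<Rightarrow> 'b::real_normed_vector"
  assumes "continuous_on UNIV f" "compact K" "\<And>x. x \<notin> K \<Longrightarrow> f x = 0"
  shows "uniformly_continuous_on UNIV f"
proof -
  obtain R where R: "K \<subseteq> cball 0 R"
    using compact_imp_bounded[OF assms(2)] by (auto simp: bounded_iff subset_eq)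
  have uc: "uniformly_continuous_on (cball 0 (R + 1)) f"
    by (intro compact_uniformly_continuous continuous_on_subset[OF assms(1)]) auto
  show ?thesis
    unfolding uniformly_continuous_on_def
  proof (intro allI impI)
    fix e :: real assume "0 < e"
    then obtain d where d: "0 < d" "\<And>x y. x \<in> cball 0 (R + 1) \<Longrightarrow> y \<in> cball 0 (R + 1) \<Longrightarrow>
        dist y x < d \<Longrightarrow> dist (f y) (f x) < e"
      using uc unfolding uniformly_continuous_on_def by metis
    \<comment> \<open>Distance below 1 leaves two cases: both points lie in the enlarged ball, where
      \<open>f\<close> is uniformly continuous, or both lie outside the support.\<close>
    have "dist (f y) (f x) < e" if "dist y x < min d 1" for x y
    proof (cases "x \<in> cball 0 R \<or> y \<in> cball 0 R")
      case True
      have "norm x \<le> norm y + dist y x" "norm y \<le> norm x + dist y x"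
        by (metis dist_0_norm dist_commute dist_triangle add.commute)+
      then show ?thesis using True that by (intro d) (auto simp: dist_0_norm)
    next
      case False
      then have "f x = 0" "f y = 0" using R assms(3) by blast+
      then show ?thesis using \<open>0 < e\<close> by simp
    qed
    then show "\<exists>d>0. \<forall>x\<in>UNIV. \<forall>x'\<in>UNIV. dist x' x < d \<longrightarrow> dist (f x') (f x) < e"
      using d(1) by (intro exI[of _ "min d 1"]) auto
  qed
qed

lemma bounded_compact_support:
  fixes f :: "'a::euclidean_space \<Rightarrow> 'b::real_normed_vector"
  assumes "continuous_on UNIV f" "compact K" "\<And>x. x \<notin> K \<Longrightarrow> f x = 0"
  obtains C where "0 \<le> C" "\<And>x. norm (f x) \<le> C"
proof -
  have "bounded (f ` K)"
    by (intro compact_imp_bounded compact_continuous_image continuous_on_subset[OF assms(1)] assms(2)) auto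
  then obtain C where "\<And>x. x \<in> K \<Longrightarrow> norm (f x) \<le> C" by (auto simp: bounded_iff)
  then have "norm (f x) \<le> max C 0" for x
    using assms(3)[of x] by (cases "x \<in> K") (auto intro: max.coboundedI1)
  then show ?thesis by (intro that[of "max C 0"]) auto
qed

lemma integrable_compact_support:
  fixes f :: "'a::euclidean_space \<Rightarrow> 'b::{banach, second_countable_topology}"
  assumes "continuous_on UNIV f" "compact K" "\<And>x. x \<notin> K \<Longrightarrow> f x = 0"
  shows "integrable lborel f"
proof -
  have "integrable lborel (\<lambda>x. indicator K x *\<^sub>R f x)"
    by (intro borel_integrable_compact assms continuous_on_subset[OF assms(1)]) auto
  moreover have "(\<lambda>x. indicator K x *\<^sub>R f x) = f"
    using assms(3) by (auto simp: indicator_def fun_eq_iff)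
  ultimately show ?thesis by simp
qed

lemma integrable_lebesgue_compact_support:
  fixes f :: "'a::euclidean_space \<Rightarrow> 'b::{banach, second_countable_topology}"
  assumes "continuous_on UNIV f" "compact K" "\<And>x. x \<notin> K \<Longrightarrow> f x = 0"
  shows "integrable lebesgue f"
  using integrable_compact_support[OF assms] by (simp add: integrable_completion)

text \<open>This also covers non-integrable \<open>f\<close>: its integral is 0 by convention, while
  \<open>g\<close> dominates a norm and so has nonnegative integral.\<close>

lemma norm_integral_le:
  fixes f :: "'a \<Rightarrow> 'b::{banach, second_countable_topology}"
  assumes "integrable M g" "AE x in M. norm (f x) \<le> g x"
  shows "norm (\<integral>x. f x \<partial>M) \<le> (\<integral>x. g x \<partial>M)"
proof (cases "integrable M f")
  case True
  then have "norm (\<integral>x. f x \<partial>M) \<le> (\<integral>x. norm (f x) \<partial>M)" by simp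
  also have "\<dots> \<le> (\<integral>x. g x \<partial>M)"
    using True assms by (intro integral_mono_AE) auto
  finally show ?thesis .
next
  case False
  have "0 \<le> (\<integral>x. g x \<partial>M)"
    using assms(2) by (intro integral_nonneg_AE) (auto elim!: eventually_mono intro: order_trans[OF norm_ge_zero])
  then show ?thesis using False by (simp add: not_integrable_integral_eq)
qed

lemma integrable_mult_bounded:
  fixes g :: "'a \<Rightarrow> 'b::{banach, second_countable_topology}" and a :: "'a \<Rightarrow> real"
  assumes "integrable M g" "a \<in> borel_measurable M" "\<And>x. \<bar>a x\<bar> \<le> C"
  shows "integrable M (\<lambda>x. a x *\<^sub>R g x)"
proof (rule Bochner_Integration.integrable_bound)
  show "integrable M (\<lambda>x. C * norm (g x))" using assms(1) by auto
  show "AE x in M. norm (a x *\<^sub>R g x) \<le> norm (C * norm (g x))"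
  proof (rule AE_I2)
    fix x
    have "0 \<le> C" using assms(3)[of x] by linarith
    then show "norm (a x *\<^sub>R g x) \<le> norm (C * norm (g x))"
      using assms(3) by (auto simp: abs_mult intro!: mult_right_mono)
  qed
qed (use assms in measurable)

lemma lborel_distr_reflect: "distr lborel borel (\<lambda>y. x - y) = (lborel :: 'a::euclidean_space measure)"
  using lborel_affine[of "-1" x] by (simp add: density_1)

lemma integral_reflect:
  fixes f :: "'a::euclidean_space \<Rightarrow> 'b::{banach, second_countable_topology}"
  assumes "f \<in> borel_measurable borel"
  shows "(\<integral>y. f (x - y) \<partial>lborel) = (\<integral>y. f y \<partial>lborel)"
  using integral_distr[of "\<lambda>y. x - y" lborel borel f] assms by (simp add: lborel_distr_reflect)

text \<open>Integrating the uniform first order remainder of the kernel against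
  \<open>norm (g y)\<close> bounds the remainder of the integral. The parameter lives in an
  arbitrary normed space because the lemma serves twice: for convolutions, with a point as
  parameter, and for radial averages, with the inverse squared radius as parameter.\<close>

lemma has_derivative_integral_uniform:
  fixes k :: "'a::real_normed_vector \<Rightarrow> 'c \<Rightarrow> real" and g :: "'c \<Rightarrow> 'b::{banach, second_countable_topology}"
  assumes g: "integrable M g"
    and k: "\<And>t. k t \<in> borel_measurable M" "\<And>t y. \<bar>k t y\<bar> \<le> B t"
    and k': "\<And>h. (\<lambda>y. k' y h) \<in> borel_measurable M" "\<And>h y. \<bar>k' y h\<bar> \<le> C * norm h"
      "\<And>y. linear (k' y)"
    and unif: "\<And>e. 0 < e \<Longrightarrow> \<exists>d>0. \<forall>h y. norm h < d \<longrightarrow> \<bar>k (t + h) y - k t y - k' y h\<bar> \<le> e * norm h"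
  shows "((\<lambda>s. \<integral>y. k s y *\<^sub>R g y \<partial>M) has_derivative (\<lambda>h. \<integral>y. k' y h *\<^sub>R g y \<partial>M)) (at t)"
proof -
  have ik: "integrable M (\<lambda>y. k s y *\<^sub>R g y)" for s
    by (rule integrable_mult_bounded[OF g k])
  have ik': "integrable M (\<lambda>y. k' y h *\<^sub>R g y)" for h
    by (rule integrable_mult_bounded[OF g k'(1,2)])
  define G where "G = (\<integral>y. norm (g y) \<partial>M)"
  have G: "0 \<le> G" by (simp add: G_def)
  have bl: "bounded_linear (\<lambda>h. \<integral>y. k' y h *\<^sub>R g y \<partial>M)"
  proof (rule bounded_linear_intro)
    show "(\<integral>y. k' y (h1 + h2) *\<^sub>R g y \<partial>M) = (\<integral>y. k' y h1 *\<^sub>R g y \<partial>M) + (\<integral>y. k' y h2 *\<^sub>R g y \<partial>M)" for h1 h2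
      using ik' by (simp add: linear_add[OF k'(3)] scaleR_left_distrib)
    show "(\<integral>y. k' y (r *\<^sub>R h) *\<^sub>R g y \<partial>M) = r *\<^sub>R (\<integral>y. k' y h *\<^sub>R g y \<partial>M)" for r h
      by (simp add: linear_cmul[OF k'(3)] flip: scaleR_scaleR)
    show "norm (\<integral>y. k' y h *\<^sub>R g y \<partial>M) \<le> norm h * (C * G)" for h
    proof -
      have "norm (\<integral>y. k' y h *\<^sub>R g y \<partial>M) \<le> (\<integral>y. C * norm h * norm (g y) \<partial>M)"
        by (rule norm_integral_le) (use g k'(2) in \<open>auto intro!: mult_right_mono\<close>)
      then show ?thesis by (simp add: G_def mult_ac)
    qed
  qed
  show ?thesis
    unfolding has_derivative_at_alt
  proof (intro conjI bl allI impI)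
    fix e :: real assume e: "0 < e"
    then have "0 < e / (G + 1)" using G by simp
    then obtain d where d: "d > 0" "\<And>h y. norm h < d \<Longrightarrow>
        \<bar>k (t + h) y - k t y - k' y h\<bar> \<le> e / (G + 1) * norm h"
      using unif by metis
    have "norm ((\<integral>y. k s y *\<^sub>R g y \<partial>M) - (\<integral>y. k t y *\<^sub>R g y \<partial>M) - (\<integral>y. k' y (s - t) *\<^sub>R g y \<partial>M))
        \<le> e * norm (s - t)" if "norm (s - t) < d" for s
    proof -
      have "(\<integral>y. k s y *\<^sub>R g y \<partial>M) - (\<integral>y. k t y *\<^sub>R g y \<partial>M) - (\<integral>y. k' y (s - t) *\<^sub>R g y \<partial>M)
          = (\<integral>y. (k s y - k t y - k' y (s - t)) *\<^sub>R g y \<partial>M)"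
        using ik ik' by (simp add: scaleR_left_diff_distrib)
      also have "norm \<dots> \<le> (\<integral>y. (e / (G + 1) * norm (s - t)) * norm (g y) \<partial>M)"
      proof (rule norm_integral_le)
        show "AE y in M. norm ((k s y - k t y - k' y (s - t)) *\<^sub>R g y) \<le> (e / (G + 1) * norm (s - t)) * norm (g y)"
          using d(2)[OF that] by (auto intro!: mult_right_mono simp del: times_divide_eq_left)
      qed (use g in auto)
      also have "\<dots> = e * norm (s - t) * (G / (G + 1))"
        by (simp add: G_def)
      also have "\<dots> \<le> e * norm (s - t) * 1"
        using G e by (intro mult_left_mono) auto
      finally show ?thesis by simp
    qed
    then show "\<exists>d>0. \<forall>s. norm (s - t) < d \<longrightarrow>
        norm ((\<integral>y. k s y *\<^sub>R g y \<partial>M) - (\<integral>y. k t y *\<^sub>R g y \<partial>M) - (\<integral>y. k' y (s - t) *\<^sub>R g y \<partial>M))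
        \<le> e * norm (s - t)"
      using d(1) by blast
  qed
qed

text \<open>The integral is taken over the completed measure because the functions \<open>g\<close>
  of interest, weak derivatives among them, are only Lebesgue measurable; the kernels are
  continuous.\<close>

definition conv :: "('a::euclidean_space \<Rightarrow> real) \<Rightarrow> ('a \<Rightarrow> 'b::{banach, second_countable_topology}) \<Rightarrow> 'a \<Rightarrow> 'b" where
  "conv k g x = (\<integral>y. k (x - y) *\<^sub>R g y \<partial>lebesgue)"

lemma borel_measurable_lebesgue_continuous:
  "continuous_on UNIV f \<Longrightarrow> f \<in> borel_measurable lebesgue"
  by (intro measurable_completion) (simp add: borel_measurable_continuous_onI)

lemma kernel_reflect_measurable:
  fixes k :: "'a::euclidean_space \<Rightarrow> real"
  assumes "continuous_on UNIV k"
  shows "(\<lambda>y. k (x - y)) \<in> borel_measurable lebesgue"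
  by (intro borel_measurable_lebesgue_continuous continuous_on_compose2[OF assms] continuous_intros) auto

lemma conv_integrable:
  fixes g :: "'a::euclidean_space \<Rightarrow> 'b::{banach, second_countable_topology}"
  assumes "continuous_on UNIV k" "\<And>z. \<bar>k z\<bar> \<le> C" "integrable lebesgue g"
  shows "integrable lebesgue (\<lambda>y. k (x - y) *\<^sub>R g y)"
  by (rule integrable_mult_bounded[where C = C, OF assms(3)])
    (rule kernel_reflect_measurable[OF assms(1)], rule assms(2))

lemma conv_continuous:
  assumes "uniformly_continuous_on UNIV k" "\<And>z. \<bar>k z\<bar> \<le> C" "integrable lebesgue g"
  shows "continuous_on UNIV (conv k g)"
proof -
  define G where "G = (\<integral>y. norm (g y) \<partial>lebesgue)"
  have G: "0 \<le> G" by (simp add: G_def)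
  have int: "integrable lebesgue (\<lambda>y. k (x - y) *\<^sub>R g y)" for x
    by (rule conv_integrable[OF uniformly_continuous_imp_continuous[OF assms(1)] assms(2,3)])
  show ?thesis
    unfolding continuous_on_iff
  proof (intro ballI allI impI)
    fix x and e :: real assume e: "0 < e"
    then have "0 < e / (G + 1)" using G by simp
    then obtain d where d: "d > 0" "\<And>z w. dist w z < d \<Longrightarrow> dist (k w) (k z) < e / (G + 1)"
      using assms(1) unfolding uniformly_continuous_on_def by (metis UNIV_I)
    have "dist (conv k g x') (conv k g x) < e" if "dist x' x < d" for x'
    proof -
      have "conv k g x' - conv k g x = (\<integral>y. (k (x' - y) - k (x - y)) *\<^sub>R g y \<partial>lebesgue)"
        using int by (simp add: conv_def scaleR_left_diff_distrib)
      also have "norm \<dots> \<le> (\<integral>y. e / (G + 1) * norm (g y) \<partial>lebesgue)"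
      proof (rule norm_integral_le)
        have "\<bar>k (x' - y) - k (x - y)\<bar> \<le> e / (G + 1)" for y
          using d(2)[of "x' - y" "x - y"] that by (auto simp: dist_norm)
        then show "AE y in lebesgue. norm ((k (x' - y) - k (x - y)) *\<^sub>R g y) \<le> e / (G + 1) * norm (g y)"
          by (auto intro!: mult_right_mono simp del: times_divide_eq_left)
      qed (use assms(3) in auto)
      also have "\<dots> = e * (G / (G + 1))" by (simp add: G_def)
      also have "\<dots> < e * 1" using G e by (intro mult_strict_left_mono) auto
      finally show ?thesis by (simp add: dist_norm)
    qed
    then show "\<exists>d>0. \<forall>x'\<in>UNIV. dist x' x < d \<longrightarrow> dist (conv k g x') (conv k g x) < e"
      using d(1) by blast
  qed
qed

text \<open>Compact support makes the partials uniformly continuous, and the mean value inequality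
  on a small ball then makes the first order remainder uniform in \<open>z\<close>, which is the
  form required under the integral sign.\<close>

lemma has_partials_uniform:
  fixes k :: "real^'n::finite \<Rightarrow> real"
  assumes k: "has_partials k D" and K: "compact K" "\<And>x. x \<notin> K \<Longrightarrow> k x = 0" and e: "0 < e"
  shows "\<exists>d>0. \<forall>h z. norm h < d \<longrightarrow> \<bar>k (z + h) - k z - (\<Sum>i\<in>UNIV. h $ i * D i z)\<bar> \<le> e * norm h"
proof -
  let ?n = "real CARD('n)"
  have uc: "uniformly_continuous_on UNIV (D i)" for i
    by (rule uniformly_continuous_compact_support[OF has_partials_continuous_partial[OF k] K(1)])
      (use has_partials_outside[OF k compact_imp_closed[OF K(1)] K(2)] in auto)
  have "\<exists>d. 0 < d \<and> (\<forall>z w. dist w z < d \<longrightarrow> dist (D i w) (D i z) < e / ?n)" for i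
    using uc[of i] e unfolding uniformly_continuous_on_def by (auto dest!: spec[of _ "e / ?n"])
  then obtain d where d: "\<And>i. 0 < d i" "\<And>i z w. dist w z < d i \<Longrightarrow> dist (D i w) (D i z) < e / ?n"
    by metis
  define d0 where "d0 = Min (range d)"
  have d0: "0 < d0" "\<And>i. d0 \<le> d i" using d(1) by (auto simp: d0_def Min_gr_iff)
  have "\<bar>k (z + h) - k z - (\<Sum>i\<in>UNIV. h $ i * D i z)\<bar> \<le> e * norm h" if "norm h < d0" for h z
  proof -
    let ?f = "\<lambda>x h. \<Sum>i\<in>UNIV. h $ i *\<^sub>R D i x"
    have "norm (k (z + h) - k z - ?f z (z + h - z)) \<le> norm (z + h - z) * e"
    proof (rule differentiable_bound_linearization[where S = "ball z d0"])
      show "z + t *\<^sub>R (z + h - z) \<in> ball z d0" if "t \<in> {0..1}" for t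
      proof -
        have "\<bar>t\<bar> * norm h \<le> 1 * norm h" using that by (intro mult_right_mono) auto
        then show ?thesis using \<open>norm h < d0\<close> by (auto simp: dist_norm)
      qed
      show "(k has_derivative ?f x) (at x within ball z d0)" for x
        using has_partials_derivative[OF k] has_derivative_at_withinI by blast
      show "onorm (?f x - ?f z) \<le> e" if x: "x \<in> ball z d0" for x
      proof (rule onorm_le)
        fix h :: "real^'n"
        have "norm ((?f x - ?f z) h) = \<bar>\<Sum>i\<in>UNIV. h $ i * (D i x - D i z)\<bar>"
          by (simp add: sum_subtractf[symmetric] right_diff_distrib)
        also have "\<dots> \<le> (\<Sum>i\<in>UNIV. \<bar>h $ i * (D i x - D i z)\<bar>)" by (rule sum_abs)
        also have "\<dots> \<le> (\<Sum>i\<in>(UNIV::'n set). norm h * (e / ?n))"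
        proof (intro sum_mono)
          fix i
          have "dist (D i x) (D i z) < e / ?n"
            using x d0(2)[of i] by (intro d(2)) (auto simp: dist_commute)
          then show "\<bar>h $ i * (D i x - D i z)\<bar> \<le> norm h * (e / ?n)"
            unfolding abs_mult dist_real_def by (intro mult_mono component_le_norm_cart) auto
        qed
        finally show "norm ((?f x - ?f z) h) \<le> e * norm h" by (simp add: mult.commute)
      qed
    qed (use d0 in auto)
    then show ?thesis by (simp add: mult.commute)
  qed
  then show ?thesis using d0(1) by blast
qed

lemma has_partials_conv:
  fixes k :: "real^'n::finite \<Rightarrow> real" and g :: "real^'n \<Rightarrow> 'b::{banach, second_countable_topology}"
  assumes k: "has_partials k D" and K: "compact K" "\<And>x. x \<notin> K \<Longrightarrow> k x = 0"
    and g: "integrable lebesgue g"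
  shows "has_partials (conv k g) (\<lambda>i. conv (D i) g)"
proof -
  have D0: "D i x = 0" if "x \<notin> K" for i x
    by (rule has_partials_outside[OF k compact_imp_closed[OF K(1)] K(2) that])
  obtain B where B: "\<And>x. \<bar>k x\<bar> \<le> B"
    using bounded_compact_support[OF has_partials_continuous[OF k] K] by (metis real_norm_def)
  have "\<exists>C. 0 \<le> C \<and> (\<forall>x. \<bar>D i x\<bar> \<le> C)" for i
    using bounded_compact_support[OF has_partials_continuous_partial[OF k] K(1) D0] by (metis real_norm_def)
  then obtain C where C: "\<And>i. 0 \<le> C i" "\<And>i x. \<bar>D i x\<bar> \<le> C i" by metis
  have iD: "integrable lebesgue (\<lambda>y. D i (x - y) *\<^sub>R g y)" for i x
    by (rule conv_integrable[OF has_partials_continuous_partial[OF k] C(2) g])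
  show ?thesis
  proof (rule has_partialsI)
    fix x
    have "((\<lambda>s. \<integral>y. k (s - y) *\<^sub>R g y \<partial>lebesgue) has_derivative
        (\<lambda>h. \<integral>y. (\<Sum>i\<in>UNIV. h $ i * D i (x - y)) *\<^sub>R g y \<partial>lebesgue)) (at x)"
    proof (rule has_derivative_integral_uniform[OF g, where C = "\<Sum>i\<in>UNIV. C i" and B = "\<lambda>_. B"])
      show "(\<lambda>y. k (t - y)) \<in> borel_measurable lebesgue" for t
        by (rule kernel_reflect_measurable[OF has_partials_continuous[OF k]])
      show "\<bar>k (t - y)\<bar> \<le> B" for t y by (rule B)
      show "(\<lambda>y. \<Sum>i\<in>UNIV. h $ i * D i (x - y)) \<in> borel_measurable lebesgue" for h
        by (intro borel_measurable_sum borel_measurable_times borel_measurable_const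
            kernel_reflect_measurable has_partials_continuous_partial[OF k])
      show "\<bar>\<Sum>i\<in>UNIV. h $ i * D i (x - y)\<bar> \<le> (\<Sum>i\<in>UNIV. C i) * norm h" for h y
      proof -
        have "\<bar>\<Sum>i\<in>UNIV. h $ i * D i (x - y)\<bar> \<le> (\<Sum>i\<in>UNIV. \<bar>h $ i * D i (x - y)\<bar>)" by (rule sum_abs)
        also have "\<dots> \<le> (\<Sum>i\<in>UNIV. norm h * C i)"
          by (intro sum_mono) (auto simp: abs_mult intro!: mult_mono component_le_norm_cart C)
        finally show ?thesis by (simp add: sum_distrib_left mult.commute)
      qed
      show "linear (\<lambda>h. \<Sum>i\<in>UNIV. h $ i * D i (x - y))" for y
        by (rule linearI) (auto simp: sum.distrib distrib_right sum_distrib_left mult.assoc)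
      show "\<exists>d>0. \<forall>h y. norm h < d \<longrightarrow>
          \<bar>k (x + h - y) - k (x - y) - (\<Sum>i\<in>UNIV. h $ i * D i (x - y))\<bar> \<le> e * norm h" if "0 < e" for e
      proof -
        have "x + h - y = x - y + h" for h y by simp
        then show ?thesis using has_partials_uniform[OF k K that] by metis
      qed
    qed
    then show "(conv k g has_derivative (\<lambda>h. \<integral>y. (\<Sum>i\<in>UNIV. h $ i * D i (x - y)) *\<^sub>R g y \<partial>lebesgue)) (at x)"
      by (simp add: conv_def[abs_def])
    show "(\<integral>y. (\<Sum>i\<in>UNIV. h $ i * D i (x - y)) *\<^sub>R g y \<partial>lebesgue) = (\<Sum>i\<in>UNIV. h $ i *\<^sub>R conv (D i) g x)" for h
      using iD by (simp add: scaleR_left.sum flip: scaleR_scaleR, simp add: conv_def)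
    show "continuous_on UNIV (conv (D i) g)" for i
      by (rule conv_continuous[OF uniformly_continuous_compact_support[OF
              has_partials_continuous_partial[OF k] K(1) D0] C(2) g])
  qed
qed

text \<open>The convolution of \<open>F\<close> with the indicator of a large ball is constant near
  the origin, with value the integral of \<open>F\<close>. Its derivative at 0 is therefore 0, and
  this derivative is the integral of \<open>D i\<close>.\<close>

lemma integral_partial_eq_0:
  fixes F :: "real^'n::finite \<Rightarrow> real"
  assumes F: "has_partials F D" and K: "compact K" "\<And>x. x \<notin> K \<Longrightarrow> F x = 0"
  shows "(\<integral>x. D i x \<partial>lebesgue) = 0"
proof -
  have D0: "D i x = 0" if "x \<notin> K" for x
    by (rule has_partials_outside[OF F compact_imp_closed[OF K(1)] K(2) that])
  obtain R where R: "K \<subseteq> cball 0 R"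
    using compact_imp_bounded[OF K(1)] by (auto simp: bounded_iff subset_eq)
  \<comment> \<open>If \<open>norm x < 1\<close> and \<open>x - y \<in> K\<close>, then
    \<open>norm y \<le> R + 1\<close>, so \<open>g\<close> is 1 wherever the shifted function is
    nonzero.\<close>
  define g :: "real^'n \<Rightarrow> real" where "g = indicator (cball 0 (R + 1))"
  have g: "integrable lebesgue g" unfolding g_def by (rule integrable_real_indicator) (auto simp: emeasure_bounded_finite[OF bounded_cball, unfolded infinity_ennreal_def])
  have conv_g: "conv f g x = (\<integral>y. f y \<partial>lebesgue)"
    if f: "continuous_on UNIV f" "\<And>x. x \<notin> K \<Longrightarrow> f x = 0" and x: "norm x < 1" for f x
  proof -
    have eq: "f (x - y) *\<^sub>R g y = f (x - y)" for y
    proof (cases "x - y \<in> K")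
      case True
      then have "norm (x - y) \<le> R" using R by auto
      then have "norm y \<le> R + 1" using x norm_triangle_ineq4[of x "x - y"] by simp
      then show ?thesis by (simp add: g_def)
    qed (simp add: f(2))
    have "conv f g x = (\<integral>y. f (x - y) \<partial>lebesgue)" unfolding conv_def eq ..
    also have "\<dots> = (\<integral>y. f (x - y) \<partial>lborel)"
      by (intro integral_completion) (auto intro!: borel_measurable_continuous_onI
            continuous_on_compose2[OF f(1)] continuous_intros)
    also have "\<dots> = (\<integral>y. f y \<partial>lborel)"
      by (rule integral_reflect[OF borel_measurable_continuous_onI[OF f(1)]])
    also have "\<dots> = (\<integral>y. f y \<partial>lebesgue)"
      using borel_measurable_continuous_onI[OF f(1)] by (intro integral_completion[symmetric]) simp
    finally show ?thesis .
  qed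
  let ?c = "\<integral>y. F y \<partial>lebesgue"
  have "has_partials (\<lambda>x. conv F g x + (- ?c)) (\<lambda>i x. conv (D i) g x + 0)"
    by (intro has_partials_add has_partials_const has_partials_conv[OF F K g])
  \<comment> \<open>The closed set of \<open>has_partials_outside\<close> is here the complement of
    the unit ball: it is inside the ball that the function vanishes.\<close>
  then have "conv (D i) g 0 + 0 = 0"
    by (rule has_partials_outside[where K = "- ball 0 1"])
      (auto simp: conv_g[OF has_partials_continuous[OF F] K(2)])
  then show ?thesis
    using conv_g[OF has_partials_continuous_partial[OF F] D0, of 0] by simp
qed

section \<open>Mollification\<close>

definition mollifier :: "real \<Rightarrow> ('a::euclidean_space \<Rightarrow> real) \<Rightarrow> bool" where
  "mollifier \<delta> k \<longleftrightarrow> continuous_on UNIV k \<and> (\<forall>z. 0 \<le> k z) \<and> (\<forall>z. \<delta> < norm z \<longrightarrow> k z = 0) \<and>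
     (\<integral>z. k z \<partial>lborel) = 1"

lemma mollifierD:
  assumes "mollifier \<delta> k"
  shows "continuous_on UNIV k" "0 \<le> k z" "\<delta> < norm z \<Longrightarrow> k z = 0" "z \<notin> cball 0 \<delta> \<Longrightarrow> k z = 0"
    "(\<integral>z. k z \<partial>lborel) = 1" "integrable lborel k" "k \<in> borel_measurable borel"
    "(\<integral>\<^sup>+z. k z \<partial>lborel) = 1"
proof -
  show *: "continuous_on UNIV k" "0 \<le> k z" "\<delta> < norm z \<Longrightarrow> k z = 0" "z \<notin> cball 0 \<delta> \<Longrightarrow> k z = 0"
    "(\<integral>z. k z \<partial>lborel) = 1" "k \<in> borel_measurable borel" for z
    using assms by (auto simp: mollifier_def borel_measurable_continuous_onI)
  show int: "integrable lborel k"
    using * by (intro integrable_compact_support[where K = "cball 0 \<delta>"]) auto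
  show "(\<integral>\<^sup>+z. k z \<partial>lborel) = 1"
    using *(2) by (subst nn_integral_eq_integral[OF int]) (auto simp: *(5))
qed

lemma mollifier_bounded:
  assumes "mollifier \<delta> k"
  obtains B where "0 \<le> B" "\<And>z. \<bar>k z\<bar> \<le> B"
  using bounded_compact_support[OF mollifierD(1)[OF assms] compact_cball[of 0 \<delta>]] mollifierD(4)[OF assms]
  by (metis real_norm_def)

lemma mollifier_uniformly_continuous:
  assumes "mollifier \<delta> k"
  shows "uniformly_continuous_on UNIV k"
  by (rule uniformly_continuous_compact_support[OF mollifierD(1)[OF assms] compact_cball[of 0 \<delta>]])
    (rule mollifierD(4)[OF assms])

lemma mollifier_conv_integrable:
  fixes g :: "'a::euclidean_space \<Rightarrow> 'b::{banach, second_countable_topology}"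
  assumes "mollifier \<delta> k" "integrable lebesgue g"
  shows "integrable lebesgue (\<lambda>y. k (x - y) *\<^sub>R g y)"
  by (metis assms mollifier_bounded conv_integrable mollifierD(1))

lemma mollifier_conv_continuous:
  fixes g :: "'a::euclidean_space \<Rightarrow> 'b::{banach, second_countable_topology}"
  assumes "mollifier \<delta> k" "integrable lebesgue g"
  shows "continuous_on UNIV (conv k g)"
  by (metis assms mollifier_bounded conv_continuous mollifier_uniformly_continuous)

lemma mollifier_reflect:
  assumes "mollifier \<delta> k"
  shows "(\<integral>y. k (x - y) \<partial>lebesgue) = 1" "integrable lebesgue (\<lambda>y. k (x - y))"
proof -
  have c: "continuous_on UNIV (\<lambda>y. k (x - y))"
    by (intro continuous_on_compose2[OF mollifierD(1)[OF assms]] continuous_intros) auto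
  have "(\<integral>y. k (x - y) \<partial>lebesgue) = (\<integral>y. k (x - y) \<partial>lborel)"
    using c by (intro integral_completion) (simp add: borel_measurable_continuous_onI)
  then show "(\<integral>y. k (x - y) \<partial>lebesgue) = 1"
    using integral_reflect[OF mollifierD(7)[OF assms]] mollifierD(5)[OF assms] by simp
  show "integrable lebesgue (\<lambda>y. k (x - y))"
  proof (rule integrable_lebesgue_compact_support[OF c compact_cball[of x \<delta>]])
    show "k (x - y) = 0" if "y \<notin> cball x \<delta>" for y
      using that by (intro mollifierD(3)[OF assms]) (simp add: dist_norm)
  qed
qed

text \<open>Young's inequality for a kernel of total mass 1, obtained by exchanging the order of
  integration for nonnegative functions.\<close>

lemma conv_L1:
  fixes g :: "'a::euclidean_space \<Rightarrow> 'b::euclidean_space"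
  assumes k: "mollifier \<delta> k" and g: "integrable lebesgue g"
  shows "integrable lebesgue (conv k g)" and "(\<integral>x. norm (conv k g x) \<partial>lebesgue) \<le> (\<integral>x. norm (g x) \<partial>lebesgue)"
proof -
  note [measurable] = mollifierD(7)[OF k]
  have gm: "(\<lambda>y. ennreal (norm (g y))) \<in> borel_measurable lebesgue" using g by measurable
  \<comment> \<open>The exchange of integrals takes place on Borel sets, so the Lebesgue measurable
    \<open>norm (g y)\<close> is replaced by a Borel representative.\<close>
  then obtain g' where [measurable]: "g' \<in> borel_measurable borel"
      and g': "AE y in lborel. ennreal (norm (g y)) = g' y"
    using completion_ex_borel_measurable[OF gm] by auto
  have g'L: "AE y in lebesgue. ennreal (norm (g y)) = g' y"
    using AE_completion[OF g'] .
  have int_g: "(\<integral>\<^sup>+y. norm (g y) \<partial>lebesgue) = ennreal (\<integral>y. norm (g y) \<partial>lebesgue)"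
    using g by (intro nn_integral_eq_integral) auto
  have cm: "conv k g \<in> borel_measurable lebesgue"
    by (rule borel_measurable_lebesgue_continuous[OF mollifier_conv_continuous[OF k g]])
  have pt: "ennreal (norm (conv k g x)) \<le> (\<integral>\<^sup>+y. ennreal (k (x - y)) * g' y \<partial>lborel)" for x
  proof -
    have "ennreal (norm (conv k g x)) \<le> (\<integral>\<^sup>+y. norm (k (x - y) *\<^sub>R g y) \<partial>lebesgue)"
      unfolding conv_def by (rule integral_norm_bound_ennreal[OF mollifier_conv_integrable[OF k g]])
    also have "\<dots> = (\<integral>\<^sup>+y. ennreal (k (x - y)) * ennreal (norm (g y)) \<partial>lebesgue)"
      using mollifierD(2)[OF k] by (simp add: ennreal_mult)
    also have "\<dots> = (\<integral>\<^sup>+y. ennreal (k (x - y)) * g' y \<partial>lebesgue)"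
      using g'L by (intro nn_integral_cong_AE) (auto elim: eventually_mono)
    also have "\<dots> = (\<integral>\<^sup>+y. ennreal (k (x - y)) * g' y \<partial>lborel)"
      by (rule nn_integral_completion)
    finally show ?thesis .
  qed
  have "(\<integral>\<^sup>+x. norm (conv k g x) \<partial>lebesgue) \<le> (\<integral>\<^sup>+x. (\<integral>\<^sup>+y. ennreal (k (x - y)) * g' y \<partial>lborel) \<partial>lebesgue)"
    by (intro nn_integral_mono pt)
  also have "\<dots> = (\<integral>\<^sup>+x. (\<integral>\<^sup>+y. ennreal (k (x - y)) * g' y \<partial>lborel) \<partial>lborel)"
    by (rule nn_integral_completion)
  also have "\<dots> = (\<integral>\<^sup>+y. (\<integral>\<^sup>+x. ennreal (k (x - y)) * g' y \<partial>lborel) \<partial>lborel)"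
    by (rule lborel_pair.Fubini') simp
  also have "\<dots> = (\<integral>\<^sup>+y. g' y \<partial>lborel)"
  proof (intro nn_integral_cong)
    fix y :: 'a
    have "(\<integral>\<^sup>+x. ennreal (k (x - y)) \<partial>lborel) = (\<integral>\<^sup>+x. ennreal (k x) \<partial>lborel)"
    proof -
      have "(\<lambda>x. x - y) = (+) (- y)" by auto
      then have "distr lborel borel (\<lambda>x. x - y) = lborel" by (simp add: lborel_distr_plus)
      then show ?thesis
        using nn_integral_distr[of "\<lambda>x. x - y" lborel borel "\<lambda>x. ennreal (k x)"] by simp
    qed
    then show "(\<integral>\<^sup>+x. ennreal (k (x - y)) * g' y \<partial>lborel) = g' y"
      by (simp add: nn_integral_multc mollifierD(8)[OF k])
  qed
  also have "\<dots> = (\<integral>\<^sup>+y. norm (g y) \<partial>lborel)"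
    using g' by (intro nn_integral_cong_AE) (auto elim: eventually_mono)
  also have "\<dots> = ennreal (\<integral>y. norm (g y) \<partial>lebesgue)"
    using int_g by (simp add: nn_integral_completion)
  finally have le: "(\<integral>\<^sup>+x. norm (conv k g x) \<partial>lebesgue) \<le> ennreal (\<integral>y. norm (g y) \<partial>lebesgue)" .
  then show i: "integrable lebesgue (conv k g)"
    using cm unfolding integrable_iff_bounded by (auto intro: le_less_trans)
  have "ennreal (\<integral>x. norm (conv k g x) \<partial>lebesgue) = (\<integral>\<^sup>+x. norm (conv k g x) \<partial>lebesgue)"
    using i by (intro nn_integral_eq_integral[symmetric]) auto
  with le have "ennreal (\<integral>x. norm (conv k g x) \<partial>lebesgue) \<le> ennreal (\<integral>x. norm (g x) \<partial>lebesgue)"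
    by simp
  then show "(\<integral>x. norm (conv k g x) \<partial>lebesgue) \<le> (\<integral>x. norm (g x) \<partial>lebesgue)"
    by (subst (asm) ennreal_le_iff) (auto intro: integral_nonneg_AE)
qed

section \<open>Density of compactly supported continuous functions in L1\<close>

definition Cc_approximable :: "('a::euclidean_space \<Rightarrow> 'b::euclidean_space) \<Rightarrow> bool" where
  "Cc_approximable f \<longleftrightarrow> (\<forall>e>0. \<exists>\<phi> K. continuous_on UNIV \<phi> \<and> compact K \<and> (\<forall>x. x \<notin> K \<longrightarrow> \<phi> x = 0) \<and>
     (\<integral>x. norm (f x - \<phi> x) \<partial>lebesgue) < e)"

lemma Cc_approximable_limit:
  assumes f: "integrable lebesgue f" and s: "\<And>i. integrable lebesgue (s i)" "\<And>i. Cc_approximable (s i)"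
    and lim: "(\<lambda>i. \<integral>x. norm (f x - s i x) \<partial>lebesgue) \<longlonglongrightarrow> 0"
  shows "Cc_approximable f"
  unfolding Cc_approximable_def
proof (intro allI impI)
  fix e :: real assume "0 < e"
  then have "\<forall>\<^sub>F i in sequentially. (\<integral>x. norm (f x - s i x) \<partial>lebesgue) < e / 2"
    using lim by (intro order_tendstoD(2)) auto
  then obtain i where i: "(\<integral>x. norm (f x - s i x) \<partial>lebesgue) < e / 2"
    by (auto dest: eventually_happens)
  obtain \<phi> K where \<phi>: "continuous_on UNIV \<phi>" "compact K" "\<And>x. x \<notin> K \<Longrightarrow> \<phi> x = 0"
    "(\<integral>x. norm (s i x - \<phi> x) \<partial>lebesgue) < e / 2"
    using s(2)[of i, unfolded Cc_approximable_def, rule_format, OF half_gt_zero[OF \<open>0 < e\<close>]] by blast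
  have i\<phi>: "integrable lebesgue \<phi>"
    by (rule integrable_lebesgue_compact_support[OF \<phi>(1-3)])
  have "(\<integral>x. norm (f x - \<phi> x) \<partial>lebesgue) \<le> (\<integral>x. norm (f x - s i x) + norm (s i x - \<phi> x) \<partial>lebesgue)"
    using f s(1)[of i] i\<phi> by (intro integral_mono) (auto simp: norm_diff_triangle_ineq intro: norm_diff_triangle_le)
  also have "\<dots> < e"
    using f s(1)[of i] i\<phi> i \<phi>(4) by (subst Bochner_Integration.integral_add) auto
  finally show "\<exists>\<phi> K. continuous_on UNIV \<phi> \<and> compact K \<and> (\<forall>x. x \<notin> K \<longrightarrow> \<phi> x = 0) \<and>
     (\<integral>x. norm (f x - \<phi> x) \<partial>lebesgue) < e" using \<phi> by blast
qed

text \<open>Regularity of Lebesgue measure puts \<open>A\<close> between a closed and an open set of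
  nearly equal measure, and a Urysohn function between the two approximates the indicator.
  Boundedness of \<open>A\<close> allows the open set to be cut down to a ball, which gives compact
  support.\<close>

lemma Cc_approximable_bounded_indicator:
  fixes c :: "'b::euclidean_space" and A :: "'a::euclidean_space set"
  assumes A: "A \<in> sets lebesgue" "A \<subseteq> cball 0 R"
  shows "Cc_approximable (\<lambda>x. indicator A x *\<^sub>R c)"
  unfolding Cc_approximable_def
proof (intro allI impI)
  fix e :: real assume "0 < e"
  define a where "a = e / (norm c + 1)"
  define e' where "e' = a / 2"
  have e': "0 < e'" using \<open>0 < e\<close> by (simp add: a_def e'_def add_nonneg_pos)
  obtain T where T: "open T" "A \<subseteq> T" "T - A \<in> lmeasurable" "emeasure lebesgue (T - A) < ennreal e'"
    using sets_lebesgue_outer_open[OF A(1) e'] .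
  obtain C where C: "closed C" "C \<subseteq> A" "A - C \<in> lmeasurable" "emeasure lebesgue (A - C) < ennreal e'"
    using sets_lebesgue_inner_closed[OF A(1) e'] .
  define U where "U = T \<inter> ball 0 (R + 1)"
  have U: "open U" "A \<subseteq> U" using T A by (auto simp: U_def)
  obtain h :: "'a \<Rightarrow> real" where h: "continuous_on UNIV h" "\<And>x. h x \<in> closed_segment 0 1"
      "\<And>x. x \<in> - U \<Longrightarrow> h x = 0" "\<And>x. x \<in> C \<Longrightarrow> h x = 1"
  proof -
    have "closed (- U)" "- U \<inter> C = {}" using U C by auto
    then show ?thesis using Urysohn[of "- U" C 0 "1 :: real"] C(1) that by blast
  qed
  have h01: "0 \<le> h x" "h x \<le> 1" for x using h(2)[of x] by (auto simp: closed_segment_eq_real_ivl)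
  define E where "E = (T - A) \<union> (A - C)"
  have E: "E \<in> lmeasurable" unfolding E_def by (rule fmeasurable.Un[OF T(3) C(3)])
  have mE: "measure lebesgue E < 2 * e'"
  proof -
    have "measure lebesgue (T - A) < e'" "measure lebesgue (A - C) < e'"
      using T(3,4) C(3,4) e' by (auto simp: emeasure_eq_measure2 ennreal_less_iff)
    then show ?thesis
      using measure_Un_le[of "T - A" lebesgue "A - C"] T(3) C(3) by (auto simp: E_def fmeasurableD)
  qed
  have le: "norm (indicator A x *\<^sub>R c - h x *\<^sub>R c) \<le> indicator E x * norm c" for x
  proof (cases "x \<in> E")
    case True
    have "norm (indicator A x *\<^sub>R c - h x *\<^sub>R c) = \<bar>indicator A x - h x\<bar> * norm c"
      by (simp add: scaleR_left_diff_distrib[symmetric])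
    also have "\<dots> \<le> 1 * norm c"
      using h01[of x] by (intro mult_right_mono) (auto simp: indicator_def)
    finally show ?thesis using True by simp
  next
    case False
    then have "indicator A x = h x"
      using h(3)[of x] h(4)[of x] C(2) A(2) U(2) by (auto simp: E_def U_def indicator_def)
    then show ?thesis by simp
  qed
  have "norm (\<integral>x. norm (indicator A x *\<^sub>R c - h x *\<^sub>R c) \<partial>lebesgue) \<le> (\<integral>x. indicator E x * norm c \<partial>lebesgue)"
  proof (rule norm_integral_le)
    show "integrable lebesgue (\<lambda>x. indicator E x * norm c)"
      using E by (intro integrable_mult_left integrable_real_indicator) (auto simp: fmeasurable_def)
    show "AE x in lebesgue. norm (norm (indicator A x *\<^sub>R c - h x *\<^sub>R c)) \<le> indicator E x * norm c"
      using le by (intro AE_I2) simp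
  qed
  then have "(\<integral>x. norm (indicator A x *\<^sub>R c - h x *\<^sub>R c) \<partial>lebesgue) \<le> (\<integral>x. indicator E x * norm c \<partial>lebesgue)"
    by simp
  also have "\<dots> = measure lebesgue E * norm c"
    using E by simp
  also have "\<dots> \<le> 2 * e' * norm c" using mE by (intro mult_right_mono) auto
  also have "2 * e' = a" by (simp add: e'_def)
  also have "a * norm c = e * (norm c / (norm c + 1))" by (simp add: a_def)
  also have "\<dots> < e * 1"
    using \<open>0 < e\<close> by (intro mult_strict_left_mono) (auto simp: divide_less_eq add_nonneg_pos)
  also have "\<dots> = e" by simp
  finally have "(\<integral>x. norm (indicator A x *\<^sub>R c - h x *\<^sub>R c) \<partial>lebesgue) < e" .
  moreover have "continuous_on UNIV (\<lambda>x. h x *\<^sub>R c)" by (intro continuous_intros h)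
  moreover have "h x *\<^sub>R c = 0" if "x \<notin> cball 0 (R + 1)" for x
    using that h(3)[of x] by (auto simp: U_def)
  ultimately show "\<exists>\<phi> K. continuous_on UNIV \<phi> \<and> compact K \<and> (\<forall>x. x \<notin> K \<longrightarrow> \<phi> x = 0) \<and>
     (\<integral>x. norm (indicator A x *\<^sub>R c - \<phi> x) \<partial>lebesgue) < e"
    by (intro exI[of _ "\<lambda>x. h x *\<^sub>R c"] exI[of _ "cball 0 (R + 1)"]) auto
qed

text \<open>By induction over integrable functions. In the base case a set of finite measure is
  exhausted by its intersections with balls.\<close>

lemma Cc_dense_L1:
  fixes f :: "'a::euclidean_space \<Rightarrow> 'b::euclidean_space"
  assumes "integrable lebesgue f"
  shows "Cc_approximable f"
  using assms
proof (induction rule: integrable_induct)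
  case (base A c)
  have iA: "integrable lebesgue (\<lambda>x. indicator A x *\<^sub>R c)"
    using base by (intro integrable_scaleR_left) (auto intro: integrable_real_indicator)
  show ?case
  proof (rule Cc_approximable_limit[OF iA])
    let ?s = "\<lambda>i::nat. \<lambda>x. indicator (A \<inter> cball 0 (real i)) x *\<^sub>R c"
    show i: "integrable lebesgue (?s i)" for i
    proof (rule Bochner_Integration.integrable_bound[OF iA])
      show "?s i \<in> borel_measurable lebesgue"
        using base by (intro borel_measurable_scaleR borel_measurable_const borel_measurable_indicator) auto
    qed (auto simp: indicator_def)
    show "Cc_approximable (?s i)" for i
      by (rule Cc_approximable_bounded_indicator[where R = "real i"]) (use base in auto)
    have "(\<lambda>i. \<integral>x. norm (indicator A x *\<^sub>R c - ?s i x) \<partial>lebesgue) \<longlonglongrightarrow> (\<integral>x. 0 \<partial>(lebesgue :: 'a measure))"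
    proof (rule integral_dominated_convergence[where w = "\<lambda>x. norm (indicator A x *\<^sub>R c)"])
      show "AE x in lebesgue. (\<lambda>i. norm (indicator A x *\<^sub>R c - ?s i x)) \<longlonglongrightarrow> 0"
      proof (rule AE_I2, rule tendsto_eventually)
        fix x :: 'a
        obtain N :: nat where "norm x \<le> real N" using real_arch_simple by blast
        then show "\<forall>\<^sub>F i in sequentially. norm (indicator A x *\<^sub>R c - ?s i x) = 0"
          by (intro eventually_sequentiallyI[of N]) (auto simp: indicator_def)
      qed
      show "integrable lebesgue (\<lambda>x. norm (indicator A x *\<^sub>R c))"
        using iA by (rule integrable_norm)
      show "(\<lambda>x. norm (indicator A x *\<^sub>R c - ?s i x)) \<in> borel_measurable lebesgue" for i
        by (rule measurable_compose[OF borel_measurable_diff[OF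
              borel_measurable_integrable[OF iA] borel_measurable_integrable[OF i]] borel_measurable_norm])
    qed (auto simp: indicator_def)
    then show "(\<lambda>i. \<integral>x. norm (indicator A x *\<^sub>R c - ?s i x) \<partial>lebesgue) \<longlonglongrightarrow> 0" by simp
  qed
next
  case (add f g)
  show ?case
    unfolding Cc_approximable_def
  proof (intro allI impI)
    fix e :: real assume "0 < e"
    then have e2: "0 < e / 2" by simp
    obtain \<phi> K where \<phi>: "continuous_on UNIV \<phi>" "compact K" "\<And>x. x \<notin> K \<Longrightarrow> \<phi> x = 0"
        "(\<integral>x. norm (f x - \<phi> x) \<partial>lebesgue) < e / 2"
      using add.IH(1)[unfolded Cc_approximable_def, rule_format, OF e2] by blast
    obtain \<psi> L where \<psi>: "continuous_on UNIV \<psi>" "compact L" "\<And>x. x \<notin> L \<Longrightarrow> \<psi> x = 0"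
        "(\<integral>x. norm (g x - \<psi> x) \<partial>lebesgue) < e / 2"
      using add.IH(2)[unfolded Cc_approximable_def, rule_format, OF e2] by blast
    have i: "integrable lebesgue \<phi>" "integrable lebesgue \<psi>"
      using \<phi> \<psi> by (auto intro: integrable_lebesgue_compact_support)
    have "(\<integral>x. norm (f x + g x - (\<phi> x + \<psi> x)) \<partial>lebesgue) \<le> (\<integral>x. norm (f x - \<phi> x) + norm (g x - \<psi> x) \<partial>lebesgue)"
      using add.hyps i by (intro integral_mono) (auto simp: norm_diff_triangle_ineq)
    also have "\<dots> < e"
      using add.hyps i \<phi>(4) \<psi>(4) by (subst Bochner_Integration.integral_add) auto
    finally show "\<exists>\<phi> K. continuous_on UNIV \<phi> \<and> compact K \<and> (\<forall>x. x \<notin> K \<longrightarrow> \<phi> x = 0) \<and>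
        (\<integral>x. norm (f x + g x - \<phi> x) \<partial>lebesgue) < e"
      using \<phi> \<psi> by (intro exI[of _ "\<lambda>x. \<phi> x + \<psi> x"] exI[of _ "K \<union> L"]) (auto intro!: continuous_intros)
  qed
next
  case (lim f s)
  show ?case
  proof (rule Cc_approximable_limit[OF lim.hyps(4) lim.hyps(1) lim.IH])
    have "(\<lambda>i. \<integral>x. norm (f x - s i x) \<partial>lebesgue) \<longlonglongrightarrow> (\<integral>x. 0 \<partial>(lebesgue :: 'a measure))"
    \<comment> \<open>The approximants of the induction principle satisfy
      \<open>norm (s i x) \<le> 2 * norm (f x)\<close>; one more \<open>norm (f x)\<close> comes
      from the difference.\<close>
    proof (rule integral_dominated_convergence[where w = "\<lambda>x. 3 * norm (f x)"])
      show "AE x in lebesgue. (\<lambda>i. norm (f x - s i x)) \<longlonglongrightarrow> 0"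
      proof (rule AE_I2)
        fix x :: 'a
        have "(\<lambda>i. f x - s i x) \<longlonglongrightarrow> f x - f x"
          using lim.hyps(2)[of x] by (intro tendsto_intros) auto
        then show "(\<lambda>i. norm (f x - s i x)) \<longlonglongrightarrow> 0" by (simp add: tendsto_norm_zero)
      qed
      show "AE x in lebesgue. norm (norm (f x - s i x)) \<le> 3 * norm (f x)" for i
      proof (rule AE_I2)
        fix x :: 'a
        show "norm (norm (f x - s i x)) \<le> 3 * norm (f x)"
          using norm_triangle_ineq4[of "f x" "s i x"] lim.hyps(3)[of x i] by simp
      qed
    qed (use lim.hyps in auto)
    then show "(\<lambda>i. \<integral>x. norm (f x - s i x) \<partial>lebesgue) \<longlonglongrightarrow> 0" by simp
  qed
qed

section \<open>Convergence of mollifications\<close>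

lemma conv_diff:
  fixes f g :: "'a::euclidean_space \<Rightarrow> 'b::euclidean_space"
  assumes "mollifier \<delta> k" "integrable lebesgue f" "integrable lebesgue g"
  shows "conv k (\<lambda>x. f x - g x) x = conv k f x - conv k g x"
  using mollifier_conv_integrable[OF assms(1,2)] mollifier_conv_integrable[OF assms(1,3)]
  by (simp add: conv_def scaleR_right_diff_distrib)

lemma conv_const_diff:
  fixes f :: "'a::euclidean_space \<Rightarrow> 'b::euclidean_space"
  assumes k: "mollifier \<delta> k" and f: "integrable lebesgue f"
  shows "conv k f x - c = (\<integral>y. k (x - y) *\<^sub>R (f y - c) \<partial>lebesgue)"
proof -
  have "(\<integral>y. k (x - y) *\<^sub>R (f y - c) \<partial>lebesgue)
      = (\<integral>y. k (x - y) *\<^sub>R f y \<partial>lebesgue) - (\<integral>y. k (x - y) *\<^sub>R c \<partial>lebesgue)"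
    using mollifier_conv_integrable[OF k f] mollifier_reflect(2)[OF k]
    by (simp add: scaleR_right_diff_distrib)
  then show ?thesis using mollifier_reflect[OF k] by (simp add: conv_def)
qed

text \<open>Uniform continuity makes the two functions pointwise close. For
  \<open>\<delta> < 1\<close> both are supported in one fixed ball, and its finite measure
  \<open>m\<close> converts pointwise closeness into closeness in L1; hence the quotient
  \<open>e / (m + 1)\<close>.\<close>

lemma conv_tendsto_Cc:
  fixes \<phi> :: "'a::euclidean_space \<Rightarrow> 'b::euclidean_space"
  assumes \<phi>: "continuous_on UNIV \<phi>" "compact K" "\<And>x. x \<notin> K \<Longrightarrow> \<phi> x = 0" and e: "0 < e"
  shows "\<exists>d>0. \<forall>\<delta> k. mollifier \<delta> k \<and> \<delta> < d \<longrightarrow> (\<integral>x. norm (conv k \<phi> x - \<phi> x) \<partial>lebesgue) \<le> e"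
proof -
  have i\<phi>: "integrable lebesgue \<phi>" by (rule integrable_lebesgue_compact_support[OF \<phi>])
  obtain R where R: "K \<subseteq> cball 0 R"
    using compact_imp_bounded[OF \<phi>(2)] by (auto simp: bounded_iff subset_eq)
  let ?B = "cball 0 (R + 1) :: 'a set"
  define m where "m = measure lebesgue ?B"
  have m: "0 \<le> m" by (simp add: m_def)
  have "0 < e / (m + 1)" using e m by simp
  then obtain d where d: "0 < d" "\<And>x y. dist y x < d \<Longrightarrow> dist (\<phi> y) (\<phi> x) < e / (m + 1)"
    using uniformly_continuous_compact_support[OF \<phi>] unfolding uniformly_continuous_on_def
    by (metis UNIV_I)
  have "(\<integral>x. norm (conv k \<phi> x - \<phi> x) \<partial>lebesgue) \<le> e" if k: "mollifier \<delta> k" and \<delta>: "\<delta> < min d 1" for \<delta> k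
  proof -
    have pt: "norm (conv k \<phi> x - \<phi> x) \<le> e / (m + 1) * indicator ?B x" for x
    proof (cases "x \<in> ?B")
      case True
      have "norm (conv k \<phi> x - \<phi> x) \<le> (\<integral>y. e / (m + 1) * k (x - y) \<partial>lebesgue)"
        unfolding conv_const_diff[OF k i\<phi>]
      proof (rule norm_integral_le)
        show "AE y in lebesgue. norm (k (x - y) *\<^sub>R (\<phi> y - \<phi> x)) \<le> e / (m + 1) * k (x - y)"
        proof (rule AE_I2)
          fix y
          show "norm (k (x - y) *\<^sub>R (\<phi> y - \<phi> x)) \<le> e / (m + 1) * k (x - y)"
          proof (cases "\<delta> < norm (x - y)")
            case False
            then have "norm (\<phi> y - \<phi> x) \<le> e / (m + 1)"
              using d(2)[of y x] \<delta> by (simp add: dist_norm norm_minus_commute)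
            then have "k (x - y) * norm (\<phi> y - \<phi> x) \<le> k (x - y) * (e / (m + 1))"
              by (intro mult_left_mono mollifierD(2)[OF k])
            then show ?thesis
              using mollifierD(2)[OF k, of "x - y"] by (simp add: mult.commute)
          qed (simp add: mollifierD(3)[OF k])
        qed
      qed (use mollifier_reflect(2)[OF k] in auto)
      also have "\<dots> = e / (m + 1)" using mollifier_reflect(1)[OF k] by simp
      finally show ?thesis using True by simp
    next
      case False
      have zero: "k (x - y) *\<^sub>R \<phi> y = 0" for y
      proof (cases "y \<in> K")
        case True
        then have "norm y \<le> R" using R by auto
        then have "\<delta> < norm (x - y)"
          using False \<delta> norm_triangle_ineq2[of x y] by auto
        then show ?thesis by (simp add: mollifierD(3)[OF k])
      qed (simp add: \<phi>(3))
      have "\<phi> x = 0" using False R by (intro \<phi>(3)) auto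
      moreover have "conv k \<phi> x = 0" unfolding conv_def zero by simp
      ultimately show ?thesis using False by simp
    qed
    have "(\<integral>x. norm (conv k \<phi> x - \<phi> x) \<partial>lebesgue) \<le> (\<integral>x. e / (m + 1) * indicator ?B x \<partial>lebesgue)"
    proof (rule integral_mono)
      show "integrable lebesgue (\<lambda>x. norm (conv k \<phi> x - \<phi> x))"
        using conv_L1(1)[OF k i\<phi>] i\<phi> by auto
      show "integrable lebesgue (\<lambda>x. e / (m + 1) * indicator ?B x)"
        using lmeasurable_cball[of "0 :: 'a" "R + 1"]
        by (intro integrable_mult_right integrable_real_indicator) (auto simp: fmeasurable_def)
    qed (use pt in auto)
    also have "\<dots> = e * (m / (m + 1))"
      by (simp add: m_def)
    also have "\<dots> \<le> e * 1" using e m by (intro mult_left_mono) auto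
    finally show ?thesis by simp
  qed
  then show ?thesis using d(1) by (intro exI[of _ "min d 1"]) auto
qed

text \<open>A three-term estimate through a compactly supported continuous \<open>\<phi>\<close>:
  Young's inequality controls the convolved error \<open>g - \<phi>\<close> uniformly in the kernel.
  Three non-strict bounds by \<open>e / 4\<close> leave the strict inequality.\<close>

lemma conv_tendsto_L1:
  fixes g :: "'a::euclidean_space \<Rightarrow> 'b::euclidean_space"
  assumes g: "integrable lebesgue g" and k: "\<And>n. mollifier (\<delta> n) (k n)" and \<delta>: "\<delta> \<longlonglongrightarrow> 0"
  shows "(\<lambda>n::nat. \<integral>x. norm (conv (k n) g x - g x) \<partial>lebesgue) \<longlonglongrightarrow> 0"
proof (rule LIMSEQ_I)
  fix e :: real assume e: "0 < e"
  then have e4: "0 < e / 4" by simp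
  obtain \<phi> K where \<phi>: "continuous_on UNIV \<phi>" "compact K" "\<And>x. x \<notin> K \<Longrightarrow> \<phi> x = 0"
      "(\<integral>x. norm (g x - \<phi> x) \<partial>lebesgue) < e / 4"
    using Cc_dense_L1[OF g, unfolded Cc_approximable_def, rule_format, OF e4] by blast
  have i\<phi>: "integrable lebesgue \<phi>" by (rule integrable_lebesgue_compact_support[OF \<phi>(1-3)])
  obtain d where d: "0 < d" "\<And>\<delta> k. mollifier \<delta> k \<Longrightarrow> \<delta> < d \<Longrightarrow>
      (\<integral>x. norm (conv k \<phi> x - \<phi> x) \<partial>lebesgue) \<le> e / 4"
    using conv_tendsto_Cc[OF \<phi>(1-3) e4] by blast
  have "\<forall>\<^sub>F n in sequentially. \<delta> n < d" using order_tendstoD(2)[OF \<delta> d(1)] .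
  then obtain N where N: "\<And>n. n \<ge> N \<Longrightarrow> \<delta> n < d" by (auto simp: eventually_sequentially)
  have "norm ((\<integral>x. norm (conv (k n) g x - g x) \<partial>lebesgue) - 0) < e" if n: "n \<ge> N" for n
  proof -
    have ig: "integrable lebesgue (conv (k n) g)" "integrable lebesgue (conv (k n) \<phi>)"
      "integrable lebesgue (conv (k n) (\<lambda>x. g x - \<phi> x))"
      using g i\<phi> by (auto intro!: conv_L1[OF k])
    have "(\<integral>x. norm (conv (k n) g x - g x) \<partial>lebesgue) \<le>
        (\<integral>x. norm (conv (k n) (\<lambda>x. g x - \<phi> x) x) + (norm (conv (k n) \<phi> x - \<phi> x) + norm (g x - \<phi> x)) \<partial>lebesgue)"
    proof (rule integral_mono)
      fix x
      have "conv (k n) g x - g x = conv (k n) (\<lambda>x. g x - \<phi> x) x + ((conv (k n) \<phi> x - \<phi> x) - (g x - \<phi> x))"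
        by (simp add: conv_diff[OF k g i\<phi>])
      then show "norm (conv (k n) g x - g x) \<le>
          norm (conv (k n) (\<lambda>x. g x - \<phi> x) x) + (norm (conv (k n) \<phi> x - \<phi> x) + norm (g x - \<phi> x))"
        by (simp only:) (rule order_trans[OF norm_triangle_ineq add_left_mono[OF norm_triangle_ineq4]])
    qed (use ig g i\<phi> in auto)
    also have "\<dots> = (\<integral>x. norm (conv (k n) (\<lambda>x. g x - \<phi> x) x) \<partial>lebesgue) +
        ((\<integral>x. norm (conv (k n) \<phi> x - \<phi> x) \<partial>lebesgue) + (\<integral>x. norm (g x - \<phi> x) \<partial>lebesgue))"
      using ig g i\<phi> by (simp add: Bochner_Integration.integral_add)
    also have "\<dots> \<le> e / 4 + (e / 4 + e / 4)"
    proof (intro add_mono)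
      have "(\<integral>x. norm (conv (k n) (\<lambda>x. g x - \<phi> x) x) \<partial>lebesgue) \<le> (\<integral>x. norm (g x - \<phi> x) \<partial>lebesgue)"
        using g i\<phi> by (intro conv_L1(2)[OF k]) auto
      then show "(\<integral>x. norm (conv (k n) (\<lambda>x. g x - \<phi> x) x) \<partial>lebesgue) \<le> e / 4" using \<phi>(4) by simp
    qed (use d(2)[OF k N[OF n]] \<phi>(4) in auto)
    finally show ?thesis using e by simp
  qed
  then show "\<exists>N. \<forall>n\<ge>N. norm ((\<integral>x. norm (conv (k n) g x - g x) \<partial>lebesgue) - 0) < e" by blast
qed

text \<open>Jensen's inequality for the probability density \<open>k (x - y)\<close>: the average of
  the squared distance of \<open>g y\<close> to its own average is nonnegative.\<close>

lemma norm_conv_power2_le: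
  fixes g :: "'a::euclidean_space \<Rightarrow> 'b::euclidean_space"
  assumes k: "mollifier \<delta> k" and g: "integrable lebesgue g" "integrable lebesgue (\<lambda>x. (norm (g x))\<^sup>2)"
  shows "(norm (conv k g x))\<^sup>2 \<le> conv k (\<lambda>x. (norm (g x))\<^sup>2) x"
proof -
  let ?m = "conv k g x"
  have i: "integrable lebesgue (\<lambda>y. k (x - y) *\<^sub>R g y)" "integrable lebesgue (\<lambda>y. k (x - y) *\<^sub>R (norm (g y))\<^sup>2)"
    "integrable lebesgue (\<lambda>y. k (x - y))"
    by (rule mollifier_conv_integrable[OF k g(1)], rule mollifier_conv_integrable[OF k g(2)],
        rule mollifier_reflect(2)[OF k])
  have "0 \<le> (\<integral>y. k (x - y) * (norm (g y - ?m))\<^sup>2 \<partial>lebesgue)"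
    by (intro integral_nonneg_AE AE_I2 mult_nonneg_nonneg mollifierD(2)[OF k]) auto
  also have "(\<lambda>y. k (x - y) * (norm (g y - ?m))\<^sup>2) =
      (\<lambda>y. k (x - y) *\<^sub>R (norm (g y))\<^sup>2 - 2 * ((k (x - y) *\<^sub>R g y) \<bullet> ?m) + k (x - y) * (norm ?m)\<^sup>2)"
    by (simp add: power2_norm_eq_inner algebra_simps inner_commute fun_eq_iff)
  also have "(\<integral>y. k (x - y) *\<^sub>R (norm (g y))\<^sup>2 - 2 * ((k (x - y) *\<^sub>R g y) \<bullet> ?m) + k (x - y) * (norm ?m)\<^sup>2 \<partial>lebesgue)
      = conv k (\<lambda>x. (norm (g x))\<^sup>2) x - 2 * (?m \<bullet> ?m) + (norm ?m)\<^sup>2"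
  proof -
    have "(\<integral>y. (k (x - y) *\<^sub>R g y) \<bullet> ?m \<partial>lebesgue) = ?m \<bullet> ?m"
      using integral_inner_left[of ?m lebesgue "\<lambda>y. k (x - y) *\<^sub>R g y"] i(1)
      by (simp add: conv_def)
    moreover have "integrable lebesgue (\<lambda>y. (k (x - y) *\<^sub>R g y) \<bullet> ?m)"
      using i(1) by (intro integrable_inner_left) auto
    ultimately show ?thesis
      using i mollifier_reflect(1)[OF k, of x]
      by (subst Bochner_Integration.integral_add) (auto simp: conv_def[of k "\<lambda>x. (norm (g x))\<^sup>2"])
  qed
  finally show ?thesis by (simp add: power2_norm_eq_inner)
qed

lemma conv_norm_le:
  fixes g :: "'a::euclidean_space \<Rightarrow> 'b::euclidean_space"
  assumes k: "mollifier \<delta> k" and B: "AE y in lebesgue. y \<in> cball x \<delta> \<longrightarrow> norm (g y) \<le> B"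
  shows "norm (conv k g x) \<le> B"
proof -
  have "norm (conv k g x) \<le> (\<integral>y. k (x - y) * B \<partial>lebesgue)"
    unfolding conv_def
  proof (rule norm_integral_le)
    show "AE y in lebesgue. norm (k (x - y) *\<^sub>R g y) \<le> k (x - y) * B"
      using B
    proof eventually_elim
      case (elim y)
      show ?case
        using elim mollifierD(2)[OF k, of "x - y"] mollifierD(3)[OF k, of "x - y"]
        by (cases "\<delta> < norm (x - y)") (auto simp: dist_norm intro!: mult_left_mono)
    qed
  qed (use mollifier_reflect(2)[OF k] in auto)
  then show ?thesis using mollifier_reflect(1)[OF k] by simp
qed

section \<open>Pointwise identities and a convex truncation\<close>

lemma has_partials_compose:
  assumes v: "has_partials v G" and p: "\<And>y. (p has_derivative q y) (at y)"
    and q: "continuous_on UNIV (\<lambda>(y, \<xi>). q y \<xi>)"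
  shows "has_partials (\<lambda>x. p (v x)) (\<lambda>i x. q (v x) (G i x))"
proof (rule has_partialsI)
  fix x
  show "((\<lambda>x. p (v x)) has_derivative (\<lambda>h. q (v x) (\<Sum>i\<in>UNIV. h $ i *\<^sub>R G i x))) (at x)"
    using has_derivative_compose[OF has_partials_derivative[OF v] p] by simp
  interpret q: bounded_linear "q (v x)" using p by (rule has_derivative_bounded_linear)
  show "q (v x) (\<Sum>i\<in>UNIV. h $ i *\<^sub>R G i x) = (\<Sum>i\<in>UNIV. h $ i *\<^sub>R q (v x) (G i x))" for h
    by (simp add: q.sum q.scaleR)
next
  fix i
  have "continuous_on UNIV (\<lambda>x. (v x, G i x))"
    by (intro continuous_intros has_partials_continuous[OF v] has_partials_continuous_partial[OF v])
  from continuous_on_compose2[OF q this]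
  show "continuous_on UNIV (\<lambda>x. q (v x) (G i x))" by simp
qed

text \<open>Sum over \<open>j\<close> the \<open>j\<close>-th partial of
  \<open>\<psi> * (G l \<bullet> G j)\<close> and subtract half the \<open>l\<close>-th partial of
  \<open>\<psi>\<close> times the squared gradient. By symmetry of \<open>H\<close> the terms with
  \<open>H l j \<bullet> G j\<close> cancel, the Laplacian remains, and every partial of a compactly
  supported function integrates to 0.\<close>

lemma pohozaev_identity:
  fixes v :: "real^'n::finite \<Rightarrow> 'b::euclidean_space" and \<psi> :: "real^'n \<Rightarrow> real"
  assumes G: "\<And>i. has_partials (G i) (H i)" and sym: "\<And>i j x. H i j x = H j i x"
    and \<psi>: "has_partials \<psi> D" "compact K" "\<And>x. x \<notin> K \<Longrightarrow> \<psi> x = 0"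
  shows "(\<integral>x. \<psi> x * (G l x \<bullet> (\<Sum>j\<in>UNIV. H j j x)) \<partial>lebesgue) =
    (\<integral>x. (\<Sum>j\<in>UNIV. G j x \<bullet> G j x) / 2 * D l x - (\<Sum>j\<in>UNIV. (G l x \<bullet> G j x) * D j x) \<partial>lebesgue)"
proof -
  let ?F = "\<lambda>j x. \<psi> x * (G l x \<bullet> G j x)"
  let ?DF = "\<lambda>j i x. \<psi> x * (G l x \<bullet> H j i x + H l i x \<bullet> G j x) + D i x * (G l x \<bullet> G j x)"
  let ?E = "\<lambda>x. \<psi> x * (\<Sum>j\<in>UNIV. G j x \<bullet> G j x)"
  let ?DE = "\<lambda>i x. \<psi> x * (\<Sum>j\<in>UNIV. G j x \<bullet> H j i x + H j i x \<bullet> G j x) + D i x * (\<Sum>j\<in>UNIV. G j x \<bullet> G j x)"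
  have F: "has_partials (?F j) (?DF j)" for j
    by (rule has_partials_mult[OF \<psi>(1) has_partials_inner[OF G G]])
  have E: "has_partials ?E ?DE"
    by (rule has_partials_mult[OF \<psi>(1) has_partials_sum[OF has_partials_inner[OF G G]]])
  have F0: "?F j x = 0" "?E x = 0" if "x \<notin> K" for j x using \<psi>(3)[OF that] by auto
  have iF: "integrable lebesgue (?DF j i)" for j i
    by (rule integrable_lebesgue_compact_support[OF has_partials_continuous_partial[OF F] \<psi>(2)])
      (rule has_partials_outside[OF F compact_imp_closed[OF \<psi>(2)] F0(1)])
  have iE: "integrable lebesgue (?DE i)" for i
    by (rule integrable_lebesgue_compact_support[OF has_partials_continuous_partial[OF E] \<psi>(2)])
      (rule has_partials_outside[OF E compact_imp_closed[OF \<psi>(2)] F0(2)])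
  have 0: "(\<integral>x. (\<Sum>j\<in>UNIV. ?DF j j x) - ?DE l x / 2 \<partial>lebesgue) = 0"
  proof -
    have "(\<integral>x. ?DF j j x \<partial>lebesgue) = 0" "(\<integral>x. ?DE l x \<partial>lebesgue) = 0" for j
      by (rule integral_partial_eq_0[OF F \<psi>(2) F0(1)], assumption,
          rule integral_partial_eq_0[OF E \<psi>(2) F0(2)])
    then show ?thesis
      using iF iE by (subst Bochner_Integration.integral_diff) auto
  qed
  let ?A = "\<lambda>x. \<psi> x * (G l x \<bullet> (\<Sum>j\<in>UNIV. H j j x))"
  let ?B = "\<lambda>x. (\<Sum>j\<in>UNIV. G j x \<bullet> G j x) / 2 * D l x - (\<Sum>j\<in>UNIV. (G l x \<bullet> G j x) * D j x)"
  have eq: "(\<Sum>j\<in>UNIV. ?DF j j x) - ?DE l x / 2 = ?A x - ?B x" for x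
    using sym[of l]
    by (simp add: inner_commute[of "H _ _ x"] sum.distrib distrib_left inner_sum_right
        sum_distrib_left[symmetric] add_divide_distrib algebra_simps)
  have D0: "D i x = 0" if "x \<notin> K" for i x
    by (rule has_partials_outside[OF \<psi>(1) compact_imp_closed[OF \<psi>(2)] \<psi>(3) that])
  have cont: "continuous_on UNIV (G i)" "continuous_on UNIV (H i j)" "continuous_on UNIV (D i)"
      "continuous_on UNIV \<psi>" for i j
    using has_partials_continuous[OF G] has_partials_continuous_partial[OF G]
      has_partials_continuous[OF \<psi>(1)] has_partials_continuous_partial[OF \<psi>(1)] by auto
  have "integrable lebesgue ?A" "integrable lebesgue ?B"
    by (rule integrable_lebesgue_compact_support[OF _ \<psi>(2)];
        auto intro!: continuous_intros cont simp: D0 \<psi>(3))+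
  then have "(\<integral>x. ?A x \<partial>lebesgue) - (\<integral>x. ?B x \<partial>lebesgue) = (\<integral>x. ?A x - ?B x \<partial>lebesgue)"
    by (rule Bochner_Integration.integral_diff[symmetric])
  also have "\<dots> = 0" using 0 unfolding eq .
  finally show ?thesis by simp
qed

lemma chain_rule_identity:
  fixes v :: "real^'n::finite \<Rightarrow> 'b::euclidean_space" and \<psi> :: "real^'n \<Rightarrow> real"
  assumes v: "has_partials v G" and \<Phi>: "\<And>y. (\<Phi> has_derivative (\<lambda>h. p y \<bullet> h)) (at y)"
    and p: "continuous_on UNIV p"
    and \<psi>: "has_partials \<psi> D" "compact K" "\<And>x. x \<notin> K \<Longrightarrow> \<psi> x = 0"
  shows "(\<integral>x. \<psi> x * (p (v x) \<bullet> G l x) \<partial>lebesgue) = - (\<integral>x. \<Phi> (v x) * D l x \<partial>lebesgue)"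
proof -
  note P = has_partials_compose_vec[OF v \<Phi> p]
  have F: "has_partials (\<lambda>x. \<psi> x * \<Phi> (v x)) (\<lambda>i x. \<psi> x * (p (v x) \<bullet> G i x) + D i x * \<Phi> (v x))"
    by (rule has_partials_mult[OF \<psi>(1) P])
  have D0: "D i x = 0" if "x \<notin> K" for i x
    by (rule has_partials_outside[OF \<psi>(1) compact_imp_closed[OF \<psi>(2)] \<psi>(3) that])
  have 0: "(\<integral>x. \<psi> x * (p (v x) \<bullet> G l x) + D l x * \<Phi> (v x) \<partial>lebesgue) = 0"
    by (rule integral_partial_eq_0[OF F \<psi>(2)]) (simp add: \<psi>(3))
  have "integrable lebesgue (\<lambda>x. \<psi> x * (p (v x) \<bullet> G l x))"
    by (rule integrable_lebesgue_compact_support[OF _ \<psi>(2)])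
      (auto intro!: continuous_intros has_partials_continuous[OF \<psi>(1)] has_partials_continuous_partial[OF P] simp: \<psi>(3))
  moreover have "integrable lebesgue (\<lambda>x. D l x * \<Phi> (v x))"
    by (rule integrable_lebesgue_compact_support[OF _ \<psi>(2)])
      (auto intro!: continuous_intros has_partials_continuous_partial[OF \<psi>(1)] has_partials_continuous[OF P] simp: D0)
  ultimately show ?thesis using 0 by (simp add: Bochner_Integration.integral_add mult.commute)
qed

text \<open>The Laplacian of \<open>\<Phi> (v x)\<close> is \<open>p (v x)\<close> applied to the
  Laplacian of \<open>v\<close> plus the sum over \<open>j\<close> of the Hessian form of
  \<open>\<Phi>\<close> at \<open>G j x\<close>. Convexity gives the latter a sign, and integration
  against \<open>\<kappa> \<ge> 0\<close> preserves it.\<close>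

lemma kato_inequality:
  fixes v :: "real^'n::finite \<Rightarrow> 'b::euclidean_space" and \<kappa> :: "real^'n \<Rightarrow> real"
  assumes v: "has_partials v G" and G: "\<And>i. has_partials (G i) (H i)"
    and \<Phi>: "\<And>y. (\<Phi> has_derivative (\<lambda>h. p y \<bullet> h)) (at y)"
    and p: "\<And>y. (p has_derivative q y) (at y)" and q: "continuous_on UNIV (\<lambda>(y, \<xi>). q y \<xi>)"
    and convex: "\<And>y \<xi>. 0 \<le> q y \<xi> \<bullet> \<xi>"
    and \<kappa>: "has_partials \<kappa> D" "\<And>i. has_partials (D i) (D2 i)" "compact K"
      "\<And>x. x \<notin> K \<Longrightarrow> \<kappa> x = 0" "\<And>x. 0 \<le> \<kappa> x"
  shows "(\<integral>x. \<kappa> x * (p (v x) \<bullet> (\<Sum>j\<in>UNIV. H j j x)) \<partial>lebesgue) \<le>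
    (\<integral>x. \<Phi> (v x) * (\<Sum>j\<in>UNIV. D2 j j x) \<partial>lebesgue)"
proof -
  have cp: "continuous_on UNIV p"
    using p by (meson continuous_at_imp_continuous_on has_derivative_continuous)
  note Pv = has_partials_compose_vec[OF v \<Phi> cp] and pv = has_partials_compose[OF v p q]
  have D0: "D i x = 0" if "x \<notin> K" for i x
    by (rule has_partials_outside[OF \<kappa>(1) compact_imp_closed[OF \<kappa>(3)] \<kappa>(4) that])
  have D20: "D2 i j x = 0" if "x \<notin> K" for i j x
    by (rule has_partials_outside[OF \<kappa>(2) compact_imp_closed[OF \<kappa>(3)] D0 that])
  \<comment> \<open>The integrals of \<open>?A j\<close> and \<open>?B j\<close> vanish, being
    integrals of derivatives of compactly supported functions. Their difference carries the
    Laplacian from \<open>\<Phi> (v x)\<close> over to \<open>\<kappa>\<close>.\<close>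
  let ?A = "\<lambda>j x. \<Phi> (v x) * D2 j j x + (p (v x) \<bullet> G j x) * D j x"
  let ?B = "\<lambda>j x. \<kappa> x * (p (v x) \<bullet> H j j x + q (v x) (G j x) \<bullet> G j x) + D j x * (p (v x) \<bullet> G j x)"
  have FA: "has_partials (\<lambda>x. \<Phi> (v x) * D j x) (\<lambda>i x. \<Phi> (v x) * D2 j i x + (p (v x) \<bullet> G i x) * D j x)" for j
    by (rule has_partials_mult[OF Pv \<kappa>(2)])
  have FB: "has_partials (\<lambda>x. \<kappa> x * (p (v x) \<bullet> G j x))
      (\<lambda>i x. \<kappa> x * (p (v x) \<bullet> H j i x + q (v x) (G i x) \<bullet> G j x) + D i x * (p (v x) \<bullet> G j x))" for j
    by (rule has_partials_mult[OF \<kappa>(1) has_partials_inner[OF pv G]])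
  have A: "(\<integral>x. ?A j x \<partial>lebesgue) = 0" for j
    by (rule integral_partial_eq_0[OF FA \<kappa>(3)]) (simp add: D0)
  have B: "(\<integral>x. ?B j x \<partial>lebesgue) = 0" for j
    by (rule integral_partial_eq_0[OF FB \<kappa>(3)]) (simp add: \<kappa>(4))
  have cA: "continuous_on UNIV (?A j)" for j by (rule has_partials_continuous_partial[OF FA])
  have cB: "continuous_on UNIV (?B j)" for j by (rule has_partials_continuous_partial[OF FB])
  have iA: "integrable lebesgue (?A j)" for j
    by (rule integrable_lebesgue_compact_support[OF cA \<kappa>(3)]) (simp add: D0 D20)
  have iB: "integrable lebesgue (?B j)" for j
    by (rule integrable_lebesgue_compact_support[OF cB \<kappa>(3)]) (simp add: D0 \<kappa>(4))
  let ?L = "\<lambda>x. \<kappa> x * (p (v x) \<bullet> (\<Sum>j\<in>UNIV. H j j x))"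
  let ?R = "\<lambda>x. \<Phi> (v x) * (\<Sum>j\<in>UNIV. D2 j j x)"
  have iL: "integrable lebesgue ?L"
    by (rule integrable_lebesgue_compact_support[OF _ \<kappa>(3)])
      (auto intro!: continuous_intros has_partials_continuous[OF \<kappa>(1)] has_partials_continuous[OF pv]
        has_partials_continuous_partial[OF G] simp: \<kappa>(4))
  have iR: "integrable lebesgue ?R"
    by (rule integrable_lebesgue_compact_support[OF _ \<kappa>(3)])
      (auto intro!: continuous_intros has_partials_continuous[OF Pv] has_partials_continuous_partial[OF \<kappa>(2)] simp: D20)
  have "?L x \<le> ?R x - (\<Sum>j\<in>UNIV. ?A j x - ?B j x)" for x
  proof -
    have "?R x - (\<Sum>j\<in>UNIV. ?A j x - ?B j x) = ?L x + \<kappa> x * (\<Sum>j\<in>UNIV. q (v x) (G j x) \<bullet> G j x)"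
      by (simp add: sum.distrib sum_subtractf inner_sum_right sum_distrib_left algebra_simps)
    also have "\<dots> \<ge> ?L x" using \<kappa>(5) by (auto intro!: mult_nonneg_nonneg sum_nonneg convex)
    finally show ?thesis .
  qed
  note le = this
  have iAB: "integrable lebesgue (\<lambda>x. ?A j x - ?B j x)" for j
    by (rule Bochner_Integration.integrable_diff[OF iA iB])
  have iS: "integrable lebesgue (\<lambda>x. \<Sum>j\<in>UNIV. ?A j x - ?B j x)"
    by (rule Bochner_Integration.integrable_sum[OF iAB])
  have "(\<integral>x. ?L x \<partial>lebesgue) \<le> (\<integral>x. ?R x - (\<Sum>j\<in>UNIV. ?A j x - ?B j x) \<partial>lebesgue)"
    by (rule integral_mono[OF iL Bochner_Integration.integrable_diff[OF iR iS] le])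
  also have "\<dots> = (\<integral>x. ?R x \<partial>lebesgue) - (\<Sum>j\<in>UNIV. (\<integral>x. ?A j x \<partial>lebesgue) - (\<integral>x. ?B j x \<partial>lebesgue))"
    by (simp only: Bochner_Integration.integral_diff[OF iR iS] Bochner_Integration.integral_sum[OF iAB]
        Bochner_Integration.integral_diff[OF iA iB])
  finally show ?thesis by (simp add: A B)
qed

text \<open>A convex function with bounded gradient that vanishes near the ball of radius \<open>T - 1\<close> and grows
  linearly; \<open>soft_excess_grad T\<close> is its gradient and is a nonnegative multiple of the identity at each point.\<close>

definition soft_excess :: "real \<Rightarrow> 'b::euclidean_space \<Rightarrow> real" where
  "soft_excess T y = (max 0 (sqrt (1 + y \<bullet> y) - T)) ^ 3 / (1 + y \<bullet> y)"

text \<open>With \<open>s = sqrt (1 + y \<bullet> y)\<close>, which unlike the norm is smooth at 0,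
  \<open>soft_excess\<close> is the cube of the positive part of \<open>s - T\<close> divided by
  \<open>s^2\<close>: the cube gives two continuous derivatives at \<open>s = T\<close>, the
  division keeps the growth linear. The derivative of this profile in \<open>s\<close> is
  \<open>s\<close> times the slope, and the factor \<open>s\<close> cancels against the derivative
  of the square root, leaving the slope times \<open>y\<close>.\<close>

definition soft_excess_slope :: "real \<Rightarrow> real \<Rightarrow> real" where
  "soft_excess_slope T s = (max 0 (s - T))\<^sup>2 * (s + 2 * T) / s ^ 4"

definition soft_excess_slope' :: "real \<Rightarrow> real \<Rightarrow> real" where
  "soft_excess_slope' T s = (2 * max 0 (s - T) * (s + 2 * T) + (max 0 (s - T))\<^sup>2) / s ^ 4
     - 4 * ((max 0 (s - T))\<^sup>2 * (s + 2 * T)) / s ^ 5"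

definition soft_excess_grad :: "real \<Rightarrow> 'b::euclidean_space \<Rightarrow> 'b" where
  "soft_excess_grad T y = soft_excess_slope T (sqrt (1 + y \<bullet> y)) *\<^sub>R y"

lemma DERIV_max_power:
  "((\<lambda>s::real. (max 0 (s - T)) ^ Suc (Suc n)) has_real_derivative
     real (Suc (Suc n)) * (max 0 (s - T)) ^ Suc n) (at s)"
proof -
  consider "s > T" | "s < T" | "s = T" by linarith
  then show ?thesis
  proof cases
    case 1
    have ev: "\<forall>\<^sub>F x in nhds s. (x - T) ^ Suc (Suc n) = (max 0 (x - T)) ^ Suc (Suc n)"
      using eventually_nhds_in_open[of "{T<..}" s] 1 by (auto elim!: eventually_mono)
    have "((\<lambda>s. (s - T) ^ Suc (Suc n)) has_real_derivative real (Suc (Suc n)) * (s - T) ^ Suc n) (at s)"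
      by (rule DERIV_cong, rule DERIV_power[OF DERIV_diff[OF DERIV_ident DERIV_const]])
        (simp del: of_nat_Suc power_Suc)
    with DERIV_cong_ev[OF refl ev refl, THEN iffD1] 1 show ?thesis by simp
  next
    case 2
    have ev: "\<forall>\<^sub>F x in nhds s. 0 = (max 0 (x - T)) ^ Suc (Suc n)"
      using eventually_nhds_in_open[of "{..<T}" s] 2 by (auto elim!: eventually_mono)
    have "((\<lambda>s. 0) has_real_derivative 0) (at s)" by simp
    from DERIV_cong_ev[OF refl ev refl, THEN iffD1, OF this] 2 show ?thesis by simp
  next
    case 3
    have "((\<lambda>h. (max 0 h) ^ Suc (Suc n) / h) \<longlongrightarrow> 0) (at (0::real))"
    proof (rule Lim_null_comparison)
      show "\<forall>\<^sub>F h in at 0. norm ((max 0 h) ^ Suc (Suc n) / h) \<le> \<bar>h\<bar> ^ Suc n" for h :: real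
        by (rule always_eventually) (auto simp: max_def abs_mult power_abs mult_nonpos_nonneg)
      have "((\<lambda>h::real. \<bar>h\<bar> ^ Suc n) \<longlongrightarrow> \<bar>0\<bar> ^ Suc n) (at 0)" by (intro tendsto_intros)
      then show "((\<lambda>h::real. \<bar>h\<bar> ^ Suc n) \<longlongrightarrow> 0) (at 0)" by simp
    qed
    then show ?thesis using 3 by (simp add: has_field_derivative_iff LIM_offset_zero_iff)
  qed
qed

lemma DERIV_soft_excess_slope:
  assumes "0 < s"
  shows "(soft_excess_slope T has_real_derivative soft_excess_slope' T s) (at s)"
proof -
  define m where "m = max 0 (s - T)"
  have d2: "((\<lambda>s. (max 0 (s - T))\<^sup>2) has_real_derivative 2 * m) (at s)"
    using DERIV_max_power[of T 0 s] by (simp add: numeral_2_eq_2 m_def)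
  have d1: "((\<lambda>s. s + 2 * T) has_real_derivative 1) (at s)"
    by (auto intro!: derivative_eq_intros)
  have d4: "((\<lambda>s. s ^ 4) has_real_derivative 4 * s ^ 3) (at s)"
    by (auto intro!: derivative_eq_intros)
  have "((\<lambda>s. (max 0 (s - T))\<^sup>2 * (s + 2 * T) / s ^ 4) has_real_derivative
      ((2 * m * (s + 2 * T) + 1 * (max 0 (s - T))\<^sup>2) * s ^ 4
        - (max 0 (s - T))\<^sup>2 * (s + 2 * T) * (4 * s ^ 3)) / (s ^ 4 * s ^ 4)) (at s)"
    by (rule DERIV_divide[OF DERIV_mult[OF d2 d1] d4]) (use assms in auto)
  also have "((2 * m * (s + 2 * T) + 1 * (max 0 (s - T))\<^sup>2) * s ^ 4
        - (max 0 (s - T))\<^sup>2 * (s + 2 * T) * (4 * s ^ 3)) / (s ^ 4 * s ^ 4) = soft_excess_slope' T s"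
    unfolding soft_excess_slope'_def m_def[symmetric]
    using assms by (simp add: diff_divide_distrib eval_nat_numeral)
  finally show ?thesis unfolding soft_excess_slope_def[abs_def] .
qed

lemma soft_excess_slope_nonneg:
  assumes "0 < T"
  shows "0 \<le> soft_excess_slope T s"
  using assms by (cases "s \<le> T") (auto simp: soft_excess_slope_def)

text \<open>The expression is the second derivative of the radial profile in \<open>s\<close>; for
  \<open>s > T\<close> it reduces to \<open>6 * T^2 * (s - T) / s^4\<close>.\<close>

lemma soft_excess_slope_convex:
  assumes "0 < T" "0 < s"
  shows "0 \<le> soft_excess_slope T s + s * soft_excess_slope' T s"
proof (cases "s \<le> T")
  case False
  have "soft_excess_slope T s + s * soft_excess_slope' T s = 6 * T\<^sup>2 * (s - T) / s ^ 4"
    using False assms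
    by (simp add: soft_excess_slope_def soft_excess_slope'_def field_simps eval_nat_numeral)
  then show ?thesis using False assms by simp
qed (simp add: soft_excess_slope_def soft_excess_slope'_def)

lemma has_derivative_sqrt_norm:
  fixes y :: "'b::euclidean_space"
  shows "((\<lambda>y. sqrt (1 + y \<bullet> y)) has_derivative (\<lambda>h. (y \<bullet> h) / sqrt (1 + y \<bullet> y))) (at y)"
proof -
  have pos: "0 < 1 + y \<bullet> y" by (simp add: add_pos_nonneg)
  have "((\<lambda>y. 1 + y \<bullet> y) has_derivative (\<lambda>h. 2 * (y \<bullet> h))) (at y)"
    by (auto intro!: derivative_eq_intros simp: inner_commute)
  from has_derivative_compose[OF this DERIV_real_sqrt[OF pos, unfolded has_field_derivative_def]]
  have "((\<lambda>y. sqrt (1 + y \<bullet> y)) has_derivative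
      (\<lambda>h. inverse (sqrt (1 + y \<bullet> y)) / 2 * (2 * (y \<bullet> h)))) (at y)" .
  moreover have "(\<lambda>h. inverse (sqrt (1 + y \<bullet> y)) / 2 * (2 * (y \<bullet> h))) = (\<lambda>h. (y \<bullet> h) / sqrt (1 + y \<bullet> y))"
    by (rule ext) (simp add: inverse_eq_divide)
  ultimately show ?thesis by (simp only:)
qed

lemma has_derivative_soft_excess:
  fixes y :: "'b::euclidean_space"
  shows "(soft_excess T has_derivative (\<lambda>h. soft_excess_grad T y \<bullet> h)) (at y)"
proof -
  define s where "s = sqrt (1 + y \<bullet> y)"
  have s: "0 < s" "s\<^sup>2 = 1 + y \<bullet> y" by (auto simp: s_def add_pos_nonneg)
  have eq: "soft_excess T = (\<lambda>y::'b. (\<lambda>s. (max 0 (s - T)) ^ 3 / s\<^sup>2) (sqrt (1 + y \<bullet> y)))"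
    by (auto simp: soft_excess_def fun_eq_iff add_nonneg_nonneg)
  have d3: "((\<lambda>s::real. (max 0 (s - T)) ^ 3) has_real_derivative 3 * (max 0 (s - T))\<^sup>2) (at s)"
    using DERIV_max_power[of T 1 s] by (simp add: numeral_3_eq_3 numeral_2_eq_2)
  have "((\<lambda>s. (max 0 (s - T)) ^ 3 / s\<^sup>2) has_real_derivative
      (3 * (max 0 (s - T))\<^sup>2 * s\<^sup>2 - (max 0 (s - T)) ^ 3 * (2 * s)) / (s\<^sup>2 * s\<^sup>2)) (at s)"
    by (rule DERIV_divide[OF d3]) (use s in \<open>auto intro!: derivative_eq_intros\<close>)
  also have "(3 * (max 0 (s - T))\<^sup>2 * s\<^sup>2 - (max 0 (s - T)) ^ 3 * (2 * s)) / (s\<^sup>2 * s\<^sup>2)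
      = s * soft_excess_slope T s"
    using s(1) by (cases "s \<le> T") (simp_all add: soft_excess_slope_def field_simps eval_nat_numeral)
  finally have "(soft_excess T has_derivative
      (\<lambda>h. s * soft_excess_slope T s * (y \<bullet> h / sqrt (1 + y \<bullet> y)))) (at y)"
    unfolding eq has_field_derivative_def s_def
    by (rule has_derivative_compose[OF has_derivative_sqrt_norm])
  then show ?thesis
    using s(1) by (simp add: soft_excess_grad_def s_def[symmetric])
qed

definition soft_excess_hess :: "real \<Rightarrow> 'b::euclidean_space \<Rightarrow> 'b \<Rightarrow> 'b" where
  "soft_excess_hess T y \<xi> = soft_excess_slope T (sqrt (1 + y \<bullet> y)) *\<^sub>R \<xi>
     + (soft_excess_slope' T (sqrt (1 + y \<bullet> y)) * (y \<bullet> \<xi> / sqrt (1 + y \<bullet> y))) *\<^sub>R y"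

lemma has_derivative_soft_excess_grad:
  fixes y :: "'b::euclidean_space"
  shows "(soft_excess_grad T has_derivative soft_excess_hess T y) (at y)"
proof -
  have s: "0 < sqrt (1 + y \<bullet> y)" by (simp add: add_pos_nonneg)
  have "((\<lambda>y::'b. soft_excess_slope T (sqrt (1 + y \<bullet> y))) has_derivative
      (\<lambda>h. soft_excess_slope' T (sqrt (1 + y \<bullet> y)) * (y \<bullet> h / sqrt (1 + y \<bullet> y)))) (at y)"
    using DERIV_soft_excess_slope[OF s, of T] unfolding has_field_derivative_def
    by (rule has_derivative_compose[OF has_derivative_sqrt_norm])
  from has_derivative_scaleR[OF this has_derivative_ident] show ?thesis
    by (simp add: soft_excess_grad_def[abs_def] soft_excess_hess_def[abs_def])
qed

lemma continuous_soft_excess_hess: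
  "continuous_on UNIV (\<lambda>(y::'b::euclidean_space, \<xi>). soft_excess_hess T y \<xi>)"
proof -
  have "sqrt (1 + y \<bullet> y) \<noteq> 0" "1 + y \<bullet> y \<noteq> 0" for y :: 'b
    using inner_ge_zero[of y] by (auto simp del: inner_ge_zero)
  then show ?thesis
    unfolding soft_excess_hess_def soft_excess_slope_def soft_excess_slope'_def case_prod_beta
    by (intro continuous_intros) auto
qed

text \<open>The Hessian form is
  \<open>b * (\<xi> \<bullet> \<xi>) + b' * (y \<bullet> \<xi>)^2 / s\<close>. A negative
  \<open>b'\<close> is at least \<open>- b / s\<close> by convexity of the profile, and
  Cauchy-Schwarz with \<open>y \<bullet> y \<le> s^2\<close> lets the first term absorb the
  second.\<close>

lemma soft_excess_hess_convex:
  fixes y \<xi> :: "'b::euclidean_space"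
  assumes T: "0 < T"
  shows "0 \<le> soft_excess_hess T y \<xi> \<bullet> \<xi>"
proof -
  define s where "s = sqrt (1 + y \<bullet> y)"
  have s: "0 < s" "s\<^sup>2 = 1 + y \<bullet> y" by (auto simp: s_def add_pos_nonneg)
  define b b' where "b = soft_excess_slope T s" and "b' = soft_excess_slope' T s"
  have b: "0 \<le> b" using soft_excess_slope_nonneg[OF T] by (simp add: b_def)
  have b': "- b / s \<le> b'"
    using soft_excess_slope_convex[OF T s(1)] s(1) by (simp add: b_def b'_def field_simps)
  have "(y \<bullet> \<xi>)\<^sup>2 \<le> (y \<bullet> y) * (\<xi> \<bullet> \<xi>)"
    by (rule Cauchy_Schwarz_ineq)
  also have "\<dots> \<le> s\<^sup>2 * (\<xi> \<bullet> \<xi>)" using s(2) by (intro mult_right_mono) auto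
  finally have cs: "(y \<bullet> \<xi>)\<^sup>2 / s\<^sup>2 \<le> \<xi> \<bullet> \<xi>" using s(1) by (simp add: divide_le_eq mult.commute)
  have "0 \<le> b * (\<xi> \<bullet> \<xi> - (y \<bullet> \<xi>)\<^sup>2 / s\<^sup>2)" using b cs by simp
  also have "\<dots> = b * (\<xi> \<bullet> \<xi>) + (- b / s) * ((y \<bullet> \<xi>)\<^sup>2 / s)"
    by (simp add: right_diff_distrib power2_eq_square)
  also have "\<dots> \<le> b * (\<xi> \<bullet> \<xi>) + b' * ((y \<bullet> \<xi>)\<^sup>2 / s)"
    using b' s(1) by (intro add_left_mono mult_right_mono) auto
  also have "\<dots> = soft_excess_hess T y \<xi> \<bullet> \<xi>"
    by (simp add: soft_excess_hess_def inner_add_left power2_eq_square b_def b'_def s_def)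
  finally show ?thesis .
qed

lemma norm_soft_excess_grad_le:
  fixes y :: "'b::euclidean_space"
  assumes T: "0 < T"
  shows "norm (soft_excess_grad T y) \<le> 3"
proof -
  define s where "s = sqrt (1 + y \<bullet> y)"
  have s: "0 < s" by (auto simp: s_def add_pos_nonneg)
  have "norm y \<le> s" unfolding s_def norm_eq_sqrt_inner by simp
  then have "norm (soft_excess_grad T y) \<le> soft_excess_slope T s * s"
    using soft_excess_slope_nonneg[OF T, of s]
    by (auto simp: soft_excess_grad_def s_def intro!: mult_left_mono)
  also have "\<dots> \<le> 3"
  proof (cases "s \<le> T")
    case False
    \<comment> \<open>For \<open>s > T > 0\<close> the squared factor is at most 1 and
      \<open>s + 2 * T \<le> 3 * s\<close>, which is the origin of the constant 3.\<close>
    have "soft_excess_slope T s * s = ((s - T) / s)\<^sup>2 * ((s + 2 * T) / s)"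
      using False s by (simp add: soft_excess_slope_def field_simps eval_nat_numeral)
    also have "\<dots> \<le> 1\<^sup>2 * 3"
      using False s T by (intro mult_mono power_mono) (auto simp: divide_le_eq)
    finally show ?thesis by simp
  qed (simp add: soft_excess_slope_def)
  finally show ?thesis .
qed

lemma soft_excess_lipschitz:
  fixes y z :: "'b::euclidean_space"
  assumes T: "0 < T"
  shows "\<bar>soft_excess T y - soft_excess T z\<bar> \<le> 3 * norm (y - z)"
proof -
  have "norm (soft_excess T y - soft_excess T z) \<le> 3 * norm (y - z)"
  proof (rule differentiable_bound[of UNIV])
    show "(soft_excess T has_derivative (\<lambda>h. soft_excess_grad T x \<bullet> h)) (at x within UNIV)" for x :: 'b
      by (rule has_derivative_soft_excess)
    show "onorm (\<lambda>h. soft_excess_grad T x \<bullet> h) \<le> 3" for x :: 'b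
    proof (rule onorm_le)
      fix h
      have "norm (soft_excess_grad T x \<bullet> h) \<le> norm (soft_excess_grad T x) * norm h"
        by (simp add: Cauchy_Schwarz_ineq2)
      also have "\<dots> \<le> 3 * norm h" by (intro mult_right_mono norm_soft_excess_grad_le T) auto
      finally show "norm (soft_excess_grad T x \<bullet> h) \<le> 3 * norm h" .
    qed
  qed auto
  then show ?thesis by simp
qed

lemma soft_excess_nonneg: "0 \<le> soft_excess T y"
  by (simp add: soft_excess_def add_nonneg_nonneg)

lemma soft_excess_zero: "1 \<le> T \<Longrightarrow> soft_excess T (0 :: 'b::euclidean_space) = 0"
  by (simp add: soft_excess_def)

lemma norm_le_soft_excess:
  fixes y :: "'b::euclidean_space"
  assumes T: "0 < T"
  shows "norm y \<le> 8 * soft_excess T y + 2 * T"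
proof -
  define s where "s = sqrt (1 + y \<bullet> y)"
  have s: "0 < s" "s\<^sup>2 = 1 + y \<bullet> y" by (auto simp: s_def add_pos_nonneg)
  have "norm y \<le> s" unfolding s_def norm_eq_sqrt_inner by simp
  also have "s \<le> 8 * soft_excess T y + 2 * T"
  proof (cases "s \<le> 2 * T")
    case True
    then show ?thesis using soft_excess_nonneg[of T y] by simp
  next
    case False
    \<comment> \<open>Beyond \<open>2 * T\<close> the excess \<open>s - T\<close> is at least
      \<open>s / 2\<close>; its cube over \<open>s^2\<close> is then at least \<open>s / 8\<close>,
      hence the factor 8.\<close>
    have "(s / 2) ^ 3 \<le> (max 0 (s - T)) ^ 3" using False s by (intro power_mono) auto
    then have "(s / 2) ^ 3 / s\<^sup>2 \<le> (max 0 (s - T)) ^ 3 / s\<^sup>2" by (intro divide_right_mono) auto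
    also have "\<dots> = soft_excess T y" by (simp only: soft_excess_def s_def[symmetric] s(2))
    finally have "(s / 2) ^ 3 / s\<^sup>2 \<le> soft_excess T y" .
    moreover have "(s / 2) ^ 3 / s\<^sup>2 = s / 8" using s(1) by (simp add: field_simps eval_nat_numeral)
    ultimately show ?thesis using T by simp
  qed
  finally show ?thesis .
qed

lemma soft_excess_grad_inner_nonneg:
  fixes y z :: "'b::euclidean_space"
  assumes T: "0 < T" and yz: "T < sqrt (1 + y \<bullet> y) \<Longrightarrow> 0 \<le> y \<bullet> z"
  shows "0 \<le> soft_excess_grad T y \<bullet> z"
proof (cases "T < sqrt (1 + y \<bullet> y)")
  case True
  then show ?thesis
    using yz soft_excess_slope_nonneg[OF T] by (simp add: soft_excess_grad_def)
qed (simp add: soft_excess_grad_def soft_excess_slope_def)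

section \<open>Radial averages of subharmonic functions\<close>

text \<open>The polynomial is \<open>bump_next 1\<close>, so this is the derivative of
  \<open>bump 1\<close>, that is, of \<open>exp (- (1 / t))\<close> continued by 0. With this
  profile for the averaging kernel, the derivative of the average in the radius becomes the
  Laplacian of a function built from \<open>bump 1\<close>, which is nonnegative.\<close>

definition bump1 :: "real \<Rightarrow> real" where "bump1 = bump (monom 1 2)"

lemma bump_next_1: "bump_next 1 = monom 1 2"
  by (simp add: bump_next_def pderiv_1)

lemma bump1_nonneg: "0 \<le> bump1 t"
  by (simp add: bump1_def bump_def poly_monom)

lemma bump1_pos: "0 < t \<Longrightarrow> 0 < bump1 t"
  by (simp add: bump1_def bump_def poly_monom)

lemma continuous_on_bump1: "continuous_on A bump1"
  by (simp add: bump1_def continuous_on_bump)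

definition bump1_mass :: real where
  "bump1_mass = (\<integral>z. bump1 (1 - (norm (z :: real^2))\<^sup>2) \<partial>lborel)"

text \<open>The factor \<open>s^2\<close> is the Jacobian of a dilation of the plane. Up to
  \<open>bump1_mass\<close> this is the kernel \<open>\<sigma> * bump1 (1 - \<sigma> * t)\<close>
  with \<open>\<sigma> = 1 / s^2\<close>, whose dependence on \<open>\<sigma>\<close> is easy to
  differentiate.\<close>

definition rho :: "real \<Rightarrow> real^2 \<Rightarrow> real" where
  "rho s z = bump1 (1 - (norm z)\<^sup>2 / s\<^sup>2) / (s\<^sup>2 * bump1_mass)"

lemma continuous_bump1_radial: "continuous_on UNIV (\<lambda>z::real^2. bump1 (1 - a * (norm z)\<^sup>2))"
  by (intro continuous_on_compose2[OF continuous_on_bump1] continuous_intros) auto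

lemma bump1_mass_pos: "0 < bump1_mass"
proof -
  let ?f = "\<lambda>z::real^2. bump1 (1 - (norm z)\<^sup>2)"
  have c: "continuous_on UNIV ?f" using continuous_bump1_radial[of 1] by simp
  have int: "integrable lborel ?f"
  proof (rule integrable_compact_support[OF c compact_cball[of 0 1]])
    fix z :: "real^2" assume "z \<notin> cball 0 1"
    then have "1 \<le> (norm z)\<^sup>2" by (simp add: one_le_power)
    then show "?f z = 0" by (simp add: bump1_def)
  qed
  have "bump1_mass \<noteq> 0"
  proof
    assume "bump1_mass = 0"
    then have "AE z in lborel. ?f z = 0"
      using integral_nonneg_eq_0_iff_AE[OF int] bump1_nonneg by (simp add: bump1_mass_def)
    moreover have "?f z \<noteq> 0" if "z \<in> ball 0 1" for z
    proof -
      have "(norm z)\<^sup>2 < 1" using that by (simp add: power_less_one_iff)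
      then show ?thesis using bump1_pos[of "1 - (norm z)\<^sup>2"] by simp
    qed
    ultimately have "AE z in lborel. z \<notin> ball (0 :: real^2) 1"
      by (auto elim!: eventually_mono)
    then have "ball (0 :: real^2) 1 \<in> null_sets lborel"
      by (subst (asm) AE_iff_null_sets[symmetric]) auto
    then have "negligible (ball (0 :: real^2) 1)"
      by (simp add: negligible_iff_null_sets null_sets_completionI)
    then show False using open_not_negligible[of "ball (0 :: real^2) 1"] by simp
  qed
  moreover have "0 \<le> bump1_mass"
    unfolding bump1_mass_def by (intro integral_nonneg_AE AE_I2 bump1_nonneg)
  ultimately show ?thesis by simp
qed

lemma bump1_mass_scale:
  assumes "0 < s"
  shows "(\<integral>z. bump1 (1 - (norm (z :: real^2))\<^sup>2 / s\<^sup>2) \<partial>lborel) = s\<^sup>2 * bump1_mass"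
proof -
  let ?f = "\<lambda>z::real^2. bump1 (1 - (norm z)\<^sup>2 / s\<^sup>2)"
  have m: "?f \<in> borel_measurable borel"
    using borel_measurable_continuous_onI[OF continuous_bump1_radial[of "1 / s\<^sup>2"]] by simp
  have "(\<integral>z. ?f z \<partial>lborel) =
      (\<integral>z. ?f z \<partial>density (distr lborel borel (\<lambda>x. 0 + s *\<^sub>R x)) (\<lambda>_. ennreal (\<bar>s\<bar> ^ DIM(real^2))))"
    using lborel_affine[of s "0 :: real^2"] assms by simp
  also have "\<dots> = s\<^sup>2 * (\<integral>z. ?f z \<partial>distr lborel borel (\<lambda>x. 0 + s *\<^sub>R x))"
    using assms m by (subst integral_density) (auto simp: measurable_distr_eq1)
  also have "(\<integral>z. ?f z \<partial>distr lborel borel (\<lambda>x. 0 + s *\<^sub>R x)) = (\<integral>z. ?f (0 + s *\<^sub>R z) \<partial>lborel)"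
    by (rule integral_distr[OF _ m]) measurable
  also have "\<dots> = bump1_mass"
    using assms by (simp add: bump1_mass_def power_mult_distrib)
  finally show ?thesis .
qed

lemma rho_outside: "0 < s \<Longrightarrow> s < norm z \<Longrightarrow> rho s z = 0"
  by (simp add: rho_def bump1_def power_mono)

lemma mollifier_rho:
  assumes "0 < s"
  shows "mollifier s (rho s)"
  unfolding mollifier_def
proof (intro conjI allI impI)
  show "continuous_on UNIV (rho s)"
    using continuous_bump1_radial[of "1 / s\<^sup>2"] unfolding rho_def
    by (intro continuous_intros) (use assms bump1_mass_pos in auto)
  show "0 \<le> rho s z" for z
    using bump1_nonneg bump1_mass_pos by (simp add: rho_def)
  show "(\<integral>z. rho s z \<partial>lborel) = 1"
    using bump1_mass_scale[OF assms] bump1_mass_pos assms by (simp add: rho_def)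
qed (rule rho_outside[OF assms])

lemma bump_algebra_rho: "bump_algebra (rho s)"
proof -
  have "bump_algebra (\<lambda>z. 1 / (s\<^sup>2 * bump1_mass) * bump (monom 1 2) (1 + (- 1 / s\<^sup>2) * (norm z)\<^sup>2))"
    by (intro bump_algebra.mult bump_algebra.const bump_algebra_radial)
  moreover have "rho s = (\<lambda>z. 1 / (s\<^sup>2 * bump1_mass) * bump (monom 1 2) (1 + (- 1 / s\<^sup>2) * (norm z)\<^sup>2))"
    by (auto simp: rho_def bump1_def fun_eq_iff)
  ultimately show ?thesis by simp
qed

text \<open>The kernel \<open>\<sigma> * bump1 (1 - \<sigma> t)\<close>, \<open>t = |x - y|\<^sup>2\<close>, has \<open>\<sigma>\<close>-derivative \<open>bump_flow (\<sigma> t)\<close>, which is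
  \<open>- 1 / (4 \<sigma>)\<close> times the planar Laplacian of \<open>bump 1 (1 - \<sigma> t)\<close>. Hence averages of subharmonic functions
  increase with the radius \<open>\<sigma> powr (- 1 / 2)\<close>.\<close>

definition bump_flow :: "real \<Rightarrow> real" where
  "bump_flow a = bump1 (1 - a) - a * bump (bump_next (monom 1 2)) (1 - a)"

lemma DERIV_bump1: "(bump1 has_real_derivative bump (bump_next (monom 1 2)) t) (at t)"
  unfolding bump1_def by (rule bump_has_derivative)

lemma DERIV_scaled_bump1:
  "((\<lambda>\<sigma>. \<sigma> * bump1 (1 - \<sigma> * t)) has_real_derivative bump_flow (\<sigma> * t)) (at \<sigma>)"
proof -
  have "((\<lambda>\<sigma>. 1 - \<sigma> * t) has_real_derivative - t) (at \<sigma>)"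
    by (auto intro!: derivative_eq_intros)
  from DERIV_mult[OF DERIV_ident DERIV_chain2[OF DERIV_bump1 this]] show ?thesis
    by (rule DERIV_cong) (simp add: bump_flow_def)
qed

lemma continuous_on_bump_flow: "continuous_on A bump_flow"
  unfolding bump_flow_def[abs_def] bump1_def
  by (intro continuous_intros continuous_on_compose2[OF continuous_on_bump[of UNIV]]) auto

lemma bump_flow_outside: "1 \<le> a \<Longrightarrow> bump_flow a = 0"
  by (simp add: bump_flow_def bump1_def)

definition radial_bump :: "real \<Rightarrow> real^2 \<Rightarrow> real^2 \<Rightarrow> real" where
  "radial_bump \<sigma> x0 y = bump 1 (1 - \<sigma> * (norm (y - x0))\<^sup>2)"

lemma has_partials_one_minus_norm_square:
  "has_partials (\<lambda>y. 1 - \<sigma> * (norm (y - x0))\<^sup>2) (\<lambda>i y. - 2 * \<sigma> * ((y :: real^2) $ i - x0 $ i))"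
proof -
  have c: "has_partials (\<lambda>x. x $ j + - (x0 $ j)) (\<lambda>i x. (if i = j then 1 else 0) + (0 :: real))" for j
    by (rule has_partials_add[OF has_partials_coord has_partials_const])
  have "has_partials (\<lambda>x. 1 + (- \<sigma>) * (\<Sum>j\<in>UNIV. (x $ j + - (x0 $ j)) * (x $ j + - (x0 $ j))))
     (\<lambda>i x. 0 + (- \<sigma>) * (\<Sum>j\<in>UNIV. (x $ j + - (x0 $ j)) * ((if i = j then 1 else 0) + 0)
        + ((if i = j then 1 else 0) + 0) * (x $ j + - (x0 $ j))))"
    by (rule has_partials_add[OF has_partials_const has_partials_cmult[OF has_partials_sum[OF
          has_partials_mult[OF c c]]]])
  moreover have "(\<lambda>x. 1 + (- \<sigma>) * (\<Sum>j\<in>UNIV. (x $ j + - (x0 $ j)) * (x $ j + - (x0 $ j))))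
      = (\<lambda>y. 1 - \<sigma> * (norm (y - x0))\<^sup>2)"
    by (simp add: norm_power2_vec fun_eq_iff)
  moreover have "(\<lambda>i x. 0 + (- \<sigma>) * (\<Sum>j\<in>UNIV. (x $ j + - (x0 $ j)) * ((if i = j then 1 else 0) + 0)
        + ((if i = j then 1 else 0) + 0) * (x $ j + - (x0 $ j)))) = (\<lambda>i y. - 2 * \<sigma> * ((y :: real^2) $ i - x0 $ i))"
    by (simp add: fun_eq_iff forall_2 UNIV_2 algebra_simps)
  ultimately show ?thesis by simp
qed

text \<open>For \<open>q = 1 - \<sigma> * (norm (x - x0))^2\<close> the squared gradient is
  \<open>4 * \<sigma>^2 * (norm (x - x0))^2\<close>, and the Laplacian is
  \<open>- 4 * \<sigma>\<close> because there are two coordinates. The chain rule for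
  \<open>bump 1\<close> at \<open>q\<close> combines them into \<open>bump_flow\<close>.\<close>

lemma radial_bump_laplacian:
  fixes x0 :: "real^2"
  shows "\<exists>D D2. has_partials (radial_bump \<sigma> x0) D \<and> (\<forall>i. has_partials (D i) (D2 i)) \<and>
    (\<forall>x. (\<Sum>i\<in>UNIV. D2 i i x) = - 4 * \<sigma> * bump_flow (\<sigma> * (norm (x - x0))\<^sup>2))"
proof -
  let ?q = "\<lambda>x. 1 - \<sigma> * (norm (x - x0))\<^sup>2"
  let ?Dq = "\<lambda>i x. - 2 * \<sigma> * ((x :: real^2) $ i - x0 $ i)"
  have c: "has_partials (\<lambda>x. x $ j + - (x0 $ j)) (\<lambda>i x. (if i = j then 1 else 0) + (0 :: real))" for j
    by (rule has_partials_add[OF has_partials_coord has_partials_const])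
  have q: "has_partials ?q ?Dq" by (rule has_partials_one_minus_norm_square)
  have Dq: "has_partials (?Dq i) (\<lambda>j x. - 2 * \<sigma> * ((if j = i then 1 else 0) + 0))" for i
    using has_partials_cmult[OF c, of "- 2 * \<sigma>" i] by simp
  let ?P = "monom 1 2" and ?Q = "bump_next (monom 1 2)"
  have D: "has_partials (radial_bump \<sigma> x0) (\<lambda>i x. bump ?P (?q x) * ?Dq i x)"
    using has_partials_bump[OF q, of 1] by (simp add: radial_bump_def[abs_def] bump_next_1)
  have D2: "has_partials (\<lambda>x. bump ?P (?q x) * ?Dq i x)
      (\<lambda>j x. bump ?P (?q x) * (- 2 * \<sigma> * ((if j = i then 1 else 0) + 0)) + bump ?Q (?q x) * ?Dq j x * ?Dq i x)" for i
    by (rule has_partials_mult[OF has_partials_bump[OF q] Dq])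
  have L: "(\<Sum>i\<in>UNIV. bump ?P (?q x) * (- 2 * \<sigma> * ((if i = i then 1 else 0) + 0)) + bump ?Q (?q x) * ?Dq i x * ?Dq i x)
      = - 4 * \<sigma> * bump_flow (\<sigma> * (norm (x - x0))\<^sup>2)" for x
    by (simp add: norm_power2_vec UNIV_2 bump_flow_def bump1_def algebra_simps)
  show ?thesis
    by (rule exI[of _ "\<lambda>i x. bump ?P (?q x) * ?Dq i x"],
        rule exI[of _ "\<lambda>i j x. bump ?P (?q x) * (- 2 * \<sigma> * ((if j = i then 1 else 0) + 0)) + bump ?Q (?q x) * ?Dq j x * ?Dq i x"],
        intro conjI allI D D2 L)
qed

text \<open>The integral in \<open>sub\<close> is the derivative in \<open>\<sigma>\<close> of the
  weighted average, so the sign condition makes the average nonincreasing in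
  \<open>\<sigma>\<close>, that is, nondecreasing in the radius.\<close>

lemma integral_flow_antimono:
  fixes g :: "real^2 \<Rightarrow> real"
  assumes g: "integrable lebesgue g" and \<sigma>: "0 < \<sigma>1" "\<sigma>1 \<le> \<sigma>2"
    and sub: "\<And>\<sigma>. \<sigma>1 \<le> \<sigma> \<Longrightarrow> (\<integral>y. bump_flow (\<sigma> * (norm (y - x0))\<^sup>2) * g y \<partial>lebesgue) \<le> 0"
  shows "(\<integral>y. (\<sigma>2 * bump1 (1 - \<sigma>2 * (norm (y - x0))\<^sup>2)) * g y \<partial>lebesgue) \<le>
    (\<integral>y. (\<sigma>1 * bump1 (1 - \<sigma>1 * (norm (y - x0))\<^sup>2)) * g y \<partial>lebesgue)"
proof -
  let ?\<tau> = "\<lambda>y. (norm (y - x0))\<^sup>2"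
  define F where "F \<sigma> = (\<integral>y. (\<sigma> * bump1 (1 - \<sigma> * ?\<tau> y)) *\<^sub>R g y \<partial>lebesgue)" for \<sigma>
  have mb: "(\<lambda>y. \<sigma> * bump1 (1 - \<sigma> * ?\<tau> y)) \<in> borel_measurable lebesgue" for \<sigma>
    by (intro borel_measurable_lebesgue_continuous continuous_intros continuous_on_compose2[OF continuous_on_bump1]) auto
  have mf: "(\<lambda>y. bump_flow (\<sigma> * ?\<tau> y)) \<in> borel_measurable lebesgue" for \<sigma>
    by (intro borel_measurable_lebesgue_continuous continuous_intros continuous_on_compose2[OF continuous_on_bump_flow]) auto
  have cb: "continuous_on UNIV (\<lambda>a. bump1 (1 - \<bar>a\<bar>))"
    by (intro continuous_intros continuous_on_compose2[OF continuous_on_bump1]) auto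
  have cf: "continuous_on UNIV (\<lambda>a. bump_flow \<bar>a\<bar>)"
    by (intro continuous_intros continuous_on_compose2[OF continuous_on_bump_flow]) auto
  have "bump1 (1 - \<bar>a\<bar>) = 0" "bump_flow \<bar>a\<bar> = 0" if "a \<notin> cball 0 1" for a :: real
    using that by (auto simp: bump1_def bump_flow_outside)
  note out = this
  obtain B where B: "\<And>a. \<bar>bump1 (1 - \<bar>a\<bar>)\<bar> \<le> B"
    using bounded_compact_support[OF cb compact_cball[of 0 1] out(1)] by auto
  obtain C where C: "0 \<le> C" "\<And>a. \<bar>bump_flow \<bar>a\<bar>\<bar> \<le> C"
    using bounded_compact_support[OF cf compact_cball[of 0 1] out(2)] by auto
  have uc: "uniformly_continuous_on UNIV (\<lambda>a. bump_flow \<bar>a\<bar>)"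
    by (rule uniformly_continuous_compact_support[OF cf compact_cball[of 0 1] out(2)])
  have deriv: "(F has_real_derivative (\<integral>y. bump_flow (\<sigma> * ?\<tau> y) * g y \<partial>lebesgue)) (at \<sigma>)" if \<sigma>: "0 < \<sigma>" for \<sigma>
  proof -
    \<comment> \<open>Clipping the parameter at 0 keeps the argument of \<open>bump1\<close> at most
      1, where the bound \<open>B\<close> is valid for every parameter; near a positive
      \<open>\<sigma>\<close> nothing changes.\<close>
    have "((\<lambda>\<sigma>. \<integral>y. (max 0 \<sigma> * bump1 (1 - max 0 \<sigma> * ?\<tau> y)) *\<^sub>R g y \<partial>lebesgue) has_derivative
        (\<lambda>h. \<integral>y. (h * bump_flow (\<sigma> * ?\<tau> y)) *\<^sub>R g y \<partial>lebesgue)) (at \<sigma>)"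
    proof (rule has_derivative_integral_uniform[OF g, where B = "\<lambda>\<sigma>. \<bar>\<sigma>\<bar> * B" and C = C])
      show "(\<lambda>y. max 0 t * bump1 (1 - max 0 t * ?\<tau> y)) \<in> borel_measurable lebesgue" for t by (rule mb)
      show "\<bar>max 0 t * bump1 (1 - max 0 t * ?\<tau> y)\<bar> \<le> \<bar>t\<bar> * B" for t y
        using B[of "max 0 t * ?\<tau> y"] by (auto simp: abs_mult intro!: mult_mono)
      show "(\<lambda>y. h * bump_flow (\<sigma> * ?\<tau> y)) \<in> borel_measurable lebesgue" for h
        using mf by simp
      show "\<bar>h * bump_flow (\<sigma> * ?\<tau> y)\<bar> \<le> C * norm h" for h y
        using C(2)[of "\<sigma> * ?\<tau> y"] \<sigma> by (auto simp: abs_mult mult.commute[of C] intro!: mult_left_mono)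
      show "linear (\<lambda>h. h * bump_flow (\<sigma> * ?\<tau> y))" for y
        by (rule linearI) (auto simp: algebra_simps)
      fix e :: real assume e: "0 < e"
      then obtain d where d: "0 < d" "\<And>a b. dist b a < d \<Longrightarrow> dist (bump_flow \<bar>b\<bar>) (bump_flow \<bar>a\<bar>) < e"
        using uc unfolding uniformly_continuous_on_def by (metis UNIV_I)
      \<comment> \<open>The first bound keeps the parameter above \<open>\<sigma> / 2\<close>, so
        that for \<open>t > 2 / \<sigma>\<close> both values of \<open>bump_flow\<close> are 0. For
        \<open>t \<le> 2 / \<sigma>\<close> the second bound makes \<open>\<xi> * t\<close> differ
        from \<open>\<sigma> * t\<close> by less than \<open>d\<close>.\<close>
      define r where "r = min (\<sigma> / 2) (d * \<sigma> / 2)"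
      have r: "0 < r" using \<sigma> d by (simp add: r_def)
      have "\<bar>max 0 (\<sigma> + h) * bump1 (1 - max 0 (\<sigma> + h) * t) - max 0 \<sigma> * bump1 (1 - max 0 \<sigma> * t)
          - h * bump_flow (\<sigma> * t)\<bar> \<le> e * norm h" if h: "norm h < r" and t: "0 \<le> t" for h t
      proof -
        have pos: "\<sigma> / 2 < \<sigma> + h" using h by (auto simp: r_def)
        have close: "\<bar>bump_flow (\<xi> * t) - bump_flow (\<sigma> * t)\<bar> \<le> e" if \<xi>: "\<bar>\<xi> - \<sigma>\<bar> \<le> \<bar>h\<bar>" for \<xi>
        proof (cases "t \<le> 2 / \<sigma>")
          case True
          have "\<bar>\<xi> * t - \<sigma> * t\<bar> = \<bar>\<xi> - \<sigma>\<bar> * t"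
            using t by (simp add: left_diff_distrib[symmetric] abs_mult)
          also have "\<dots> \<le> \<bar>h\<bar> * (2 / \<sigma>)" using \<xi> True t by (intro mult_mono) auto
          also have "\<dots> < d"
            using h \<sigma> by (auto simp: r_def field_simps)
          finally have "dist (bump_flow \<bar>\<xi> * t\<bar>) (bump_flow \<bar>\<sigma> * t\<bar>) < e"
            by (intro d(2)) (simp add: dist_real_def)
          moreover have "0 \<le> \<xi>" using \<xi> h \<sigma> by (auto simp: r_def)
          ultimately show ?thesis using \<sigma> t by (simp add: dist_real_def abs_mult)
        next
          case False
          have "\<sigma> / 2 \<le> \<xi>" using \<xi> h by (auto simp: r_def)
          then have "\<sigma> / 2 * (2 / \<sigma>) \<le> \<xi> * t" using False \<sigma> by (intro mult_mono) auto
          moreover have "\<sigma> / 2 * (2 / \<sigma>) \<le> \<sigma> * t" using False \<sigma> by (intro mult_mono) auto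
          ultimately show ?thesis using \<sigma> e by (simp add: bump_flow_outside)
        qed
        let ?f = "\<lambda>\<sigma>. \<sigma> * bump1 (1 - \<sigma> * t)"
        have "norm (?f (\<sigma> + h) - ?f \<sigma> - (\<sigma> + h - \<sigma>) * bump_flow (\<sigma> * t)) \<le> norm (\<sigma> + h - \<sigma>) * e"
        proof (rule differentiable_bound_linearization[where S = "cball \<sigma> \<bar>h\<bar>" and
              f' = "\<lambda>\<xi> k. k * bump_flow (\<xi> * t)"])
          show "\<sigma> + u *\<^sub>R (\<sigma> + h - \<sigma>) \<in> cball \<sigma> \<bar>h\<bar>" if "u \<in> {0..1}" for u
            using that by (auto simp: dist_real_def abs_mult mult_left_le_one_le)
          show "(?f has_derivative (\<lambda>k. k * bump_flow (\<xi> * t))) (at \<xi> within cball \<sigma> \<bar>h\<bar>)" for \<xi>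
          proof -
            have "(*) (bump_flow (\<xi> * t)) = (\<lambda>k. k * bump_flow (\<xi> * t))"
              by (rule ext) (rule mult.commute)
            then show ?thesis
              using DERIV_scaled_bump1[of t \<xi>] unfolding has_field_derivative_def
              by (metis has_derivative_at_withinI)
          qed
          show "onorm ((\<lambda>k. k * bump_flow (\<xi> * t)) - (\<lambda>k. k * bump_flow (\<sigma> * t))) \<le> e"
            if "\<xi> \<in> cball \<sigma> \<bar>h\<bar>" for \<xi>
          proof (rule onorm_le)
            fix k :: real
            have "\<bar>k\<bar> * \<bar>bump_flow (\<xi> * t) - bump_flow (\<sigma> * t)\<bar> \<le> \<bar>k\<bar> * e"
              using that by (intro mult_left_mono close) (auto simp: dist_real_def abs_minus_commute)
            then show "norm (((\<lambda>k. k * bump_flow (\<xi> * t)) - (\<lambda>k. k * bump_flow (\<sigma> * t))) k) \<le> e * norm k"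
              by (simp add: right_diff_distrib[symmetric] abs_mult mult.commute)
          qed
        qed auto
        then show ?thesis using pos \<sigma> by (simp add: mult.commute[of e])
      qed
      then show "\<exists>d>0. \<forall>h y. norm h < d \<longrightarrow>
          \<bar>max 0 (\<sigma> + h) * bump1 (1 - max 0 (\<sigma> + h) * ?\<tau> y) - max 0 \<sigma> * bump1 (1 - max 0 \<sigma> * ?\<tau> y)
          - h * bump_flow (\<sigma> * ?\<tau> y)\<bar> \<le> e * norm h"
        using r by (intro exI[of _ r]) simp
    qed
    moreover have "(\<lambda>h. \<integral>y. (h * bump_flow (\<sigma> * ?\<tau> y)) *\<^sub>R g y \<partial>lebesgue)
        = (*) (\<integral>y. bump_flow (\<sigma> * ?\<tau> y) * g y \<partial>lebesgue)"
    proof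
      fix h
      have "(\<integral>y. (h * bump_flow (\<sigma> * ?\<tau> y)) *\<^sub>R g y \<partial>lebesgue) = h * (\<integral>y. bump_flow (\<sigma> * ?\<tau> y) * g y \<partial>lebesgue)"
        by (simp only: real_scaleR_def mult.assoc integral_mult_right_zero)
      then show "(\<integral>y. (h * bump_flow (\<sigma> * ?\<tau> y)) *\<^sub>R g y \<partial>lebesgue) = (\<integral>y. bump_flow (\<sigma> * ?\<tau> y) * g y \<partial>lebesgue) * h"
        by (simp only: mult.commute)
    qed
    ultimately have "((\<lambda>\<sigma>. F (max 0 \<sigma>)) has_real_derivative (\<integral>y. bump_flow (\<sigma> * ?\<tau> y) * g y \<partial>lebesgue)) (at \<sigma>)"
      by (simp add: has_field_derivative_def F_def)
    moreover have ev: "\<forall>\<^sub>F x in nhds \<sigma>. F (max 0 x) = F x"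
      using eventually_nhds_in_open[of "{0<..}" \<sigma>] \<sigma> by (auto elim!: eventually_mono)
    ultimately show ?thesis using DERIV_cong_ev[OF refl ev refl, THEN iffD1] by blast
  qed
  have "F \<sigma>2 \<le> F \<sigma>1"
  proof (rule DERIV_nonpos_imp_nonincreasing[OF \<sigma>(2)])
    fix \<sigma> assume "\<sigma>1 \<le> \<sigma>"
    then show "\<exists>y. (F has_real_derivative y) (at \<sigma>) \<and> y \<le> 0"
      using deriv[of \<sigma>] sub[of \<sigma>] \<sigma>(1) by force
  qed
  then show ?thesis by (simp add: F_def)
qed

section \<open>Mollified square-integrable functions\<close>

text \<open>One factor converges in L1, the other is bounded and converges almost everywhere. The
  error \<open>w n - w'\<close> is absorbed by the bound \<open>C\<close>, and
  \<open>b n x \<bullet> w' x\<close> is treated by dominated convergence.\<close>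

lemma tendsto_integral_inner:
  fixes w :: "nat \<Rightarrow> 'a \<Rightarrow> 'b::euclidean_space"
  assumes w: "\<And>n. integrable M (w n)" "integrable M w'"
      "(\<lambda>n. \<integral>x. norm (w n x - w' x) \<partial>M) \<longlonglongrightarrow> 0"
    and b: "\<And>n. b n \<in> borel_measurable M" "b' \<in> borel_measurable M" "\<And>n x. norm (b n x) \<le> C"
      "AE x in M. (\<lambda>n. b n x) \<longlonglongrightarrow> b' x"
  shows "(\<lambda>n. \<integral>x. b n x \<bullet> w n x \<partial>M) \<longlonglongrightarrow> (\<integral>x. b' x \<bullet> w' x \<partial>M)"
proof -
  have bound: "norm (b n x \<bullet> y) \<le> C * norm y" for n x y
    using order_trans[OF Cauchy_Schwarz_ineq2 mult_right_mono[OF b(3) norm_ge_zero]] by simp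
  have int: "integrable M (\<lambda>x. b n x \<bullet> h x)" if "integrable M h" for n and h :: "'a \<Rightarrow> 'b"
  proof (rule Bochner_Integration.integrable_bound)
    show "integrable M (\<lambda>x. C * norm (h x))" using that by auto
    show "(\<lambda>x. b n x \<bullet> h x) \<in> borel_measurable M"
      by (intro borel_measurable_inner b borel_measurable_integrable[OF that])
    show "AE x in M. norm (b n x \<bullet> h x) \<le> norm (C * norm (h x))"
      using bound by (intro AE_I2) (metis abs_ge_self order_trans real_norm_def)
  qed
  have "(\<lambda>n. \<integral>x. b n x \<bullet> (w n x - w' x) \<partial>M) \<longlonglongrightarrow> 0"
  proof (rule Lim_null_comparison)
    show "\<forall>\<^sub>F n in sequentially. norm (\<integral>x. b n x \<bullet> (w n x - w' x) \<partial>M) \<le> C * (\<integral>x. norm (w n x - w' x) \<partial>M)"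
    proof (intro always_eventually allI)
      fix n
      have "norm (\<integral>x. b n x \<bullet> (w n x - w' x) \<partial>M) \<le> (\<integral>x. C * norm (w n x - w' x) \<partial>M)"
        by (rule norm_integral_le) (use w bound in auto)
      then show "norm (\<integral>x. b n x \<bullet> (w n x - w' x) \<partial>M) \<le> C * (\<integral>x. norm (w n x - w' x) \<partial>M)" by simp
    qed
    show "(\<lambda>n. C * (\<integral>x. norm (w n x - w' x) \<partial>M)) \<longlonglongrightarrow> 0"
      using tendsto_mult_left[OF w(3), of C] by simp
  qed
  moreover have "(\<lambda>n. \<integral>x. b n x \<bullet> w' x \<partial>M) \<longlonglongrightarrow> (\<integral>x. b' x \<bullet> w' x \<partial>M)"
  proof (rule integral_dominated_convergence[where w = "\<lambda>x. C * norm (w' x)"])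
    show "AE x in M. (\<lambda>n. b n x \<bullet> w' x) \<longlonglongrightarrow> b' x \<bullet> w' x"
      using b(4) by eventually_elim (intro tendsto_intros)
  qed (use bound w in \<open>auto intro!: borel_measurable_inner b\<close>)
  ultimately have "(\<lambda>n. (\<integral>x. b n x \<bullet> (w n x - w' x) \<partial>M) + (\<integral>x. b n x \<bullet> w' x \<partial>M)) \<longlonglongrightarrow>
      0 + (\<integral>x. b' x \<bullet> w' x \<partial>M)" by (rule tendsto_add)
  moreover have "(\<integral>x. b n x \<bullet> (w n x - w' x) \<partial>M) + (\<integral>x. b n x \<bullet> w' x \<partial>M) = (\<integral>x. b n x \<bullet> w n x \<partial>M)" for n
    using int[of "\<lambda>x. w n x - w' x" n] int[OF w(2), of n] w(1)[of n] w(2)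
    by (simp add: Bochner_Integration.integral_add[symmetric] inner_diff_right)
  ultimately show ?thesis by simp
qed

text \<open>Scheffe's lemma for the squares: Jensen's inequality followed by Young's inequality
  shows that mollification does not increase the integral of the square, which together with almost
  everywhere convergence gives convergence in L1.\<close>

lemma conv_square_tendsto_L1:
  fixes g :: "'a::euclidean_space \<Rightarrow> 'b::euclidean_space"
  assumes k: "\<And>n::nat. mollifier (\<delta> n) (k n)"
    and g: "integrable lebesgue g" "integrable lebesgue (\<lambda>x. (norm (g x))\<^sup>2)"
    and ae: "AE x in lebesgue. (\<lambda>n. conv (k n) g x) \<longlonglongrightarrow> g x"
  shows "integrable lebesgue (\<lambda>x. (norm (conv (k n) g x))\<^sup>2)"
    and "(\<lambda>n. \<integral>x. norm ((norm (conv (k n) g x))\<^sup>2 - (norm (g x))\<^sup>2) \<partial>lebesgue) \<longlonglongrightarrow> 0"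
proof -
  have m: "(\<lambda>x. (norm (conv (k n) g x))\<^sup>2) \<in> borel_measurable lebesgue" for n
    by (intro borel_measurable_lebesgue_continuous continuous_intros mollifier_conv_continuous[OF k g(1)])
  show i: "integrable lebesgue (\<lambda>x. (norm (conv (k n) g x))\<^sup>2)" for n
    by (rule Bochner_Integration.integrable_bound[OF conv_L1(1)[OF k g(2)] m])
      (use norm_conv_power2_le[OF k g] in \<open>auto intro!: AE_I2 intro: order_trans[OF _ abs_ge_self]\<close>)
  have "(\<lambda>n. \<integral>\<^sup>+x. norm ((norm (conv (k n) g x))\<^sup>2 - (norm (g x))\<^sup>2) \<partial>lebesgue) \<longlonglongrightarrow> 0"
  proof (rule Scheffe_lemma2[OF m g(2)])
    show "AE x in lebesgue. (\<lambda>n. (norm (conv (k n) g x))\<^sup>2) \<longlonglongrightarrow> (norm (g x))\<^sup>2"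
      using ae by eventually_elim (intro tendsto_intros)
    fix n
    have "(\<integral>x. (norm (conv (k n) g x))\<^sup>2 \<partial>lebesgue) \<le> (\<integral>x. norm (conv (k n) (\<lambda>x. (norm (g x))\<^sup>2) x) \<partial>lebesgue)"
      by (rule integral_mono[OF i integrable_norm[OF conv_L1(1)[OF k g(2)]]])
        (metis norm_conv_power2_le[OF k g] order_trans abs_ge_self real_norm_def)
    also have "\<dots> \<le> (\<integral>x. norm ((norm (g x))\<^sup>2) \<partial>lebesgue)"
      by (rule conv_L1(2)[OF k g(2)])
    finally have "(\<integral>x. (norm (conv (k n) g x))\<^sup>2 \<partial>lebesgue) \<le> (\<integral>x. (norm (g x))\<^sup>2 \<partial>lebesgue)" by simp
    moreover have "(\<integral>\<^sup>+x. norm ((norm (conv (k n) g x))\<^sup>2) \<partial>lebesgue) = ennreal (\<integral>x. (norm (conv (k n) g x))\<^sup>2 \<partial>lebesgue)"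
      using nn_integral_eq_integral[OF i] by simp
    moreover have "(\<integral>\<^sup>+x. norm ((norm (g x))\<^sup>2) \<partial>lebesgue) = ennreal (\<integral>x. (norm (g x))\<^sup>2 \<partial>lebesgue)"
      using nn_integral_eq_integral[OF g(2)] by simp
    ultimately show "(\<integral>\<^sup>+x. norm ((norm (conv (k n) g x))\<^sup>2) \<partial>lebesgue) \<le> (\<integral>\<^sup>+x. norm ((norm (g x))\<^sup>2) \<partial>lebesgue)"
      by (simp add: ennreal_leI)
  qed
  moreover have "(\<integral>\<^sup>+x. norm ((norm (conv (k n) g x))\<^sup>2 - (norm (g x))\<^sup>2) \<partial>lebesgue) =
      ennreal (\<integral>x. norm ((norm (conv (k n) g x))\<^sup>2 - (norm (g x))\<^sup>2) \<partial>lebesgue)" for n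
    using i g(2) by (intro nn_integral_eq_integral) auto
  ultimately have "(\<lambda>n. ennreal (\<integral>x. norm ((norm (conv (k n) g x))\<^sup>2 - (norm (g x))\<^sup>2) \<partial>lebesgue)) \<longlonglongrightarrow> ennreal 0"
    by simp
  then show "(\<lambda>n. \<integral>x. norm ((norm (conv (k n) g x))\<^sup>2 - (norm (g x))\<^sup>2) \<partial>lebesgue) \<longlonglongrightarrow> 0"
    by (subst (asm) tendsto_ennreal_iff) (auto intro: always_eventually integral_nonneg_AE)
qed

lemma integrable_inner_of_squares:
  fixes g h :: "'a \<Rightarrow> 'b::euclidean_space"
  assumes "g \<in> borel_measurable M" "h \<in> borel_measurable M"
    "integrable M (\<lambda>x. (norm (g x))\<^sup>2)" "integrable M (\<lambda>x. (norm (h x))\<^sup>2)"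
  shows "integrable M (\<lambda>x. g x \<bullet> h x)"
proof (rule Bochner_Integration.integrable_bound)
  show "integrable M (\<lambda>x. (norm (g x))\<^sup>2 + (norm (h x))\<^sup>2)" using assms by auto
  show "(\<lambda>x. g x \<bullet> h x) \<in> borel_measurable M" using assms by (intro borel_measurable_inner)
  have "norm (a \<bullet> b) \<le> norm ((norm a)\<^sup>2 + (norm b)\<^sup>2)" for a b :: 'b
  proof -
    have "\<bar>a \<bullet> b\<bar> \<le> norm a * norm b" by (rule Cauchy_Schwarz_ineq2)
    also have "\<dots> \<le> (norm a)\<^sup>2 + (norm b)\<^sup>2"
    proof -
      have "0 \<le> norm a * norm b" by simp
      then show ?thesis using sum_squares_bound[of "norm a" "norm b"] by linarith
    qed
    finally show ?thesis by simp
  qed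
  then show "AE x in M. norm (g x \<bullet> h x) \<le> norm ((norm (g x))\<^sup>2 + (norm (h x))\<^sup>2)" by simp
qed

lemma integrable_norm_squared_add:
  fixes g h :: "'a \<Rightarrow> 'b::euclidean_space"
  assumes "g \<in> borel_measurable M" "h \<in> borel_measurable M"
    "integrable M (\<lambda>x. (norm (g x))\<^sup>2)" "integrable M (\<lambda>x. (norm (h x))\<^sup>2)"
  shows "integrable M (\<lambda>x. (norm (g x + h x))\<^sup>2)"
proof -
  have "integrable M (\<lambda>x. (norm (g x))\<^sup>2 + (norm (h x))\<^sup>2 + 2 * (g x \<bullet> h x))"
    using assms integrable_inner_of_squares[OF assms] by auto
  then show ?thesis by (simp add: power2_norm_eq_inner inner_add algebra_simps inner_commute)
qed

lemma conv_add:
  fixes f g :: "'a::euclidean_space \<Rightarrow> 'b::euclidean_space"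
  assumes "mollifier \<delta> k" "integrable lebesgue f" "integrable lebesgue g"
  shows "conv k (\<lambda>x. f x + g x) x = conv k f x + conv k g x"
  using mollifier_conv_integrable[OF assms(1,2)] mollifier_conv_integrable[OF assms(1,3)]
  by (simp add: conv_def scaleR_right_distrib)

text \<open>Polarization: the inner product is a quarter of the difference of the squares of
  \<open>g + h\<close> and \<open>g - h\<close>, and mollification is linear.\<close>

lemma conv_inner_tendsto:
  fixes g h :: "'a::euclidean_space \<Rightarrow> 'b::euclidean_space" and a :: "'a \<Rightarrow> real"
  assumes k: "\<And>n::nat. mollifier (\<delta> n) (k n)"
    and g: "integrable lebesgue g" "integrable lebesgue (\<lambda>x. (norm (g x))\<^sup>2)"
      "AE x in lebesgue. (\<lambda>n. conv (k n) g x) \<longlonglongrightarrow> g x"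
    and h: "integrable lebesgue h" "integrable lebesgue (\<lambda>x. (norm (h x))\<^sup>2)"
      "AE x in lebesgue. (\<lambda>n. conv (k n) h x) \<longlonglongrightarrow> h x"
    and a: "a \<in> borel_measurable lebesgue" "\<And>x. \<bar>a x\<bar> \<le> C"
  shows "(\<lambda>n. \<integral>x. a x * (conv (k n) g x \<bullet> conv (k n) h x) \<partial>lebesgue) \<longlonglongrightarrow> (\<integral>x. a x * (g x \<bullet> h x) \<partial>lebesgue)"
proof -
  have sq: "(\<lambda>n. \<integral>x. a x * (norm (conv (k n) f x))\<^sup>2 \<partial>lebesgue) \<longlonglongrightarrow> (\<integral>x. a x * (norm (f x))\<^sup>2 \<partial>lebesgue)"
    and int: "\<And>n. integrable lebesgue (\<lambda>x. a x * (norm (conv (k n) f x))\<^sup>2)"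
    and int': "integrable lebesgue (\<lambda>x. a x * (norm (f x))\<^sup>2)"
    if f: "integrable lebesgue f" "integrable lebesgue (\<lambda>x. (norm (f x))\<^sup>2)"
      "AE x in lebesgue. (\<lambda>n. conv (k n) f x) \<longlonglongrightarrow> f x" for f :: "'a \<Rightarrow> 'b"
  proof -
    note L = conv_square_tendsto_L1[OF k f]
    show "(\<lambda>n. \<integral>x. a x * (norm (conv (k n) f x))\<^sup>2 \<partial>lebesgue) \<longlonglongrightarrow> (\<integral>x. a x * (norm (f x))\<^sup>2 \<partial>lebesgue)"
      using tendsto_integral_inner[OF L(1) f(2) L(2), of "\<lambda>_. a" a C] a by simp
    show "integrable lebesgue (\<lambda>x. a x * (norm (conv (k n) f x))\<^sup>2)" for n
      using integrable_mult_bounded[OF L(1) a] by simp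
    show "integrable lebesgue (\<lambda>x. a x * (norm (f x))\<^sup>2)"
      using integrable_mult_bounded[OF f(2) a] by simp
  qed
  let ?s = "\<lambda>x. g x + h x" and ?d = "\<lambda>x. g x + (- h x)"
  have h': "integrable lebesgue (\<lambda>x. - h x)" "integrable lebesgue (\<lambda>x. (norm (- h x))\<^sup>2)" using h by auto
  have cm: "conv (k n) (\<lambda>x. - h x) x = - conv (k n) h x" for n x by (simp add: conv_def)
  have s: "integrable lebesgue ?s" "integrable lebesgue (\<lambda>x. (norm (?s x))\<^sup>2)"
      "AE x in lebesgue. (\<lambda>n. conv (k n) ?s x) \<longlonglongrightarrow> ?s x"
  proof -
    show "AE x in lebesgue. (\<lambda>n. conv (k n) ?s x) \<longlonglongrightarrow> ?s x"
      using g(3) h(3) unfolding conv_add[OF k g(1) h(1)] by eventually_elim (intro tendsto_add)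
  qed (use g h in \<open>auto intro!: integrable_norm_squared_add\<close>)
  have d: "integrable lebesgue ?d" "integrable lebesgue (\<lambda>x. (norm (?d x))\<^sup>2)"
      "AE x in lebesgue. (\<lambda>n. conv (k n) ?d x) \<longlonglongrightarrow> ?d x"
  proof -
    show "AE x in lebesgue. (\<lambda>n. conv (k n) ?d x) \<longlonglongrightarrow> ?d x"
      using g(3) h(3) unfolding conv_add[OF k g(1) h'(1)] cm by eventually_elim (intro tendsto_add tendsto_minus)
    show "integrable lebesgue (\<lambda>x. (norm (?d x))\<^sup>2)"
      using g h h' by (intro integrable_norm_squared_add) auto
  qed (use g h in auto)
  have pol: "c * (x \<bullet> y) = (c * (norm (x + y))\<^sup>2 - c * (norm (x + - y))\<^sup>2) / 4" for c and x y :: 'b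
    by (simp add: power2_norm_eq_inner inner_add inner_diff algebra_simps inner_commute)
  have e1: "(\<integral>x. a x * (conv (k n) g x \<bullet> conv (k n) h x) \<partial>lebesgue) =
      ((\<integral>x. a x * (norm (conv (k n) ?s x))\<^sup>2 \<partial>lebesgue) - (\<integral>x. a x * (norm (conv (k n) ?d x))\<^sup>2 \<partial>lebesgue)) / 4" for n
    unfolding Bochner_Integration.integral_diff[OF int[OF s] int[OF d], symmetric]
    by (subst integral_divide_zero[symmetric]) (simp only: pol conv_add[OF k g(1) h(1)] conv_add[OF k g(1) h'(1)] cm)
  have e2: "(\<integral>x. a x * (g x \<bullet> h x) \<partial>lebesgue) =
      ((\<integral>x. a x * (norm (?s x))\<^sup>2 \<partial>lebesgue) - (\<integral>x. a x * (norm (?d x))\<^sup>2 \<partial>lebesgue)) / 4"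
    unfolding Bochner_Integration.integral_diff[OF int'[OF s] int'[OF d], symmetric]
    by (subst integral_divide_zero[symmetric]) (simp only: pol)
  show ?thesis
    unfolding e1 e2 by (intro tendsto_divide tendsto_diff sq s d tendsto_const) auto
qed

text \<open>The L1 errors of the finitely many functions are added before a subsequence is
  extracted, so one sequence of radii gives almost everywhere convergence for all of them. The bound
  \<open>r\<close> keeps the supports of the kernels inside a prescribed neighbourhood.\<close>

lemma rho_sequence:
  fixes g :: "'i \<Rightarrow> real^2 \<Rightarrow> 'b::euclidean_space"
  assumes I: "finite I" and g: "\<And>i. i \<in> I \<Longrightarrow> integrable lebesgue (g i)" and r: "0 < r"
  shows "\<exists>s. (\<forall>n::nat. 0 < s n \<and> s n \<le> r) \<and> s \<longlonglongrightarrow> 0 \<and>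
    (\<forall>i\<in>I. AE x in lebesgue. (\<lambda>n. conv (rho (s n)) (g i) x) \<longlonglongrightarrow> g i x)"
proof -
  define t where "t n = r / real (Suc n)" for n
  have t: "0 < t n" "t n \<le> r" for n
    using r by (auto simp: t_def divide_le_eq mult_le_cancel_left1 mult_left_mono_neg)
  have t0: "t \<longlonglongrightarrow> 0"
    using tendsto_mult_right_zero[OF LIMSEQ_inverse_real_of_nat, of r]
    by (simp add: t_def[abs_def] divide_inverse)
  have mol: "mollifier (t n) (rho (t n))" for n by (rule mollifier_rho[OF t(1)])
  let ?S = "\<lambda>n x. \<Sum>i\<in>I. norm (conv (rho (t n)) (g i) x - g i x)"
  have iS: "integrable lebesgue (\<lambda>x. norm (conv (rho (t n)) (g i) x - g i x))" if "i \<in> I" for n i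
    using conv_L1(1)[OF mol g[OF that]] g[OF that] by auto
  have iSS: "integrable lebesgue (?S n)" for n by (rule Bochner_Integration.integrable_sum[OF iS])
  have "(\<lambda>n. \<Sum>i\<in>I. \<integral>x. norm (conv (rho (t n)) (g i) x - g i x) \<partial>lebesgue) \<longlonglongrightarrow> (\<Sum>i\<in>I. 0)"
    by (intro tendsto_sum conv_tendsto_L1[OF g mol t0])
  moreover have "(\<Sum>i\<in>I. \<integral>x. norm (conv (rho (t n)) (g i) x - g i x) \<partial>lebesgue) = (\<integral>x. norm (?S n x) \<partial>lebesgue)" for n
  proof -
    have eq: "norm (?S n x) = ?S n x" for x by (simp add: sum_nonneg)
    show ?thesis unfolding eq by (rule Bochner_Integration.integral_sum[symmetric]) (rule iS)
  qed
  ultimately have "(\<lambda>n. \<integral>x. norm (?S n x) \<partial>lebesgue) \<longlonglongrightarrow> 0" by simp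
  from tendsto_L1_AE_subseq[OF iSS this] obtain \<phi> where \<phi>: "strict_mono \<phi>"
      and ae: "AE x in lebesgue. (\<lambda>n. ?S (\<phi> n) x) \<longlonglongrightarrow> 0" by blast
  have "AE x in lebesgue. (\<lambda>n. conv (rho (t (\<phi> n))) (g i) x) \<longlonglongrightarrow> g i x" if i: "i \<in> I" for i
    using ae
  proof eventually_elim
    case (elim x)
    have "(\<lambda>n. conv (rho (t (\<phi> n))) (g i) x - g i x) \<longlonglongrightarrow> 0"
    proof (rule Lim_null_comparison[OF _ elim])
      show "\<forall>\<^sub>F n in sequentially. norm (conv (rho (t (\<phi> n))) (g i) x - g i x) \<le> ?S (\<phi> n) x"
        using i I by (intro always_eventually allI member_le_sum) auto
    qed
    then show ?case by (simp add: LIM_zero_iff)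
  qed
  then show ?thesis
    using t LIMSEQ_subseq_LIMSEQ[OF t0 \<phi>] by (intro exI[of _ "t \<circ> \<phi>"]) (auto simp: o_def)
qed

section \<open>Local boundedness and the stress identity for weak solutions\<close>

text \<open>Weak solutions of \<open>\<Delta>u = f\<close>, tested against mollification kernels only; the functions are extended
  by zero outside \<open>L\<close>.\<close>

locale weak_poisson =
  fixes L :: "(real^2) set" and u :: "real^2 \<Rightarrow> 'b::euclidean_space"
    and w :: "2 \<Rightarrow> real^2 \<Rightarrow> 'b" and f :: "real^2 \<Rightarrow> 'b"
  assumes u_int: "integrable lebesgue u" and w_int: "\<And>i. integrable lebesgue (w i)"
    and f_int: "integrable lebesgue f"
    and weak_gradient: "\<And>k \<delta> x i. bump_algebra k \<Longrightarrow> (\<And>z. \<delta> < norm z \<Longrightarrow> k z = 0) \<Longrightarrow> cball x \<delta> \<subseteq> L \<Longrightarrow>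
      conv (partial_deriv i k) u x = conv k (w i) x"
    and weak_equation: "\<And>k \<delta> x. bump_algebra k \<Longrightarrow> (\<And>z. \<delta> < norm z \<Longrightarrow> k z = 0) \<Longrightarrow> cball x \<delta> \<subseteq> L \<Longrightarrow>
      (\<Sum>i\<in>UNIV. conv (partial_deriv i k) (w i) x) = conv k f x"
begin

definition mol :: "real \<Rightarrow> real^2 \<Rightarrow> 'b" where "mol s = conv (rho s) u"
definition mol1 :: "real \<Rightarrow> 2 \<Rightarrow> real^2 \<Rightarrow> 'b" where "mol1 s i = conv (partial_deriv i (rho s)) u"
definition mol2 :: "real \<Rightarrow> 2 \<Rightarrow> 2 \<Rightarrow> real^2 \<Rightarrow> 'b" where
  "mol2 s i j = conv (partial_deriv j (partial_deriv i (rho s))) u"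

lemma rho_partial_outside:
  assumes "0 < s" "s < norm z"
  shows "partial_deriv i (rho s) z = 0"
  by (rule has_partials_outside[OF bump_algebra_has_partials(1)[OF bump_algebra_rho] closed_cball[of 0 s]])
    (use assms rho_outside[OF assms(1)] in auto)

lemma mol_partials:
  assumes "0 < s"
  shows "has_partials (mol s) (mol1 s)" "has_partials (mol1 s i) (mol2 s i)" "mol2 s i j x = mol2 s j i x"
proof -
  show "has_partials (mol s) (mol1 s)"
    unfolding mol_def mol1_def[abs_def]
    by (rule has_partials_conv[OF bump_algebra_has_partials(1)[OF bump_algebra_rho] compact_cball[of 0 s] _ u_int])
      (use rho_outside[OF assms] in auto)
  show "has_partials (mol1 s i) (mol2 s i)"
    unfolding mol1_def mol2_def[abs_def]
    by (rule has_partials_conv[OF bump_algebra_has_partials(1)[OF bump_algebra_has_partials(2)[OF bump_algebra_rho]]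
          compact_cball[of 0 s] _ u_int])
      (use rho_partial_outside[OF assms] in auto)
  show "mol2 s i j x = mol2 s j i x"
    unfolding mol2_def by (subst bump_algebra_has_partials(3)[OF bump_algebra_rho]) (rule refl)
qed

text \<open>\<open>mol1\<close> and \<open>mol2\<close> put all derivatives on the kernel and so
  exist on the whole plane, but the hypotheses on \<open>u\<close> speak only of kernels supported
  in \<open>L\<close>. The Laplacian uses them twice: the weak gradient with the kernel
  \<open>partial_deriv j (rho s)\<close>, then the weak equation with \<open>rho s\<close>.\<close>

lemma mol_interior:
  assumes "0 < s" "cball x s \<subseteq> L"
  shows "mol1 s i x = conv (rho s) (w i) x" "(\<Sum>j\<in>UNIV. mol2 s j j x) = conv (rho s) f x"
proof -
  show "mol1 s i x = conv (rho s) (w i) x"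
    unfolding mol1_def by (rule weak_gradient[OF bump_algebra_rho rho_outside[OF assms(1)] assms(2)])
  have "(\<Sum>j\<in>UNIV. mol2 s j j x) = (\<Sum>j\<in>UNIV. conv (partial_deriv j (rho s)) (w j) x)"
    unfolding mol2_def
    by (intro sum.cong refl weak_gradient[OF bump_algebra_has_partials(2)[OF bump_algebra_rho]
          rho_partial_outside[OF assms(1)] assms(2)])
  then show "(\<Sum>j\<in>UNIV. mol2 s j j x) = conv (rho s) f x"
    using weak_equation[OF bump_algebra_rho rho_outside[OF assms(1)] assms(2)] by simp
qed

lemma mol_continuous:
  assumes "0 < s"
  shows "continuous_on UNIV (mol s)"
  by (rule has_partials_continuous[OF mol_partials(1)[OF assms]])

text \<open>Kato's inequality is applied to mollifications, whose Laplacian on \<open>K\<close> is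
  the mollified \<open>f\<close>. Boundedness of \<open>soft_excess_grad\<close> lets the left side
  pass to the limit against L1 convergence of the mollified \<open>f\<close>, and the Lipschitz
  bound on \<open>soft_excess\<close> does the same for the right side. Only in the limit does
  \<open>sign\<close> become available, as it concerns \<open>u\<close> itself and not its
  averages.\<close>

lemma soft_excess_subharmonic:
  assumes r: "0 < r" and T: "0 < T"
    and sign: "AE x in lebesgue. x \<in> L \<longrightarrow> 0 \<le> soft_excess_grad T (u x) \<bullet> f x"
    and \<kappa>: "has_partials \<kappa> D" "\<And>i. has_partials (D i) (D2 i)" "compact K"
      "\<And>x. x \<notin> K \<Longrightarrow> \<kappa> x = 0" "\<And>x. 0 \<le> \<kappa> x"
    and K: "\<And>x. x \<in> K \<Longrightarrow> cball x r \<subseteq> L"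
  shows "0 \<le> (\<integral>x. soft_excess T (u x) * (\<Sum>j\<in>UNIV. D2 j j x) \<partial>lebesgue)"
proof -
  let ?p = "soft_excess_grad T :: 'b \<Rightarrow> 'b" and ?\<Phi> = "soft_excess T :: 'b \<Rightarrow> real"
  define g where "g = (\<lambda>i::nat. if i = 0 then u else f)"
  have "\<exists>s. (\<forall>n::nat. 0 < s n \<and> s n \<le> r) \<and> s \<longlonglongrightarrow> 0 \<and>
      (\<forall>i\<in>{0,1}. AE x in lebesgue. (\<lambda>n. conv (rho (s n)) (g i) x) \<longlonglongrightarrow> g i x)"
    by (rule rho_sequence) (use u_int f_int r in \<open>auto simp: g_def\<close>)
  then obtain s where s: "\<And>n::nat. 0 < s n" "\<And>n. s n \<le> r" "s \<longlonglongrightarrow> 0"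
      and aeu: "AE x in lebesgue. (\<lambda>n. mol (s n) x) \<longlonglongrightarrow> u x"
    by (auto simp: g_def mol_def)
  have moll: "mollifier (s n) (rho (s n))" for n by (rule mollifier_rho[OF s(1)])
  have cp: "continuous_on UNIV ?p"
    by (meson continuous_at_imp_continuous_on has_derivative_continuous has_derivative_soft_excess_grad)
  have c\<Phi>: "continuous_on UNIV ?\<Phi>"
    by (meson continuous_at_imp_continuous_on has_derivative_continuous has_derivative_soft_excess)
  have um: "u \<in> borel_measurable lebesgue" using u_int by auto
  have D0: "D i x = 0" if "x \<notin> K" for i x
    by (rule has_partials_outside[OF \<kappa>(1) compact_imp_closed[OF \<kappa>(3)] \<kappa>(4) that])
  have D20: "D2 i j x = 0" if "x \<notin> K" for i j x
    by (rule has_partials_outside[OF \<kappa>(2) compact_imp_closed[OF \<kappa>(3)] D0 that])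
  have c\<kappa>: "continuous_on UNIV \<kappa>" by (rule has_partials_continuous[OF \<kappa>(1)])
  have cl: "continuous_on UNIV (\<lambda>x. \<Sum>j\<in>UNIV. D2 j j x)"
    by (intro continuous_intros has_partials_continuous_partial[OF \<kappa>(2)])
  obtain A where A: "0 \<le> A" "\<And>x. norm (\<kappa> x) \<le> A"
    using bounded_compact_support[OF c\<kappa> \<kappa>(3,4)] by blast
  obtain B where B: "\<And>x. norm (\<Sum>j\<in>UNIV. D2 j j x) \<le> B"
  proof -
    have "(\<Sum>j\<in>UNIV. D2 j j x) = 0" if "x \<notin> K" for x using D20[OF that] by simp
    from bounded_compact_support[OF cl \<kappa>(3) this] that show ?thesis by blast
  qed
  have le: "(\<integral>x. (\<kappa> x *\<^sub>R ?p (mol (s n) x)) \<bullet> conv (rho (s n)) f x \<partial>lebesgue) \<le>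
      (\<integral>x. (\<Sum>j\<in>UNIV. D2 j j x) \<bullet> ?\<Phi> (mol (s n) x) \<partial>lebesgue)" for n
  proof -
    have eq: "(\<kappa> x *\<^sub>R ?p (mol (s n) x)) \<bullet> conv (rho (s n)) f x =
        \<kappa> x * (?p (mol (s n) x) \<bullet> (\<Sum>j\<in>UNIV. mol2 (s n) j j x))" for x
    proof (cases "x \<in> K")
      case True
      then have "cball x (s n) \<subseteq> L" using K[OF True] s(2)[of n] by force
      then show ?thesis by (simp add: mol_interior(2)[OF s(1)])
    qed (simp add: \<kappa>(4))
    have "(\<integral>x. (\<kappa> x *\<^sub>R ?p (mol (s n) x)) \<bullet> conv (rho (s n)) f x \<partial>lebesgue) =
        (\<integral>x. \<kappa> x * (?p (mol (s n) x) \<bullet> (\<Sum>j\<in>UNIV. mol2 (s n) j j x)) \<partial>lebesgue)"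
      unfolding eq by (rule refl)
    also have "\<dots> \<le> (\<integral>x. ?\<Phi> (mol (s n) x) * (\<Sum>j\<in>UNIV. D2 j j x) \<partial>lebesgue)"
      by (rule kato_inequality[OF mol_partials(1,2)[OF s(1)] has_derivative_soft_excess
            has_derivative_soft_excess_grad continuous_soft_excess_hess soft_excess_hess_convex[OF T] \<kappa>])
    finally show ?thesis by (simp add: mult.commute)
  qed
  have lim1: "(\<lambda>n. \<integral>x. (\<kappa> x *\<^sub>R ?p (mol (s n) x)) \<bullet> conv (rho (s n)) f x \<partial>lebesgue)
      \<longlonglongrightarrow> (\<integral>x. (\<kappa> x *\<^sub>R ?p (u x)) \<bullet> f x \<partial>lebesgue)"
  proof (rule tendsto_integral_inner[where C = "A * 3"])
    show "integrable lebesgue (conv (rho (s n)) f)" for n by (rule conv_L1(1)[OF moll f_int])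
    show "(\<lambda>n. \<integral>x. norm (conv (rho (s n)) f x - f x) \<partial>lebesgue) \<longlonglongrightarrow> 0"
      by (rule conv_tendsto_L1[OF f_int moll s(3)])
    show "(\<lambda>x. \<kappa> x *\<^sub>R ?p (mol (s n) x)) \<in> borel_measurable lebesgue" for n
      by (intro borel_measurable_lebesgue_continuous continuous_intros c\<kappa>
          continuous_on_compose2[OF cp mol_continuous[OF s(1)]]) auto
    show "(\<lambda>x. \<kappa> x *\<^sub>R ?p (u x)) \<in> borel_measurable lebesgue"
      by (intro borel_measurable_scaleR borel_measurable_lebesgue_continuous[OF c\<kappa>]
          measurable_compose[OF um] borel_measurable_continuous_onI[OF cp])
    show "norm (\<kappa> x *\<^sub>R ?p (mol (s n) x)) \<le> A * 3" for n x
      using A(2)[of x] norm_soft_excess_grad_le[OF T] A(1) by (auto intro!: mult_mono)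
    show "AE x in lebesgue. (\<lambda>n. \<kappa> x *\<^sub>R ?p (mol (s n) x)) \<longlonglongrightarrow> \<kappa> x *\<^sub>R ?p (u x)"
      using aeu
    proof eventually_elim
      case (elim x)
      show ?case
        by (intro tendsto_intros isCont_tendsto_compose[OF _ elim])
          (use cp in \<open>auto simp: continuous_on_eq_continuous_at\<close>)
    qed
  qed (rule f_int)
  \<comment> \<open>The indicator makes the constant \<open>?\<Phi> 0\<close> integrable; it does
    not alter the limit because \<open>D2\<close> vanishes off \<open>K\<close>.\<close>
  have iK: "integrable lebesgue (\<lambda>x. indicator K x * ?\<Phi> (v x))" if v: "integrable lebesgue v" for v :: "real^2 \<Rightarrow> 'b"
  proof (rule Bochner_Integration.integrable_bound)
    have mK: "K \<in> lmeasurable" by (rule lmeasurable_compact[OF \<kappa>(3)])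
    then show "integrable lebesgue (\<lambda>x. 3 * norm (v x) + indicator K x * ?\<Phi> 0)"
      using v by (intro Bochner_Integration.integrable_add integrable_mult_right integrable_norm
          integrable_mult_left integrable_real_indicator) (auto simp: fmeasurable_def)
    show "(\<lambda>x. indicator K x * ?\<Phi> (v x)) \<in> borel_measurable lebesgue"
    proof (rule borel_measurable_times)
      show "indicator K \<in> borel_measurable lebesgue"
        using mK by (intro borel_measurable_indicator) auto
      show "(\<lambda>x. ?\<Phi> (v x)) \<in> borel_measurable lebesgue"
        by (rule measurable_compose[OF borel_measurable_integrable[OF v] borel_measurable_continuous_onI[OF c\<Phi>]])
    qed
    have "norm (indicator K x * ?\<Phi> (v x)) \<le> norm (3 * norm (v x) + indicator K x * ?\<Phi> 0)" for x
      using soft_excess_lipschitz[OF T, of "v x" 0] soft_excess_nonneg[of T "v x"] soft_excess_nonneg[of T "0::'b"]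
      by (auto simp: indicator_def)
    then show "AE x in lebesgue. norm (indicator K x * ?\<Phi> (v x)) \<le> norm (3 * norm (v x) + indicator K x * ?\<Phi> 0)"
      by simp
  qed
  have imol: "integrable lebesgue (mol (s n))" for n unfolding mol_def by (rule conv_L1(1)[OF moll u_int])
  have lim2: "(\<lambda>n. \<integral>x. (\<Sum>j\<in>UNIV. D2 j j x) \<bullet> (indicator K x * ?\<Phi> (mol (s n) x)) \<partial>lebesgue)
      \<longlonglongrightarrow> (\<integral>x. (\<Sum>j\<in>UNIV. D2 j j x) \<bullet> (indicator K x * ?\<Phi> (u x)) \<partial>lebesgue)"
  proof (rule tendsto_integral_inner[where C = B])
    show "integrable lebesgue (\<lambda>x. indicator K x * ?\<Phi> (mol (s n) x))" for n by (rule iK[OF imol])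
    show "integrable lebesgue (\<lambda>x. indicator K x * ?\<Phi> (u x))" by (rule iK[OF u_int])
    show "(\<lambda>n. \<integral>x. norm (indicator K x * ?\<Phi> (mol (s n) x) - indicator K x * ?\<Phi> (u x)) \<partial>lebesgue) \<longlonglongrightarrow> 0"
    proof (rule Lim_null_comparison)
      show "(\<lambda>n. 3 * (\<integral>x. norm (mol (s n) x - u x) \<partial>lebesgue)) \<longlonglongrightarrow> 0"
        using tendsto_mult_left[OF conv_tendsto_L1[OF u_int moll s(3)], of 3] by (simp add: mol_def)
      show "\<forall>\<^sub>F n in sequentially. norm (\<integral>x. norm (indicator K x * ?\<Phi> (mol (s n) x) - indicator K x * ?\<Phi> (u x)) \<partial>lebesgue)
          \<le> 3 * (\<integral>x. norm (mol (s n) x - u x) \<partial>lebesgue)"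
      proof (intro always_eventually allI)
        fix n
        have "norm (\<integral>x. norm (indicator K x * ?\<Phi> (mol (s n) x) - indicator K x * ?\<Phi> (u x)) \<partial>lebesgue)
          \<le> (\<integral>x. 3 * norm (mol (s n) x - u x) \<partial>lebesgue)"
        proof (rule norm_integral_le)
          show "integrable lebesgue (\<lambda>x. 3 * norm (mol (s n) x - u x))" using imol u_int by auto
          have "norm (norm (indicator K x * ?\<Phi> (mol (s n) x) - indicator K x * ?\<Phi> (u x))) \<le> 3 * norm (mol (s n) x - u x)" for x
            using soft_excess_lipschitz[OF T, of "mol (s n) x" "u x"] by (auto simp: indicator_def)
          then show "AE x in lebesgue. norm (norm (indicator K x * ?\<Phi> (mol (s n) x) - indicator K x * ?\<Phi> (u x))) \<le> 3 * norm (mol (s n) x - u x)"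
            by simp
        qed
        then show "norm (\<integral>x. norm (indicator K x * ?\<Phi> (mol (s n) x) - indicator K x * ?\<Phi> (u x)) \<partial>lebesgue)
          \<le> 3 * (\<integral>x. norm (mol (s n) x - u x) \<partial>lebesgue)" by simp
      qed
    qed
  qed (use B cl borel_measurable_lebesgue_continuous[OF cl] in auto)
  have ind: "(\<Sum>j\<in>UNIV. D2 j j x) \<bullet> (indicator K x * c) = (\<Sum>j\<in>UNIV. D2 j j x) \<bullet> c" for x c
    by (cases "x \<in> K") (simp_all add: D20)
  have "0 \<le> (\<integral>x. (\<kappa> x *\<^sub>R ?p (u x)) \<bullet> f x \<partial>lebesgue)"
  proof (rule integral_nonneg_AE)
    show "AE x in lebesgue. 0 \<le> (\<kappa> x *\<^sub>R ?p (u x)) \<bullet> f x"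
      using sign
    proof eventually_elim
      case (elim x)
      show ?case
      proof (cases "x \<in> K")
        case True
        then have "x \<in> L" using K[OF True] r by auto
        then show ?thesis using elim \<kappa>(5) by simp
      qed (simp add: \<kappa>(4))
    qed
  qed
  also have "\<dots> \<le> (\<integral>x. (\<Sum>j\<in>UNIV. D2 j j x) \<bullet> ?\<Phi> (u x) \<partial>lebesgue)"
    using LIMSEQ_le[OF lim1 lim2[unfolded ind]] le by blast
  finally show ?thesis by (simp add: mult.commute)
qed

text \<open>Almost everywhere \<open>soft_excess T (u x)\<close> is a limit of averages over
  shrinking radii, each at most the average at radius \<open>r\<close>, which is bounded by the
  supremum of the kernel times an L1 norm. The room \<open>2 * r\<close> consists of the radius of
  the averages and the radius reserved for mollification.\<close>

lemma locally_bounded: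
  assumes r: "0 < r" and T: "1 \<le> T"
    and sign: "AE x in lebesgue. x \<in> L \<longrightarrow> 0 \<le> soft_excess_grad T (u x) \<bullet> f x"
  shows "\<exists>C. AE x in lebesgue. cball x (2 * r) \<subseteq> L \<longrightarrow> norm (u x) \<le> C"
proof -
  have T0: "0 < T" using T by simp
  define g where "g x = soft_excess T (u x)" for x
  have c\<Phi>: "continuous_on UNIV (soft_excess T :: 'b \<Rightarrow> real)"
    by (meson continuous_at_imp_continuous_on has_derivative_continuous has_derivative_soft_excess)
  have g: "integrable lebesgue g"
  proof (rule Bochner_Integration.integrable_bound)
    show "integrable lebesgue (\<lambda>x. 3 * norm (u x))" using u_int by auto
    show "g \<in> borel_measurable lebesgue"
      unfolding g_def by (rule measurable_compose[OF borel_measurable_integrable[OF u_int]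
            borel_measurable_continuous_onI[OF c\<Phi>]])
    have "norm (g x) \<le> norm (3 * norm (u x))" for x
      using soft_excess_lipschitz[OF T0, of "u x" 0] by (simp add: g_def soft_excess_zero[OF T])
    then show "AE x in lebesgue. norm (g x) \<le> norm (3 * norm (u x))" by simp
  qed
  have conv_eq: "conv (rho s) g x =
      (\<integral>y. (1 / s\<^sup>2 * bump1 (1 - 1 / s\<^sup>2 * (norm (y - x))\<^sup>2)) * g y \<partial>lebesgue) / bump1_mass" for s x
  proof -
    have "rho s (x - y) *\<^sub>R g y = (1 / s\<^sup>2 * bump1 (1 - 1 / s\<^sup>2 * (norm (y - x))\<^sup>2)) * g y / bump1_mass" for y
      by (simp add: rho_def norm_minus_commute)
    then show ?thesis unfolding conv_def by simp
  qed
  have mono: "conv (rho s) g x \<le> conv (rho r) g x" if s: "0 < s" "s \<le> r" and x: "cball x (2 * r) \<subseteq> L" for s x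
  proof -
    have "(\<integral>y. (1 / s\<^sup>2 * bump1 (1 - 1 / s\<^sup>2 * (norm (y - x))\<^sup>2)) * g y \<partial>lebesgue) \<le>
        (\<integral>y. (1 / r\<^sup>2 * bump1 (1 - 1 / r\<^sup>2 * (norm (y - x))\<^sup>2)) * g y \<partial>lebesgue)"
    proof (rule integral_flow_antimono[OF g])
      show "1 / r\<^sup>2 \<le> 1 / s\<^sup>2" using s by (intro divide_left_mono power_mono) auto
      \<comment> \<open>The corresponding radius is at most \<open>r\<close>, so
        \<open>radial_bump \<sigma> x\<close> is supported in \<open>cball x r\<close>. Testing
        subharmonicity with it gives the sign of the flow integral, since the Laplacian is
        \<open>- 4 * \<sigma>\<close> times \<open>bump_flow\<close>.\<close>
      fix \<sigma> assume \<sigma>: "1 / r\<^sup>2 \<le> \<sigma>"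
      have "0 < 1 / r\<^sup>2" using r by simp
      then have \<sigma>0: "0 < \<sigma>" using \<sigma> by linarith
      obtain D D2 where D: "has_partials (radial_bump \<sigma> x) D" "\<And>i. has_partials (D i) (D2 i)"
        "\<And>y. (\<Sum>i\<in>UNIV. D2 i i y) = - 4 * \<sigma> * bump_flow (\<sigma> * (norm (y - x))\<^sup>2)"
        using radial_bump_laplacian[of \<sigma> x] by blast
      have "0 \<le> (\<integral>y. soft_excess T (u y) * (\<Sum>j\<in>UNIV. D2 j j y) \<partial>lebesgue)"
      proof (rule soft_excess_subharmonic[OF r T0 sign D(1,2) compact_cball[of x r]])
        show "radial_bump \<sigma> x y = 0" if "y \<notin> cball x r" for y
        proof -
          have "r\<^sup>2 \<le> (norm (y - x))\<^sup>2" using that r by (intro power_mono) (auto simp: dist_norm norm_minus_commute)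
          then have "1 / r\<^sup>2 * r\<^sup>2 \<le> \<sigma> * (norm (y - x))\<^sup>2" using \<sigma> \<sigma>0 by (intro mult_mono) auto
          then show ?thesis using r by (simp add: radial_bump_def)
        qed
        show "0 \<le> radial_bump \<sigma> x y" for y by (simp add: radial_bump_def bump_def)
        show "cball y r \<subseteq> L" if "y \<in> cball x r" for y
        proof
          fix z assume "z \<in> cball y r"
          then have "z \<in> cball x (2 * r)" using that dist_triangle[of x z y] by auto
          then show "z \<in> L" using x by blast
        qed
      qed
      also have "(\<integral>y. soft_excess T (u y) * (\<Sum>j\<in>UNIV. D2 j j y) \<partial>lebesgue)
          = - 4 * \<sigma> * (\<integral>y. bump_flow (\<sigma> * (norm (y - x))\<^sup>2) * g y \<partial>lebesgue)"
        unfolding D(3) integral_mult_right_zero[symmetric] by (simp add: g_def mult_ac)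
      finally show "(\<integral>y. bump_flow (\<sigma> * (norm (y - x))\<^sup>2) * g y \<partial>lebesgue) \<le> 0"
        using \<sigma>0 by (simp add: mult_le_0_iff zero_le_mult_iff)
    qed (use r in auto)
    then show ?thesis unfolding conv_eq using bump1_mass_pos by (intro divide_right_mono) auto
  qed
  obtain B where B: "0 \<le> B" "\<And>z. \<bar>rho r z\<bar> \<le> B" using mollifier_bounded[OF mollifier_rho[OF r]] by blast
  define C where "C = B * (\<integral>y. norm (g y) \<partial>lebesgue)"
  have C: "conv (rho r) g x \<le> C" for x
  proof -
    have "norm (conv (rho r) g x) \<le> (\<integral>y. B * norm (g y) \<partial>lebesgue)"
      unfolding conv_def by (rule norm_integral_le) (use g B in \<open>auto simp: abs_mult intro!: mult_right_mono\<close>)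
    then show ?thesis by (simp add: C_def)
  qed
  have "\<exists>s. (\<forall>n::nat. 0 < s n \<and> s n \<le> r) \<and> s \<longlonglongrightarrow> 0 \<and>
      (\<forall>i\<in>{()}. AE x in lebesgue. (\<lambda>n. conv (rho (s n)) g x) \<longlonglongrightarrow> g x)"
    by (rule rho_sequence) (use g r in auto)
  then obtain s where s: "\<And>n::nat. 0 < s n" "\<And>n. s n \<le> r"
      and ae: "AE x in lebesgue. (\<lambda>n. conv (rho (s n)) g x) \<longlonglongrightarrow> g x" by auto
  have "AE x in lebesgue. cball x (2 * r) \<subseteq> L \<longrightarrow> norm (u x) \<le> 8 * C + 2 * T"
    using ae
  proof eventually_elim
    case (elim x)
    show ?case
    proof
      assume x: "cball x (2 * r) \<subseteq> L"
      have "g x \<le> C"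
        by (rule LIMSEQ_le_const2[OF elim]) (use mono[OF s x] C order_trans in blast)
      then show "norm (u x) \<le> 8 * C + 2 * T"
        using norm_le_soft_excess[OF T0, of "u x"] by (simp add: g_def)
    qed
  qed
  then show ?thesis by blast
qed

end

text \<open>For the mollifications both the Pohozaev identity and the chain rule for
  \<open>V\<close> are classical. Their combination is the stress identity up to the commutator of
  mollification and nonlinearity, which disappears in the limit. The quadratic terms converge by
  \<open>conv_inner_tendsto\<close>, the potential term by dominated convergence with the bound
  \<open>MV\<close>.\<close>

lemma (in weak_poisson) stress_identity:
  fixes V :: "'b \<Rightarrow> real" and gV :: "'b \<Rightarrow> 'b"
  assumes r: "0 < r" and w2: "\<And>i. integrable lebesgue (\<lambda>x. (norm (w i x))\<^sup>2)"
    and V: "\<And>y. (V has_derivative (\<lambda>h. gV y \<bullet> h)) (at y)" "continuous_on UNIV gV"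
    and bdd: "AE x in lebesgue. cball x (2 * r) \<subseteq> L \<longrightarrow> norm (u x) \<le> C"
    and f: "AE x in lebesgue. x \<in> L \<longrightarrow> f x = c *\<^sub>R gV (u x)"
    and \<psi>: "has_partials \<psi> D" "compact K" "\<And>x. x \<notin> K \<Longrightarrow> \<psi> x = 0"
    and K: "\<And>x. x \<in> K \<Longrightarrow> cball x (4 * r) \<subseteq> L"
  shows "(\<Sum>j\<in>UNIV. \<integral>x. D l x * (w j x \<bullet> w j x) \<partial>lebesgue) / 2 + c * (\<integral>x. V (u x) * D l x \<partial>lebesgue)
    - (\<Sum>j\<in>UNIV. \<integral>x. D j x * (w l x \<bullet> w j x) \<partial>lebesgue) = 0"
proof -
  define g where "g = (\<lambda>i::nat. if i = 0 then u else if i = 1 then f else if i = 2 then w 1 else w 2)"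
  have "\<exists>s. (\<forall>n::nat. 0 < s n \<and> s n \<le> r) \<and> s \<longlonglongrightarrow> 0 \<and>
      (\<forall>i\<in>{0,1,2,3}. AE x in lebesgue. (\<lambda>n. conv (rho (s n)) (g i) x) \<longlonglongrightarrow> g i x)"
    by (rule rho_sequence) (use u_int f_int w_int r in \<open>auto simp: g_def\<close>)
  then obtain s where s: "\<And>n::nat. 0 < s n" "\<And>n. s n \<le> r" "s \<longlonglongrightarrow> 0"
      and aeu: "AE x in lebesgue. (\<lambda>n. mol (s n) x) \<longlonglongrightarrow> u x"
      and aef: "AE x in lebesgue. (\<lambda>n. conv (rho (s n)) f x) \<longlonglongrightarrow> f x"
      and aew12: "AE x in lebesgue. (\<lambda>n. conv (rho (s n)) (w 1) x) \<longlonglongrightarrow> w 1 x"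
        "AE x in lebesgue. (\<lambda>n. conv (rho (s n)) (w 2) x) \<longlonglongrightarrow> w 2 x"
    by (auto simp: g_def mol_def)
  have aew: "AE x in lebesgue. (\<lambda>n. conv (rho (s n)) (w j) x) \<longlonglongrightarrow> w j x" for j
    using aew12 exhaust_2[of j] by auto
  have moll: "mollifier (s n) (rho (s n))" for n by (rule mollifier_rho[OF s(1)])
  let ?v = "\<lambda>n. mol (s n)" and ?w = "\<lambda>n j. conv (rho (s n)) (w j)" and ?f = "\<lambda>n. conv (rho (s n)) f"
  have um: "u \<in> borel_measurable lebesgue" using u_int by auto
  have cV: "continuous_on UNIV V"
    using V(1) by (meson continuous_at_imp_continuous_on has_derivative_continuous)
  have D0: "D i x = 0" if "x \<notin> K" for i x
    by (rule has_partials_outside[OF \<psi>(1) compact_imp_closed[OF \<psi>(2)] \<psi>(3) that])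
  have c\<psi>: "continuous_on UNIV \<psi>" by (rule has_partials_continuous[OF \<psi>(1)])
  have cD: "continuous_on UNIV (D j)" for j by (rule has_partials_continuous_partial[OF \<psi>(1)])
  have cv: "continuous_on UNIV (?v n)" for n by (rule mol_continuous[OF s(1)])
  have cw: "continuous_on UNIV (?w n j)" for n j by (rule mollifier_conv_continuous[OF moll w_int])
  have cf: "continuous_on UNIV (?f n)" for n by (rule mollifier_conv_continuous[OF moll f_int])
  obtain A where A: "0 \<le> A" "\<And>x. norm (\<psi> x) \<le> A" using bounded_compact_support[OF c\<psi> \<psi>(2,3)] by blast
  have "\<exists>B. \<forall>x. norm (D j x) \<le> B" for j
    using bounded_compact_support[OF cD \<psi>(2) D0] by blast
  then obtain B where B: "\<And>j x. norm (D j x) \<le> B j" by metis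
  have "bounded (gV ` cball 0 C)" "bounded (V ` cball 0 C)"
    by (intro compact_imp_bounded compact_continuous_image continuous_on_subset[OF V(2)]
        continuous_on_subset[OF cV] compact_cball subset_UNIV)+
  then obtain M MV where M0: "0 < M" and M': "\<forall>y\<in>cball 0 C. norm (gV y) \<le> M"
      and MV': "\<forall>y\<in>cball 0 C. norm (V y) \<le> MV"
    unfolding bounded_pos by blast
  have M: "norm (gV y) \<le> M" and MV: "norm (V y) \<le> MV" if "norm y \<le> C" for y
    using M' MV' that by simp_all
  \<comment> \<open>As \<open>s n \<le> r\<close>, the ball of radius \<open>2 * r\<close> about
    such a \<open>y\<close> stays inside \<open>cball x (4 * r)\<close>, hence in \<open>L\<close>,
    so the bound on \<open>u\<close> holds throughout the set over which the kernel
    averages.\<close>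
  have near: "AE y in lebesgue. y \<in> cball x (s n) \<longrightarrow> norm (u y) \<le> C \<and> norm (f y) \<le> \<bar>c\<bar> * M" if x: "x \<in> K" for x n
    using bdd f
  proof eventually_elim
    case (elim y)
    show ?case
    proof
      assume y: "y \<in> cball x (s n)"
      have "cball y (2 * r) \<subseteq> cball x (4 * r)"
      proof
        fix z assume "z \<in> cball y (2 * r)"
        then show "z \<in> cball x (4 * r)" using y s(2)[of n] r dist_triangle[of x z y] by auto
      qed
      then have yL: "cball y (2 * r) \<subseteq> L" using K[OF x] by blast
      then have "y \<in> L" using r by auto
      then show "norm (u y) \<le> C \<and> norm (f y) \<le> \<bar>c\<bar> * M"
        using elim yL M by (auto intro!: mult_left_mono)
    qed
  qed
  have vC: "norm (?v n x) \<le> C" if "x \<in> K" for n x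
    unfolding mol_def by (rule conv_norm_le[OF moll]) (use near[OF that, of n] in \<open>auto elim: eventually_mono\<close>)
  have fM: "norm (?f n x) \<le> \<bar>c\<bar> * M" if "x \<in> K" for n x
    by (rule conv_norm_le[OF moll]) (use near[OF that, of n] in \<open>auto elim: eventually_mono\<close>)
  \<comment> \<open>The localized commutator. It is bounded because both \<open>f\<close> and the
    mollified function are bounded near \<open>K\<close>, and it tends to 0 almost everywhere by
    continuity of \<open>gV\<close>; paired with gradients that converge in L1 it contributes
    nothing in the limit.\<close>
  define b where "b n x = \<psi> x *\<^sub>R (?f n x - c *\<^sub>R gV (?v n x))" for n x
  have cb: "continuous_on UNIV (b n)" for n
    unfolding b_def by (intro continuous_intros c\<psi> cf continuous_on_compose2[OF V(2) cv]) auto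
  have bB: "norm (b n x) \<le> A * (\<bar>c\<bar> * M + \<bar>c\<bar> * M)" for n x
  proof (cases "x \<in> K")
    case True
    have "norm (?f n x - c *\<^sub>R gV (?v n x)) \<le> norm (?f n x) + norm (c *\<^sub>R gV (?v n x))"
      by (rule norm_triangle_ineq4)
    also have "\<dots> \<le> \<bar>c\<bar> * M + \<bar>c\<bar> * M"
      unfolding norm_scaleR
      by (rule add_mono[OF fM[OF True] mult_left_mono[OF M[OF vC[OF True]] abs_ge_zero]])
    finally show ?thesis
      using A unfolding b_def norm_scaleR by (intro mult_mono) auto
  next
    case False
    then show ?thesis using A M0 \<psi>(3) by (simp add: b_def)
  qed
  have b_lim: "AE x in lebesgue. (\<lambda>n. b n x) \<longlonglongrightarrow> 0"
    using aeu aef f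
  proof eventually_elim
    case (elim x)
    show ?case
    proof (cases "x \<in> K")
      case True
      then have "x \<in> L" using K[OF True] r by auto
      have "(\<lambda>n. gV (?v n x)) \<longlonglongrightarrow> gV (u x)"
        by (rule isCont_tendsto_compose[OF _ elim(1)]) (use V(2) in \<open>auto simp: continuous_on_eq_continuous_at\<close>)
      then have "(\<lambda>n. b n x) \<longlonglongrightarrow> \<psi> x *\<^sub>R (f x - c *\<^sub>R gV (u x))"
        unfolding b_def by (intro tendsto_intros elim(2))
      then show ?thesis using elim(3) \<open>x \<in> L\<close> by simp
    qed (simp add: b_def \<psi>(3))
  qed
  have "(\<lambda>n. \<integral>x. b n x \<bullet> ?w n l x \<partial>lebesgue) \<longlonglongrightarrow> (\<integral>x. 0 \<bullet> w l x \<partial>lebesgue)"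
    by (rule tendsto_integral_inner[OF conv_L1(1)[OF moll w_int] w_int conv_tendsto_L1[OF w_int moll s(3)]
          borel_measurable_lebesgue_continuous[OF cb] _ bB b_lim]) simp
  then have lim0: "(\<lambda>n. \<integral>x. b n x \<bullet> ?w n l x \<partial>lebesgue) \<longlonglongrightarrow> 0" by simp
  let ?E = "\<lambda>n. (\<Sum>j\<in>UNIV. \<integral>x. D l x * (?w n j x \<bullet> ?w n j x) \<partial>lebesgue) / 2 + c * (\<integral>x. V (?v n x) * D l x \<partial>lebesgue)
    - (\<Sum>j\<in>UNIV. \<integral>x. D j x * (?w n l x \<bullet> ?w n j x) \<partial>lebesgue)"
  \<comment> \<open>The part of \<open>b\<close> containing \<open>?f n\<close> is rewritten by the
    Pohozaev identity, the part containing \<open>gV\<close> by the chain rule. Only values on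
    \<open>K\<close> matter, and there \<open>mol1\<close> and \<open>mol2\<close> are the mollified
    weak derivatives and right-hand side.\<close>
  have E: "(\<integral>x. b n x \<bullet> ?w n l x \<partial>lebesgue) = ?E n" for n
  proof -
    have inner: "mol1 (s n) j x = ?w n j x" "(\<Sum>j\<in>UNIV. mol2 (s n) j j x) = ?f n x" if "x \<in> K" for j x
    proof -
      have "cball x (s n) \<subseteq> L" using K[OF that] s(2)[of n] r by force
      then show "mol1 (s n) j x = ?w n j x" "(\<Sum>j\<in>UNIV. mol2 (s n) j j x) = ?f n x"
        by (simp_all add: mol_interior[OF s(1)])
    qed
    have e1: "\<psi> x * (mol1 (s n) l x \<bullet> (\<Sum>j\<in>UNIV. mol2 (s n) j j x)) = \<psi> x * (?f n x \<bullet> ?w n l x)" for x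
      by (cases "x \<in> K") (simp_all add: inner \<psi>(3) inner_commute)
    have e2: "(\<Sum>j\<in>UNIV. mol1 (s n) j x \<bullet> mol1 (s n) j x) / 2 * D l x
        - (\<Sum>j\<in>UNIV. (mol1 (s n) l x \<bullet> mol1 (s n) j x) * D j x)
        = (\<Sum>j\<in>UNIV. D l x * (?w n j x \<bullet> ?w n j x)) / 2 - (\<Sum>j\<in>UNIV. D j x * (?w n l x \<bullet> ?w n j x))" for x
      by (cases "x \<in> K") (simp_all add: inner D0 sum_distrib_left mult.commute)
    have e3: "\<psi> x * (gV (?v n x) \<bullet> mol1 (s n) l x) = \<psi> x * (gV (?v n x) \<bullet> ?w n l x)" for x
      by (cases "x \<in> K") (simp_all add: inner \<psi>(3))
    have i: "integrable lebesgue (\<lambda>x. \<psi> x * (?f n x \<bullet> ?w n l x))"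
      "integrable lebesgue (\<lambda>x. \<psi> x * (gV (?v n x) \<bullet> ?w n l x))"
      "integrable lebesgue (\<lambda>x. D j x * (?w n j' x \<bullet> ?w n i x))" for j j' i
      by (rule integrable_lebesgue_compact_support[OF _ \<psi>(2)];
          auto intro!: continuous_intros c\<psi> cf cw cD continuous_on_compose2[OF V(2) cv] simp: \<psi>(3) D0)+
    have "(\<integral>x. \<psi> x * (?f n x \<bullet> ?w n l x) \<partial>lebesgue) =
        (\<integral>x. (\<Sum>j\<in>UNIV. D l x * (?w n j x \<bullet> ?w n j x)) / 2 - (\<Sum>j\<in>UNIV. D j x * (?w n l x \<bullet> ?w n j x)) \<partial>lebesgue)"
      using pohozaev_identity[OF mol_partials(2,3)[OF s(1)] \<psi>, of n l] unfolding e1 e2 .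
    also have "\<dots> = (\<Sum>j\<in>UNIV. \<integral>x. D l x * (?w n j x \<bullet> ?w n j x) \<partial>lebesgue) / 2
        - (\<Sum>j\<in>UNIV. \<integral>x. D j x * (?w n l x \<bullet> ?w n j x) \<partial>lebesgue)"
      using i(3) by (subst Bochner_Integration.integral_diff) auto
    finally have p: "(\<integral>x. \<psi> x * (?f n x \<bullet> ?w n l x) \<partial>lebesgue) = \<dots>" .
    have q: "(\<integral>x. \<psi> x * (gV (?v n x) \<bullet> ?w n l x) \<partial>lebesgue) = - (\<integral>x. V (?v n x) * D l x \<partial>lebesgue)"
      using chain_rule_identity[OF mol_partials(1)[OF s(1)] V \<psi>, of n l] unfolding e3 .
    have "b n x \<bullet> ?w n l x = \<psi> x * (?f n x \<bullet> ?w n l x) - c * (\<psi> x * (gV (?v n x) \<bullet> ?w n l x))" for x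
      by (simp add: b_def inner_diff_left algebra_simps)
    then have "(\<integral>x. b n x \<bullet> ?w n l x \<partial>lebesgue) =
        (\<integral>x. \<psi> x * (?f n x \<bullet> ?w n l x) - c * (\<psi> x * (gV (?v n x) \<bullet> ?w n l x)) \<partial>lebesgue)"
      by (simp only:)
    also have "\<dots> = (\<integral>x. \<psi> x * (?f n x \<bullet> ?w n l x) \<partial>lebesgue) - c * (\<integral>x. \<psi> x * (gV (?v n x) \<bullet> ?w n l x) \<partial>lebesgue)"
      using i(1,2) by (subst Bochner_Integration.integral_diff) auto
    finally show ?thesis unfolding p q by simp
  qed
  have limV: "(\<lambda>n. \<integral>x. V (?v n x) * D l x \<partial>lebesgue) \<longlonglongrightarrow> (\<integral>x. V (u x) * D l x \<partial>lebesgue)"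
  proof (rule integral_dominated_convergence[where w = "\<lambda>x. MV * norm (D l x)"])
    show "integrable lebesgue (\<lambda>x. MV * norm (D l x))"
      using integrable_lebesgue_compact_support[OF cD \<psi>(2) D0] by auto
    show "(\<lambda>x. V (u x) * D l x) \<in> borel_measurable lebesgue"
      by (intro borel_measurable_times borel_measurable_lebesgue_continuous[OF cD]
          measurable_compose[OF um borel_measurable_continuous_onI[OF cV]])
    show "(\<lambda>x. V (?v n x) * D l x) \<in> borel_measurable lebesgue" for n
      by (intro borel_measurable_lebesgue_continuous continuous_intros cD continuous_on_compose2[OF cV cv]) auto
    show "AE x in lebesgue. (\<lambda>n. V (?v n x) * D l x) \<longlonglongrightarrow> V (u x) * D l x"
      using aeu
    proof eventually_elim
      case (elim x)
      show ?case
        by (intro tendsto_intros isCont_tendsto_compose[OF _ elim])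
          (use cV in \<open>auto simp: continuous_on_eq_continuous_at\<close>)
    qed
    fix n
    have "norm (V (?v n x) * D l x) \<le> MV * norm (D l x)" for x
    proof (cases "x \<in> K")
      case True
      then show ?thesis using MV[OF vC[OF True, of n]] by (auto simp: abs_mult intro!: mult_right_mono)
    qed (simp add: D0)
    then show "AE x in lebesgue. norm (V (?v n x) * D l x) \<le> MV * norm (D l x)" by simp
  qed
  have limq: "(\<lambda>n. \<integral>x. D i x * (?w n j x \<bullet> ?w n j' x) \<partial>lebesgue) \<longlonglongrightarrow> (\<integral>x. D i x * (w j x \<bullet> w j' x) \<partial>lebesgue)" for i j j'
    using B[of i] by (intro conv_inner_tendsto[OF moll w_int w2 aew w_int w2 aew
          borel_measurable_lebesgue_continuous[OF cD]]) auto
  have "?E \<longlonglongrightarrow> (\<Sum>j\<in>UNIV. \<integral>x. D l x * (w j x \<bullet> w j x) \<partial>lebesgue) / 2 + c * (\<integral>x. V (u x) * D l x \<partial>lebesgue)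
    - (\<Sum>j\<in>UNIV. \<integral>x. D j x * (w l x \<bullet> w j x) \<partial>lebesgue)"
    by (intro tendsto_intros limV limq) auto
  then show ?thesis using lim0 unfolding E by (rule LIMSEQ_unique)
qed

section \<open>Allen--Cahn solutions\<close>

lemma integral_lebesgue_on_supported:
  fixes h :: "real^'n::finite \<Rightarrow> 'b::euclidean_space" and a :: "real^'n \<Rightarrow> real"
  assumes "\<Omega> \<in> sets lebesgue" "L \<subseteq> \<Omega>" "\<And>x. x \<notin> L \<Longrightarrow> a x = 0"
  shows "(\<integral>x. a x *\<^sub>R h x \<partial>lebesgue_on \<Omega>) = (\<integral>x. a x *\<^sub>R (indicator L x *\<^sub>R h x) \<partial>lebesgue)"
proof -
  have "(\<integral>x. a x *\<^sub>R h x \<partial>lebesgue_on \<Omega>) = (\<integral>x. indicator \<Omega> x *\<^sub>R (a x *\<^sub>R h x) \<partial>lebesgue)"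
    using assms(1) by (subst integral_restrict_space) auto
  moreover have "indicator \<Omega> x *\<^sub>R (a x *\<^sub>R h x) = a x *\<^sub>R (indicator L x *\<^sub>R h x)" for x
    using assms(2,3) by (cases "x \<in> L") auto
  ultimately show ?thesis by (simp only:)
qed

lemma kernel_test_function:
  fixes k :: "real^'n::finite \<Rightarrow> real"
  assumes "bump_algebra k" "\<And>z. \<delta> < norm z \<Longrightarrow> k z = 0" "cball x \<delta> \<subseteq> \<Omega>"
  shows "test_function \<Omega> (\<lambda>y. k (x - y))"
  unfolding test_function_def
  using assms(2,3)
  by (auto intro!: bump_algebra_smooth bump_algebra_reflect assms(1) exI[of _ "cball x \<delta>"] simp: dist_norm)

lemma kernel_partial_deriv:
  fixes k :: "real^'n::finite \<Rightarrow> real"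
  assumes "bump_algebra k"
  shows "partial_deriv i (\<lambda>y. k (x - y)) y = - partial_deriv i k (x - y)"
proof -
  note k = bump_algebra_has_partials(1)[OF assms]
  have "has_partials (\<lambda>y. k (x - y)) (\<lambda>i y. - partial_deriv i k (x - y))"
  proof (rule has_partialsI)
    fix y
    have "((\<lambda>y. x - y) has_derivative (\<lambda>h. - h)) (at y)"
      by (auto intro!: derivative_eq_intros)
    from has_derivative_compose[OF this has_partials_derivative[OF k]]
    show "((\<lambda>y. k (x - y)) has_derivative (\<lambda>h. \<Sum>i\<in>UNIV. (- h) $ i *\<^sub>R partial_deriv i k (x - y))) (at y)" .
  next
    fix i
    show "continuous_on UNIV (\<lambda>y. - partial_deriv i k (x - y))"
      by (intro continuous_intros continuous_on_compose2[OF has_partials_continuous_partial[OF k, of UNIV]]) auto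
  qed simp
  then show ?thesis by (simp add: has_partials_imp_partial_deriv)
qed

lemma kernel_partial_outside:
  fixes k :: "real^'n::finite \<Rightarrow> real"
  assumes "bump_algebra k" "\<And>z. \<delta> < norm z \<Longrightarrow> k z = 0" "\<delta> < norm z"
  shows "partial_deriv i k z = 0"
  by (rule has_partials_outside[OF bump_algebra_has_partials(1)[OF assms(1)] closed_cball[of 0 \<delta>]])
    (use assms in auto)

text \<open>The reflected kernel \<open>k (x - y)\<close> is an admissible test function of
  \<open>y\<close>; the sign from the reflection cancels the sign in the definition of a weak
  derivative. The indicator of \<open>L\<close> is invisible since this test function is supported
  in \<open>L\<close>.\<close>

lemma has_weak_partial_conv:
  fixes u w :: "real^'n::finite \<Rightarrow> real^'k::finite"
  assumes \<Omega>: "open \<Omega>" and L: "L \<subseteq> \<Omega>" and w: "has_weak_partial \<Omega> i u w"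
    and k: "bump_algebra k" "\<And>z. \<delta> < norm z \<Longrightarrow> k z = 0" "cball x \<delta> \<subseteq> L"
  shows "conv (partial_deriv i k) (\<lambda>y. indicator L y *\<^sub>R u y) x = conv k (\<lambda>y. indicator L y *\<^sub>R w y) x"
proof -
  have S: "\<Omega> \<in> sets lebesgue" using \<Omega> by auto
  have out: "\<delta> < norm (x - y)" if "y \<notin> L" for y
  proof -
    have "y \<notin> cball x \<delta>" using k(3) that by blast
    then show ?thesis by (simp add: dist_norm)
  qed
  have "test_function \<Omega> (\<lambda>y. k (x - y))"
    using kernel_test_function[OF k(1,2)] k(3) L by blast
  then have "(\<integral>y. partial_deriv i (\<lambda>y. k (x - y)) y *\<^sub>R u y \<partial>lebesgue_on \<Omega>) = - (\<integral>y. k (x - y) *\<^sub>R w y \<partial>lebesgue_on \<Omega>)"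
    using w unfolding has_weak_partial_def by blast
  then have "(\<integral>y. (- partial_deriv i k (x - y)) *\<^sub>R u y \<partial>lebesgue_on \<Omega>) = - (\<integral>y. k (x - y) *\<^sub>R w y \<partial>lebesgue_on \<Omega>)"
    unfolding kernel_partial_deriv[OF k(1)] .
  moreover have "(\<integral>y. (- partial_deriv i k (x - y)) *\<^sub>R u y \<partial>lebesgue_on \<Omega>) =
      (\<integral>y. (- partial_deriv i k (x - y)) *\<^sub>R (indicator L y *\<^sub>R u y) \<partial>lebesgue)"
    using kernel_partial_outside[OF k(1,2) out] by (intro integral_lebesgue_on_supported[OF S L]) simp
  moreover have "(\<integral>y. k (x - y) *\<^sub>R w y \<partial>lebesgue_on \<Omega>) = (\<integral>y. k (x - y) *\<^sub>R (indicator L y *\<^sub>R w y) \<partial>lebesgue)"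
    using k(2)[OF out] by (intro integral_lebesgue_on_supported[OF S L]) simp
  ultimately show ?thesis by (simp add: conv_def)
qed

text \<open>\<open>L n\<close> consists of the points of norm at most \<open>n + 1\<close> with
  distance at least \<open>1 / (n + 1)\<close> from the complement. The same index also governs the
  radius of the ball about \<open>x\<close>, so a countable family of statements covers all of
  \<open>\<Omega>\<close>, each with a uniform radius available for mollification.\<close>

lemma open_compact_exhaustion:
  fixes \<Omega> :: "(real^'n::finite) set"
  assumes "open \<Omega>"
  obtains L :: "nat \<Rightarrow> (real^'n) set" where "\<And>n. compact (L n)" "\<And>n. L n \<subseteq> \<Omega>"
    "\<And>x. x \<in> \<Omega> \<Longrightarrow> \<exists>n. cball x (1 / real (Suc n)) \<subseteq> L n"
proof -
  define L where "L n = cball 0 (real n + 1) \<inter> (\<Inter>z\<in>- \<Omega>. {y. 1 / real (Suc n) \<le> dist y z})" for n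
  have "closed {y. 1 / real (Suc n) \<le> dist y z}" for n and z :: "real^'n"
    by (intro closed_Collect_le continuous_intros)
  then have "compact (L n)" for n
    unfolding L_def by (intro compact_Int_closed compact_cball closed_INT) auto
  moreover have "L n \<subseteq> \<Omega>" for n
  proof
    fix y assume y: "y \<in> L n"
    show "y \<in> \<Omega>"
    proof (rule ccontr)
      assume "y \<notin> \<Omega>"
      then have "1 / real (Suc n) \<le> dist y y" using y unfolding L_def by blast
      then show False by simp
    qed
  qed
  moreover have "\<exists>n. cball x (1 / real (Suc n)) \<subseteq> L n" if x: "x \<in> \<Omega>" for x
  proof -
    obtain e where e: "0 < e" "cball x e \<subseteq> \<Omega>" using open_contains_cball_eq[OF assms] x by blast
    obtain n1 :: nat where n1: "norm x < real n1" using reals_Archimedean2 by blast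
    \<comment> \<open>One half of \<open>e\<close> is spent on the ball about \<open>x\<close>, the
      other half on the distance to the complement.\<close>
    obtain n2 where n2: "inverse (real (Suc n2)) < e / 2" using reals_Archimedean[of "e / 2"] e by auto
    define n where "n = max n1 n2"
    have small: "1 / real (Suc n) < e / 2"
    proof -
      have "1 / real (Suc n) \<le> 1 / real (Suc n2)" by (intro divide_left_mono) (auto simp: n_def)
      then show ?thesis using n2 by (simp add: inverse_eq_divide)
    qed
    have "cball x (1 / real (Suc n)) \<subseteq> L n"
    proof
      fix y assume "y \<in> cball x (1 / real (Suc n))"
      then have y: "dist x y \<le> 1 / real (Suc n)" by simp
      have "norm y \<le> norm x + dist x y" using dist_triangle[of 0 y x] by (simp add: dist_0_norm)
      also have "\<dots> \<le> real n + 1"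
      proof -
        have "1 / real (Suc n) \<le> 1" by simp
        moreover have "norm x \<le> real n" using n1 by (simp add: n_def)
        ultimately show ?thesis using y by linarith
      qed
      finally have 1: "norm y \<le> real n + 1" .
      have "1 / real (Suc n) \<le> dist y z" if "z \<notin> \<Omega>" for z
      proof -
        have "z \<notin> cball x e" using that e(2) by blast
        then have "e < dist x z" by simp
        then show ?thesis using dist_triangle[of x z y] y small by linarith
      qed
      then show "y \<in> L n" using 1 by (auto simp: L_def)
    qed
    then show ?thesis by blast
  qed
  ultimately show ?thesis by (rule that)
qed

lemma locally_integrable_indicator:
  assumes "locally_integrable_on f \<Omega>" "compact L" "L \<subseteq> \<Omega>"
  shows "integrable lebesgue (\<lambda>x. indicator L x *\<^sub>R f x)"
  using assms unfolding locally_integrable_on_def set_integrable_def by blast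

text \<open>Mollifications of the two candidates agree wherever the kernel has room inside
  \<open>L n\<close>, and they converge almost everywhere to the candidates. This pins down
  \<open>weak_partial\<close>, which is an arbitrary choice.\<close>

lemma has_weak_partial_unique:
  fixes u w w' :: "real^2 \<Rightarrow> real^'k::finite"
  assumes \<Omega>: "open \<Omega>" and w: "has_weak_partial \<Omega> i u w" and w': "has_weak_partial \<Omega> i u w'"
  shows "AE x in lebesgue. x \<in> \<Omega> \<longrightarrow> w x = w' x"
proof -
  obtain L :: "nat \<Rightarrow> (real^2) set" where L: "\<And>n. compact (L n)" "\<And>n. L n \<subseteq> \<Omega>"
    "\<And>x. x \<in> \<Omega> \<Longrightarrow> \<exists>n. cball x (1 / real (Suc n)) \<subseteq> L n"
    using open_compact_exhaustion[OF \<Omega>] by blast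
  have "AE x in lebesgue. cball x (1 / real (Suc n)) \<subseteq> L n \<longrightarrow> w x = w' x" for n
  proof -
    let ?w = "\<lambda>x. indicator (L n) x *\<^sub>R w x" and ?w' = "\<lambda>x. indicator (L n) x *\<^sub>R w' x"
    have i: "integrable lebesgue ?w" "integrable lebesgue ?w'"
      using w w' by (auto simp: has_weak_partial_def intro!: locally_integrable_indicator[OF _ L(1,2)])
    define g where "g = (\<lambda>b::bool. if b then ?w else ?w')"
    have "\<exists>s. (\<forall>m::nat. 0 < s m \<and> s m \<le> 1 / real (Suc n)) \<and> s \<longlonglongrightarrow> 0 \<and>
        (\<forall>i\<in>UNIV. AE x in lebesgue. (\<lambda>m. conv (rho (s m)) (g i) x) \<longlonglongrightarrow> g i x)"
      by (rule rho_sequence) (use i in \<open>auto simp: g_def\<close>)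
    then obtain s where s: "\<And>m::nat. 0 < s m" "\<And>m. s m \<le> 1 / real (Suc n)"
        and ae: "AE x in lebesgue. (\<lambda>m. conv (rho (s m)) ?w x) \<longlonglongrightarrow> ?w x"
          "AE x in lebesgue. (\<lambda>m. conv (rho (s m)) ?w' x) \<longlonglongrightarrow> ?w' x"
      unfolding g_def by (force simp: all_bool_eq)
    show ?thesis
      using ae
    proof eventually_elim
      case (elim x)
      show ?case
      proof
        assume x: "cball x (1 / real (Suc n)) \<subseteq> L n"
        have eq: "conv (rho (s m)) ?w x = conv (rho (s m)) ?w' x" for m
        proof -
          have c: "cball x (s m) \<subseteq> L n" using x s(2)[of m] by force
          show ?thesis
            using has_weak_partial_conv[OF \<Omega> L(2) w bump_algebra_rho rho_outside[OF s(1)] c]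
              has_weak_partial_conv[OF \<Omega> L(2) w' bump_algebra_rho rho_outside[OF s(1)] c] by simp
        qed
        have "?w x = ?w' x" by (rule LIMSEQ_unique[OF elim(1)[unfolded eq] elim(2)])
        moreover have "x \<in> L n" using x by auto
        ultimately show "w x = w' x" by simp
      qed
    qed
  qed
  then have "AE x in lebesgue. \<forall>n. cball x (1 / real (Suc n)) \<subseteq> L n \<longrightarrow> w x = w' x"
    unfolding AE_all_countable by (rule allI)
  then show ?thesis by eventually_elim (use L(3) in blast)
qed

lemma H1_on_weak_partial:
  assumes "H1_on \<Omega> u"
  shows "has_weak_partial \<Omega> i u (weak_partial \<Omega> i u)"
proof -
  have "\<exists>w. has_weak_partial \<Omega> i u w" using assms unfolding H1_on_def by blast
  then show ?thesis unfolding weak_partial_def by (rule someI_ex)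
qed

text \<open>\<open>H1_on\<close> supplies some square integrable weak derivative, while
  \<open>weak_partial\<close> is chosen without regard to integrability of its square; uniqueness
  identifies the two almost everywhere.\<close>

lemma weak_partial_square_integrable:
  fixes u :: "real^2 \<Rightarrow> real^'k::finite"
  assumes \<Omega>: "open \<Omega>" and u: "H1_on \<Omega> u" and L: "compact L" "L \<subseteq> \<Omega>"
  shows "integrable lebesgue (\<lambda>x. (norm (indicator L x *\<^sub>R weak_partial \<Omega> i u x))\<^sup>2)"
proof -
  let ?W = "weak_partial \<Omega> i u"
  obtain w where w: "L2_on \<Omega> w" "has_weak_partial \<Omega> i u w" using u unfolding H1_on_def by blast
  note W = H1_on_weak_partial[OF u, of i]
  have iW: "integrable lebesgue (\<lambda>x. indicator L x *\<^sub>R ?W x)"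
    using W by (auto simp: has_weak_partial_def intro!: locally_integrable_indicator[OF _ L])
  have "integrable (lebesgue_on \<Omega>) (\<lambda>x. (norm (w x))\<^sup>2)" using w(1) by (simp add: L2_on_def)
  then have "integrable lebesgue (\<lambda>x. indicator \<Omega> x *\<^sub>R (norm (w x))\<^sup>2)"
    using \<Omega> by (subst (asm) integrable_restrict_space) auto
  then show ?thesis
  proof (rule Bochner_Integration.integrable_bound)
    show "(\<lambda>x. (norm (indicator L x *\<^sub>R ?W x))\<^sup>2) \<in> borel_measurable lebesgue"
      using iW by (intro borel_measurable_power measurable_compose[OF borel_measurable_integrable borel_measurable_norm])
    show "AE x in lebesgue. norm ((norm (indicator L x *\<^sub>R ?W x))\<^sup>2) \<le> norm (indicator \<Omega> x *\<^sub>R (norm (w x))\<^sup>2)"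
      using has_weak_partial_unique[OF \<Omega> W w(2)] by eventually_elim (use L(2) in \<open>auto simp: indicator_def\<close>)
  qed
qed

lemma multi_well_potential_derivative:
  assumes "multi_well_potential V"
  shows "(V has_derivative (\<lambda>h. grad V y \<bullet> h)) (at y)" "continuous_on UNIV (grad V)" "0 \<le> V y"
proof -
  have sm: "smooth_on UNIV V" using assms by (simp add: multi_well_potential_def)
  have ck: "V differentiable (at y)" "\<And>i. continuous_on UNIV (partial_deriv i V)" for y
    using sm[unfolded smooth_on_def, rule_format, of 1] by auto
  show "(V has_derivative (\<lambda>h. grad V y \<bullet> h)) (at y)"
  proof -
    have d: "(V has_derivative frechet_derivative V (at y)) (at y)"
      using ck(1) by (simp add: frechet_derivative_works)
    interpret bounded_linear "frechet_derivative V (at y)" using d by (rule has_derivative_bounded_linear)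
    have "frechet_derivative V (at y) h = grad V y \<bullet> h" for h
    proof -
      have "h = (\<Sum>i\<in>UNIV. h $ i *\<^sub>R axis i 1)" using basis_expansion[of h] by (simp add: scalar_mult_eq_scaleR)
      then have "frechet_derivative V (at y) h = frechet_derivative V (at y) (\<Sum>i\<in>UNIV. h $ i *\<^sub>R axis i 1)"
        by (rule arg_cong)
      also have "\<dots> = (\<Sum>i\<in>UNIV. h $ i * frechet_derivative V (at y) (axis i 1))"
        by (simp add: sum scaleR)
      finally show ?thesis by (simp add: grad_def partial_deriv_def inner_vec_def mult.commute)
    qed
    then show ?thesis using d by presburger
  qed
  show "continuous_on UNIV (grad V)"
    unfolding grad_def[abs_def] by (intro continuous_on_vec_lambda ck(2))
  have "bdd_below (range V)" "(INF y. V y) = 0" using assms by (auto simp: multi_well_potential_def)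
  then show "0 \<le> V y" by (metis cINF_lower UNIV_I)
qed

text \<open>Multiplication by the indicator of a compact \<open>L\<close> makes locally integrable
  functions globally integrable, and kernels whose translates are supported in \<open>L\<close> do
  not see it.\<close>

lemma allen_cahn_weak_poisson:
  fixes u :: "real^2 \<Rightarrow> real^'k::finite"
  assumes \<Omega>: "open \<Omega>" and u: "allen_cahn_solution V \<Omega> \<epsilon> u" and L: "compact L" "L \<subseteq> \<Omega>"
  shows "weak_poisson L (\<lambda>x. indicator L x *\<^sub>R u x) (\<lambda>i x. indicator L x *\<^sub>R weak_partial \<Omega> i u x)
    (\<lambda>x. (1 / \<epsilon>\<^sup>2) *\<^sub>R (indicator L x *\<^sub>R grad V (u x)))"
proof
  let ?W = "\<lambda>i. weak_partial \<Omega> i u"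
  have H1: "H1_on \<Omega> u" using u by (simp add: allen_cahn_solution_def)
  note W = H1_on_weak_partial[OF H1]
  show "integrable lebesgue (\<lambda>x. indicator L x *\<^sub>R u x)" "integrable lebesgue (\<lambda>x. indicator L x *\<^sub>R ?W i x)" for i
    using W[of i] by (auto simp: has_weak_partial_def intro!: locally_integrable_indicator[OF _ L])
  have "integrable lebesgue (\<lambda>x. indicator L x *\<^sub>R grad V (u x))"
    using u by (auto simp: allen_cahn_solution_def intro!: locally_integrable_indicator[OF _ L])
  then show "integrable lebesgue (\<lambda>x. (1 / \<epsilon>\<^sup>2) *\<^sub>R (indicator L x *\<^sub>R grad V (u x)))" by (rule integrable_scaleR_right)
  fix k :: "real^2 \<Rightarrow> real" and \<delta> x
  assume k: "bump_algebra k" "\<And>z. \<delta> < norm z \<Longrightarrow> k z = 0" "cball x \<delta> \<subseteq> L"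
  show "conv (partial_deriv i k) (\<lambda>x. indicator L x *\<^sub>R u x) x = conv k (\<lambda>x. indicator L x *\<^sub>R ?W i x) x" for i
    by (rule has_weak_partial_conv[OF \<Omega> L(2) W k])
  have S: "\<Omega> \<in> sets lebesgue" using \<Omega> by auto
  have out: "\<delta> < norm (x - y)" if "y \<notin> L" for y
  proof -
    have "y \<notin> cball x \<delta>" using k(3) that by blast
    then show ?thesis by (simp add: dist_norm)
  qed
  have "test_function \<Omega> (\<lambda>y. k (x - y))"
    using kernel_test_function[OF k(1,2)] k(3) L by blast
  with u have "(\<integral>y. (\<Sum>i\<in>UNIV. partial_deriv i (\<lambda>y. k (x - y)) y *\<^sub>R ?W i y) \<partial>lebesgue_on \<Omega>)
      = - (1 / \<epsilon>\<^sup>2) *\<^sub>R (\<integral>y. k (x - y) *\<^sub>R grad V (u y) \<partial>lebesgue_on \<Omega>)"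
    unfolding allen_cahn_solution_def by blast
  then have eq: "(\<integral>y. (\<Sum>i\<in>UNIV. (- partial_deriv i k (x - y)) *\<^sub>R ?W i y) \<partial>lebesgue_on \<Omega>)
      = - (1 / \<epsilon>\<^sup>2) *\<^sub>R (\<integral>y. k (x - y) *\<^sub>R grad V (u y) \<partial>lebesgue_on \<Omega>)"
    unfolding kernel_partial_deriv[OF k(1)] .
  have int: "integrable lebesgue (\<lambda>y. partial_deriv i k (x - y) *\<^sub>R (indicator L y *\<^sub>R ?W i y))" for i
  proof -
    have c: "continuous_on UNIV (partial_deriv i k)"
      by (rule has_partials_continuous_partial[OF bump_algebra_has_partials(1)[OF k(1)]])
    obtain B where "\<And>z. \<bar>partial_deriv i k z\<bar> \<le> B"
      using bounded_compact_support[OF c compact_cball[of 0 \<delta>]] kernel_partial_outside[OF k(1,2)]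
      by (metis mem_cball_0 not_le real_norm_def)
    then show ?thesis by (rule conv_integrable[OF c]) fact
  qed
  have "(\<integral>y. (\<Sum>i\<in>UNIV. (- partial_deriv i k (x - y)) *\<^sub>R ?W i y) \<partial>lebesgue_on \<Omega>) =
      (\<integral>y. indicator \<Omega> y *\<^sub>R (\<Sum>i\<in>UNIV. (- partial_deriv i k (x - y)) *\<^sub>R ?W i y) \<partial>lebesgue)"
    using S by (subst integral_restrict_space) auto
  also have "\<dots> = (\<integral>y. - (\<Sum>i\<in>UNIV. partial_deriv i k (x - y) *\<^sub>R (indicator L y *\<^sub>R ?W i y)) \<partial>lebesgue)"
  proof (rule Bochner_Integration.integral_cong[OF refl])
    fix y
    show "indicator \<Omega> y *\<^sub>R (\<Sum>i\<in>UNIV. (- partial_deriv i k (x - y)) *\<^sub>R ?W i y)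
      = - (\<Sum>i\<in>UNIV. partial_deriv i k (x - y) *\<^sub>R (indicator L y *\<^sub>R ?W i y))"
      using kernel_partial_outside[OF k(1,2) out] L(2)
      by (cases "y \<in> L") (auto simp: sum_negf)
  qed
  also have "\<dots> = - (\<Sum>i\<in>UNIV. conv (partial_deriv i k) (\<lambda>x. indicator L x *\<^sub>R ?W i x) x)"
    using int by (simp add: conv_def)
  finally have "- (1 / \<epsilon>\<^sup>2) *\<^sub>R (\<integral>y. k (x - y) *\<^sub>R grad V (u y) \<partial>lebesgue_on \<Omega>)
      = - (\<Sum>i\<in>UNIV. conv (partial_deriv i k) (\<lambda>x. indicator L x *\<^sub>R ?W i x) x)"
    unfolding eq .
  then have "(\<Sum>i\<in>UNIV. conv (partial_deriv i k) (\<lambda>x. indicator L x *\<^sub>R ?W i x) x)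
      = (1 / \<epsilon>\<^sup>2) *\<^sub>R (\<integral>y. k (x - y) *\<^sub>R grad V (u y) \<partial>lebesgue_on \<Omega>)"
    unfolding scaleR_minus_left neg_equal_iff_equal by (rule sym)
  also have "(\<integral>y. k (x - y) *\<^sub>R grad V (u y) \<partial>lebesgue_on \<Omega>) =
      (\<integral>y. k (x - y) *\<^sub>R (indicator L y *\<^sub>R grad V (u y)) \<partial>lebesgue)"
    using k(2)[OF out] by (intro integral_lebesgue_on_supported[OF S L(2)]) simp
  also have "(1 / \<epsilon>\<^sup>2) *\<^sub>R \<dots> = conv k (\<lambda>x. (1 / \<epsilon>\<^sup>2) *\<^sub>R (indicator L x *\<^sub>R grad V (u x))) x"
    unfolding conv_def integral_scaleR_right[symmetric] by (simp add: mult_ac)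
  finally show "(\<Sum>i\<in>UNIV. conv (partial_deriv i k) (\<lambda>x. indicator L x *\<^sub>R ?W i x) x)
      = conv k (\<lambda>x. (1 / \<epsilon>\<^sup>2) *\<^sub>R (indicator L x *\<^sub>R grad V (u x))) x" .
qed

text \<open>The local bound and the stress identity are applied on a compact neighbourhood
  \<open>L\<close> of the support of \<open>\<psi>\<close>, with
  \<open>c = 1 / \<epsilon>\<^sup>2\<close>; multiplying by \<open>\<epsilon>\<close> yields the
  scaling of the energy density.\<close>

lemma allen_cahn_stress:
  fixes u :: "real^2 \<Rightarrow> real^'k::finite"
  assumes \<Omega>: "open \<Omega>" and V: "multi_well_potential V" and \<epsilon>: "0 < \<epsilon>"
    and u: "allen_cahn_solution V \<Omega> \<epsilon> u"
    and \<psi>: "has_partials \<psi> D" "compact K" "K \<subseteq> \<Omega>" "\<And>x. x \<notin> K \<Longrightarrow> \<psi> x = 0"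
  shows "(\<Sum>j\<in>UNIV. \<integral>x. D l x * (\<epsilon> * (weak_partial \<Omega> j u x \<bullet> weak_partial \<Omega> j u x)) \<partial>lebesgue_on \<Omega>) / 2
    + (\<integral>x. D l x * (V (u x) / \<epsilon>) \<partial>lebesgue_on \<Omega>)
    - (\<Sum>j\<in>UNIV. \<integral>x. D j x * (\<epsilon> * (weak_partial \<Omega> l u x \<bullet> weak_partial \<Omega> j u x)) \<partial>lebesgue_on \<Omega>) = 0"
proof -
  let ?W = "\<lambda>i. weak_partial \<Omega> i u"
  have S: "\<Omega> \<in> sets lebesgue" using \<Omega> by auto
  have H1: "H1_on \<Omega> u" using u by (simp add: allen_cahn_solution_def)
  obtain e where e: "0 < e" "(\<Union>x\<in>K. cball x e) \<subseteq> \<Omega>"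
    using compact_subset_open_imp_cball_epsilon_subset[OF \<psi>(2) \<Omega> \<psi>(3)] by blast
  define L where "L = (\<Union>x\<in>K. cball x e)"
  have L: "compact L" "L \<subseteq> \<Omega>" using compact_minkowski_sum_cball[OF \<psi>(2)] e by (auto simp: L_def)
  have KL: "K \<subseteq> L" using e by (force simp: L_def)
  interpret weak_poisson L "\<lambda>x. indicator L x *\<^sub>R u x" "\<lambda>i x. indicator L x *\<^sub>R ?W i x"
    "\<lambda>x. (1 / \<epsilon>\<^sup>2) *\<^sub>R (indicator L x *\<^sub>R grad V (u x))"
    by (rule allen_cahn_weak_poisson[OF \<Omega> u L])
  obtain \<alpha> R where R: "0 < \<alpha>" "0 < R" "\<And>y. R < norm y \<Longrightarrow> \<alpha> * (norm y)\<^sup>2 \<le> y \<bullet> grad V y"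
    using V unfolding multi_well_potential_def by blast
  \<comment> \<open>The threshold \<open>1 + R\<close> is chosen because
    \<open>sqrt (1 + y \<bullet> y) > 1 + R\<close> forces \<open>norm y > R\<close>, where
    coercivity gives \<open>0 \<le> y \<bullet> grad V y\<close>; below the threshold
    \<open>soft_excess_grad\<close> is 0.\<close>
  have sign: "AE x in lebesgue. x \<in> L \<longrightarrow>
      0 \<le> soft_excess_grad (1 + R) (indicator L x *\<^sub>R u x) \<bullet> ((1 / \<epsilon>\<^sup>2) *\<^sub>R (indicator L x *\<^sub>R grad V (u x)))"
  proof (rule AE_I2, rule impI)
    fix x assume x: "x \<in> L"
    have "0 \<le> soft_excess_grad (1 + R) (u x) \<bullet> grad V (u x)"
    proof (rule soft_excess_grad_inner_nonneg)
      assume "1 + R < sqrt (1 + u x \<bullet> u x)"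
      then have "(1 + R)\<^sup>2 < (sqrt (1 + u x \<bullet> u x))\<^sup>2" using R(2) by (intro power_strict_mono) auto
      then have "(1 + R)\<^sup>2 < 1 + (norm (u x))\<^sup>2" by (simp add: add_nonneg_nonneg power2_norm_eq_inner)
      moreover have "R\<^sup>2 + 1 \<le> (1 + R)\<^sup>2" using R(2) by (simp add: power2_eq_square algebra_simps)
      ultimately have "R\<^sup>2 < (norm (u x))\<^sup>2" by simp
      then have "R < norm (u x)" by (rule power_less_imp_less_base) simp
      then have "\<alpha> * (norm (u x))\<^sup>2 \<le> u x \<bullet> grad V (u x)" by (rule R(3))
      then show "0 \<le> u x \<bullet> grad V (u x)" using R(1) by (meson mult_nonneg_nonneg order_less_imp_le order_trans zero_le_power2)
    qed (use R in simp)
    then show "0 \<le> soft_excess_grad (1 + R) (indicator L x *\<^sub>R u x) \<bullet> ((1 / \<epsilon>\<^sup>2) *\<^sub>R (indicator L x *\<^sub>R grad V (u x)))"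
      using x by simp
  qed
  \<comment> \<open>\<open>stress_identity\<close> asks for balls of radius \<open>4 * r\<close>
    about points of \<open>K\<close>, and \<open>L\<close> provides balls of radius
    \<open>e\<close>.\<close>
  have r: "0 < e / 4" using e by simp
  obtain C where C: "AE x in lebesgue. cball x (2 * (e / 4)) \<subseteq> L \<longrightarrow> norm (indicator L x *\<^sub>R u x) \<le> C"
    using locally_bounded[OF r _ sign] R by auto
  have "(\<Sum>j\<in>UNIV. \<integral>x. D l x * ((indicator L x *\<^sub>R ?W j x) \<bullet> (indicator L x *\<^sub>R ?W j x)) \<partial>lebesgue) / 2
    + 1 / \<epsilon>\<^sup>2 * (\<integral>x. V (indicator L x *\<^sub>R u x) * D l x \<partial>lebesgue)
    - (\<Sum>j\<in>UNIV. \<integral>x. D j x * ((indicator L x *\<^sub>R ?W l x) \<bullet> (indicator L x *\<^sub>R ?W j x)) \<partial>lebesgue) = 0"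
  proof (rule stress_identity[OF r weak_partial_square_integrable[OF \<Omega> H1 L] multi_well_potential_derivative(1,2)[OF V] C _ \<psi>(1,2,4)])
    show "AE x in lebesgue. x \<in> L \<longrightarrow> (1 / \<epsilon>\<^sup>2) *\<^sub>R (indicator L x *\<^sub>R grad V (u x)) = (1 / \<epsilon>\<^sup>2) *\<^sub>R grad V (indicator L x *\<^sub>R u x)"
      by auto
    show "cball x (4 * (e / 4)) \<subseteq> L" if "x \<in> K" for x using that by (auto simp: L_def)
  qed
  moreover have D0: "D i x = 0" if "x \<notin> L" for i x
    by (rule has_partials_outside[OF \<psi>(1) compact_imp_closed[OF \<psi>(2)] \<psi>(4)]) (use that KL in auto)
  have "(\<integral>x. D i x * (\<epsilon> * (?W j x \<bullet> ?W j' x)) \<partial>lebesgue_on \<Omega>) =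
      \<epsilon> * (\<integral>x. D i x * ((indicator L x *\<^sub>R ?W j x) \<bullet> (indicator L x *\<^sub>R ?W j' x)) \<partial>lebesgue)" for i j j'
  proof -
    have "(\<integral>x. D i x *\<^sub>R (\<epsilon> * (?W j x \<bullet> ?W j' x)) \<partial>lebesgue_on \<Omega>) =
        (\<integral>x. D i x *\<^sub>R (indicator L x *\<^sub>R (\<epsilon> * (?W j x \<bullet> ?W j' x))) \<partial>lebesgue)"
      by (rule integral_lebesgue_on_supported[OF S L(2) D0])
    also have "\<dots> = (\<integral>x. \<epsilon> * (D i x * ((indicator L x *\<^sub>R ?W j x) \<bullet> (indicator L x *\<^sub>R ?W j' x))) \<partial>lebesgue)"
      by (rule Bochner_Integration.integral_cong[OF refl]) (simp add: indicator_def)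
    finally show ?thesis by simp
  qed
  moreover have "(\<integral>x. D l x * (V (u x) / \<epsilon>) \<partial>lebesgue_on \<Omega>) = 1 / \<epsilon> * (\<integral>x. V (indicator L x *\<^sub>R u x) * D l x \<partial>lebesgue)"
  proof -
    have "(\<integral>x. D l x *\<^sub>R (V (u x) / \<epsilon>) \<partial>lebesgue_on \<Omega>) = (\<integral>x. D l x *\<^sub>R (indicator L x *\<^sub>R (V (u x) / \<epsilon>)) \<partial>lebesgue)"
      by (rule integral_lebesgue_on_supported[OF S L(2) D0])
    also have "\<dots> = (\<integral>x. 1 / \<epsilon> * (V (indicator L x *\<^sub>R u x) * D l x) \<partial>lebesgue)"
      by (rule Bochner_Integration.integral_cong[OF refl]) (simp add: indicator_def D0)
    finally show ?thesis by simp
  qed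
  ultimately show ?thesis
    using \<epsilon> by (simp add: sum_distrib_left[symmetric] field_simps power2_eq_square)
qed

section \<open>One-dimensional densities and blow-up\<close>

text \<open>Vitali covering: disjoint balls of radius \<open>r\<close> on which \<open>P\<close> has
  mass at least \<open>t * r\<close>, whose fivefold enlargements cover \<open>A\<close>. Each
  enlarged ball has diameter \<open>10 * r\<close>, at most \<open>10 / t\<close> times the mass of
  the original ball, and the disjoint originals lie in \<open>U\<close>.\<close>

lemma hausdorff1_outer_le_vitali:
  fixes P :: "'a::euclidean_space measure"
  assumes P: "finite_measure P" "sets P = sets borel" and U: "open U" "A \<subseteq> U" and t: "0 < t"
    and dense: "\<And>x \<delta>. x \<in> A \<Longrightarrow> 0 < \<delta> \<Longrightarrow> \<exists>r. 0 < r \<and> r < \<delta> \<and> t * r \<le> measure P (cball x r)"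
  shows "hausdorff1_outer A \<le> ennreal (10 / t * measure P U)"
  unfolding hausdorff1_outer_def
proof (rule SUP_least)
  interpret finite_measure P by fact
  fix \<delta> :: real assume "\<delta> \<in> {0<..}"
  then have \<delta>: "0 < \<delta>" by simp
  \<comment> \<open>Balls are coded as pairs of centre and radius. The bound
    \<open>10 * snd p \<le> \<delta>\<close> keeps the fivefold enlargements admissible in
    \<open>hausdorff1_pre \<delta>\<close>.\<close>
  define K where "K = {p :: 'a \<times> real. fst p \<in> A \<and> 0 < snd p \<and> 10 * snd p \<le> \<delta> \<and> cball (fst p) (snd p) \<subseteq> U \<and>
    t * snd p \<le> measure P (cball (fst p) (snd p))}"
  have cover: "A \<subseteq> (\<Union>p\<in>K. cball (fst p) (snd p))"
  proof
    fix x assume x: "x \<in> A"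
    obtain e where e: "0 < e" "cball x e \<subseteq> U" using U x open_contains_cball by blast
    obtain r where r: "0 < r" "r < min e (\<delta> / 10)" "t * r \<le> measure P (cball x r)"
      using dense[OF x, of "min e (\<delta> / 10)"] e \<delta> by auto
    have "cball x r \<subseteq> cball x e" using r by auto
    then have "(x, r) \<in> K" using x r e by (auto simp: K_def)
    then show "x \<in> (\<Union>p\<in>K. cball (fst p) (snd p))" using r by force
  qed
  have K: "0 < snd p \<and> snd p \<le> \<delta>" if "p \<in> K" for p using that \<delta> by (auto simp: K_def)
  obtain C where C: "countable C" "C \<subseteq> K"
      "pairwise (\<lambda>i j. disjnt (cball (fst i) (snd i)) (cball (fst j) (snd j))) C"
      "A \<subseteq> (\<Union>i\<in>C. cball (fst i) (5 * snd i))"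
    using Vitali_covering_lemma_cballs[OF cover K] by blast
  define I where "I = to_nat_on C ` C"
  define g where "g = inv_into C (to_nat_on C)"
  have inj: "inj_on (to_nat_on C) C" using C(1) by (rule inj_on_to_nat_on)
  have gC: "g n \<in> C" if "n \<in> I" for n using that by (auto simp: g_def I_def inv_into_into)
  have g_inj: "g m \<noteq> g n" if "m \<in> I" "n \<in> I" "m \<noteq> n" for m n
    using that unfolding g_def I_def by (metis inv_into_injective)
  have g_surj: "\<exists>n\<in>I. g n = p" if "p \<in> C" for p
    using that inv_into_f_f[OF inj that] by (auto simp: g_def I_def)
  \<comment> \<open>The countable family is reindexed by natural numbers and padded with empty sets,
    of diameter 0, to match the sequences in \<open>hausdorff1_pre\<close>.\<close>
  define W where "W n = (if n \<in> I then cball (fst (g n)) (5 * snd (g n)) else {})" for n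
  define B where "B n = (if n \<in> I then cball (fst (g n)) (snd (g n)) else {})" for n
  have disj: "disjoint_family B"
    unfolding disjoint_family_on_def
  proof (intro ballI impI)
    fix m n :: nat assume "m \<noteq> n"
    show "B m \<inter> B n = {}"
    proof (cases "m \<in> I \<and> n \<in> I")
      case True
      then have "disjnt (cball (fst (g m)) (snd (g m))) (cball (fst (g n)) (snd (g n)))"
        using pairwiseD[OF C(3) gC gC g_inj] \<open>m \<noteq> n\<close> by blast
      then show ?thesis using True by (simp add: B_def disjnt_def)
    qed (auto simp: B_def)
  qed
  have Bs: "B n \<in> sets P" for n by (auto simp: B_def P)
  have BU: "(\<Union>n. B n) \<subseteq> U" using gC C(2) by (fastforce simp: B_def K_def split: if_splits)
  have "hausdorff1_pre \<delta> A \<le> (\<Sum>n. ennreal (diameter (W n)))"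
    unfolding hausdorff1_pre_def
  proof (rule INF_lower, intro CollectI conjI allI)
    show "A \<subseteq> (\<Union>n. W n)"
    proof
      fix x assume "x \<in> A"
      then obtain p where "p \<in> C" "x \<in> cball (fst p) (5 * snd p)" using C(4) by blast
      then show "x \<in> (\<Union>n. W n)" using g_surj[of p] by (auto simp: W_def)
    qed
    show "bounded (W n)" for n by (simp add: W_def)
    show "diameter (W n) \<le> \<delta>" for n
      using gC[of n] C(2) \<delta> by (auto simp: W_def K_def diameter_cball)
  qed
  also have "\<dots> \<le> (\<Sum>n. ennreal (10 / t) * emeasure P (B n))"
  proof (rule suminf_le)
    show "ennreal (diameter (W n)) \<le> ennreal (10 / t) * emeasure P (B n)" for n
    proof (cases "n \<in> I")
      case True
      then have p: "0 < snd (g n)" "t * snd (g n) \<le> measure P (cball (fst (g n)) (snd (g n)))"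
        using gC C(2) by (auto simp: K_def)
      have "diameter (W n) = 10 / t * (t * snd (g n))" using True p t by (simp add: W_def diameter_cball)
      also have "\<dots> \<le> 10 / t * measure P (B n)"
        using p True t by (intro mult_left_mono) (auto simp: B_def)
      finally have "ennreal (diameter (W n)) \<le> ennreal (10 / t * measure P (B n))" by (rule ennreal_leI)
      also have "\<dots> = ennreal (10 / t) * ennreal (measure P (B n))" using t by (intro ennreal_mult) auto
      finally show ?thesis by (simp only: emeasure_eq_measure)
    qed (simp add: W_def)
  qed auto
  also have "\<dots> = ennreal (10 / t) * emeasure P (\<Union>n. B n)"
  proof -
    have "range B \<subseteq> sets P" using Bs by blast
    then show ?thesis using suminf_emeasure[OF _ disj, of P] by simp
  qed
  also have "\<dots> \<le> ennreal (10 / t) * emeasure P U"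
    using BU U P by (intro mult_left_mono emeasure_mono) auto
  also have "\<dots> = ennreal (10 / t * measure P U)"
    unfolding emeasure_eq_measure using t by (intro ennreal_mult[symmetric]) auto
  finally show "hausdorff1_pre \<delta> A \<le> ennreal (10 / t * measure P U)" .
qed

section \<open>Null sets and densities for one-dimensional Hausdorff measure\<close>

lemma sets_hausdorff1 [simp, measurable_cong]: "sets (hausdorff1 :: 'a::metric_space measure) = sets borel"
  unfolding hausdorff1_def using sets.sigma_sets_eq[of "borel :: 'a measure"] by simp

lemma space_hausdorff1 [simp]: "space (hausdorff1 :: 'a::metric_space measure) = UNIV"
  using sets_eq_imp_space_eq[OF sets_hausdorff1] by simp

text \<open>The inequality holds even if \<open>measure_of\<close> falls back to the zero measure, so countable additivity of the
  outer measure on Borel sets is never needed.\<close>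

lemma emeasure_hausdorff1_le: "emeasure hausdorff1 A \<le> hausdorff1_outer (A :: 'a::metric_space set)"
  unfolding hausdorff1_def emeasure_measure_of_conv by auto

text \<open>An almost everywhere statement asks for a measurable null set, whereas \<open>N\<close>
  may fail to be Borel. Closures of covering sets have the same diameters, so the intersection over
  \<open>k\<close> of the unions of closures is a Borel superset whose outer measure is still
  0.\<close>

lemma AE_hausdorff1_outer_null:
  fixes N :: "'a::metric_space set"
  assumes N: "hausdorff1_outer N = 0"
  shows "AE x in hausdorff1. x \<notin> N"
proof -
  have "\<exists>U :: nat \<Rightarrow> 'a set. N \<subseteq> (\<Union>i. U i) \<and> (\<forall>i. bounded (U i) \<and> diameter (U i) \<le> 1 / real (Suc k)) \<and>
      (\<Sum>i. ennreal (diameter (U i))) < ennreal (1 / real (Suc k))" for k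
  proof -
    have "hausdorff1_pre (1 / real (Suc k)) N \<le> hausdorff1_outer N"
      unfolding hausdorff1_outer_def by (rule SUP_upper) simp
    then have "hausdorff1_pre (1 / real (Suc k)) N < ennreal (1 / real (Suc k))" using N by simp
    then show ?thesis unfolding hausdorff1_pre_def INF_less_iff by blast
  qed
  then obtain U :: "nat \<Rightarrow> nat \<Rightarrow> 'a set" where U: "\<And>k. N \<subseteq> (\<Union>i. U k i)" "\<And>k i. bounded (U k i)"
    "\<And>k i. diameter (U k i) \<le> 1 / real (Suc k)" "\<And>k. (\<Sum>i. ennreal (diameter (U k i))) < ennreal (1 / real (Suc k))"
    by metis
  define B where "B = (\<Inter>k. \<Union>i. closure (U k i))"
  have NB: "N \<subseteq> B"
  proof
    fix x assume x: "x \<in> N"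
    have "\<exists>i. x \<in> closure (U k i)" for k
    proof -
      obtain i where "x \<in> U k i" using U(1)[of k] x by blast
      then show ?thesis using closure_subset[of "U k i"] by blast
    qed
    then show "x \<in> B" by (simp add: B_def)
  qed
  have B: "B \<in> sets borel" unfolding B_def by (intro sets.countable_INT sets.countable_UN) auto
  have "hausdorff1_pre \<delta> B = 0" if \<delta>: "0 < \<delta>" for \<delta>
  proof -
    have le: "hausdorff1_pre \<delta> B \<le> ennreal (1 / real (Suc k))" if k: "1 / real (Suc k) \<le> \<delta>" for k
    proof -
      have "hausdorff1_pre \<delta> B \<le> (\<Sum>i. ennreal (diameter (closure (U k i))))"
        unfolding hausdorff1_pre_def
      proof (rule INF_lower, intro CollectI conjI allI)
        show "diameter (closure (U k i)) \<le> \<delta>" for i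
          using order_trans[OF U(3) k] U(2) by (simp add: diameter_closure)
      qed (use U(2) in \<open>auto simp: B_def\<close>)
      also have "\<dots> \<le> ennreal (1 / real (Suc k))" using U(2,4) by (simp add: diameter_closure less_imp_le)
      finally show ?thesis .
    qed
    show ?thesis
    proof (rule antisym[OF ennreal_le_epsilon])
      fix e :: real assume e: "0 < e"
      obtain k where k: "inverse (real (Suc k)) < min e \<delta>" using reals_Archimedean[of "min e \<delta>"] e \<delta> by auto
      have "hausdorff1_pre \<delta> B \<le> ennreal (1 / real (Suc k))" using k by (intro le) (simp add: inverse_eq_divide)
      also have "\<dots> \<le> ennreal e" using k by (intro ennreal_leI) (simp add: inverse_eq_divide)
      finally show "hausdorff1_pre \<delta> B \<le> 0 + ennreal e" by simp
    qed simp
  qed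
  then have "hausdorff1_outer B = 0" unfolding hausdorff1_outer_def by simp
  then have "emeasure hausdorff1 B = 0" using emeasure_hausdorff1_le[of B] by simp
  then have "B \<in> null_sets hausdorff1" using B by auto
  then show ?thesis by (rule AE_I') (use NB in auto)
qed

text \<open>At the exceptional points the Vitali estimate applies with every threshold
  \<open>t\<close>, so their outer measure is at most a constant over \<open>t\<close> for all
  \<open>t\<close>.\<close>

lemma AE_upper_density_finite:
  fixes P :: "'a::euclidean_space measure"
  assumes P: "finite_measure P" "sets P = sets borel"
  shows "AE x in hausdorff1. \<exists>C \<delta>. 0 < \<delta> \<and> (\<forall>r. 0 < r \<and> r < \<delta> \<longrightarrow> measure P (cball x r) \<le> C * r)"
proof -
  define N where "N = {x. \<forall>C \<delta>. 0 < \<delta> \<longrightarrow> (\<exists>r. 0 < r \<and> r < \<delta> \<and> C * r < measure P (cball x r))}"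
  have le: "hausdorff1_outer N \<le> ennreal (10 / t * measure P UNIV)" if "0 < t" for t
  proof (rule hausdorff1_outer_le_vitali[OF P open_UNIV subset_UNIV that])
    fix x \<delta> assume "x \<in> N" "0 < (\<delta> :: real)"
    then show "\<exists>r. 0 < r \<and> r < \<delta> \<and> t * r \<le> measure P (cball x r)"
      unfolding N_def by (blast intro: less_imp_le)
  qed
  have "hausdorff1_outer N = 0"
  proof (rule antisym[OF ennreal_le_epsilon])
    fix e :: real assume e: "0 < e"
    define t where "t = 10 * (measure P UNIV + 1) / e"
    have t: "0 < t" using e by (simp add: t_def add_nonneg_pos)
    have "e * t = 10 * (measure P UNIV + 1)" using e by (simp add: t_def)
    then have "10 * measure P UNIV \<le> e * t" by simp
    then have "10 / t * measure P UNIV \<le> e" using t by (simp add: pos_divide_le_eq)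
    then show "hausdorff1_outer N \<le> 0 + ennreal e" using order_trans[OF le[OF t] ennreal_leI] by simp
  qed simp
  from AE_hausdorff1_outer_null[OF this] show ?thesis
  proof eventually_elim
    case (elim x)
    then obtain C \<delta> where "0 < \<delta>" "\<not> (\<exists>r. 0 < r \<and> r < \<delta> \<and> C * r < measure P (cball x r))"
      unfolding N_def by blast
    then show ?case by (metis not_less)
  qed
qed

text \<open>Outer regularity encloses the null set \<open>E\<close> in open sets of arbitrarily
  small \<open>P\<close>-mass. For fixed \<open>t\<close> the Vitali estimate inside such a set
  shows that the points of \<open>E\<close> with upper density above \<open>t\<close> are
  negligible; then \<open>t\<close> runs through a sequence tending to 0.\<close>

lemma AE_density_zero:
  fixes P :: "'a::euclidean_space measure"
  assumes P: "finite_measure P" "sets P = sets borel" and E: "E \<in> sets borel" "measure P E = 0"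
  shows "AE x in hausdorff1. x \<in> E \<longrightarrow> ((\<lambda>r. measure P (cball x r) / r) \<longlongrightarrow> 0) (at_right 0)"
proof -
  interpret finite_measure P by fact
  define N where "N t = {x\<in>E. \<forall>\<delta>. 0 < \<delta> \<longrightarrow> (\<exists>r. 0 < r \<and> r < \<delta> \<and> t * r \<le> measure P (cball x r))}" for t
  have "hausdorff1_outer (N t) = 0" if t: "0 < t" for t
  proof (rule antisym[OF ennreal_le_epsilon])
    fix e :: real assume e: "0 < e"
    have "emeasure P E = (INF U\<in>{U. E \<subseteq> U \<and> open U}. emeasure P U)"
      by (rule outer_regular[OF P(2) _ E(1)]) simp
    moreover have "emeasure P E < ennreal (t * e / 10)" using E t e by (simp add: emeasure_eq_measure)
    ultimately obtain U where U: "E \<subseteq> U" "open U" "emeasure P U < ennreal (t * e / 10)"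
      by (auto simp: INF_less_iff)
    then have "measure P U < t * e / 10" using t e by (simp add: emeasure_eq_measure ennreal_less_iff)
    then have m: "10 / t * measure P U \<le> e" using t by (simp add: field_simps)
    have "hausdorff1_outer (N t) \<le> ennreal (10 / t * measure P U)"
      by (rule hausdorff1_outer_le_vitali[OF P U(2) _ t]) (use U(1) in \<open>auto simp: N_def\<close>)
    also have "\<dots> \<le> ennreal e" by (rule ennreal_leI[OF m])
    finally show "hausdorff1_outer (N t) \<le> 0 + ennreal e" by simp
  qed simp
  then have "AE x in hausdorff1. x \<notin> N (1 / real (Suc k))" for k
    by (intro AE_hausdorff1_outer_null) simp
  then have "AE x in hausdorff1. \<forall>k. x \<notin> N (1 / real (Suc k))"
    unfolding AE_all_countable by (rule allI)
  then show ?thesis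
  proof eventually_elim
    case (elim x)
    show ?case
    proof (intro impI tendstoI)
      fix e :: real assume x: "x \<in> E" and e: "0 < e"
      obtain k where k: "inverse (real (Suc k)) < e" using reals_Archimedean[OF e] by blast
      obtain \<delta> where \<delta>: "0 < \<delta>" "\<And>r. 0 < r \<Longrightarrow> r < \<delta> \<Longrightarrow> measure P (cball x r) < 1 / real (Suc k) * r"
        using elim[rule_format, of k] x by (auto simp: N_def not_le)
      show "\<forall>\<^sub>F r in at_right 0. dist (measure P (cball x r) / r) 0 < e"
        unfolding eventually_at_right_field
      proof (intro exI[of _ \<delta>] conjI allI impI \<delta>(1))
        fix r assume r: "0 < r" "r < \<delta>"
        have "measure P (cball x r) / r < 1 / real (Suc k)"
          using \<delta>(2)[OF r] r(1) by (simp only: pos_divide_less_eq)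
        then show "dist (measure P (cball x r) / r) 0 < e"
          using k r by (simp add: dist_real_def inverse_eq_divide)
      qed
    qed
  qed
qed

text \<open>For rational bounds the part of \<open>\<Lambda>\<close> living off
  \<open>{y. a < f y \<and> f y < b}\<close>, suitably weighted, has zero density at almost every
  point of that set. At \<open>x\<close>, rational bounds close to \<open>f x\<close> make
  \<open>f y - f x\<close> small on the set, where finiteness of the upper density of
  \<open>\<Lambda>\<close> controls the division by \<open>r\<close>, and the weighted measure
  controls the rest.\<close>

lemma AE_lebesgue_point:
  fixes \<Lambda> :: "'a::euclidean_space measure" and f :: "'a \<Rightarrow> real"
  assumes \<Lambda>: "finite_measure \<Lambda>" "sets \<Lambda> = sets borel" and f: "integrable \<Lambda> f"
  shows "AE x in hausdorff1.
    ((\<lambda>r. (\<integral>y. indicator (cball x r) y * \<bar>f y - f x\<bar> \<partial>\<Lambda>) / r) \<longlongrightarrow> 0) (at_right 0)"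
proof -
  interpret finite_measure \<Lambda> by fact
  have fm: "f \<in> borel_measurable borel" 
    using borel_measurable_integrable[OF f] unfolding measurable_cong_sets[OF \<Lambda>(2) refl] .
  define E where "E a b = {y. a < f y \<and> f y < b}" for a b
  have E: "E a b \<in> sets borel" for a b
    unfolding E_def using fm by measurable
  \<comment> \<open>The weight dominates the oscillation off the set:
    \<open>\<bar>f y - f x\<bar>\<close> is at most
    \<open>(1 + \<bar>f x\<bar>) * (1 + \<bar>f y\<bar>)\<close>, with a first factor independent of
    \<open>y\<close>.\<close>
  define h where "h a b y = indicator (- E a b) y * (1 + \<bar>f y\<bar>)" for a b y
  have h0: "0 \<le> h a b y" for a b y by (simp add: h_def)
  have ih: "integrable \<Lambda> (\<lambda>y. indicator X y * h a b y)" if X: "X \<in> sets borel" for X a b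
  proof (rule Bochner_Integration.integrable_bound)
    show "integrable \<Lambda> (\<lambda>y. 1 + \<bar>f y\<bar>)" using f by auto
    show "(\<lambda>y. indicator X y * h a b y) \<in> borel_measurable \<Lambda>"
      unfolding h_def using f X E[of a b] \<Lambda>(2)
      by (intro borel_measurable_times borel_measurable_indicator borel_measurable_add borel_measurable_const
          borel_measurable_abs borel_measurable_integrable) auto
    show "AE y in \<Lambda>. norm (indicator X y * h a b y) \<le> norm (1 + \<bar>f y\<bar>)"
      by (auto simp: h_def indicator_def)
  qed
  define P where "P a b = density \<Lambda> (\<lambda>y. ennreal (h a b y))" for a b
  have ih': "integrable \<Lambda> (h a b)" for a b using ih[of UNIV a b] by simp
  have eP: "emeasure (P a b) X = ennreal (\<integral>y. indicator X y * h a b y \<partial>\<Lambda>)" if X: "X \<in> sets borel" for X a b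
  proof -
    have "emeasure (P a b) X = (\<integral>\<^sup>+y. ennreal (h a b y) * indicator X y \<partial>\<Lambda>)"
      unfolding P_def using X \<Lambda>(2) ih' by (intro emeasure_density) auto
    also have "\<dots> = (\<integral>\<^sup>+y. ennreal (indicator X y * h a b y) \<partial>\<Lambda>)"
      by (intro nn_integral_cong) (auto simp: indicator_def)
    also have "\<dots> = ennreal (\<integral>y. indicator X y * h a b y \<partial>\<Lambda>)"
      using h0 by (intro nn_integral_eq_integral ih X) auto
    finally show ?thesis .
  qed
  have mP: "measure (P a b) X = (\<integral>y. indicator X y * h a b y \<partial>\<Lambda>)" if X: "X \<in> sets borel" for X a b
    unfolding measure_def eP[OF X] using h0 by (intro enn2real_ennreal integral_nonneg_AE) auto
  have sP: "sets (P a b) = sets borel" "space (P a b) = UNIV" for a b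
    using \<Lambda>(2) sets_eq_imp_space_eq[OF \<Lambda>(2)] by (auto simp: P_def)
  have fP: "finite_measure (P a b)" for a b
    by (rule finite_measureI) (simp add: sP eP)
  have "AE x in hausdorff1. x \<in> E a b \<longrightarrow> ((\<lambda>r. measure (P a b) (cball x r) / r) \<longlongrightarrow> 0) (at_right 0)" for a b
  proof (rule AE_density_zero[OF fP sP(1) E])
    have 0: "indicator (E a b) y * h a b y = 0" for y by (auto simp: h_def indicator_def)
    show "measure (P a b) (E a b) = 0" unfolding mP[OF E] 0 by simp
  qed
  then have "AE x in hausdorff1. \<forall>p q :: rat. x \<in> E (of_rat p) (of_rat q) \<longrightarrow>
      ((\<lambda>r. measure (P (of_rat p) (of_rat q)) (cball x r) / r) \<longlongrightarrow> 0) (at_right 0)"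
    unfolding AE_all_countable by blast
  then show ?thesis using AE_upper_density_finite[OF \<Lambda>]
  proof eventually_elim
    case (elim x)
    obtain C \<delta> where C: "0 < \<delta>" "\<And>r. 0 < r \<Longrightarrow> r < \<delta> \<Longrightarrow> measure \<Lambda> (cball x r) \<le> C * r" using elim(2) by blast
    show ?case
    proof (rule tendstoI)
      fix e :: real assume e: "0 < e"
      \<comment> \<open>Half of \<open>e\<close> pays for the set where \<open>f\<close> is near
        \<open>f x\<close>, whose mass is at most \<open>\<bar>C\<bar> * r\<close>; the other half
        pays for the weighted measure.\<close>
      define e' where "e' = e / (2 * (\<bar>C\<bar> + 1))"
      have e': "0 < e'" using e by (simp add: e'_def add_nonneg_pos)
      have e'C: "e' * \<bar>C\<bar> \<le> e / 2"
      proof -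
        have "e' * (2 * (\<bar>C\<bar> + 1)) = e" by (simp add: e'_def add_nonneg_pos)
        then show ?thesis using e' by (simp add: algebra_simps)
      qed
      obtain p where p: "f x - e' / 2 < of_rat p" "of_rat p < f x" using of_rat_dense[of "f x - e' / 2" "f x"] e' by auto
      obtain q where q: "f x < of_rat q" "of_rat q < f x + e' / 2" using of_rat_dense[of "f x" "f x + e' / 2"] e' by auto
      let ?E = "E (of_rat p) (of_rat q)" and ?P = "P (of_rat p) (of_rat q)" and ?h = "h (of_rat p) (of_rat q)"
      have "x \<in> ?E" using p q by (simp add: E_def)
      then have lim: "((\<lambda>r. measure ?P (cball x r) / r) \<longlongrightarrow> 0) (at_right 0)" using elim(1) by blast
      have pt: "\<bar>f y - f x\<bar> \<le> e' + (1 + \<bar>f x\<bar>) * ?h y" for y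
      proof (cases "y \<in> ?E")
        case True
        then have "\<bar>f y - f x\<bar> \<le> e'" using p q by (auto simp: E_def)
        moreover have "0 \<le> (1 + \<bar>f x\<bar>) * ?h y" by (intro mult_nonneg_nonneg h0) simp
        ultimately show ?thesis by linarith
      next
        case False
        then have "(1 + \<bar>f x\<bar>) * ?h y = 1 + \<bar>f x\<bar> + \<bar>f y\<bar> + \<bar>f x\<bar> * \<bar>f y\<bar>"
          by (simp add: h_def algebra_simps)
        moreover have "\<bar>f y - f x\<bar> \<le> \<bar>f y\<bar> + \<bar>f x\<bar>" by (rule abs_triangle_ineq4)
        moreover have "0 \<le> \<bar>f x\<bar> * \<bar>f y\<bar>" by simp
        ultimately have "\<bar>f y - f x\<bar> \<le> (1 + \<bar>f x\<bar>) * ?h y" by linarith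
        then show ?thesis using e' by simp
      qed
      have bound: "(\<integral>y. indicator (cball x r) y * \<bar>f y - f x\<bar> \<partial>\<Lambda>) \<le>
          e' * measure \<Lambda> (cball x r) + (1 + \<bar>f x\<bar>) * measure ?P (cball x r)" for r
      proof -
        have i1: "integrable \<Lambda> (\<lambda>y. e' * indicator (cball x r) y)"
          using \<Lambda>(2) by (intro integrable_mult_right integrable_real_indicator) (auto simp: emeasure_eq_measure)
        have i2: "integrable \<Lambda> (\<lambda>y. (1 + \<bar>f x\<bar>) * (indicator (cball x r) y * ?h y))"
          by (intro integrable_mult_right ih) simp
        have "norm (\<integral>y. indicator (cball x r) y * \<bar>f y - f x\<bar> \<partial>\<Lambda>) \<le>
            (\<integral>y. e' * indicator (cball x r) y + (1 + \<bar>f x\<bar>) * (indicator (cball x r) y * ?h y) \<partial>\<Lambda>)"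
          by (rule norm_integral_le[OF Bochner_Integration.integrable_add[OF i1 i2]])
            (use pt in \<open>auto simp: indicator_def\<close>)
        also have "\<dots> = e' * measure \<Lambda> (cball x r) + (1 + \<bar>f x\<bar>) * measure ?P (cball x r)"
          using \<Lambda>(2) by (simp only: Bochner_Integration.integral_add[OF i1 i2]) (simp add: mP sets_eq_imp_space_eq)
        finally show ?thesis by simp
      qed
      have "0 < e / (2 * (1 + \<bar>f x\<bar>))" using e by (simp add: add_pos_nonneg)
      then have "\<forall>\<^sub>F r in at_right 0. measure ?P (cball x r) / r < e / (2 * (1 + \<bar>f x\<bar>))"
        using order_tendstoD(2)[OF lim] by blast
      moreover have "\<forall>\<^sub>F r in at_right (0::real). 0 < r \<and> r < \<delta>"
        using C(1) unfolding eventually_at_right_field by blast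
      ultimately show "\<forall>\<^sub>F r in at_right 0. dist ((\<integral>y. indicator (cball x r) y * \<bar>f y - f x\<bar> \<partial>\<Lambda>) / r) 0 < e"
      proof eventually_elim
        case (elim r)
        have "0 \<le> (\<integral>y. indicator (cball x r) y * \<bar>f y - f x\<bar> \<partial>\<Lambda>)" by (intro integral_nonneg_AE) auto
        moreover have "(\<integral>y. indicator (cball x r) y * \<bar>f y - f x\<bar> \<partial>\<Lambda>) / r < e"
        proof -
          have "measure \<Lambda> (cball x r) \<le> \<bar>C\<bar> * r"
          proof -
            have "C * r \<le> \<bar>C\<bar> * r" using elim by (intro mult_right_mono) auto
            then show ?thesis using C(2)[of r] elim by linarith
          qed
          then have "e' * measure \<Lambda> (cball x r) \<le> e' * (\<bar>C\<bar> * r)" using e' by (intro mult_left_mono) auto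
          also have "\<dots> \<le> e / 2 * r" using mult_right_mono[OF e'C, of r] elim by (simp add: mult.assoc)
          finally have 1: "e' * measure \<Lambda> (cball x r) \<le> e / 2 * r" .
          have "measure ?P (cball x r) < e / (2 * (1 + \<bar>f x\<bar>)) * r"
            using elim(1) elim(2) pos_divide_less_eq[of r "measure ?P (cball x r)" "e / (2 * (1 + \<bar>f x\<bar>))"] by blast
          then have "(1 + \<bar>f x\<bar>) * measure ?P (cball x r) < (1 + \<bar>f x\<bar>) * (e / (2 * (1 + \<bar>f x\<bar>)) * r)"
            by (intro mult_strict_left_mono) auto
          also have "\<dots> = e / 2 * r"
          proof -
            have "0 < 1 + \<bar>f x\<bar>" by (intro add_pos_nonneg) auto
            then show ?thesis by (simp del: distrib_left_numeral)
          qed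
          finally have "(\<integral>y. indicator (cball x r) y * \<bar>f y - f x\<bar> \<partial>\<Lambda>) < e / 2 * r + e / 2 * r"
            using bound[of r] 1 by linarith
          then show ?thesis using elim by (simp add: pos_divide_less_eq)
        qed
        ultimately show ?case using elim by (simp add: dist_real_def)
      qed
    qed
  qed
qed

text \<open>A blow-up argument: \<open>a \<Lambda>\<close> is divergence free, and near \<open>x\<close> the measure \<open>\<Lambda>\<close> concentrates on the line through \<open>x\<close>
  with normal \<open>rot90 \<tau>\<close>. Testing with a cutoff times the signed distance to that line kills the tangential
  part in the limit.\<close>

lemma blowup_normal_zero:
  fixes \<Lambda> :: "(real^2) measure" and a :: "2 \<Rightarrow> real^2 \<Rightarrow> real"
  assumes \<Lambda>: "finite_measure \<Lambda>" "sets \<Lambda> = sets borel" and \<Omega>: "open \<Omega>" "x \<in> \<Omega>"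
    and a: "\<And>j. integrable \<Lambda> (a j)"
    and div: "\<And>\<psi> D K. has_partials \<psi> D \<Longrightarrow> compact K \<Longrightarrow> K \<subseteq> \<Omega> \<Longrightarrow> (\<And>y. y \<notin> K \<Longrightarrow> \<psi> y = 0) \<Longrightarrow>
      (\<Sum>j\<in>UNIV. \<integral>y. a j y * D j y \<partial>\<Lambda>) = 0"
    and leb: "\<And>j. ((\<lambda>r. (\<integral>y. indicator (cball x r) y * \<bar>a j y - a j x\<bar> \<partial>\<Lambda>) / r) \<longlongrightarrow> 0) (at_right 0)"
    and upper: "0 < \<delta>0" "\<And>r. 0 < r \<Longrightarrow> r < \<delta>0 \<Longrightarrow> measure \<Lambda> (cball x r) \<le> C * r"
    and lower: "0 < c" "\<And>\<delta>. 0 < \<delta> \<Longrightarrow> \<exists>r. 0 < r \<and> r < \<delta> \<and> c * r \<le> measure \<Lambda> (cball x r)"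
    and \<tau>: "norm \<tau> = 1"
    and cone: "\<And>s. 0 < s \<Longrightarrow> s < 1 \<Longrightarrow>
      ((\<lambda>r. measure \<Lambda> (cball x r \<inter> {y. s * norm (y - x) \<le> \<bar>rot90 \<tau> \<bullet> (y - x)\<bar>}) / r) \<longlongrightarrow> 0) (at_right 0)"
  shows "(\<Sum>j\<in>UNIV. a j x * rot90 \<tau> $ j) = 0"
proof -
  interpret finite_measure \<Lambda> by fact
  define n where "n = rot90 \<tau>"
  have n1: "norm n = 1"
    using \<tau> by (simp add: n_def rot90_def norm_eq_1 inner_vec_def UNIV_2 vector_2 add.commute)
  define \<beta> where "\<beta> = (\<Sum>j\<in>UNIV. a j x * n $ j)"
  define M where "M = (\<Sum>j\<in>UNIV. \<bar>a j x\<bar>)"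
  have M0: "0 \<le> M" by (simp add: M_def sum_nonneg)
  define Z where "Z s R = cball x R \<inter> {y. s * norm (y - x) \<le> \<bar>n \<bullet> (y - x)\<bar>}" for s R
  have Zs: "Z s R \<in> sets \<Lambda>" for s R
  proof -
    have "closed {y. s * norm (y - x) \<le> \<bar>n \<bullet> (y - x)\<bar>}" by (intro closed_Collect_le continuous_intros)
    then show ?thesis unfolding Z_def \<Lambda>(2) by auto
  qed
  define A where "A j R = (\<integral>y. indicator (cball x R) y * \<bar>a j y - a j x\<bar> \<partial>\<Lambda>)" for j R
  have main: "\<bar>\<beta>\<bar> * (measure \<Lambda> (cball x (R / 2)) / 2) \<le>
      5 * (\<Sum>j\<in>UNIV. A j R) + 4 * M * s * measure \<Lambda> (cball x R) + 4 * M * measure \<Lambda> (Z s R)"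
    if R: "0 < R" "cball x R \<subseteq> \<Omega>" and s: "0 < s" for R s
  proof -
    \<comment> \<open>The square of this positive part is a C^1 cutoff supported in
      \<open>cball x R\<close>. On the half ball \<open>m\<close> is at least \<open>3 / 4\<close>,
      so its square exceeds \<open>1 / 2\<close>.\<close>
    define m where "m y = max 0 (1 - 1 / R\<^sup>2 * (norm (y - x))\<^sup>2)" for y
    let ?\<psi> = "\<lambda>y. (m y)\<^sup>2 * (n \<bullet> (y - x))"
    \<comment> \<open>The part of the gradient in which the cutoff is differentiated. It keeps the
      signed distance as a factor and is therefore small near the tangent line; the other part is
      the constant normal times the cutoff.\<close>
    define T where "T j y = (n \<bullet> (y - x)) * (2 * m y * (- 2 * (1 / R\<^sup>2) * (y $ j - x $ j)))" for j y
    let ?D = "\<lambda>j y. (m y)\<^sup>2 * n $ j + T j y"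
    have m01: "0 \<le> m y" "m y \<le> 1" for y by (auto simp: m_def)
    have m_out: "m y = 0" if "y \<notin> cball x R" for y
    proof -
      have "R\<^sup>2 \<le> (norm (y - x))\<^sup>2" using that R by (intro power_mono) (auto simp: dist_norm norm_minus_commute)
      then show ?thesis using R by (simp add: m_def)
    qed
    have m_in: "1 / 2 \<le> (m y)\<^sup>2" if "y \<in> cball x (R / 2)" for y
    proof -
      have "(norm (y - x))\<^sup>2 \<le> (R / 2)\<^sup>2" using that R by (intro power_mono) (auto simp: dist_norm norm_minus_commute)
      then have "1 / R\<^sup>2 * (norm (y - x))\<^sup>2 \<le> 1 / R\<^sup>2 * (R / 2)\<^sup>2" by (intro mult_left_mono) auto
      also have "\<dots> = 1 / 4" using R by (simp add: power2_eq_square)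
      finally have "3 / 4 \<le> 1 - 1 / R\<^sup>2 * (norm (y - x))\<^sup>2" by linarith
      then have "3 / 4 \<le> m y" unfolding m_def by (rule max.coboundedI2)
      then have "(3 / 4)\<^sup>2 \<le> (m y)\<^sup>2" by (intro power_mono) auto
      then show ?thesis by (simp add: power2_eq_square)
    qed
    have dm: "((\<lambda>t. (max 0 t)\<^sup>2) has_real_derivative 2 * max 0 t) (at t)" for t :: real
      using DERIV_max_power[of 0 0 t] by (simp add: numeral_2_eq_2)
    have pm: "has_partials (\<lambda>y. (m y)\<^sup>2) (\<lambda>j y. 2 * m y * (- 2 * (1 / R\<^sup>2) * (y $ j - x $ j)))"
      unfolding m_def
      by (rule has_partials_compose_real[OF has_partials_one_minus_norm_square dm]) (intro continuous_intros)
    have pn: "has_partials (\<lambda>y. n \<bullet> (y - x)) (\<lambda>j y. n $ j)"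
    proof (rule has_partialsI)
      show "((\<lambda>y. n \<bullet> (y - x)) has_derivative (\<lambda>h. n \<bullet> h)) (at y)" for y
        by (auto intro!: derivative_eq_intros)
      show "n \<bullet> h = (\<Sum>i\<in>UNIV. h $ i *\<^sub>R n $ i)" for h by (simp add: inner_vec_def mult.commute)
    qed auto
    have p: "has_partials ?\<psi> ?D"
      using has_partials_mult[OF pm pn] by (simp add: T_def mult_ac)
    have cD: "continuous_on UNIV (?D j)" for j by (rule has_partials_continuous_partial[OF p])
    have cm: "continuous_on UNIV m" unfolding m_def by (intro continuous_intros)
    have cT: "continuous_on UNIV (T j)" for j unfolding T_def by (intro continuous_intros cm)
    have zero: "(\<Sum>j\<in>UNIV. \<integral>y. a j y * ?D j y \<partial>\<Lambda>) = 0"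
      by (rule div[OF p compact_cball R(2)]) (simp add: m_out)
    have nle: "\<bar>n \<bullet> v\<bar> \<le> norm v" for v using Cauchy_Schwarz_ineq2[of n v] n1 by simp
    have nj: "\<bar>n $ j\<bar> \<le> 1" for j using component_le_norm_cart[of n j] n1 by simp
    have Tb: "\<bar>T j y\<bar> \<le> 4 * (\<bar>n \<bullet> (y - x)\<bar> / R)" for j y
    proof (cases "y \<in> cball x R")
      case True
      have "\<bar>(y - x) $ j\<bar> \<le> R" using component_le_norm_cart[of "y - x" j] True by (simp add: dist_norm norm_minus_commute)
      then have "2 * m y * (2 * (1 / R\<^sup>2) * \<bar>y $ j - x $ j\<bar>) \<le> 2 * 1 * (2 * (1 / R\<^sup>2) * R)"
        using m01[of y] R by (intro mult_mono) auto
      also have "\<dots> = 4 / R" using R by (simp add: power2_eq_square)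
      finally have "\<bar>n \<bullet> (y - x)\<bar> * (2 * m y * (2 * (1 / R\<^sup>2) * \<bar>y $ j - x $ j\<bar>)) \<le> \<bar>n \<bullet> (y - x)\<bar> * (4 / R)"
        by (intro mult_left_mono) auto
      moreover have "\<bar>T j y\<bar> = \<bar>n \<bullet> (y - x)\<bar> * (2 * m y * (2 * (1 / R\<^sup>2) * \<bar>y $ j - x $ j\<bar>))"
        unfolding T_def abs_mult using m01[of y] by simp
      ultimately show ?thesis by (simp only: times_divide_eq_right mult.commute)
    qed (use R in \<open>simp add: T_def m_out\<close>)
    have Tout: "T j y = 0" if "y \<notin> cball x R" for j y using that by (simp add: T_def m_out)
    have Tb4: "\<bar>T j y\<bar> \<le> 4" for j y
    proof (cases "y \<in> cball x R")
      case True
      have "\<bar>n \<bullet> (y - x)\<bar> \<le> R" using nle[of "y - x"] True by (simp add: dist_norm norm_minus_commute)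
      then have "\<bar>n \<bullet> (y - x)\<bar> / R \<le> 1" using R by simp
      then show ?thesis using Tb[of j y] by linarith
    qed (simp add: Tout)
    have D5: "\<bar>?D j y\<bar> \<le> 5 * indicator (cball x R) y" for j y
    proof (cases "y \<in> cball x R")
      case True
      have "\<bar>(m y)\<^sup>2 * n $ j\<bar> \<le> 1 * 1"
        unfolding abs_mult using m01[of y] nj[of j] by (intro mult_mono) (auto simp: power_le_one)
      then show ?thesis using Tb4[of j y] True abs_triangle_ineq[of "(m y)\<^sup>2 * n $ j" "T j y"] by simp
    qed (simp add: Tout m_out)
    have D5': "\<bar>?D j y\<bar> \<le> 5" for j y
      by (rule order_trans[OF D5]) (simp add: indicator_def)
    have meas: "g \<in> borel_measurable \<Lambda>" if "continuous_on UNIV g" for g :: "real^2 \<Rightarrow> real"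
      using borel_measurable_continuous_onI[OF that] unfolding measurable_cong_sets[OF \<Lambda>(2) refl] .
    have intD: "integrable \<Lambda> (?D j)" for j
      by (rule integrable_const_bound[of _ 5]) (use D5' meas[OF cD] in auto)
    have intT: "integrable \<Lambda> (T j)" for j
      by (rule integrable_const_bound[of _ 4]) (use Tb4[of j] meas[OF cT] in auto)
    have intm: "integrable \<Lambda> (\<lambda>y. (m y)\<^sup>2)"
      by (rule integrable_const_bound[of _ 1]) (use m01 meas[OF continuous_on_power[OF cm]] in \<open>auto simp: power_le_one\<close>)
    have int_ad: "integrable \<Lambda> (\<lambda>y. (a j y - a j x) * ?D j y)" for j
    proof -
      have "integrable \<Lambda> (\<lambda>y. ?D j y *\<^sub>R (a j y - a j x))"
        by (rule integrable_mult_bounded[where C = 5])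
          (use a D5' meas[OF cD] in auto)
      then show ?thesis by (simp add: mult.commute)
    qed
    have eq: "(\<integral>y. a j y * ?D j y \<partial>\<Lambda>) = (\<integral>y. (a j y - a j x) * ?D j y \<partial>\<Lambda>)
        + (a j x * n $ j * (\<integral>y. (m y)\<^sup>2 \<partial>\<Lambda>) + a j x * (\<integral>y. T j y \<partial>\<Lambda>))" for j
    proof -
      have "(\<integral>y. a j y * ?D j y \<partial>\<Lambda>) = (\<integral>y. (a j y - a j x) * ?D j y + a j x * ?D j y \<partial>\<Lambda>)"
        by (rule Bochner_Integration.integral_cong[OF refl]) (simp add: algebra_simps)
      also have "\<dots> = (\<integral>y. (a j y - a j x) * ?D j y \<partial>\<Lambda>) + a j x * (\<integral>y. ?D j y \<partial>\<Lambda>)"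
        using Bochner_Integration.integral_add[OF int_ad integrable_mult_right[OF intD]] by simp
      also have "(\<integral>y. ?D j y \<partial>\<Lambda>) = (\<integral>y. (m y)\<^sup>2 \<partial>\<Lambda>) * n $ j + (\<integral>y. T j y \<partial>\<Lambda>)"
        using Bochner_Integration.integral_add[OF integrable_mult_left[OF intm] intT] by simp
      finally show ?thesis by (simp add: algebra_simps)
    qed
    have "0 = (\<Sum>j\<in>UNIV. \<integral>y. (a j y - a j x) * ?D j y \<partial>\<Lambda>) + \<beta> * (\<integral>y. (m y)\<^sup>2 \<partial>\<Lambda>) + (\<Sum>j\<in>UNIV. a j x * (\<integral>y. T j y \<partial>\<Lambda>))"
      using zero unfolding eq \<beta>_def by (simp add: sum.distrib sum_distrib_right)
    then have "\<bar>\<beta> * (\<integral>y. (m y)\<^sup>2 \<partial>\<Lambda>)\<bar> \<le>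
        \<bar>\<Sum>j\<in>UNIV. \<integral>y. (a j y - a j x) * ?D j y \<partial>\<Lambda>\<bar> + \<bar>\<Sum>j\<in>UNIV. a j x * (\<integral>y. T j y \<partial>\<Lambda>)\<bar>" by linarith
    also have "\<dots> \<le> 5 * (\<Sum>j\<in>UNIV. A j R) + M * (4 * s * measure \<Lambda> (cball x R) + 4 * measure \<Lambda> (Z s R))"
    proof (rule add_mono)
      have intA: "integrable \<Lambda> (\<lambda>y. indicator (cball x R) y * \<bar>a j y - a j x\<bar>)" for j
      proof -
        have "integrable \<Lambda> (\<lambda>y. indicator (cball x R) y *\<^sub>R \<bar>a j y - a j x\<bar>)"
          by (rule integrable_mult_bounded[where C = 1]) (use a \<Lambda>(2) in \<open>auto simp: indicator_def\<close>)
        then show ?thesis by simp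
      qed
      have "\<bar>\<integral>y. (a j y - a j x) * ?D j y \<partial>\<Lambda>\<bar> \<le> 5 * A j R" for j
      proof -
        have "norm (\<integral>y. (a j y - a j x) * ?D j y \<partial>\<Lambda>) \<le> (\<integral>y. 5 * (indicator (cball x R) y * \<bar>a j y - a j x\<bar>) \<partial>\<Lambda>)"
        proof (rule norm_integral_le[OF integrable_mult_right[OF intA]], rule AE_I2)
          fix y
          show "norm ((a j y - a j x) * ?D j y) \<le> 5 * (indicator (cball x R) y * \<bar>a j y - a j x\<bar>)"
            using mult_left_mono[OF D5[where j = j and y = y] abs_ge_zero[of "a j y - a j x"]] by (simp add: abs_mult mult_ac)
        qed
        then show ?thesis by (simp add: A_def)
      qed
      then have "(\<Sum>j\<in>UNIV. \<bar>\<integral>y. (a j y - a j x) * ?D j y \<partial>\<Lambda>\<bar>) \<le> (\<Sum>j\<in>UNIV. 5 * A j R)" by (intro sum_mono)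
      then show "\<bar>\<Sum>j\<in>UNIV. \<integral>y. (a j y - a j x) * ?D j y \<partial>\<Lambda>\<bar> \<le> 5 * (\<Sum>j\<in>UNIV. A j R)"
        by (intro order_trans[OF sum_abs]) (simp add: sum_distrib_left)
      \<comment> \<open>Outside the cone the distance to the line is at most \<open>s * R\<close>,
        and the factor \<open>4 / R\<close> of the differentiated cutoff leaves
        \<open>4 * s\<close>; inside the cone the crude bound 4 is used.\<close>
      have "\<bar>\<integral>y. T j y \<partial>\<Lambda>\<bar> \<le> 4 * s * measure \<Lambda> (cball x R) + 4 * measure \<Lambda> (Z s R)" for j
      proof -
        have i1: "integrable \<Lambda> (\<lambda>y. 4 * s * indicator (cball x R) y)"
          using \<Lambda>(2) by (intro integrable_mult_right integrable_real_indicator) (auto simp: emeasure_eq_measure)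
        have i2: "integrable \<Lambda> (\<lambda>y. 4 * indicat_real (Z s R) y)"
          using Zs by (intro integrable_mult_right integrable_real_indicator) (auto simp: emeasure_eq_measure)
        have "norm (\<integral>y. T j y \<partial>\<Lambda>) \<le> (\<integral>y. 4 * s * indicator (cball x R) y + 4 * indicator (Z s R) y \<partial>\<Lambda>)"
        proof (rule norm_integral_le[OF Bochner_Integration.integrable_add[OF i1 i2]], rule AE_I2)
          fix y
          show "norm (T j y) \<le> 4 * s * indicator (cball x R) y + 4 * indicator (Z s R) y"
          proof (cases "y \<in> cball x R")
            case True
            show ?thesis
            proof (cases "y \<in> Z s R")
              case False
              then have "\<bar>n \<bullet> (y - x)\<bar> \<le> s * norm (y - x)" using True by (auto simp: Z_def)
              also have "\<dots> \<le> s * R" using True s by (intro mult_left_mono) (auto simp: dist_norm norm_minus_commute)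
              finally have "\<bar>n \<bullet> (y - x)\<bar> / R \<le> s" using R by (simp add: pos_divide_le_eq)
              then show ?thesis using Tb[of j y] True False by simp
            qed (use Tb4[of j y] s True in simp)
          qed (simp add: Tout)
        qed
        also have "\<dots> = 4 * s * measure \<Lambda> (cball x R) + 4 * measure \<Lambda> (Z s R)"
          unfolding Bochner_Integration.integral_add[OF i1 i2] using Zs \<Lambda>(2)
          by (simp add: sets_eq_imp_space_eq[OF \<Lambda>(2)])
        finally show ?thesis by simp
      qed
      then have "(\<Sum>j\<in>UNIV. \<bar>a j x\<bar> * \<bar>\<integral>y. T j y \<partial>\<Lambda>\<bar>) \<le>
          (\<Sum>j\<in>UNIV. \<bar>a j x\<bar> * (4 * s * measure \<Lambda> (cball x R) + 4 * measure \<Lambda> (Z s R)))"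
        by (intro sum_mono mult_left_mono) auto
      then show "\<bar>\<Sum>j\<in>UNIV. a j x * (\<integral>y. T j y \<partial>\<Lambda>)\<bar> \<le> M * (4 * s * measure \<Lambda> (cball x R) + 4 * measure \<Lambda> (Z s R))"
        unfolding M_def sum_distrib_right
        by (intro order_trans[OF sum_abs]) (simp add: abs_mult)
    qed
    finally have up: "\<bar>\<beta> * (\<integral>y. (m y)\<^sup>2 \<partial>\<Lambda>)\<bar> \<le> \<dots>" .
    have "measure \<Lambda> (cball x (R / 2)) / 2 = (\<integral>y. 1 / 2 * indicator (cball x (R / 2)) y \<partial>\<Lambda>)"
      using \<Lambda>(2) by (simp add: sets_eq_imp_space_eq[OF \<Lambda>(2)])
    also have "\<dots> \<le> (\<integral>y. (m y)\<^sup>2 \<partial>\<Lambda>)"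
    proof (rule integral_mono[OF _ intm])
      show "integrable \<Lambda> (\<lambda>y. 1 / 2 * indicat_real (cball x (R / 2)) y)"
        using \<Lambda>(2) by (intro integrable_mult_right integrable_real_indicator) (auto simp: emeasure_eq_measure)
      show "1 / 2 * indicator (cball x (R / 2)) y \<le> (m y)\<^sup>2" for y using m_in[of y] by (auto simp: indicator_def)
    qed
    finally have low: "measure \<Lambda> (cball x (R / 2)) / 2 \<le> (\<integral>y. (m y)\<^sup>2 \<partial>\<Lambda>)" .
    have "\<bar>\<beta>\<bar> * (measure \<Lambda> (cball x (R / 2)) / 2) \<le> \<bar>\<beta>\<bar> * (\<integral>y. (m y)\<^sup>2 \<partial>\<Lambda>)"
      using low by (intro mult_left_mono) auto
    also have "\<dots> = \<bar>\<beta> * (\<integral>y. (m y)\<^sup>2 \<partial>\<Lambda>)\<bar>" by (simp add: abs_mult)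
    finally show ?thesis using up by (simp add: algebra_simps)
  qed
  obtain \<rho> where \<rho>: "0 < \<rho>" "cball x \<rho> \<subseteq> \<Omega>" using \<Omega> open_contains_cball by blast
  have small: "\<bar>\<beta>\<bar> * (c / 4) \<le> (10 + 4 * M * \<bar>C\<bar> + 4 * M) * e" if e: "0 < e" "e < 1" for e
  proof -
    have "\<forall>\<^sub>F R in at_right 0. A j R / R < e" for j
      using order_tendstoD(2)[OF leb e(1)] by (simp add: A_def)
    then have "\<forall>\<^sub>F R in at_right 0. \<forall>j. A j R / R < e" by (simp add: eventually_all_finite)
    moreover have "\<forall>\<^sub>F R in at_right 0. measure \<Lambda> (Z e R) / R < e"
      using order_tendstoD(2)[OF cone[OF e] e(1)] by (simp add: Z_def n_def)
    ultimately have "\<forall>\<^sub>F R in at_right 0. (\<forall>j. A j R / R < e) \<and> measure \<Lambda> (Z e R) / R < e"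
      by eventually_elim simp
    then obtain d where d: "0 < d" "\<And>R j. 0 < R \<Longrightarrow> R < d \<Longrightarrow> A j R / R < e"
        "\<And>R. 0 < R \<Longrightarrow> R < d \<Longrightarrow> measure \<Lambda> (Z e R) / R < e"
      unfolding eventually_at_right_field by auto
    obtain r where r: "0 < r" "r < min (d / 2) (min (\<rho> / 2) (\<delta>0 / 2))" "c * r \<le> measure \<Lambda> (cball x r)"
      using lower(2)[of "min (d / 2) (min (\<rho> / 2) (\<delta>0 / 2))"] d(1) \<rho>(1) upper(1) by auto
    \<comment> \<open>The lower bound on the mass is known only for some arbitrarily small radii.
      Such a radius is taken for the inner ball, on which the cutoff is bounded below, while all
      upper estimates hold at every small scale.\<close>
    define R where "R = 2 * r"
    have R: "0 < R" "R < d" "R < \<rho>" "R < \<delta>0" "R / 2 = r" using r by (auto simp: R_def)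
    have "cball x R \<subseteq> \<Omega>" using \<rho> R by (meson cball_subset_cball_iff dual_order.trans less_imp_le subset_cball)
    note mn = main[OF R(1) this e(1)]
    have Aj: "A j R \<le> e * R" for j using d(2)[OF R(1,2), of j] R(1) by (simp add: pos_divide_less_eq)
    have ZR: "measure \<Lambda> (Z e R) \<le> e * R" using d(3)[OF R(1,2)] R(1) by (simp add: pos_divide_less_eq)
    have CR: "measure \<Lambda> (cball x R) \<le> \<bar>C\<bar> * R"
      using upper(2)[OF R(1,4)] mult_right_mono[OF abs_ge_self[of C], of R] R(1) by linarith
    have "\<bar>\<beta>\<bar> * (c / 4) * R = \<bar>\<beta>\<bar> * (c * r / 2)" by (simp add: R_def)
    also have "\<dots> \<le> \<bar>\<beta>\<bar> * (measure \<Lambda> (cball x (R / 2)) / 2)"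
      using r(3) unfolding R(5) by (intro mult_left_mono) auto
    also have "\<dots> \<le> 5 * (\<Sum>j\<in>UNIV. A j R) + 4 * M * e * measure \<Lambda> (cball x R) + 4 * M * measure \<Lambda> (Z e R)"
      by (rule mn)
    also have "\<dots> \<le> 5 * (\<Sum>j\<in>(UNIV :: 2 set). e * R) + 4 * M * e * (\<bar>C\<bar> * R) + 4 * M * (e * R)"
      using Aj ZR CR M0 e by (intro add_mono mult_left_mono sum_mono) auto
    also have "\<dots> = (10 + 4 * M * \<bar>C\<bar> + 4 * M) * e * R" by (simp add: algebra_simps)
    finally show ?thesis using R(1) by simp
  qed
  have "\<bar>\<beta>\<bar> * (c / 4) \<le> 0"
  proof (rule field_le_epsilon)
    fix e :: real assume e: "0 < e"
    define B where "B = 10 + 4 * M * \<bar>C\<bar> + 4 * M"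
    have B: "0 < B" using M0 by (simp add: B_def add_pos_nonneg)
    define e' where "e' = min (1 / 2) (e / B)"
    have "0 < e'" "e' < 1" using e B by (auto simp: e'_def)
    from small[OF this] have "\<bar>\<beta>\<bar> * (c / 4) \<le> B * e'" by (simp add: B_def)
    also have "\<dots> \<le> B * (e / B)" using B by (intro mult_left_mono) (auto simp: e'_def)
    finally show "\<bar>\<beta>\<bar> * (c / 4) \<le> 0 + e" using B by simp
  qed
  then have "\<beta> = 0" using lower(1) by (simp add: mult_le_0_iff)
  then show ?thesis by (simp add: \<beta>_def n_def)
qed

section \<open>Limit measures\<close>

text \<open>Needed for densities built from the tangent field \<open>e\<close>, whose measurability
  enters only through almost everywhere agreement with a Borel function.\<close>

lemma borel_measurable_completion_AE:
  fixes f g :: "'a \<Rightarrow> 'b::topological_space"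
  assumes g: "g \<in> borel_measurable M" and ae: "AE x in M. f x = g x"
  shows "f \<in> borel_measurable (completion M)"
proof (rule measurableI)
  obtain N where N: "N \<in> null_sets M" "{x\<in>space M. f x \<noteq> g x} \<subseteq> N"
    using ae by (auto elim!: AE_E)
  fix B :: "'b set" assume B: "B \<in> sets borel"
  have 0: "f -` B \<inter> space M = (g -` B \<inter> space M - N) \<union> (f -` B \<inter> space M \<inter> N)"
    using N(2) by auto
  have 1: "g -` B \<inter> space M - N \<in> sets (completion M)"
    using measurable_sets[OF g B] N(1) by (intro sets_completionI_sets) auto
  have 2: "f -` B \<inter> space M \<inter> N \<in> sets (completion M)"
    by (rule completion.complete[of _ N]) (use N(1) in \<open>auto intro: null_sets_completionI\<close>)
  show "f -` B \<inter> space (completion M) \<in> sets (completion M)"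
    unfolding space_completion by (subst 0) (rule sets.Un[OF 1 2])
qed simp

text \<open>Weak convergence tests only compactly supported functions, so mass may escape to the
  boundary but none is created. Cutoffs equal to 1 on \<open>K j\<close> and supported in the
  slightly larger compact \<open>L j\<close> give the bound on \<open>K j\<close>, and the
  \<open>K j\<close> increase to \<open>\<Omega>\<close>.\<close>

lemma weak_limit_mass_le:
  fixes \<Omega> :: "(real^'n::finite) set"
  assumes \<Omega>: "open \<Omega>" "bounded \<Omega>" and w: "weakly_converges \<Omega> g \<nu>"
    and g0: "\<And>n x. 0 \<le> g n x"
    and mass: "\<And>n. (\<integral>\<^sup>+x. ennreal (g n x) \<partial>lebesgue_on \<Omega>) \<le> ennreal M" and M: "0 \<le> M"
  shows "emeasure \<nu> \<Omega> \<le> ennreal M"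
proof -
  have s\<nu>: "sets \<nu> = sets (restrict_space borel \<Omega>)" and fin: "\<And>K. compact K \<Longrightarrow> K \<subseteq> \<Omega> \<Longrightarrow> emeasure \<nu> K < \<infinity>"
    and lim: "\<And>\<phi>. \<phi> \<in> Cc \<Omega> \<Longrightarrow> (\<lambda>n. \<integral>x. \<phi> x * g n x \<partial>lebesgue_on \<Omega>) \<longlonglongrightarrow> (\<integral>x. \<phi> x \<partial>\<nu>)"
    using w by (auto simp: weakly_converges_def radon_measure_on_def)
  define d where "d x = infdist x (- \<Omega>)" for x
  have cd: "continuous_on UNIV d" unfolding d_def by (intro continuous_intros)
  have d0: "d x = 0" if "x \<notin> \<Omega>" for x using that by (simp add: d_def)
  define K where "K j = {x. 2 / real (Suc j) \<le> d x}" for j :: nat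
  define L where "L j = {x. 1 / real (Suc j) \<le> d x}" for j :: nat
  define \<phi> where "\<phi> j x = min 1 (max 0 (real (Suc j) * d x - 1))" for j x
  have L: "compact (L j)" "L j \<subseteq> \<Omega>" for j
  proof -
    show sub: "L j \<subseteq> \<Omega>" using d0 by (force simp: L_def)
    have "closed (L j)" unfolding L_def by (intro closed_Collect_le continuous_intros cd)
    then show "compact (L j)" using bounded_subset[OF \<Omega>(2) sub] by (simp add: compact_eq_bounded_closed)
  qed
  have KL: "K j \<subseteq> L j" for j
  proof
    fix x assume "x \<in> K j"
    moreover have "1 / real (Suc j) \<le> 2 / real (Suc j)" by (intro divide_right_mono) auto
    ultimately show "x \<in> L j" unfolding K_def L_def by simp
  qed
  have cK: "closed (K j)" for j unfolding K_def by (intro closed_Collect_le continuous_intros cd)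
  have c\<phi>: "continuous_on UNIV (\<phi> j)" for j unfolding \<phi>_def by (intro continuous_intros cd)
  have \<phi>01: "0 \<le> \<phi> j x" "\<phi> j x \<le> 1" for j x by (auto simp: \<phi>_def)
  have \<phi>0: "\<phi> j x = 0" if "x \<notin> L j" for j x
  proof -
    have "d x < 1 / real (Suc j)" using that by (simp add: L_def)
    then have "real (Suc j) * d x < 1" by (simp add: field_simps)
    then show ?thesis by (simp add: \<phi>_def)
  qed
  have \<phi>1: "\<phi> j x = 1" if "x \<in> K j" for j x
  proof -
    have "2 / real (Suc j) \<le> d x" using that by (simp add: K_def)
    then have "2 \<le> real (Suc j) * d x" by (simp add: field_simps)
    then show ?thesis by (simp add: \<phi>_def)
  qed
  have \<phi>C: "\<phi> j \<in> Cc \<Omega>" for j 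
    unfolding Cc_def by (intro CollectI conjI exI[of _ "L j"] allI impI c\<phi> L \<phi>0)
  have in_\<nu>: "X \<inter> \<Omega> \<in> sets \<nu>" if "X \<in> sets borel" for X
    using that by (auto simp: s\<nu> sets_restrict_space)
  have K\<nu>: "K j \<in> sets \<nu>" and L\<nu>: "L j \<in> sets \<nu>" for j
    using in_\<nu>[of "K j"] in_\<nu>[of "L j"] KL[of j] L[of j] cK[of j]
    by (auto simp: Int_absorb2 compact_imp_closed dest: order_trans)
  have m\<phi>: "\<phi> j \<in> borel_measurable \<nu>" for j
    unfolding measurable_cong_sets[OF s\<nu> refl]
    by (rule measurable_restrict_space1[OF borel_measurable_continuous_onI[OF c\<phi>]])
  have i\<phi>: "integrable \<nu> (\<phi> j)" for j
  proof (rule Bochner_Integration.integrable_bound)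
    show "integrable \<nu> (indicat_real (L j))"
      using L\<nu> fin[OF L] by (intro integrable_real_indicator) auto
    have "norm (\<phi> j x) \<le> norm (indicat_real (L j) x)" for x
      using \<phi>01[of j x] \<phi>0[of x j] by (auto simp: indicator_def)
    then show "AE x in \<nu>. norm (\<phi> j x) \<le> norm (indicat_real (L j) x)" by simp
  qed (rule m\<phi>)
  have "emeasure \<nu> (K j) \<le> ennreal M" for j
  proof -
    have "(\<integral>x. \<phi> j x * g n x \<partial>lebesgue_on \<Omega>) \<le> M" for n
    proof (cases "integrable (lebesgue_on \<Omega>) (\<lambda>x. \<phi> j x * g n x)")
      case True
      have "ennreal (norm (\<integral>x. \<phi> j x * g n x \<partial>lebesgue_on \<Omega>)) \<le> (\<integral>\<^sup>+x. norm (\<phi> j x * g n x) \<partial>lebesgue_on \<Omega>)"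
        by (rule integral_norm_bound_ennreal[OF True])
      also have "\<dots> \<le> (\<integral>\<^sup>+x. ennreal (g n x) \<partial>lebesgue_on \<Omega>)"
        using \<phi>01[of j] g0[of n] by (intro nn_integral_mono ennreal_leI) (auto simp: abs_mult mult_left_le_one_le)
      also have "\<dots> \<le> ennreal M" by (rule mass)
      finally have "norm (\<integral>x. \<phi> j x * g n x \<partial>lebesgue_on \<Omega>) \<le> M" using M by (simp add: ennreal_le_iff)
      then show ?thesis by simp
    qed (use M in \<open>simp add: not_integrable_integral_eq\<close>)
    then have le: "(\<integral>x. \<phi> j x \<partial>\<nu>) \<le> M" by (intro LIMSEQ_le_const2[OF lim[OF \<phi>C]]) auto
    have "emeasure \<nu> (K j) = (\<integral>\<^sup>+x. indicator (K j) x \<partial>\<nu>)" using K\<nu> by simp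
    also have "\<dots> \<le> (\<integral>\<^sup>+x. ennreal (\<phi> j x) \<partial>\<nu>)"
      using \<phi>1 by (intro nn_integral_mono) (auto simp: indicator_def)
    also have "\<dots> = ennreal (\<integral>x. \<phi> j x \<partial>\<nu>)" using \<phi>01 by (intro nn_integral_eq_integral i\<phi>) auto
    also have "\<dots> \<le> ennreal M" using le by (rule ennreal_leI)
    finally show ?thesis .
  qed
  then have "(SUP j. emeasure \<nu> (K j)) \<le> ennreal M" by (intro SUP_least)
  moreover have "(SUP j. emeasure \<nu> (K j)) = emeasure \<nu> (\<Union>j. K j)"
  proof (rule SUP_emeasure_incseq)
    show "incseq K"
    proof (rule incseq_SucI, rule subsetI)
      fix j x assume "x \<in> K j"
      moreover have "2 / real (Suc (Suc j)) \<le> 2 / real (Suc j)" by (intro divide_left_mono) auto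
      ultimately show "x \<in> K (Suc j)" unfolding K_def by simp
    qed
  qed (use K\<nu> in auto)
  moreover have "(\<Union>j. K j) = \<Omega>"
  proof
    show "(\<Union>j. K j) \<subseteq> \<Omega>" using KL L(2) by blast
    show "\<Omega> \<subseteq> (\<Union>j. K j)"
    proof
      fix x assume x: "x \<in> \<Omega>"
      \<comment> \<open>\<open>infdist\<close> to the empty set is 0 by convention, so a positive
        distance presupposes a nonempty complement; boundedness of \<open>\<Omega>\<close> provides
        it.\<close>
      have "- \<Omega> \<noteq> {}" 
      proof
        assume "- \<Omega> = {}"
        then have "\<Omega> = UNIV" by blast
        then show False using \<Omega>(2) not_bounded_UNIV[where 'a = "real^'n"] by simp
      qed
      then have "0 < d x" unfolding d_def using x \<Omega>(1) by (intro infdist_pos_not_in_closed) auto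
      then obtain j where "inverse (real (Suc j)) < d x / 2" using reals_Archimedean[of "d x / 2"] by auto
      then have "x \<in> K j" by (simp add: K_def inverse_eq_divide field_simps)
      then show "x \<in> (\<Union>j. K j)" by blast
    qed
  qed
  ultimately show ?thesis by simp
qed

text \<open>Moving negative parts across, the sum of \<open>P\<close> and the measure with density
  \<open>hm\<close> equals the sum of \<open>N\<close> and the measure with density
  \<open>hp\<close>. These are positive measures, so equality on sets extends to nonnegative
  functions; real bounded functions follow by adding a constant.\<close>

lemma signed_density_integral:
  fixes h \<phi> :: "'a \<Rightarrow> real"
  assumes P: "finite_measure P" "sets P = sets M" and N: "finite_measure N" "sets N = sets M"
    and h: "integrable M h" and eq: "\<And>A. A \<in> sets M \<Longrightarrow> measure P A - measure N A = (\<integral>x. indicator A x * h x \<partial>M)"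
    and \<phi>: "\<phi> \<in> borel_measurable M" "\<And>x. \<bar>\<phi> x\<bar> \<le> C"
  shows "(\<integral>x. \<phi> x \<partial>P) - (\<integral>x. \<phi> x \<partial>N) = (\<integral>x. \<phi> x * h x \<partial>M)"
proof -
  interpret P: finite_measure P by fact
  interpret N: finite_measure N by fact
  define hp hm where "hp x = max 0 (h x)" and "hm x = max 0 (- h x)" for x
  have hpm: "h x = hp x - hm x" "0 \<le> hp x" "0 \<le> hm x" for x by (auto simp: hp_def hm_def)
  have hm_meas: "h \<in> borel_measurable M" using h by auto
  have ihp: "integrable M (\<lambda>x. a x * hp x)" and ihm: "integrable M (\<lambda>x. a x * hm x)"
    if "a \<in> borel_measurable M" "\<And>x. \<bar>a x\<bar> \<le> B" for a B
  proof -
    have "integrable M hp" "integrable M hm" unfolding hp_def hm_def using h by auto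
    from integrable_mult_bounded[OF this(1) that] integrable_mult_bounded[OF this(2) that]
    show "integrable M (\<lambda>x. a x * hp x)" "integrable M (\<lambda>x. a x * hm x)" by simp_all
  qed
  have meas_hp: "hp \<in> borel_measurable M" "hm \<in> borel_measurable M"
    unfolding hp_def hm_def using hm_meas by auto
  \<comment> \<open>The rearranged identity contains only sums, so extended nonnegative integrals
    can be used without subtraction.\<close>
  have nn: "(\<integral>\<^sup>+x. f x \<partial>P) + (\<integral>\<^sup>+x. f x * ennreal (hm x) \<partial>M) = (\<integral>\<^sup>+x. f x \<partial>N) + (\<integral>\<^sup>+x. f x * ennreal (hp x) \<partial>M)"
    if "f \<in> borel_measurable M" for f
    using that
  proof (induction rule: borel_measurable_induct)
    case (cong f g)
    have "(\<integral>\<^sup>+x. f x \<partial>P) = (\<integral>\<^sup>+x. g x \<partial>P)" "(\<integral>\<^sup>+x. f x \<partial>N) = (\<integral>\<^sup>+x. g x \<partial>N)"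
      using cong.hyps(3) sets_eq_imp_space_eq[OF P(2)] sets_eq_imp_space_eq[OF N(2)] by (auto intro!: nn_integral_cong)
    moreover have "(\<integral>\<^sup>+x. f x * ennreal (hp x) \<partial>M) = (\<integral>\<^sup>+x. g x * ennreal (hp x) \<partial>M)"
      "(\<integral>\<^sup>+x. f x * ennreal (hm x) \<partial>M) = (\<integral>\<^sup>+x. g x * ennreal (hm x) \<partial>M)"
      using cong.hyps(3) by (auto intro!: nn_integral_cong)
    ultimately show ?case using cong.IH by simp
  next
    case (set A)
    have e: "(\<integral>\<^sup>+x. indicator A x * ennreal (k x) \<partial>M) = ennreal (\<integral>x. indicator A x * k x \<partial>M)"
      if "integrable M (\<lambda>x. indicator A x * k x)" "\<And>x. 0 \<le> k x" for k :: "'a \<Rightarrow> real"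
      using that by (subst nn_integral_eq_integral[symmetric]) (auto intro!: nn_integral_cong simp: indicator_def)
    have i: "integrable M (\<lambda>x. indicator A x * hp x)" "integrable M (\<lambda>x. indicator A x * hm x)"
      using set by (auto intro!: ihp[of _ 1] ihm[of _ 1] simp: indicator_def)
    have "measure P A - measure N A = (\<integral>x. indicator A x * hp x \<partial>M) - (\<integral>x. indicator A x * hm x \<partial>M)"
      unfolding eq[OF set] Bochner_Integration.integral_diff[OF i, symmetric]
      by (intro Bochner_Integration.integral_cong[OF refl]) (simp add: hpm(1) right_diff_distrib)
    then have "measure P A + (\<integral>x. indicator A x * hm x \<partial>M) = measure N A + (\<integral>x. indicator A x * hp x \<partial>M)" by simp
    then have "ennreal (measure P A) + ennreal (\<integral>x. indicator A x * hm x \<partial>M) =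
        ennreal (measure N A) + ennreal (\<integral>x. indicator A x * hp x \<partial>M)"
      using hpm by (simp add: ennreal_plus[symmetric] integral_nonneg_AE del: ennreal_plus)
    then show ?case
      using set P(2) N(2) by (simp add: e[OF i(1) hpm(2)] e[OF i(2) hpm(3)] P.emeasure_eq_measure N.emeasure_eq_measure)
  next
    case (mult u c)
    have u: "u \<in> borel_measurable P" "u \<in> borel_measurable N"
      using mult.hyps unfolding measurable_cong_sets[OF P(2) refl] measurable_cong_sets[OF N(2) refl] by auto
    show ?case
      using mult.IH mult.hyps u meas_hp by (simp add: nn_integral_cmult mult.assoc distrib_left[symmetric])
  next
    case (add u v)
    have uv: "u \<in> borel_measurable P" "u \<in> borel_measurable N" "v \<in> borel_measurable P" "v \<in> borel_measurable N"
      using add.hyps unfolding measurable_cong_sets[OF P(2) refl] measurable_cong_sets[OF N(2) refl] by auto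
    have "(\<integral>\<^sup>+x. v x + u x \<partial>P) + (\<integral>\<^sup>+x. (v x + u x) * ennreal (hm x) \<partial>M) =
       ((\<integral>\<^sup>+x. v x \<partial>P) + (\<integral>\<^sup>+x. v x * ennreal (hm x) \<partial>M)) + ((\<integral>\<^sup>+x. u x \<partial>P) + (\<integral>\<^sup>+x. u x * ennreal (hm x) \<partial>M))"
      using add.hyps uv meas_hp by (simp add: nn_integral_add distrib_right add_ac)
    also have "\<dots> = (\<integral>\<^sup>+x. v x + u x \<partial>N) + (\<integral>\<^sup>+x. (v x + u x) * ennreal (hp x) \<partial>M)"
      unfolding add.IH using add.hyps uv meas_hp by (simp add: nn_integral_add distrib_right add_ac)
    finally show ?case .
  next
    case (seq U)
    have U: "U i \<in> borel_measurable P" "U i \<in> borel_measurable N" for i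
      using seq.hyps unfolding measurable_cong_sets[OF P(2) refl] measurable_cong_sets[OF N(2) refl] by auto
    have inc: "incseq (\<lambda>i x. U i x * ennreal (k x))" for k :: "'a \<Rightarrow> real"
      using seq.hyps(3) by (auto simp: incseq_def le_fun_def intro!: mult_right_mono)
    have lim: "(\<integral>\<^sup>+x. (SUP i. U i) x \<partial>Q) = (SUP i. \<integral>\<^sup>+x. U i x \<partial>Q)" if "\<And>i. U i \<in> borel_measurable Q" for Q
      unfolding SUP_apply by (rule nn_integral_monotone_convergence_SUP[OF seq.hyps(3) that])
    have lim': "(\<integral>\<^sup>+x. (SUP i. U i) x * ennreal (k x) \<partial>M) = (SUP i. \<integral>\<^sup>+x. U i x * ennreal (k x) \<partial>M)"
      if "k \<in> borel_measurable M" for k :: "'a \<Rightarrow> real"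
      unfolding SUP_apply SUP_mult_right_ennreal
      using seq.hyps that by (intro nn_integral_monotone_convergence_SUP[OF inc]) auto
    have mono: "incseq (\<lambda>i. \<integral>\<^sup>+x. U i x \<partial>Q)" "incseq (\<lambda>i. \<integral>\<^sup>+x. U i x * ennreal (k x) \<partial>Q)" for Q and k :: "'a \<Rightarrow> real"
      using seq.hyps(3) inc[of k] by (auto simp: incseq_def le_fun_def intro!: nn_integral_mono)
    show ?case
      unfolding lim[OF U(1)] lim[OF U(2)] lim'[OF meas_hp(1)] lim'[OF meas_hp(2)]
        ennreal_SUP_add[OF mono, symmetric] using seq.IH by simp
  qed
  have real_eq: "(\<integral>x. f x \<partial>P) + (\<integral>x. f x * hm x \<partial>M) = (\<integral>x. f x \<partial>N) + (\<integral>x. f x * hp x \<partial>M)"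
    if f: "f \<in> borel_measurable M" "\<And>x. 0 \<le> f x" "\<And>x. f x \<le> B" for f B
  proof -
    have B: "\<bar>f x\<bar> \<le> B" for x using f(2,3)[of x] by simp
    have iP: "integrable P f" "integrable N f"
      using f B unfolding measurable_cong_sets[OF P(2), of borel borel, OF refl, symmetric]
      by (auto intro!: P.integrable_const_bound[of _ B] N.integrable_const_bound[of _ B]
          simp: measurable_cong_sets[OF P(2) refl] measurable_cong_sets[OF N(2) refl])
    note i = ihp[OF f(1) B] ihm[OF f(1) B]
    have "(\<integral>\<^sup>+x. ennreal (f x) \<partial>P) = ennreal (\<integral>x. f x \<partial>P)" "(\<integral>\<^sup>+x. ennreal (f x) \<partial>N) = ennreal (\<integral>x. f x \<partial>N)"
      using f by (auto intro!: nn_integral_eq_integral iP)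
    moreover have "(\<integral>\<^sup>+x. ennreal (f x) * ennreal (hp x) \<partial>M) = ennreal (\<integral>x. f x * hp x \<partial>M)"
      "(\<integral>\<^sup>+x. ennreal (f x) * ennreal (hm x) \<partial>M) = ennreal (\<integral>x. f x * hm x \<partial>M)"
      using f hpm i by (subst nn_integral_eq_integral[symmetric]; auto simp: ennreal_mult intro!: mult_nonneg_nonneg)+
    moreover have "(\<lambda>x. ennreal (f x)) \<in> borel_measurable M" using f by simp
    ultimately have "ennreal (\<integral>x. f x \<partial>P) + ennreal (\<integral>x. f x * hm x \<partial>M) = ennreal (\<integral>x. f x \<partial>N) + ennreal (\<integral>x. f x * hp x \<partial>M)"
      using nn[of "\<lambda>x. ennreal (f x)"] by simp
    then show ?thesis
      using f hpm by (simp add: ennreal_plus[symmetric] integral_nonneg_AE add_nonneg_nonneg del: ennreal_plus)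
  qed
  have C0: "0 \<le> C" using \<phi>(2)[of undefined] by linarith
  have bnd: "0 \<le> \<phi> x + C" "\<phi> x + C \<le> 2 * C" for x using \<phi>(2)[of x] by linarith+
  \<comment> \<open>The identity for the nonnegative function \<open>\<phi> x + C\<close> minus the
    identity for the constant \<open>C\<close> gives the one for \<open>\<phi>\<close>.\<close>
  have r1: "(\<integral>x. \<phi> x + C \<partial>P) + (\<integral>x. (\<phi> x + C) * hm x \<partial>M) = (\<integral>x. \<phi> x + C \<partial>N) + (\<integral>x. (\<phi> x + C) * hp x \<partial>M)"
    by (rule real_eq[where B = "2 * C"]) (use \<phi> bnd in auto)
  have r2: "(\<integral>x. C \<partial>P) + (\<integral>x. C * hm x \<partial>M) = (\<integral>x. C \<partial>N) + (\<integral>x. C * hp x \<partial>M)"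
    by (rule real_eq[where B = C]) (use C0 in auto)
  have i\<phi>: "integrable P \<phi>" "integrable N \<phi>"
  proof -
    have "\<phi> \<in> borel_measurable P" "\<phi> \<in> borel_measurable N"
      using \<phi>(1) unfolding measurable_cong_sets[OF P(2) refl] measurable_cong_sets[OF N(2) refl] by auto
    then show "integrable P \<phi>" "integrable N \<phi>"
      using \<phi>(2) by (auto intro!: P.integrable_const_bound[of _ C] N.integrable_const_bound[of _ C])
  qed
  note j = ihp[OF \<phi>] ihm[OF \<phi>] ihp[of "\<lambda>_. C" C] ihm[of "\<lambda>_. C" C]
  have "(\<integral>x. \<phi> x \<partial>P) + (\<integral>x. \<phi> x * hm x \<partial>M) = (\<integral>x. \<phi> x \<partial>N) + (\<integral>x. \<phi> x * hp x \<partial>M)"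
    using r1 r2 i\<phi> j C0 by (simp add: distrib_right)
  moreover have "(\<integral>x. \<phi> x * h x \<partial>M) = (\<integral>x. \<phi> x * hp x \<partial>M) - (\<integral>x. \<phi> x * hm x \<partial>M)"
    unfolding Bochner_Integration.integral_diff[OF j(1,2), symmetric]
    by (intro Bochner_Integration.integral_cong[OF refl]) (simp add: hpm(1) right_diff_distrib)
  ultimately show ?thesis by simp
qed

text \<open>A point of \<open>\<Omega>\<close> outside the set has a small radius with mass ratio
  below \<open>\<eta>\<close>. Clearing-out then removes all mass from the half ball, so every point
  in its interior has vanishing lower density and lies outside the set as well.\<close>

lemma concentration_set_closed:
  assumes \<Omega>: "open \<Omega>"
    and clear: "\<And>x r. 0 < r \<Longrightarrow> ball x r \<subseteq> \<Omega> \<Longrightarrow> emeasure \<nu> (cball x r \<inter> \<Omega>) < ennreal (\<eta> * r) \<Longrightarrow>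
      emeasure \<nu> (cball x (r / 2) \<inter> \<Omega>) = 0"
    and \<nu>: "sets \<nu> = sets (restrict_space borel \<Omega>)" and \<eta>: "0 < \<eta>"
  shows "open (\<Omega> - concentration_set \<Omega> \<eta> \<nu>)"
  unfolding open_contains_ball
proof
  fix x assume x: "x \<in> \<Omega> - concentration_set \<Omega> \<eta> \<nu>"
  then have "\<not> ennreal \<eta> \<le> Liminf (at_right 0) (\<lambda>r. emeasure \<nu> (cball x r \<inter> \<Omega>) / ennreal r)"
    by (auto simp: concentration_set_def)
  then obtain y where y: "y < ennreal \<eta>" "\<not> (\<forall>\<^sub>F r in at_right 0. y < emeasure \<nu> (cball x r \<inter> \<Omega>) / ennreal r)"
    unfolding le_Liminf_iff by blast
  obtain e where e: "0 < e" "ball x e \<subseteq> \<Omega>" using \<Omega> x open_contains_ball by blast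
  have "\<forall>\<^sub>F r in at_right (0::real). 0 < r \<and> r < e"
    using e(1) unfolding eventually_at_right_field by blast
  then have "\<exists>r. (0 < r \<and> r < e) \<and> \<not> y < emeasure \<nu> (cball x r \<inter> \<Omega>) / ennreal r"
    using y(2) eventually_mono by (metis (mono_tags, lifting))
  then obtain r where r: "0 < r" "r < e" "emeasure \<nu> (cball x r \<inter> \<Omega>) / ennreal r \<le> y" by (auto simp: not_less)
  have "emeasure \<nu> (cball x r \<inter> \<Omega>) / ennreal r < ennreal \<eta>" using r(3) y(1) by (rule le_less_trans)
  then have "emeasure \<nu> (cball x r \<inter> \<Omega>) < ennreal \<eta> * ennreal r"
    using r(1) by (simp add: divide_less_ennreal)
  then have "emeasure \<nu> (cball x r \<inter> \<Omega>) < ennreal (\<eta> * r)" using \<eta> r(1) by (simp add: ennreal_mult)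
  moreover have "ball x r \<subseteq> \<Omega>" using e(2) r(2) by (meson less_imp_le order_trans subset_ball)
  ultimately have null: "emeasure \<nu> (cball x (r / 2) \<inter> \<Omega>) = 0" using clear r(1) by blast
  have "ball x (r / 2) \<subseteq> \<Omega> - concentration_set \<Omega> \<eta> \<nu>"
  proof
    fix z assume z: "z \<in> ball x (r / 2)"
    then have z\<Omega>: "z \<in> \<Omega>" using \<open>ball x r \<subseteq> \<Omega>\<close> r(1) by auto
    define \<rho> where "\<rho> = r / 2 - dist x z"
    have \<rho>: "0 < \<rho>" using z by (simp add: \<rho>_def)
    have zero: "emeasure \<nu> (cball z s \<inter> \<Omega>) = 0" if "s < \<rho>" for s
    proof -
      have "cball z s \<subseteq> cball x (r / 2)"
      proof
        fix w assume "w \<in> cball z s"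
        then show "w \<in> cball x (r / 2)" using that dist_triangle[of x w z] by (simp add: \<rho>_def)
      qed
      then have "emeasure \<nu> (cball z s \<inter> \<Omega>) \<le> emeasure \<nu> (cball x (r / 2) \<inter> \<Omega>)"
        by (intro emeasure_mono) (auto simp: \<nu> sets_restrict_space)
      then show ?thesis using null by simp
    qed
    have "\<not> ennreal \<eta> \<le> Liminf (at_right 0) (\<lambda>r. emeasure \<nu> (cball z r \<inter> \<Omega>) / ennreal r)"
    proof
      assume "ennreal \<eta> \<le> Liminf (at_right 0) (\<lambda>r. emeasure \<nu> (cball z r \<inter> \<Omega>) / ennreal r)"
      then have "\<forall>\<^sub>F r in at_right 0. 0 < emeasure \<nu> (cball z r \<inter> \<Omega>) / ennreal r"
        using \<eta> unfolding le_Liminf_iff by simp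
      moreover have "\<forall>\<^sub>F r in at_right (0::real). 0 < r \<and> r < \<rho>"
        using \<rho> unfolding eventually_at_right_field by blast
      ultimately have "\<forall>\<^sub>F r in at_right (0::real). False" by eventually_elim (simp add: zero)
      then show False by (simp add: trivial_limit_at_right_real)
    qed
    then show "z \<in> \<Omega> - concentration_set \<Omega> \<eta> \<nu>" using z\<Omega> by (simp add: concentration_set_def)
  qed
  then show "\<exists>e>0. ball x e \<subseteq> \<Omega> - concentration_set \<Omega> \<eta> \<nu>" using r(1) by (intro exI[of _ "r / 2"]) simp
qed

section \<open>Hausdorff measure restricted to the concentration set\<close>

lemma emeasure_density_hausdorff1:
  fixes S :: "'a::metric_space set"
  assumes "S \<in> sets borel" "X \<in> sets borel"
  shows "emeasure (density hausdorff1 (indicator S)) X = emeasure hausdorff1 (S \<inter> X)"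
  by (rule emeasure_restricted) (use assms in auto)

text \<open>Presents \<open>lam\<close> as the restriction to \<open>\<Omega>\<close> of a Borel
  measure on the whole plane, the setting of the density and blow-up lemmas, where balls need not be
  intersected with \<open>\<Omega>\<close>.\<close>

lemma hausdorff1_on_eq:
  assumes "\<Omega> \<in> sets borel" "S \<in> sets borel"
  shows "hausdorff1_on \<Omega> S = restrict_space (density hausdorff1 (indicator S)) \<Omega>"
proof (rule measure_eqI)
  show "sets (hausdorff1_on \<Omega> S) = sets (restrict_space (density hausdorff1 (indicator S)) \<Omega>)"
    by (simp add: hausdorff1_on_def sets_restrict_space)
  fix A assume "A \<in> sets (hausdorff1_on \<Omega> S)"
  then have A: "A \<in> sets (restrict_space hausdorff1 \<Omega>)" by (simp add: hausdorff1_on_def)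
  then have A': "A \<subseteq> \<Omega>" "A \<in> sets borel" using assms(1) by (auto simp: sets_restrict_space)
  have "emeasure (hausdorff1_on \<Omega> S) A = (\<integral>\<^sup>+x. indicator S x * indicator A x \<partial>restrict_space hausdorff1 \<Omega>)"
    unfolding hausdorff1_on_def
  proof (rule emeasure_density[OF _ A])
    have "S \<in> sets hausdorff1" using assms(2) by simp
    then show "indicator S \<in> borel_measurable (restrict_space hausdorff1 \<Omega>)"
      by (intro measurable_restrict_space1 borel_measurable_indicator)
  qed
  also have "\<dots> = (\<integral>\<^sup>+x. (indicator S x * indicator A x) * indicator \<Omega> x \<partial>hausdorff1)"
    using assms(1) by (intro nn_integral_restrict_space) auto
  also have "\<dots> = (\<integral>\<^sup>+x. indicator (S \<inter> A) x \<partial>hausdorff1)"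
    using A' by (intro nn_integral_cong) (auto simp: indicator_def)
  also have "\<dots> = emeasure hausdorff1 (S \<inter> A)"
    using A' assms by (intro nn_integral_indicator) auto
  also have "\<dots> = emeasure (restrict_space (density hausdorff1 (indicator S)) \<Omega>) A"
    using A' assms by (subst emeasure_restrict_space) (auto simp: emeasure_density_hausdorff1)
  finally show "emeasure (hausdorff1_on \<Omega> S) A = emeasure (restrict_space (density hausdorff1 (indicator S)) \<Omega>) A" .
qed

lemma AE_hausdorff1_on:
  assumes "\<Omega> \<in> sets borel" "S \<in> sets borel" "AE x in hausdorff1. Q x"
  shows "AE x in hausdorff1_on \<Omega> S. Q x"
proof -
  have "AE x in density hausdorff1 (indicator S). Q x"
    using assms by (subst AE_density) (auto elim: eventually_mono)
  then show ?thesis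
    using assms unfolding hausdorff1_on_eq[OF assms(1,2)]
    by (subst AE_restrict_space_iff) (auto elim: eventually_mono)
qed

text \<open>A positive upper density is a Limsup, so it yields a constant and arbitrarily small good
  radii, not an estimate at all small radii.\<close>

lemma approx_tangent_lower_density:
  fixes S :: "(real^2) set"
  assumes S: "S \<in> sets borel" and fin: "finite_measure (density hausdorff1 (indicator S))"
    and t: "approx_tangent S x \<tau>"
  shows "\<exists>c>0. \<forall>\<delta>>0. \<exists>r. 0 < r \<and> r < \<delta> \<and> c * r \<le> measure (density hausdorff1 (indicator S)) (cball x r)"
proof -
  let ?\<Lambda> = "density hausdorff1 (indicator S)"
  interpret finite_measure ?\<Lambda> by fact
  have E: "emeasure hausdorff1 (S \<inter> cball x r) = ennreal (measure ?\<Lambda> (cball x r))" for r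
    using emeasure_density_hausdorff1[OF S, of "cball x r"] by (simp add: emeasure_eq_measure)
  have "0 < Limsup (at_right 0) (\<lambda>r. emeasure hausdorff1 (S \<inter> cball x r) / ennreal (2 * r))"
    using t by (simp add: approx_tangent_def)
  then obtain y where y: "0 < y" "y < Limsup (at_right 0) (\<lambda>r. emeasure hausdorff1 (S \<inter> cball x r) / ennreal (2 * r))"
    using dense by blast
  have "y < top" using y(2) by (rule less_le_trans) simp
  then obtain c where c: "y = ennreal c" "0 < c" using y(1) by (cases y) auto
  have "\<exists>r. 0 < r \<and> r < \<delta> \<and> c * r \<le> measure ?\<Lambda> (cball x r)" if \<delta>: "0 < \<delta>" for \<delta>
  proof (rule ccontr)
    assume neg: "\<not> (\<exists>r. 0 < r \<and> r < \<delta> \<and> c * r \<le> measure ?\<Lambda> (cball x r))"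
    have "\<forall>\<^sub>F r in at_right 0. emeasure hausdorff1 (S \<inter> cball x r) / ennreal (2 * r) \<le> y"
      unfolding eventually_at_right_field
    proof (intro exI[of _ \<delta>] conjI allI impI \<delta>)
      fix r :: real assume r: "0 < r" "r < \<delta>"
      then have "measure ?\<Lambda> (cball x r) < c * r" using neg by (meson not_le)
      also have "\<dots> \<le> c * (2 * r)" using c r by simp
      finally have "measure ?\<Lambda> (cball x r) / (2 * r) \<le> c" using r by (simp add: pos_divide_le_eq)
      then show "emeasure hausdorff1 (S \<inter> cball x r) / ennreal (2 * r) \<le> y"
        using r by (simp add: E c(1) divide_ennreal ennreal_leI)
    qed
    from Limsup_bounded[OF this] y(2) show False by simp
  qed
  then show ?thesis using c(2) by blast
qed

lemma approx_tangent_cone: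
  fixes S :: "(real^2) set"
  assumes S: "S \<in> sets borel" and fin: "finite_measure (density hausdorff1 (indicator S))"
    and t: "approx_tangent S x \<tau>" and s: "0 < s" "s < 1"
  shows "((\<lambda>r. measure (density hausdorff1 (indicator S))
      (cball x r \<inter> {y. s * norm (y - x) \<le> \<bar>rot90 \<tau> \<bullet> (y - x)\<bar>}) / r) \<longlongrightarrow> 0) (at_right 0)"
proof -
  let ?\<Lambda> = "density hausdorff1 (indicator S)"
  interpret finite_measure ?\<Lambda> by fact
  let ?Z = "\<lambda>r. cball x r \<inter> {y. s * norm (y - x) \<le> \<bar>rot90 \<tau> \<bullet> (y - x)\<bar>}"
  have "closed {y. s * norm (y - x) \<le> \<bar>rot90 \<tau> \<bullet> (y - x)\<bar>}" by (intro closed_Collect_le continuous_intros)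
  then have Z: "?Z r \<in> sets borel" for r by auto
  have E: "emeasure hausdorff1 (S \<inter> cball x r \<inter> {y. s * norm (y - x) \<le> \<bar>rot90 \<tau> \<bullet> (y - x)\<bar>}) = ennreal (measure ?\<Lambda> (?Z r))" for r
    using emeasure_density_hausdorff1[OF S Z] by (simp add: emeasure_eq_measure Int_assoc)
  have "((\<lambda>r. ennreal (measure ?\<Lambda> (?Z r)) / ennreal r) \<longlongrightarrow> 0) (at_right 0)"
  proof -
    have "\<forall>s. 0 < s \<and> s < 1 \<longrightarrow> ((\<lambda>r. emeasure hausdorff1
        (S \<inter> cball x r \<inter> {y. s * norm (y - x) \<le> \<bar>rot90 \<tau> \<bullet> (y - x)\<bar>}) / ennreal r) \<longlongrightarrow> 0) (at_right 0)"
      using t unfolding approx_tangent_def by (elim conjE)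
    from this[THEN spec, THEN mp, OF conjI[OF s]] show ?thesis unfolding E .
  qed
  moreover have pos: "\<forall>\<^sub>F r in at_right (0::real). 0 < r" by (rule eventually_at_right_less)
  moreover have "\<forall>\<^sub>F r in at_right 0. ennreal (measure ?\<Lambda> (?Z r)) / ennreal r = ennreal (measure ?\<Lambda> (?Z r) / r)"
    using pos by eventually_elim (simp add: divide_ennreal)
  ultimately have "((\<lambda>r. ennreal (measure ?\<Lambda> (?Z r) / r)) \<longlongrightarrow> ennreal 0) (at_right 0)"
    by (simp add: tendsto_cong)
  then show ?thesis
    by (subst (asm) tendsto_ennreal_iff) (use pos in \<open>auto elim!: eventually_mono\<close>)
qed

text \<open>On this set the lower density of \<open>\<nu>\<close> is at least \<open>\<eta>\<close>,
  so the Vitali estimate with threshold \<open>\<eta> / 2\<close> bounds the length by a multiple of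
  the total mass. The measure \<open>P\<close> is \<open>\<nu>\<close> regarded as a Borel measure
  on the plane.\<close>

lemma hausdorff1_concentration_set_finite:
  fixes \<nu> :: "(real^2) measure"
  assumes \<nu>: "finite_measure \<nu>" "sets \<nu> = sets (restrict_space borel \<Omega>)" and \<eta>: "0 < \<eta>"
  shows "emeasure hausdorff1 (concentration_set \<Omega> \<eta> \<nu>) < \<infinity>"
proof -
  interpret \<nu>: finite_measure \<nu> by fact
  have sp: "space \<nu> = \<Omega>" using sets_eq_imp_space_eq[OF \<nu>(2)] by (simp add: space_restrict_space)
  have id: "(\<lambda>x. x) \<in> measurable \<nu> borel"
    unfolding measurable_cong_sets[OF \<nu>(2) refl] by (rule measurable_restrict_space1) simp
  define P where "P = distr \<nu> borel (\<lambda>x. x)"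
  have P: "finite_measure P" "sets P = sets borel"
    unfolding P_def by (rule \<nu>.finite_measure_distr[OF id]) simp
  have eP: "emeasure \<nu> (cball x r \<inter> \<Omega>) = ennreal (measure P (cball x r))" for x r
  proof -
    interpret P: finite_measure P by fact
    have "emeasure P (cball x r) = emeasure \<nu> (cball x r \<inter> \<Omega>)"
      unfolding P_def by (subst emeasure_distr[OF id]) (auto simp: sp vimage_def Int_def)
    then show ?thesis by (simp add: P.emeasure_eq_measure)
  qed
  have "hausdorff1_outer (concentration_set \<Omega> \<eta> \<nu>) \<le> ennreal (10 / (\<eta> / 2) * measure P UNIV)"
  proof (rule hausdorff1_outer_le_vitali[OF P open_UNIV subset_UNIV])
    show "0 < \<eta> / 2" using \<eta> by simp
    fix x and \<delta> :: real assume x: "x \<in> concentration_set \<Omega> \<eta> \<nu>" and \<delta>: "0 < \<delta>"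
    have lt: "ennreal (\<eta> / 2) < ennreal \<eta>" using \<eta> by (simp add: ennreal_less_iff)
    have "ennreal \<eta> \<le> Liminf (at_right 0) (\<lambda>r. emeasure \<nu> (cball x r \<inter> \<Omega>) / ennreal r)"
      using x by (simp add: concentration_set_def)
    then have "\<forall>\<^sub>F r in at_right 0. ennreal (\<eta> / 2) < emeasure \<nu> (cball x r \<inter> \<Omega>) / ennreal r"
      using lt unfolding le_Liminf_iff by blast
    moreover have "\<forall>\<^sub>F r in at_right (0::real). 0 < r \<and> r < \<delta>"
      using \<delta> unfolding eventually_at_right_field by blast
    ultimately have "\<forall>\<^sub>F r in at_right 0. 0 < r \<and> r < \<delta> \<and> \<eta> / 2 * r \<le> measure P (cball x r)"
    proof eventually_elim
      case (elim r)
      then have "ennreal (\<eta> / 2) < ennreal (measure P (cball x r) / r)" by (simp add: eP divide_ennreal)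
      then have "\<eta> / 2 < measure P (cball x r) / r" using \<eta> by (simp add: ennreal_less_iff)
      then show ?case using elim by (simp add: pos_less_divide_eq)
    qed
    from eventually_happens[OF this]
    show "\<exists>r. 0 < r \<and> r < \<delta> \<and> \<eta> / 2 * r \<le> measure P (cball x r)"
      by (simp add: trivial_limit_at_right_real)
  qed
  then show ?thesis
    using emeasure_hausdorff1_le[of "concentration_set \<Omega> \<eta> \<nu>"] by (auto intro: le_less_trans order_trans)
qed

section \<open>Limit measures through their densities\<close>

lemma Cc_bounded_measurable:
  assumes "\<phi> \<in> Cc \<Omega>" "sets M = sets (restrict_space borel \<Omega>)"
  shows "\<phi> \<in> borel_measurable M" "\<exists>C. \<forall>x. \<bar>\<phi> x\<bar> \<le> C"
proof -
  obtain K where K: "continuous_on UNIV \<phi>" "compact K" "\<And>x. x \<notin> K \<Longrightarrow> \<phi> x = 0"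
    using assms(1) unfolding Cc_def by blast
  show "\<phi> \<in> borel_measurable M"
    unfolding measurable_cong_sets[OF assms(2) refl]
    by (rule measurable_restrict_space1[OF borel_measurable_continuous_onI[OF K(1)]])
  show "\<exists>C. \<forall>x. \<bar>\<phi> x\<bar> \<le> C" using bounded_compact_support[OF K] by (metis real_norm_def)
qed

text \<open>The Jordan parts \<open>P\<close> and \<open>N\<close> in the definition of convergence
  and the density on the completion describe the same set function. Passing to the Borel
  representative \<open>f'\<close> expresses the limit as one integral against
  \<open>lam\<close>.\<close>

lemma signed_weak_limit_density:
  assumes w: "weakly_converges_signed \<Omega> g \<mu>" and d: "has_signed_density lam f \<mu>"
    and s: "sets lam = sets (restrict_space borel \<Omega>)"
    and f': "f' \<in> borel_measurable lam" "AE x in lam. f x = f' x" and \<phi>: "\<phi> \<in> Cc \<Omega>"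
  shows "(\<lambda>n. \<integral>x. \<phi> x * g n x \<partial>lebesgue_on \<Omega>) \<longlonglongrightarrow> (\<integral>x. \<phi> x * f' x \<partial>lam)"
proof -
  obtain P N where P: "finite_measure P" "sets P = sets lam" and N: "finite_measure N" "sets N = sets lam"
    and \<mu>: "\<And>A. A \<in> sets lam \<Longrightarrow> \<mu> A = measure P A - measure N A"
    and lim: "(\<lambda>n. \<integral>x. \<phi> x * g n x \<partial>lebesgue_on \<Omega>) \<longlonglongrightarrow> (\<integral>x. \<phi> x \<partial>P) - (\<integral>x. \<phi> x \<partial>N)"
    using w \<phi> unfolding weakly_converges_signed_def s by blast
  have aec: "AE x in completion lam. f x = f' x" using f'(2) by (rule AE_completion)
  have i: "integrable (completion lam) f" and \<mu>d: "\<And>A. A \<in> sets lam \<Longrightarrow> \<mu> A = density_measure lam f A"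
    using d by (auto simp: has_signed_density_def)
  have "integrable (completion lam) f'"
    using i aec borel_measurable_integrable[OF i] measurable_completion[OF f'(1)]
    by (subst (asm) integrable_cong_AE) auto
  then have i': "integrable lam f'" using f'(1) by (simp add: integrable_completion)
  have eq: "measure P A - measure N A = (\<integral>x. indicator A x * f' x \<partial>lam)" if A: "A \<in> sets lam" for A
  proof -
    have "measure P A - measure N A = (\<integral>x. indicator A x *\<^sub>R f x \<partial>completion lam)"
      using \<mu>[OF A] \<mu>d[OF A] by (simp add: density_measure_def set_lebesgue_integral_def)
    also have "\<dots> = (\<integral>x. indicator A x *\<^sub>R f' x \<partial>completion lam)"
    proof (rule integral_cong_AE)
      have "indicat_real A \<in> borel_measurable (completion lam)" using A by (intro borel_measurable_indicator) auto
      then show "(\<lambda>x. indicator A x *\<^sub>R f x) \<in> borel_measurable (completion lam)"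
        "(\<lambda>x. indicator A x *\<^sub>R f' x) \<in> borel_measurable (completion lam)"
        using borel_measurable_integrable[OF i] measurable_completion[OF f'(1)] by auto
      show "AE x in completion lam. indicator A x *\<^sub>R f x = indicator A x *\<^sub>R f' x"
        using aec by eventually_elim simp
    qed
    also have "\<dots> = (\<integral>x. indicator A x *\<^sub>R f' x \<partial>lam)"
      using A f'(1) by (intro integral_completion) auto
    finally show ?thesis by simp
  qed
  obtain C where "\<And>x. \<bar>\<phi> x\<bar> \<le> C" using Cc_bounded_measurable(2)[OF \<phi> s] by blast
  from signed_density_integral[OF P N i' eq Cc_bounded_measurable(1)[OF \<phi> s] this] lim show ?thesis by simp
qed

lemma has_signed_density_representative:
  assumes "has_signed_density lam f \<mu>"
  obtains f' where "f' \<in> borel_measurable lam" "AE x in lam. f x = f' x" "integrable lam f'"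
proof -
  have i: "integrable (completion lam) f" using assms by (simp add: has_signed_density_def)
  obtain f' where f': "f' \<in> borel_measurable lam" "AE x in lam. f x = f' x"
    using completion_ex_borel_measurable_real[OF borel_measurable_integrable[OF i]] by blast
  have "integrable (completion lam) f'"
    using i AE_completion[OF f'(2)] borel_measurable_integrable[OF i] measurable_completion[OF f'(1)]
    by (subst (asm) integrable_cong_AE) auto
  then have "integrable lam f'" using f'(1) by (simp add: integrable_completion)
  with f' show ?thesis by (rule that)
qed

lemma density_measure_AE:
  assumes g: "integrable lam g" and ae: "AE x in lam. f x = g x"
  shows "integrable (completion lam) f" and "A \<in> sets lam \<Longrightarrow> density_measure lam f A = (\<integral>x. indicator A x * g x \<partial>lam)"
proof -
  have gm: "g \<in> borel_measurable lam" using g by auto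
  have fm: "f \<in> borel_measurable (completion lam)" by (rule borel_measurable_completion_AE[OF gm ae])
  have aec: "AE x in completion lam. f x = g x" using ae by (rule AE_completion)
  have "integrable (completion lam) g" using g gm by (simp add: integrable_completion)
  then show "integrable (completion lam) f"
    using aec fm measurable_completion[OF gm] by (subst integrable_cong_AE[of f _ g]) auto
  assume A: "A \<in> sets lam"
  have "density_measure lam f A = (\<integral>x. indicator A x *\<^sub>R f x \<partial>completion lam)"
    by (simp add: density_measure_def set_lebesgue_integral_def)
  also have "\<dots> = (\<integral>x. indicator A x *\<^sub>R g x \<partial>completion lam)"
  proof (rule integral_cong_AE)
    have "indicat_real A \<in> borel_measurable (completion lam)" using A by (intro borel_measurable_indicator) auto
    then show "(\<lambda>x. indicator A x *\<^sub>R f x) \<in> borel_measurable (completion lam)"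
      "(\<lambda>x. indicator A x *\<^sub>R g x) \<in> borel_measurable (completion lam)"
      using fm measurable_completion[OF gm] by auto
    show "AE x in completion lam. indicator A x *\<^sub>R f x = indicator A x *\<^sub>R g x"
      using aec by eventually_elim simp
  qed
  also have "\<dots> = (\<integral>x. indicator A x *\<^sub>R g x \<partial>lam)"
    using A gm by (intro integral_completion) auto
  finally show "density_measure lam f A = (\<integral>x. indicator A x * g x \<partial>lam)" by simp
qed

text \<open>The hypothesis says that \<open>rot90 (e x)\<close> is an eigenvector of the matrix
  \<open>m\<close> with eigenvalue \<open>w\<close>, the sum of \<open>z\<close> and half the trace.
  Pairing with the normal gives \<open>w\<close>, the trace then gives the tangential entry, and
  pairing with the orthogonal tangent gives 0.\<close>

lemma frame_algebra:
  fixes m :: "2 \<Rightarrow> 2 \<Rightarrow> real^2 \<Rightarrow> real" and e :: "real^2 \<Rightarrow> real^2"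
  assumes n: "norm (e x) = 1"
    and row: "\<And>l. (\<Sum>j\<in>UNIV. ((if l = j then z + (\<Sum>i\<in>UNIV. m i i x) / 2 else 0) - m l j x) * rot90 (e x) $ j) = 0"
  shows "m_perp_perp m e x = z + (\<Sum>i\<in>UNIV. m i i x) / 2"
    "m_parallel_parallel m e x = (\<Sum>i\<in>UNIV. m i i x) / 2 - z" "m_perp_parallel m e x = 0"
proof -
  define a b where "a = e x $ 1" and "b = e x $ 2"
  define w where "w = z + (m 1 1 x + m 2 2 x) / 2"
  have ab: "a * a + b * b = 1"
    using n by (simp add: norm_eq_1 inner_vec_def UNIV_2 a_def b_def)
  have e: "rot90 (e x) $ 1 = - b" "rot90 (e x) $ 2 = a" "(1::2) \<noteq> 2" by (simp_all add: rot90_def a_def b_def)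
  have "(w - m 1 1 x) * - b + (0 - m 1 2 x) * a = 0"
    using row[of 1] unfolding sum_2 e if_P[OF refl] if_not_P[OF e(3)] w_def .
  then have r1: "m 1 1 x * b - m 1 2 x * a = w * b" by (simp add: algebra_simps)
  have "(0 - m 2 1 x) * - b + (w - m 2 2 x) * a = 0"
    using row[of 2] unfolding sum_2 e if_P[OF refl] if_not_P[OF e(3)[symmetric]] w_def .
  then have r2: "m 2 2 x * a - m 2 1 x * b = w * a" by (simp add: algebra_simps)
  have "m_perp_perp m e x = b * (m 1 1 x * b - m 1 2 x * a) + a * (m 2 2 x * a - m 2 1 x * b)"
    by (simp add: m_perp_perp_def frame_component_def UNIV_2 rot90_def a_def b_def algebra_simps)
  also have "\<dots> = w * (a * a + b * b)" unfolding r1 r2 by (simp add: algebra_simps)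
  finally show pp: "m_perp_perp m e x = z + (\<Sum>i\<in>UNIV. m i i x) / 2" using ab by (simp add: w_def UNIV_2)
  have "m_perp_perp m e x + m_parallel_parallel m e x = (m 1 1 x + m 2 2 x) * (a * a + b * b)"
    by (simp add: m_perp_perp_def m_parallel_parallel_def frame_component_def UNIV_2 rot90_def
        a_def b_def algebra_simps)
  then show "m_parallel_parallel m e x = (\<Sum>i\<in>UNIV. m i i x) / 2 - z" using ab pp by (simp add: UNIV_2) argo
  have "m_perp_parallel m e x = b * (m 2 2 x * a - m 2 1 x * b) - a * (m 1 1 x * b - m 1 2 x * a)"
    by (simp add: m_perp_parallel_def frame_component_def UNIV_2 rot90_def a_def b_def algebra_simps)
  also have "\<dots> = 0" unfolding r1 r2 by (simp add: algebra_simps)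
  finally show "m_perp_parallel m e x = 0" .
qed

theorem theorem5:
  fixes \<Omega> :: "(real^2) set"
    and V :: "real^'k::finite \<Rightarrow> real"
    and M0 \<eta>1 :: real
    and \<epsilon> :: "nat \<Rightarrow> real"
    and u :: "nat \<Rightarrow> real^2 \<Rightarrow> real^'k"
    and \<nu> \<zeta> lam :: "(real^2) measure"
    and \<mu> :: "2 \<Rightarrow> 2 \<Rightarrow> (real^2) set \<Rightarrow> real"
    and m :: "2 \<Rightarrow> 2 \<Rightarrow> real^2 \<Rightarrow> real"
    and S :: "(real^2) set"
    and e :: "real^2 \<Rightarrow> real^2"
  assumes "smooth_bounded_domain \<Omega>"
    and "multi_well_potential V"
    and "0 < M0"
    and "\<And>n. 0 < \<epsilon> n \<and> \<epsilon> n \<le> 1" and "\<epsilon> \<longlonglongrightarrow> 0"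
    and "\<And>n. allen_cahn_solution V \<Omega> (\<epsilon> n) (u n)"
    and "\<And>n. energy V \<Omega> (\<epsilon> n) (u n) \<le> ennreal M0"
    and "weakly_converges \<Omega> (\<lambda>n. energy_density V \<Omega> (\<epsilon> n) (u n)) \<nu>"
    and "weakly_converges \<Omega> (\<lambda>n x. V (u n x) / \<epsilon> n) \<zeta>"
    and "\<And>i j. weakly_converges_signed \<Omega>
           (\<lambda>n x. \<epsilon> n * (weak_partial \<Omega> i (u n) x \<bullet> weak_partial \<Omega> j (u n) x)) (\<mu> i j)"
    and "0 < \<eta>1" and "clearing_out V \<Omega> \<eta>1"
    and "S = concentration_set \<Omega> \<eta>1 \<nu>"
    and "lam = hausdorff1_on \<Omega> S"
    and "absolutely_continuous lam \<nu>" and "absolutely_continuous lam \<zeta>"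
    and "\<And>i j. has_signed_density lam (m i j) (\<mu> i j)"
    and "AE x in lam. approx_tangent S x (e x)"
  shows "integrable (completion lam) (m_perp_perp m e) \<and>
    integrable (completion lam) (m_parallel_parallel m e) \<and>
    integrable (completion lam) (m_perp_parallel m e) \<and>
    (\<forall>A\<in>sets (restrict_space borel \<Omega>).
       2 * measure \<zeta> A =
         density_measure lam (m_perp_perp m e) A - density_measure lam (m_parallel_parallel m e) A) \<and>
    (\<forall>A\<in>sets (restrict_space borel \<Omega>). density_measure lam (m_perp_parallel m e) A = 0)"
proof -

  \<comment> \<open>Finiteness of the limit measures and regularity of the concentration set\<close>
  have \<Omega>: "open \<Omega>" "bounded \<Omega>" using assms(1) by (auto simp: smooth_bounded_domain_def)
  have \<epsilon>: "0 < \<epsilon> n" for n using assms(4) by blast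
  have V0: "0 \<le> V y" for y by (rule multi_well_potential_derivative(3)[OF assms(2)])
  have e0: "0 \<le> energy_density V \<Omega> (\<epsilon> n) (u n) x" and Ve: "V (u n x) / \<epsilon> n \<le> energy_density V \<Omega> (\<epsilon> n) (u n) x" for n x
    using V0[of "u n x"] \<epsilon>[of n] by (auto simp: energy_density_def sum_nonneg)
  have mass: "(\<integral>\<^sup>+x. ennreal (energy_density V \<Omega> (\<epsilon> n) (u n) x) \<partial>lebesgue_on \<Omega>) \<le> ennreal M0" for n
    using assms(7)[of n] by (simp add: energy_def)
  have "emeasure \<nu> \<Omega> \<le> ennreal M0"
    by (rule weak_limit_mass_le[OF \<Omega> assms(8) e0 mass]) (use assms(3) in simp)
  moreover have "emeasure \<zeta> \<Omega> \<le> ennreal M0"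
  proof (rule weak_limit_mass_le[OF \<Omega> assms(9)])
    show "0 \<le> V (u n x) / \<epsilon> n" for n x using V0 \<epsilon>[of n] by simp
    show "(\<integral>\<^sup>+x. ennreal (V (u n x) / \<epsilon> n) \<partial>lebesgue_on \<Omega>) \<le> ennreal M0" for n
      by (rule order_trans[OF nn_integral_mono mass]) (rule ennreal_leI[OF Ve])
  qed (use assms(3) in simp)
  moreover have s\<nu>: "sets \<nu> = sets (restrict_space borel \<Omega>)" and s\<zeta>: "sets \<zeta> = sets (restrict_space borel \<Omega>)"
    using assms(8,9) by (auto simp: weakly_converges_def radon_measure_on_def)
  moreover have "space \<nu> = \<Omega>" "space \<zeta> = \<Omega>"
    using sets_eq_imp_space_eq[OF s\<nu>] sets_eq_imp_space_eq[OF s\<zeta>] by (simp_all add: space_restrict_space)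
  ultimately have fin: "finite_measure \<nu>" "finite_measure \<zeta>"
    by (auto intro!: finite_measureI simp: top_unique dest: order_trans)
  have "open (\<Omega> - S)"
    unfolding assms(13)
  proof (rule concentration_set_closed[OF \<Omega>(1) _ s\<nu> assms(11)])
    fix x r assume "0 < r" "ball x r \<subseteq> \<Omega>" "emeasure \<nu> (cball x r \<inter> \<Omega>) < ennreal (\<eta>1 * r)"
    then show "emeasure \<nu> (cball x (r / 2) \<inter> \<Omega>) = 0"
      by (rule assms(12)[unfolded clearing_out_def, rule_format, OF assms(4-8)])
  qed
  moreover have "S \<subseteq> \<Omega>" by (auto simp: assms(13) concentration_set_def)
  then have "\<Omega> - (\<Omega> - S) = S" by blast
  ultimately have S: "S \<in> sets borel"
    using sets.Diff[OF borel_open[OF \<Omega>(1)] borel_open, of "\<Omega> - S"] by simp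
  have \<Omega>b: "\<Omega> \<in> sets borel" using \<Omega>(1) by simp
  define \<Lambda> where "\<Lambda> = density hausdorff1 (indicator S)"
  have \<Lambda>: "finite_measure \<Lambda>" "sets \<Lambda> = sets borel"
  proof -
    show s: "sets \<Lambda> = sets borel" by (simp add: \<Lambda>_def)
    have "emeasure \<Lambda> (space \<Lambda>) = emeasure hausdorff1 S"
      using emeasure_density_hausdorff1[OF S, of UNIV] by (simp add: \<Lambda>_def)
    then show "finite_measure \<Lambda>"
      using hausdorff1_concentration_set_finite[OF fin(1) s\<nu> assms(11)] by (intro finite_measureI) (simp add: assms(13))
  qed
  have lam: "lam = restrict_space \<Lambda> \<Omega>"
    unfolding assms(14) \<Lambda>_def by (rule hausdorff1_on_eq[OF \<Omega>b S])
  have slam: "sets lam = sets (restrict_space borel \<Omega>)"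
    by (simp add: lam sets_restrict_space \<Lambda>(2))
  have spl: "space lam = \<Omega>" using sets_eq_imp_space_eq[OF slam] by (simp add: space_restrict_space)
  have \<Omega>\<Lambda>: "\<Omega> \<inter> space \<Lambda> \<in> sets \<Lambda>" using \<Omega>b sets_eq_imp_space_eq[OF \<Lambda>(2)] by (simp add: \<Lambda>(2))
  interpret lam: finite_measure lam
    unfolding lam by (rule finite_measure_restrict_space[OF \<Lambda>(1)]) (simp add: \<Lambda>(2) \<Omega>b)

  \<comment> \<open>Borel densities with respect to \<open>lam\<close>\<close>
  obtain z where z: "z \<in> borel_measurable lam" "AE x in lam. RN_deriv lam \<zeta> x = ennreal (z x)" "\<And>x. 0 \<le> z x"
    by (rule lam.real_RN_deriv[OF fin(2) assms(16)]) (simp_all add: s\<zeta> slam)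
  have \<zeta>: "\<zeta> = density lam (\<lambda>x. ennreal (z x))"
  proof -
    have "\<zeta> = density lam (RN_deriv lam \<zeta>)" using lam.density_RN_deriv[OF assms(16)] s\<zeta> slam by simp
    also have "\<dots> = density lam (\<lambda>x. ennreal (z x))" using z(1,2) by (intro density_cong) auto
    finally show ?thesis .
  qed
  have iz: "integrable lam z"
  proof -
    interpret \<zeta>: finite_measure \<zeta> by fact
    have "integrable \<zeta> (\<lambda>x. 1 :: real)" by simp
    then show ?thesis using z by (subst (asm) \<zeta>, subst (asm) integrable_density) auto
  qed
  have \<zeta>A: "measure \<zeta> A = (\<integral>x. indicator A x * z x \<partial>lam)" if A: "A \<in> sets lam" for A
  proof -
    interpret \<zeta>: finite_measure \<zeta> by fact
    have "measure \<zeta> A = (\<integral>x. indicator A x \<partial>\<zeta>)" using A s\<zeta> slam by simp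
    also have "\<dots> = (\<integral>x. z x *\<^sub>R indicator A x \<partial>lam)"
      by (subst \<zeta>, rule integral_density) (use A z in auto)
    finally show ?thesis by (simp add: mult.commute)
  qed
  \<comment> \<open>The given densities are measurable only on the completion; Borel representatives
    are used until the final comparison.\<close>
  have "\<forall>i j. \<exists>f. f \<in> borel_measurable lam \<and> (AE x in lam. m i j x = f x) \<and> integrable lam f"
  proof (intro allI)
    show "\<exists>f. f \<in> borel_measurable lam \<and> (AE x in lam. m i j x = f x) \<and> integrable lam f" for i j
      by (rule has_signed_density_representative[OF assms(17)[of i j]]) (intro exI conjI)
  qed
  then obtain m' where m': "\<And>i j. m' i j \<in> borel_measurable lam" "\<And>i j. AE x in lam. m i j x = m' i j x"
      "\<And>i j. integrable lam (m' i j)" by metis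

  \<comment> \<open>The limit of the stress identity\<close>
  have limit: "(\<Sum>j\<in>UNIV. \<integral>x. D l x * m' j j x \<partial>lam) / 2 + (\<integral>x. D l x * z x \<partial>lam)
      - (\<Sum>j\<in>UNIV. \<integral>x. D j x * m' l j x \<partial>lam) = 0"
    and D_bounded: "\<And>j. D j \<in> borel_measurable lam \<and> (\<exists>C. \<forall>x. \<bar>D j x\<bar> \<le> C)"
    if \<psi>: "has_partials \<psi> D" "compact K" "K \<subseteq> \<Omega>" "\<And>x. x \<notin> K \<Longrightarrow> \<psi> x = 0" for \<psi> D K l
  proof -
    have "D j x = 0" if "x \<notin> K" for j x
      by (rule has_partials_outside[OF \<psi>(1) compact_imp_closed[OF \<psi>(2)] \<psi>(4) that])
    then have D: "D j \<in> Cc \<Omega>" for j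
      unfolding Cc_def using has_partials_continuous_partial[OF \<psi>(1)] \<psi>(2,3) by auto
    show "D j \<in> borel_measurable lam \<and> (\<exists>C. \<forall>x. \<bar>D j x\<bar> \<le> C)" for j
      using Cc_bounded_measurable[OF D slam] by blast
    have l\<mu>: "(\<lambda>n. \<integral>x. D k x * (\<epsilon> n * (weak_partial \<Omega> i (u n) x \<bullet> weak_partial \<Omega> j (u n) x)) \<partial>lebesgue_on \<Omega>)
        \<longlonglongrightarrow> (\<integral>x. D k x * m' i j x \<partial>lam)" for i j k
      by (rule signed_weak_limit_density[OF assms(10) assms(17) slam m'(1,2) D])
    have D\<zeta>: "(\<integral>x. D l x \<partial>\<zeta>) = (\<integral>x. z x *\<^sub>R D l x \<partial>lam)"
      by (subst \<zeta>, rule integral_density) (use z Cc_bounded_measurable(1)[OF D slam] in auto)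
    have "\<forall>\<phi>\<in>Cc \<Omega>. (\<lambda>n. \<integral>x. \<phi> x * (V (u n x) / \<epsilon> n) \<partial>lebesgue_on \<Omega>) \<longlonglongrightarrow> (\<integral>x. \<phi> x \<partial>\<zeta>)"
      using assms(9) unfolding weakly_converges_def by (elim conjE)
    from bspec[OF this D[of l]] have l\<zeta>: "(\<lambda>n. \<integral>x. D l x * (V (u n x) / \<epsilon> n) \<partial>lebesgue_on \<Omega>) \<longlonglongrightarrow> (\<integral>x. D l x * z x \<partial>lam)"
      unfolding D\<zeta> by (simp only: real_scaleR_def mult.commute)
    have "(\<lambda>n. (\<Sum>j\<in>UNIV. \<integral>x. D l x * (\<epsilon> n * (weak_partial \<Omega> j (u n) x \<bullet> weak_partial \<Omega> j (u n) x)) \<partial>lebesgue_on \<Omega>) / 2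
        + (\<integral>x. D l x * (V (u n x) / \<epsilon> n) \<partial>lebesgue_on \<Omega>)
        - (\<Sum>j\<in>UNIV. \<integral>x. D j x * (\<epsilon> n * (weak_partial \<Omega> l (u n) x \<bullet> weak_partial \<Omega> j (u n) x)) \<partial>lebesgue_on \<Omega>))
      \<longlonglongrightarrow> (\<Sum>j\<in>UNIV. \<integral>x. D l x * m' j j x \<partial>lam) / 2 + (\<integral>x. D l x * z x \<partial>lam)
        - (\<Sum>j\<in>UNIV. \<integral>x. D j x * m' l j x \<partial>lam)"
      by (intro tendsto_intros l\<mu> l\<zeta>) simp
    moreover have "(\<Sum>j\<in>UNIV. \<integral>x. D l x * (\<epsilon> n * (weak_partial \<Omega> j (u n) x \<bullet> weak_partial \<Omega> j (u n) x)) \<partial>lebesgue_on \<Omega>) / 2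
        + (\<integral>x. D l x * (V (u n x) / \<epsilon> n) \<partial>lebesgue_on \<Omega>)
        - (\<Sum>j\<in>UNIV. \<integral>x. D j x * (\<epsilon> n * (weak_partial \<Omega> l (u n) x \<bullet> weak_partial \<Omega> j (u n) x)) \<partial>lebesgue_on \<Omega>) = 0" for n
      by (rule allen_cahn_stress[OF \<Omega>(1) assms(2) \<epsilon> assms(6) \<psi>])
    ultimately show "(\<Sum>j\<in>UNIV. \<integral>x. D l x * m' j j x \<partial>lam) / 2 + (\<integral>x. D l x * z x \<partial>lam)
      - (\<Sum>j\<in>UNIV. \<integral>x. D j x * m' l j x \<partial>lam) = 0"
      by (simp only: LIMSEQ_const_iff)
  qed

  \<comment> \<open>The divergence-free matrix density\<close>
  define f where "f l j x = (if l = j then z x + (\<Sum>i\<in>UNIV. m' i i x) / 2 else 0) - m' l j x" for l j x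
  have i_f: "integrable lam (f l j)" for l j
    unfolding f_def using iz m'(3) by (cases "l = j") auto
  \<comment> \<open>Extension by zero, because \<open>\<Lambda>\<close> lives on the whole plane
    while the densities are integrable only on \<open>\<Omega>\<close>.\<close>
  define a where "a l j x = indicator \<Omega> x * f l j x" for l j x
  have i_a: "integrable \<Lambda> (a l j)" for l j
    using i_f[of l j] unfolding lam a_def by (subst (asm) integrable_restrict_space[OF \<Omega>\<Lambda>]) simp
  have div: "(\<Sum>j\<in>UNIV. \<integral>y. a l j y * D j y \<partial>\<Lambda>) = 0"
    if \<psi>: "has_partials \<psi> D" "compact K" "K \<subseteq> \<Omega>" "\<And>x. x \<notin> K \<Longrightarrow> \<psi> x = 0" for \<psi> D K l
  proof -
    note Db = D_bounded[OF \<psi>]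
    have iD: "integrable lam (\<lambda>x. D j x * h x)" if "integrable lam h" for h j
    proof -
      obtain C where "\<And>x. \<bar>D j x\<bar> \<le> C" using Db[of j] by blast
      from integrable_mult_bounded[OF that _ this] Db[of j] show ?thesis by simp
    qed
    have "(\<integral>y. a l j y * D j y \<partial>\<Lambda>) = (if l = j then (\<integral>x. D j x * z x \<partial>lam) + (\<Sum>i\<in>UNIV. \<integral>x. D j x * m' i i x \<partial>lam) / 2 else 0)
        - (\<integral>x. D j x * m' l j x \<partial>lam)" for j
    proof -
      have "(\<integral>y. a l j y * D j y \<partial>\<Lambda>) = (\<integral>y. indicator \<Omega> y *\<^sub>R (D j y * f l j y) \<partial>\<Lambda>)"
        by (rule Bochner_Integration.integral_cong[OF refl]) (simp add: a_def)
      also have "\<dots> = (\<integral>x. D j x * f l j x \<partial>lam)"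
        unfolding lam by (rule integral_restrict_space[OF \<Omega>\<Lambda>, symmetric])
      also have "\<dots> = (\<integral>x. (if l = j then D j x * z x + (\<Sum>i\<in>UNIV. D j x * m' i i x) / 2 else 0) - D j x * m' l j x \<partial>lam)"
        by (rule Bochner_Integration.integral_cong[OF refl]) (simp add: f_def algebra_simps sum_distrib_left)
      also have "\<dots> = (if l = j then (\<integral>x. D j x * z x \<partial>lam) + (\<Sum>i\<in>UNIV. \<integral>x. D j x * m' i i x \<partial>lam) / 2 else 0)
        - (\<integral>x. D j x * m' l j x \<partial>lam)"
      proof (cases "l = j")
        case True
        have i1: "integrable lam (\<lambda>x. (\<Sum>i\<in>UNIV. D j x * m' i i x) / 2)"
          by (intro integrable_divide_zero Bochner_Integration.integrable_sum iD m'(3))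
        show ?thesis
          using True i1 iD[OF iz, of j] iD[OF m'(3), of j]
          by (simp add: Bochner_Integration.integral_diff Bochner_Integration.integral_add Bochner_Integration.integral_sum)
      qed simp
      finally show ?thesis .
    qed
    then have "(\<Sum>j\<in>UNIV. \<integral>y. a l j y * D j y \<partial>\<Lambda>) = (\<integral>x. D l x * z x \<partial>lam) + (\<Sum>i\<in>UNIV. \<integral>x. D l x * m' i i x \<partial>lam) / 2
        - (\<Sum>j\<in>UNIV. \<integral>x. D j x * m' l j x \<partial>lam)"
      by (simp add: sum_subtractf)
    then show ?thesis using limit[OF \<psi>, of l] by simp
  qed

  \<comment> \<open>Blow-up at almost every point\<close>
  have leb: "AE x in lam. \<forall>l j. ((\<lambda>r. (\<integral>y. indicator (cball x r) y * \<bar>a l j y - a l j x\<bar> \<partial>\<Lambda>) / r) \<longlongrightarrow> 0) (at_right 0)"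
    unfolding assms(14)
    by (rule AE_hausdorff1_on[OF \<Omega>b S]) (simp only: AE_all_countable, intro allI AE_lebesgue_point[OF \<Lambda> i_a])
  have upper: "AE x in lam. \<exists>C \<delta>. 0 < \<delta> \<and> (\<forall>r. 0 < r \<and> r < \<delta> \<longrightarrow> measure \<Lambda> (cball x r) \<le> C * r)"
    unfolding assms(14) by (rule AE_hausdorff1_on[OF \<Omega>b S AE_upper_density_finite[OF \<Lambda>]])
  have rows: "AE x in lam. \<forall>l. (\<Sum>j\<in>UNIV. f l j x * rot90 (e x) $ j) = 0"
    using leb upper assms(18) AE_space
  proof eventually_elim
    case (elim x)
    have x: "x \<in> \<Omega>" using elim(4) spl by simp
    obtain C \<delta> where C: "0 < \<delta>" "\<And>r. 0 < r \<Longrightarrow> r < \<delta> \<Longrightarrow> measure \<Lambda> (cball x r) \<le> C * r" using elim(2) by blast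
    obtain c where c: "0 < c" "\<And>\<delta>. 0 < \<delta> \<Longrightarrow> \<exists>r. 0 < r \<and> r < \<delta> \<and> c * r \<le> measure \<Lambda> (cball x r)"
      using approx_tangent_lower_density[OF S \<Lambda>(1)[unfolded \<Lambda>_def] elim(3)] unfolding \<Lambda>_def by blast
    have n1: "norm (e x) = 1" using elim(3) by (simp add: approx_tangent_def)
    show ?case
    proof
      fix l
      have "(\<Sum>j\<in>UNIV. a l j x * rot90 (e x) $ j) = 0"
      proof (rule blowup_normal_zero[OF \<Lambda> \<Omega>(1) x i_a div _ C c n1])
        show "((\<lambda>r. (\<integral>y. indicator (cball x r) y * \<bar>a l j y - a l j x\<bar> \<partial>\<Lambda>) / r) \<longlongrightarrow> 0) (at_right 0)" for j
          using elim(1) by blast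
        show "((\<lambda>r. measure \<Lambda> (cball x r \<inter> {y. s * norm (y - x) \<le> \<bar>rot90 (e x) \<bullet> (y - x)\<bar>}) / r) \<longlongrightarrow> 0) (at_right 0)"
          if "0 < s" "s < 1" for s
          using approx_tangent_cone[OF S \<Lambda>(1)[unfolded \<Lambda>_def] elim(3) that] unfolding \<Lambda>_def .
      qed
      then show "(\<Sum>j\<in>UNIV. f l j x * rot90 (e x) $ j) = 0" using x by (simp add: a_def)
    qed
  qed

  \<comment> \<open>From pointwise identities of densities to identities of measures\<close>
  have mm': "AE x in lam. \<forall>i j. m i j x = m' i j x"
    by (simp only: AE_all_countable) (intro allI m'(2))
  define t where "t x = (\<Sum>i\<in>UNIV. m' i i x) / 2" for x
  have it: "integrable lam t" unfolding t_def using m'(3) by auto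
  have frame: "AE x in lam. m_perp_perp m e x = z x + t x \<and> m_parallel_parallel m e x = t x - z x \<and> m_perp_parallel m e x = 0"
    using rows mm' assms(18)
  proof eventually_elim
    case (elim x)
    have n1: "norm (e x) = 1" using elim(3) by (simp add: approx_tangent_def)
    have "(\<Sum>j\<in>UNIV. ((if l = j then z x + (\<Sum>i\<in>UNIV. m i i x) / 2 else 0) - m l j x) * rot90 (e x) $ j) = 0" for l
    proof -
      have mx: "m i j x = m' i j x" for i j using elim(2) by blast
      show ?thesis unfolding mx using elim(1)[THEN spec, of l] unfolding f_def .
    qed
    from frame_algebra[of e x "z x" m, OF n1 this] show ?case using elim(2) by (auto simp: t_def)
  qed
  have ae1: "AE x in lam. m_perp_perp m e x = z x + t x" using frame by (rule eventually_mono) simp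
  have ae2: "AE x in lam. m_parallel_parallel m e x = t x - z x" using frame by (rule eventually_mono) simp
  have ae3: "AE x in lam. m_perp_parallel m e x = 0" using frame by (rule eventually_mono) simp
  have i1: "integrable lam (\<lambda>x. z x + t x)" and i2: "integrable lam (\<lambda>x. t x - z x)" and i3: "integrable lam (\<lambda>x. 0 :: real)"
    using iz it by auto
  note d1 = density_measure_AE[OF i1 ae1] and d2 = density_measure_AE[OF i2 ae2] and d3 = density_measure_AE[OF i3 ae3]
  have "2 * measure \<zeta> A = density_measure lam (m_perp_perp m e) A - density_measure lam (m_parallel_parallel m e) A"
    if A: "A \<in> sets lam" for A
  proof -
    have iA: "integrable lam (\<lambda>x. indicator A x * h x)" if "integrable lam h" for h :: "real^2 \<Rightarrow> real"
      using integrable_mult_indicator[OF A that] by simp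
    have "density_measure lam (m_perp_perp m e) A - density_measure lam (m_parallel_parallel m e) A
        = (\<integral>x. indicator A x * (z x + t x) - indicator A x * (t x - z x) \<partial>lam)"
      unfolding d1(2)[OF A] d2(2)[OF A] by (rule Bochner_Integration.integral_diff[OF iA[OF i1] iA[OF i2], symmetric])
    also have "\<dots> = (\<integral>x. 2 * (indicator A x * z x) \<partial>lam)"
      by (rule Bochner_Integration.integral_cong[OF refl]) (simp add: algebra_simps)
    finally show ?thesis by (simp add: \<zeta>A[OF A])
  qed
  moreover have "density_measure lam (m_perp_parallel m e) A = 0" if "A \<in> sets lam" for A
    using d3(2)[OF that] by simp
  ultimately show ?thesis using d1(1) d2(1) d3(1) unfolding slam[symmetric] by blast
qed

end
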